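(* Consider the following eight families of polynomials in $\mathbb{Z}[x_1,x_2,\ldots]$, each indexed by weak compositions: Schubert polynomials $\{\mathfrak{S}\}$, Demazure characters $\{\kappa_a\}$, quasi-key polynomials $\{\mathfrak{Q}_a\}$, fundamental slide polynomials $\{\mathfrak{F}_a\}$, monomial slide polynomials $\{\mathfrak{M}_a\}$, Demazure atoms $\{\mathcal{A}_a\}$, fundamental particles $\{\mathfrak{L}_a\}$ and monomials $\{x^a\}$. Let $\mathcal{P}$ be the partial order on these eight families whose strict relations $\mathcal{B}>\mathcal{B}'$ are exactly: $\mathfrak{S}$ is greater than all seven others; $\kappa>\mathfrak{Q},\mathfrak{F},\mathfrak{M},\mathcal{A},\mathfrak{L},x$; $\mathfrak{Q}>\mathfrak{F},\mathfrak{M},\mathcal{A},\mathfrak{L},x$; $\mathfrak{F}>\mathfrak{M},\mathfrak{L},x$; $\mathfrak{M}>x$; $\mathcal{A}>\mathfrak{L},x$; $\mathfrak{L}>x$ (so the incomparable pairs are $\{\mathcal{A},\mathfrak{F}\}$, $\{\mathcal{A},\mathfrak{M}\}$, $\{\mathfrak{L},\mathfrak{M}\}$). Then for distinct families $\mathcal{B},\mathcal{B}'$ in $\mathcal{P}$, every element of $\mathcal{B}$ expands positively in $\mathcal{B}'$ if and only if $\mathcal{B}>\mathcal{B}'$ in $\mathcal{P}$.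
   Context: A weak composition of length $n$ is a sequence $a=(a_1,\ldots,a_n)$ of nonnegative integers; weak compositions differing by trailing zeros index the same polynomial. $x^a=x_1^{a_1}\cdots x_n^{a_n}$. $\mathrm{flat}(a)$ is the composition obtained by deleting the zero parts of $a$. For weak compositions $a,b$ of the same length $n$, $b\ge a$ (dominance) means $b_1+\cdots+b_i\ge a_1+\cdots+a_i$ for all $i$. "$\mathcal{B}$ expands positively in $\mathcal{B}'$" means each element of $\mathcal{B}$ is a linear combination of elements of $\mathcal{B}'$ with nonnegative coefficients. Schubert polynomials: for $w\in S_n$, $\mathfrak{S}_{w_0}=x_1^{n-1}x_2^{n-2}\cdots x_{n-1}$ for the longest element $w_0$, and $\mathfrak{S}_{ws_i}=\partial_i\mathfrak{S}_w$ whenever $w(i)>w(i+1)$, where $\partial_i f=(f-s_if)/(x_i-x_{i+1})$ and $s_i$ swaps $x_i,x_{i+1}$; these are stable under $S_n\subset S_{n+1}$ and indexed by weak compositions via the code $c(w)_i=\#\{j>i: w(j)<w(i)\}$. Demazure characters: if $a_1\ge\cdots\ge a_n$ then $\kappa_a=x^a$; if $a_i<a_{i+1}$ then $\kappa_a=\pi_i\kappa_{s_ia}$ where $s_ia$ swaps $a_i,a_{i+1}$ and $\pi_i f=\partial_i(x_if)$. Skyline diagram $D(a)$: $a_i$ boxes in row $i$, left-justified, row $1$ lowest, columns $1,2,\ldots$ from the left. For a filling $S$ of $D(a)$ by positive integers, $\mathrm{wt}(S)$ is the weak composition whose $i$th part is the number of entries $i$. A triple of $D(a)$, with rows $r<s$: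 (Type A) boxes $\gamma=(r,c)$, $\alpha=(r,c+1)$ and $\beta=(s,c+1)$ with $a_r\ge a_s$; (Type B) boxes $\gamma=(s,c)$, $\alpha=(s,c+1)$ and $\beta=(r,c)$ with $a_s>a_r$. A triple is an inversion triple if (entries) $\beta>\gamma\ge\alpha$ or $\gamma\ge\alpha>\beta$. A semi-skyline filling of $D(a)$ is a filling by positive integers with entries weakly decreasing left to right in rows, distinct entries in each column, and all triples inversion triples. Demazure atom: $\mathcal{A}_a=\sum_S x^{\mathrm{wt}(S)}$ over semi-skyline fillings $S$ of $D(a)$ whose first-column entry in each nonempty row $i$ equals $i$. Quasi-key tableau of shape $a$: filling of $D(a)$ with positive integers such that (1) entries weakly decrease along rows and no entry of row $i$ exceeds $i$; (2) entries in each column are distinct and entries increase going up the first column; (3) if an entry $i$ is above an entry $k$ in the same column with $i<k$, then there is an entry $j$ immediately right of $k$ with $i<j$; (4) for two rows with the higher row strictly longer, if entry $i$ is in column $c$ of the lower row and $j$ in column $c+1$ of the higher row, then $i<j$. $\mathfrak{Q}_a=\sum_T x^{\mathrm{wt}(T)}$ over quasi-key tableaux $T$ of shape $a$. $\mathfrak{M}_a=\sum x^b$ over $b\ge a$ with $\mathrm{flat}(b)=\mathrm{flat}(a)$; $\mathfrak{F}_a=\sum x^b$ over $b\ge a$ with $\mathrm{flat}(b)$ refining $\mathrm{flat}(a)$ (i.e. $\mathrm{flat}(a)$ is obtained by summing consecutive parts of $\mathrm{flat}(b)$). Fixed slides: a local move on a weak composition replaces two consecutive entries $(0,k)$ in positions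 $p,p+1$ by $(i,j)$ with $i+j=k$, $i,j\ge 0$. A fixed slide of $a$ is a weak composition obtained from $a$ by a (possibly empty) sequence of such moves, subject to: if position $p+1$ is a position where $a$ is nonzero, then $j>0$. $\mathfrak{L}_a=\sum x^b$ over the set of fixed slides $b$ of $a$. *)

theory Defs
  imports Main "HOL-Library.Poly_Mapping"
begin

text \<open>Polynomials with integer coefficients in countably many variables.
  Variables are indexed from 0: the key k stands for the paper's x_(k+1).
  Weak compositions are lists of naturals; list position k (0-based) is the
  paper's part a_(k+1).\<close>

type_synonym poly = "(nat \<Rightarrow>\<^sub>0 nat) \<Rightarrow>\<^sub>0 int"

definition X :: "nat \<Rightarrow> poly" where
  "X k = Poly_Mapping.single (Poly_Mapping.single k 1) 1"

definition xmon :: "nat list \<Rightarrow> poly" where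
  "xmon a = (\<Prod>k<length a. X k ^ (a ! k))"

definition sw :: "nat \<Rightarrow> nat \<Rightarrow> nat" where
  "sw k j = (if j = k then Suc k else if j = Suc k then k else j)"

definition swap_mon :: "nat \<Rightarrow> (nat \<Rightarrow>\<^sub>0 nat) \<Rightarrow> poly" where
  "swap_mon k m = (\<Prod>j\<in>Poly_Mapping.keys m. X (sw k j) ^ Poly_Mapping.lookup m j)"

definition swapv :: "nat \<Rightarrow> poly \<Rightarrow> poly" where
  "swapv k f = (\<Sum>m\<in>Poly_Mapping.keys f. of_int (Poly_Mapping.lookup f m) * swap_mon k m)"

definition ddiff :: "nat \<Rightarrow> poly \<Rightarrow> poly" where
  "ddiff k f = (THE g. (X k - X (Suc k)) * g = f - swapv k f)"

definition pidiff :: "nat \<Rightarrow> poly \<Rightarrow> poly" where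
  "pidiff k f = ddiff k (X k * f)"

definition lswap :: "nat \<Rightarrow> 'a list \<Rightarrow> 'a list" where
  "lswap k w = w[k := w ! Suc k, Suc k := w ! k]"

text \<open>Two weak compositions index the same polynomial if they differ by trailing zeros.\<close>
definition trail_eq :: "nat list \<Rightarrow> nat list \<Rightarrow> bool" where
  "trail_eq a b \<longleftrightarrow> (\<exists>m. a = b @ replicate m 0 \<or> b = a @ replicate m 0)"

text \<open>Permutations w in S_n are lists [w(1),...,w(n)]; right multiplication by s_k swaps
  positions k, k+1. The longest element of S_n is [n, n-1, ..., 1].\<close>

inductive schub :: "nat list \<Rightarrow> poly \<Rightarrow> bool" where
  longest: "schub (rev [1..<Suc n]) (xmon (rev [0..<n]))"
| step: "schub w f \<Longrightarrow> Suc k < length w \<Longrightarrow> w ! k > w ! Suc k \<Longrightarrow>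
         schub (lswap k w) (ddiff k f)"

definition code :: "nat list \<Rightarrow> nat list" where
  "code w = map (\<lambda>i. card {j. i < j \<and> j < length w \<and> w ! j < w ! i}) [0..<length w]"

definition schubert :: "nat list \<Rightarrow> poly" where
  "schubert a = (THE f. \<exists>w. schub w f \<and> trail_eq (code w) a)"

inductive demaz :: "nat list \<Rightarrow> poly \<Rightarrow> bool" where
  dominant: "(\<forall>k. Suc k < length a \<longrightarrow> a ! Suc k \<le> a ! k) \<Longrightarrow> demaz a (xmon a)"
| step: "Suc k < length a \<Longrightarrow> a ! k < a ! Suc k \<Longrightarrow> demaz (lswap k a) f \<Longrightarrow>
         demaz a (pidiff k f)"

definition kappa :: "nat list \<Rightarrow> poly" where
  "kappa a = (THE f. demaz a f)"

text \<open>Cells (r, c), both 0-based: row r is the paper's row r+1 (row 0 lowest),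
  column c is the paper's column c+1.  A filling is a function on cells, set to 0
  outside the diagram; entries are the paper's (1-based) values.\<close>

definition cells :: "nat list \<Rightarrow> (nat \<times> nat) set" where
  "cells a = {(r, c). r < length a \<and> c < a ! r}"

definition filling :: "nat list \<Rightarrow> (nat \<times> nat \<Rightarrow> nat) \<Rightarrow> bool" where
  "filling a T \<longleftrightarrow> (\<forall>x. x \<notin> cells a \<longrightarrow> T x = 0) \<and> (\<forall>x\<in>cells a. 0 < T x)"

text \<open>x^wt(T): each entry e contributes the variable x_e (key e - 1).\<close>
definition fmon :: "nat list \<Rightarrow> (nat \<times> nat \<Rightarrow> nat) \<Rightarrow> poly" where
  "fmon a T = (\<Prod>x\<in>cells a. X (T x - 1))"

definition inv_triple :: "nat \<Rightarrow> nat \<Rightarrow> nat \<Rightarrow> bool" where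
  "inv_triple \<gamma> \<alpha> \<beta> \<longleftrightarrow> (\<beta> > \<gamma> \<and> \<gamma> \<ge> \<alpha>) \<or> (\<gamma> \<ge> \<alpha> \<and> \<alpha> > \<beta>)"

definition semi_skyline :: "nat list \<Rightarrow> (nat \<times> nat \<Rightarrow> nat) \<Rightarrow> bool" where
  "semi_skyline a T \<longleftrightarrow> filling a T
   \<and> (\<forall>r c. (r, c) \<in> cells a \<and> (r, Suc c) \<in> cells a \<longrightarrow> T (r, Suc c) \<le> T (r, c))
   \<and> (\<forall>r s c. (r, c) \<in> cells a \<and> (s, c) \<in> cells a \<and> r \<noteq> s \<longrightarrow> T (r, c) \<noteq> T (s, c))
   \<and> (\<forall>r s c. r < s \<and> a ! s \<le> a ! r \<and> (r, c) \<in> cells a \<and> (r, Suc c) \<in> cells a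
              \<and> (s, Suc c) \<in> cells a \<longrightarrow> inv_triple (T (r, c)) (T (r, Suc c)) (T (s, Suc c)))
   \<and> (\<forall>r s c. r < s \<and> a ! r < a ! s \<and> (s, c) \<in> cells a \<and> (s, Suc c) \<in> cells a
              \<and> (r, c) \<in> cells a \<longrightarrow> inv_triple (T (s, c)) (T (s, Suc c)) (T (r, c)))"

definition atom :: "nat list \<Rightarrow> poly" where
  "atom a = (\<Sum>T\<in>{T. semi_skyline a T \<and> (\<forall>r. (r, 0) \<in> cells a \<longrightarrow> T (r, 0) = Suc r)}.
               fmon a T)"

definition qkey_tableau :: "nat list \<Rightarrow> (nat \<times> nat \<Rightarrow> nat) \<Rightarrow> bool" where
  "qkey_tableau a T \<longleftrightarrow> filling a T
   \<and> (\<forall>r c. (r, c) \<in> cells a \<and> (r, Suc c) \<in> cells a \<longrightarrow> T (r, Suc c) \<le> T (r, c))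
   \<and> (\<forall>r c. (r, c) \<in> cells a \<longrightarrow> T (r, c) \<le> Suc r)
   \<and> (\<forall>r s c. (r, c) \<in> cells a \<and> (s, c) \<in> cells a \<and> r \<noteq> s \<longrightarrow> T (r, c) \<noteq> T (s, c))
   \<and> (\<forall>r s. r < s \<and> (r, 0) \<in> cells a \<and> (s, 0) \<in> cells a \<longrightarrow> T (r, 0) < T (s, 0))
   \<and> (\<forall>r s c. r < s \<and> (r, c) \<in> cells a \<and> (s, c) \<in> cells a \<and> T (s, c) < T (r, c) \<longrightarrow>
              (r, Suc c) \<in> cells a \<and> T (s, c) < T (r, Suc c))
   \<and> (\<forall>r s c. r < s \<and> a ! r < a ! s \<and> (r, c) \<in> cells a \<and> (s, Suc c) \<in> cells a \<longrightarrow>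
              T (r, c) < T (s, Suc c))"

definition qkey :: "nat list \<Rightarrow> poly" where
  "qkey a = (\<Sum>T\<in>{T. qkey_tableau a T}. fmon a T)"

definition flat :: "nat list \<Rightarrow> nat list" where
  "flat a = filter (\<lambda>x. x \<noteq> 0) a"

definition dominates :: "nat list \<Rightarrow> nat list \<Rightarrow> bool" where
  "dominates b a \<longleftrightarrow> length b = length a \<and>
     (\<forall>i\<le>length a. sum_list (take i a) \<le> sum_list (take i b))"

definition refines :: "nat list \<Rightarrow> nat list \<Rightarrow> bool" where
  "refines \<beta> \<alpha> \<longleftrightarrow> (\<exists>L. concat L = \<beta> \<and> (\<forall>l\<in>set L. l \<noteq> []) \<and> map sum_list L = \<alpha>)"

definition mslide :: "nat list \<Rightarrow> poly" where
  "mslide a = (\<Sum>b\<in>{b. dominates b a \<and> flat b = flat a}. xmon b)"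

definition fslide :: "nat list \<Rightarrow> poly" where
  "fslide a = (\<Sum>b\<in>{b. dominates b a \<and> refines (flat b) (flat a)}. xmon b)"

inductive fixed_slide :: "nat list \<Rightarrow> nat list \<Rightarrow> bool" for a where
  refl: "fixed_slide a a"
| move: "fixed_slide a b \<Longrightarrow> Suc p < length b \<Longrightarrow> b ! p = 0 \<Longrightarrow> i + j = b ! Suc p \<Longrightarrow>
         (a ! Suc p \<noteq> 0 \<longrightarrow> 0 < j) \<Longrightarrow> fixed_slide a (b[p := i, Suc p := j])"

definition particle :: "nat list \<Rightarrow> poly" where
  "particle a = (\<Sum>b\<in>{b. fixed_slide a b}. xmon b)"

datatype family = Schub | Demaz | QKey | FSlide | MSlide | Atom | Part | Mono

fun fam :: "family \<Rightarrow> nat list \<Rightarrow> poly" where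
  "fam Schub = schubert"
| "fam Demaz = kappa"
| "fam QKey = qkey"
| "fam FSlide = fslide"
| "fam MSlide = mslide"
| "fam Atom = atom"
| "fam Part = particle"
| "fam Mono = xmon"

definition fam_gt :: "family \<Rightarrow> family \<Rightarrow> bool" where
  "fam_gt B B' \<longleftrightarrow> (B, B') \<in>
     {(Schub, Demaz), (Schub, QKey), (Schub, FSlide), (Schub, MSlide), (Schub, Atom),
      (Schub, Part), (Schub, Mono),
      (Demaz, QKey), (Demaz, FSlide), (Demaz, MSlide), (Demaz, Atom), (Demaz, Part), (Demaz, Mono),
      (QKey, FSlide), (QKey, MSlide), (QKey, Atom), (QKey, Part), (QKey, Mono),
      (FSlide, MSlide), (FSlide, Part), (FSlide, Mono),
      (MSlide, Mono),
      (Atom, Part), (Atom, Mono),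
      (Part, Mono)}"

definition expands_pos :: "(nat list \<Rightarrow> poly) \<Rightarrow> (nat list \<Rightarrow> poly) \<Rightarrow> bool" where
  "expands_pos B B' \<longleftrightarrow>
     (\<forall>a. \<exists>S c. finite S \<and> B a = (\<Sum>b\<in>S. of_nat (c b) * B' b))"

end

theory Submission
  imports Defs "HOL-Library.Multiset"
begin

text \<open>Positivity is transitive, so it suffices to treat the covering relations of the order and five
  extremal pairs \<open>B, B'\<close> for which \<open>B > B'\<close> fails.

  Everything between keys and atoms is read off one model: a tuple of column sets, each of which
  parks in the previous one.  Parking all columns leftwards produces a key, and the atom of \<open>a\<close> is
  the generating function of the tuples with key \<open>a\<close>.  The crystal operators on column tuples show
  how \<open>\<pi>\<^sub>i\<close> acts on atoms; hence a key polynomial is the sum of the atoms over a lower Bruhat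
  interval.  A semi-skyline filling and a quasi-key tableau are determined by their column sets, so
  \<open>Q\<^sub>a\<close> is the sum of the atoms of all \<open>b \<ge> a\<close> with \<open>flat b = flat a\<close>, and a Bruhat interval
  splits into such classes.

  A Schubert polynomial is obtained from a smaller one by operators \<open>\<pi>\<^sub>i\<close> and a multiplication by
  \<open>x\<^sub>1 \<cdots> x\<^sub>k\<close>, corresponding to the first column of the Rothe diagram, and such a product with a
  key polynomial is key positive by commuting \<open>x\<^sub>1 \<cdots> x\<^sub>k\<close> past the \<open>\<pi>\<^sub>i\<close>.

  Standardisation of tableaux turns quasi-keys and atoms into sums over weakly increasing words with
  prescribed strict ascents, which are fundamental slides and particles.

  The negative results apply \<open>\<pi>\<^sub>1\<close> or divided differences, under which the target family is stable, or
  compare two coefficients.\<close>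

section \<open>Divided differences\<close>

text \<open>Key and Schubert polynomials are definite descriptions over nondeterministic recursions,
  so nothing can be expanded before all derivations are known to agree. In both cases this comes
  from a closed formula (\<open>kap\<close>, \<open>Sfn\<close>) that satisfies every instance of
  the recursion. Column tuples enter because the triple conditions on fillings are not visibly
  compatible with \<pi>_i: changing an entry upsets the arrangement of the rows. A column set
  forgets which row an entry belongs to, so a crystal operator changes one column only, and the rows
  are recovered afterwards, by one greedy rule for semi-skyline fillings and another for quasi-key
  tableaux. Since parking is Hall's condition, the tuples are semistandard tableaux with decreasing
  rows and columns. The two arrangements of a tuple have the same key up to the naming of rows,
  which is why quasi-keys split into atoms. In the counterexamples an operator preserving the target
  cone sends an element of the source to a negative polynomial, or a nonzero one to zero. Two
  variables suffice, except for key against Schubert polynomials, where three are used.\<close>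

abbreviation lookup where "lookup \<equiv> Poly_Mapping.lookup"

abbreviation keys where "keys \<equiv> Poly_Mapping.keys"

abbreviation mon :: "(nat \<Rightarrow>\<^sub>0 nat) \<Rightarrow> poly" where
  "mon m \<equiv> Poly_Mapping.single m 1"

lemma X_power: "X k ^ e = mon (Poly_Mapping.single k e)"
  by (induction e) (simp_all add: X_def mult_single single_add[symmetric] add.commute)

lemma prod_mon: "finite A \<Longrightarrow> (\<Prod>j\<in>A. mon (f j)) = mon (\<Sum>j\<in>A. f j)"
  by (induction A rule: finite_induct) (simp_all add: mult_single)

text \<open>The monomials generate the polynomials as an abelian group; zero and integer multiples
  are built from the closure properties, so an additive identity need only be tested on
  \<open>mon m\<close>.\<close>

lemma poly_induct [case_names mon uminus add]:
  fixes P :: "poly \<Rightarrow> bool"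
  assumes "\<And>m. P (mon m)" "\<And>f. P f \<Longrightarrow> P (- f)" "\<And>f g. P f \<Longrightarrow> P g \<Longrightarrow> P (f + g)"
  shows "P f"
proof -
  have "P (mon 0 + - mon 0)" by (intro assms)
  then have z: "P 0" by simp
  have nat: "P (of_nat n * mon m)" for n m
    by (induction n) (auto simp: z distrib_right intro!: assms)
  have int: "P (of_int c * mon m)" for c m
    by (cases c rule: int_cases2) (use nat assms(2) in \<open>fastforce+\<close>)
  have "f = (\<Sum>m\<in>Poly_Mapping.keys f. of_int (lookup f m) * mon m)"
  proof -
    have "of_int c * mon m = Poly_Mapping.single m c" for c :: int and m
    proof -
      have "of_int c = (Poly_Mapping.single 0 c :: poly)" 
        by (rule poly_mapping_eqI) (auto simp: lookup_of_int lookup_single when_def)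
      then show ?thesis by (simp add: mult_single)
    qed
    moreover have "f = (\<Sum>m\<in>keys f. Poly_Mapping.single m (lookup f m))"
      by (rule poly_mapping_eqI) (simp add: lookup_sum lookup_single when_def in_keys_iff)
    ultimately show ?thesis by simp
  qed
  moreover have "P (\<Sum>m\<in>M. of_int (c m) * mon m)" if "finite M" for M and c :: "_ \<Rightarrow> int"
    using that by (induction M rule: finite_induct) (auto simp: z intro!: assms(3) int)
  ultimately show ?thesis by (metis finite_keys)
qed

section \<open>Adjacent transpositions acting on polynomials\<close>

lemma inj_sw: "inj (sw k)"
  by (auto simp: inj_def sw_def split: if_splits)

lemma sw_sw [simp]: "sw k (sw k j) = j"
  by (auto simp: sw_def)

text \<open>Through \<open>map_key\<close> the swap is additive on exponents, and this is what makes
  \<open>swapv\<close> multiplicative.\<close>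

lemma swap_mon_eq: "swap_mon k m = mon (Poly_Mapping.map_key (sw k) m)"
proof -
  have "(\<Sum>j\<in>keys m. Poly_Mapping.single (sw k j) (lookup m j)) = Poly_Mapping.map_key (sw k) m"
  proof (rule poly_mapping_eqI)
    fix t
    have "lookup (\<Sum>j\<in>keys m. Poly_Mapping.single (sw k j) (lookup m j)) t
        = (\<Sum>j\<in>keys m. if j = sw k t then lookup m j else 0)"
      unfolding lookup_sum by (rule sum.cong) (auto simp: lookup_single when_def)
    also have "\<dots> = lookup m (sw k t)" by (simp add: in_keys_iff)
    finally show "lookup (\<Sum>j\<in>keys m. Poly_Mapping.single (sw k j) (lookup m j)) t
        = lookup (Poly_Mapping.map_key (sw k) m) t"
      by (simp add: map_key.rep_eq inj_sw)
  qed
  then show ?thesis by (simp add: swap_mon_def X_power prod_mon)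
qed

lemma swapv_superset:
  assumes "finite A" "keys f \<subseteq> A"
  shows "swapv k f = (\<Sum>m\<in>A. of_int (lookup f m) * swap_mon k m)"
  unfolding swapv_def by (rule sum.mono_neutral_left) (use assms in \<open>auto simp: in_keys_iff\<close>)

lemma swapv_add [simp]: "swapv k (f + g) = swapv k f + swapv k g"
proof -
  let ?A = "keys f \<union> keys g"
  have "keys (f + g) \<subseteq> ?A" by (rule keys_add)
  then show ?thesis
    by (simp add: swapv_superset[of ?A] lookup_add distrib_right sum.distrib)
qed

lemma swapv_uminus [simp]: "swapv k (- f) = - swapv k f"
  by (simp add: swapv_superset[of "keys f"] sum_negf)

lemma swapv_0 [simp]: "swapv k 0 = 0"
  by (simp add: swapv_def)

lemma swapv_diff [simp]: "swapv k (f - g) = swapv k f - swapv k g"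
  using swapv_add[of k f "- g"] by simp

lemma swapv_sum: "swapv k (\<Sum>i\<in>A. f i) = (\<Sum>i\<in>A. swapv k (f i))"
  by (induction A rule: infinite_finite_induct) simp_all

lemma swapv_mon: "swapv k (mon m) = mon (Poly_Mapping.map_key (sw k) m)"
  by (simp add: swapv_def swap_mon_eq)

lemma swapv_1 [simp]: "swapv k 1 = 1"
  using swapv_mon[of k 0] by (simp add: map_key_zero inj_sw)

lemma swapv_X: "swapv k (X j) = X (sw k j)"
  using swapv_mon[of k "Poly_Mapping.single j 1"] map_key_single[OF inj_sw, of k "sw k j" "1::nat"]
  by (simp add: X_def)

lemma swapv_mult [simp]: "swapv k (f * g) = swapv k f * swapv k g"
proof (induction f rule: poly_induct)
  case (mon m)
  show ?case
    by (induction g rule: poly_induct)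
       (simp_all add: mult_single swapv_mon map_key_plus inj_sw distrib_left)
qed (simp_all add: distrib_right)

lemma swapv_prod: "swapv k (\<Prod>i\<in>A. f i) = (\<Prod>i\<in>A. swapv k (f i))"
  by (induction A rule: infinite_finite_induct) simp_all

lemma swapv_power: "swapv k (f ^ e) = swapv k f ^ e"
  by (induction e) simp_all

lemma mon_eq_prod: "mon m = (\<Prod>j\<in>keys m. X j ^ lookup m j)"
proof -
  have "(\<Sum>j\<in>keys m. Poly_Mapping.single j (lookup m j)) = m"
    by (rule poly_mapping_eqI)
       (simp add: lookup_sum lookup_single when_def in_keys_iff)
  then show ?thesis by (simp add: X_power prod_mon)
qed

text \<open>Monomials are products of variables, so identities between compositions of the ring
  homomorphisms \<open>swapv\<close> reduce to generators, where they are computations with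
  transpositions.\<close>

lemma poly_ring_induct [case_names one var uminus add mult]:
  fixes P :: "poly \<Rightarrow> bool"
  assumes one: "P 1" and var: "\<And>j. P (X j)" and um: "\<And>f. P f \<Longrightarrow> P (- f)"
    and add: "\<And>f g. P f \<Longrightarrow> P g \<Longrightarrow> P (f + g)" and mult: "\<And>f g. P f \<Longrightarrow> P g \<Longrightarrow> P (f * g)"
  shows "P f"
proof (induction f rule: poly_induct)
  case (mon m)
  have pow: "P (X j ^ e)" for j e by (induction e) (simp_all add: one var mult)
  have "P (\<Prod>j\<in>A. X j ^ lookup m j)" if "finite A" for A
    using that pow by (induction A rule: finite_induct) (simp_all add: one mult)
  then show ?case by (simp add: mon_eq_prod)
qed (simp_all add: um add)

lemma swapv_swapv [simp]: "swapv k (swapv k f) = f"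
  by (induction f rule: poly_ring_induct) (simp_all add: swapv_X)

lemma swapv_commute: "Suc i < j \<Longrightarrow> swapv i (swapv j f) = swapv j (swapv i f)"
  by (induction f rule: poly_ring_induct) (auto simp: swapv_X sw_def)

lemma swapv_braid: "swapv i (swapv (Suc i) (swapv i f)) = swapv (Suc i) (swapv i (swapv (Suc i) f))"
  by (induction f rule: poly_ring_induct) (auto simp: swapv_X sw_def)

lemma X_inject: "X i = X j \<longleftrightarrow> i = j"
proof
  assume "X i = X j"
  then have "lookup (X i) (Poly_Mapping.single i 1) = lookup (X j) (Poly_Mapping.single i 1)" by simp
  then have "Poly_Mapping.single i (1::nat) = Poly_Mapping.single j 1"
    unfolding X_def lookup_single when_def by (auto split: if_splits)
  then have "lookup (Poly_Mapping.single i (1::nat)) i = lookup (Poly_Mapping.single j 1) i" by simp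
  then show "i = j" by (auto simp: lookup_single when_def split: if_splits)
qed simp

text \<open>Divisibility is clear on variables and passes to products by the twisted Leibniz rule,
  which supplies the quotient \<open>g * f' + swapv k f * g'\<close>.\<close>

lemma ddiff_exists: "\<exists>g. (X k - X (Suc k)) * g = f - swapv k f"
proof (induction f rule: poly_ring_induct)
  case one then show ?case by (intro exI[of _ 0]) simp
next
  case (var j)
  show ?case
    by (rule exI[of _ "if j = k then 1 else if j = Suc k then -1 else 0"])
       (auto simp: swapv_X sw_def)
next
  case (uminus f)
  then obtain g where "(X k - X (Suc k)) * g = f - swapv k f" by blast
  then show ?case by (intro exI[of _ "- g"]) simp
next
  case (add f f')
  then obtain g g' where "(X k - X (Suc k)) * g = f - swapv k f" "(X k - X (Suc k)) * g' = f' - swapv k f'"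
    by blast
  then show ?case by (intro exI[of _ "g + g'"]) (simp add: distrib_left)
next
  case (mult f f')
  then obtain g g' where g: "(X k - X (Suc k)) * g = f - swapv k f" "(X k - X (Suc k)) * g' = f' - swapv k f'"
    by blast
  have "(X k - X (Suc k)) * (g * f' + swapv k f * g')
      = ((X k - X (Suc k)) * g) * f' + swapv k f * ((X k - X (Suc k)) * g')" by algebra
  also have "\<dots> = f * f' - swapv k (f * f')" unfolding g by (simp add: algebra_simps)
  finally show ?case by blast
qed

lemma X_diff_nonzero: "i \<noteq> j \<Longrightarrow> X i - X j \<noteq> 0"
  by (simp add: X_inject)

text \<open>The quotient is unique because the polynomial ring has no zero divisors, so the
  description in \<open>ddiff\<close> denotes it.\<close>

lemma ddiff_spec: "(X k - X (Suc k)) * ddiff k f = f - swapv k f"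
  unfolding ddiff_def
proof (rule theI')
  obtain g where g: "(X k - X (Suc k)) * g = f - swapv k f" using ddiff_exists by blast
  show "\<exists>!g. (X k - X (Suc k)) * g = f - swapv k f"
    using g X_diff_nonzero[of k "Suc k"] by (metis mult_cancel_left n_not_Suc_n)
qed

lemma ddiff_eqI: "(X k - X (Suc k)) * g = f - swapv k f \<Longrightarrow> ddiff k f = g"
  using ddiff_spec[of k f] X_diff_nonzero[of k "Suc k"] by (metis mult_cancel_left n_not_Suc_n)

lemma ddiff_add: "ddiff k (f + g) = ddiff k f + ddiff k g"
  by (rule ddiff_eqI) (simp add: distrib_left ddiff_spec)

lemma ddiff_diff: "ddiff k (f - g) = ddiff k f - ddiff k g"
  by (rule ddiff_eqI) (simp add: right_diff_distrib ddiff_spec)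

lemma ddiff_0 [simp]: "ddiff k 0 = 0"
  by (rule ddiff_eqI) simp

lemma ddiff_mult_sym: "swapv k s = s \<Longrightarrow> ddiff k (s * f) = s * ddiff k f"
proof (rule ddiff_eqI)
  assume s: "swapv k s = s"
  have "(X k - X (Suc k)) * (s * ddiff k f) = s * ((X k - X (Suc k)) * ddiff k f)" by algebra
  also have "\<dots> = s * f - swapv k (s * f)" unfolding ddiff_spec by (simp add: s algebra_simps)
  finally show "(X k - X (Suc k)) * (s * ddiff k f) = s * f - swapv k (s * f)" .
qed

lemma ddiff_sym: "swapv k f = f \<Longrightarrow> ddiff k f = 0"
  by (rule ddiff_eqI) simp

lemma swapv_ddiff [simp]: "swapv k (ddiff k f) = ddiff k f"
proof -
  have "swapv k ((X k - X (Suc k)) * ddiff k f) = swapv k (f - swapv k f)" by (simp add: ddiff_spec)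
  then have "(X (Suc k) - X k) * swapv k (ddiff k f) = swapv k f - f" by (simp add: swapv_X sw_def)
  then have "(X k - X (Suc k)) * swapv k (ddiff k f) = f - swapv k f"
    by (metis minus_diff_eq mult_minus_left)
  then show ?thesis by (rule ddiff_eqI[symmetric])
qed

lemma ddiff_ddiff [simp]: "ddiff k (ddiff k f) = 0"
  by (rule ddiff_sym) simp

lemma ddiff_X_mult: "ddiff k (X k * f) = f + X (Suc k) * ddiff k f"
proof (rule ddiff_eqI)
  have "(X k - X (Suc k)) * (f + X (Suc k) * ddiff k f)
      = (X k - X (Suc k)) * f + X (Suc k) * ((X k - X (Suc k)) * ddiff k f)" by algebra
  also have "\<dots> = X k * f - swapv k (X k * f)"
    unfolding ddiff_spec by (simp add: swapv_X sw_def algebra_simps)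
  finally show "(X k - X (Suc k)) * (f + X (Suc k) * ddiff k f) = X k * f - swapv k (X k * f)" .
qed

lemma ddiff_XX_mult: "ddiff k (X k * X (Suc k) * f) = X k * X (Suc k) * ddiff k f"
  by (rule ddiff_mult_sym) (simp add: swapv_X sw_def mult.commute)

text \<open>The sides are compared after multiplication by the two linear forms, each of which is
  fixed by the other swap.\<close>

lemma ddiff_commute: "Suc i < j \<Longrightarrow> ddiff i (ddiff j f) = ddiff j (ddiff i f)"
proof (rule ddiff_eqI)
  assume ij: "Suc i < j"
  let ?a = "X i - X (Suc i)" and ?b = "X j - X (Suc j)"
  have inv: "swapv i ?b = ?b" "swapv j ?a = ?a" using ij by (auto simp: swapv_X sw_def)
  have "?b * (?a * ddiff j (ddiff i f)) = ?a * (?b * ddiff j (ddiff i f))" by algebra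
  also have "\<dots> = ?a * ddiff i f - swapv j (?a * ddiff i f)"
    unfolding ddiff_spec[of j "ddiff i f"] by (simp add: inv right_diff_distrib del: swapv_diff)
  also have "\<dots> = (f - swapv j f) - swapv i (f - swapv j f)"
    by (simp add: ddiff_spec swapv_commute[OF ij] del: swapv_mult)
  also have "\<dots> = ?b * ddiff j f - swapv i (?b * ddiff j f)" by (simp only: ddiff_spec)
  also have "\<dots> = ?b * (ddiff j f - swapv i (ddiff j f))"
    by (simp add: inv right_diff_distrib del: swapv_diff)
  finally show "?a * ddiff j (ddiff i f) = ddiff j f - swapv i (ddiff j f)"
    using X_diff_nonzero[of j "Suc j"] by (metis mult_cancel_left n_not_Suc_n)
qed

text \<open>Multiplied by (a - b)(b - c)(a - c), either side becomes the alternating sum of f over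
  the symmetric group on three letters; the longest element is written in two ways.\<close>

lemma ddiff_braid: "ddiff i (ddiff (Suc i) (ddiff i f)) = ddiff (Suc i) (ddiff i (ddiff (Suc i) f))"
proof -
  define a b c where abc: "a = X i" "b = X (Suc i)" "c = X (Suc (Suc i))"
  define s t where st: "s = swapv i" "t = swapv (Suc i)"
  have sv: "s a = b" "s b = a" "s c = c" "t a = a" "t b = c" "t c = b"
    by (auto simp: abc st swapv_X sw_def)
  have hom: "s (p * q) = s p * s q" "t (p * q) = t p * t q" "s (p - q) = s p - s q"
    "t (p - q) = t p - t q" for p q by (auto simp: st)
  have nz: "a - b \<noteq> 0" "b - c \<noteq> 0" "a - c \<noteq> 0" by (auto simp: abc X_inject)
  have D: "(a - b) * ddiff i g = g - s g" "(b - c) * ddiff (Suc i) g = g - t g" for g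
    by (simp_all add: abc st ddiff_spec)
  have inv: "s (ddiff i g) = ddiff i g" "t (ddiff (Suc i) g) = ddiff (Suc i) g" for g
    by (simp_all add: st)
  \<comment> \<open>Applying a swap to a defining equation gives one for another linear form, so
    that every denominator met below can be cleared.\<close>
  have tD: "(a - c) * t (ddiff i g) = t g - t (s g)" for g
    using arg_cong[OF D(1), of t g] by (simp add: hom sv)
  have sD: "(a - c) * s (ddiff (Suc i) g) = s g - s (t g)" for g
    using arg_cong[OF D(2), of s g] by (simp add: hom sv)
  have stD: "(b - c) * s (t (ddiff i g)) = s (t g) - s (t (s g))" for g
    using arg_cong[OF tD, of s g] by (simp add: hom sv)
  have tsD: "(a - b) * t (s (ddiff (Suc i) g)) = t (s g) - t (s (t g))" for g
    using arg_cong[OF sD, of t g] by (simp add: hom sv)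
  have L: "(a - b) * (b - c) * (a - c) * ddiff i (ddiff (Suc i) (ddiff i f))
      = f - s f - t f + t (s f) + s (t f) - s (t (s f))"
  proof -
    let ?f1 = "ddiff i f" let ?f2 = "ddiff (Suc i) ?f1"
    have "(a - b) * (b - c) * (a - c) * ddiff i ?f2 = (b - c) * (a - c) * ((a - b) * ddiff i ?f2)" by algebra
    also have "\<dots> = (a - c) * ((b - c) * ?f2) - (b - c) * ((a - c) * s ?f2)" unfolding D(1) by algebra
    also have "\<dots> = (a - b) * ?f1 - (a - c) * t ?f1 + (b - c) * s (t ?f1)"
      unfolding D(2) sD inv by algebra
    finally show ?thesis unfolding D tD stD by algebra
  qed
  have R: "(a - b) * (b - c) * (a - c) * ddiff (Suc i) (ddiff i (ddiff (Suc i) f))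
      = f - s f - t f + t (s f) + s (t f) - t (s (t f))"
  proof -
    let ?f1 = "ddiff (Suc i) f" let ?f2 = "ddiff i ?f1"
    have "(a - b) * (b - c) * (a - c) * ddiff (Suc i) ?f2 = (a - b) * (a - c) * ((b - c) * ddiff (Suc i) ?f2)" by algebra
    also have "\<dots> = (a - c) * ((a - b) * ?f2) - (a - b) * ((a - c) * t ?f2)" unfolding D(2) by algebra
    also have "\<dots> = (b - c) * ?f1 - (a - c) * s ?f1 + (a - b) * t (s ?f1)"
      unfolding D(1) tD inv by algebra
    finally show ?thesis unfolding D sD tsD by algebra
  qed
  have "s (t (s f)) = t (s (t f))" by (simp add: st swapv_braid)
  with L R nz show ?thesis by (metis mult_cancel_left no_zero_divisors)
qed

section \<open>The isobaric operators \<pi>_i\<close>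

lemma pidiff_eq: "pidiff k f = f + X (Suc k) * ddiff k f"
  by (simp add: pidiff_def ddiff_X_mult)

lemma pidiff_add: "pidiff k (f + g) = pidiff k f + pidiff k g"
  by (simp add: pidiff_def distrib_left ddiff_add)

lemma pidiff_0 [simp]: "pidiff k 0 = 0"
  by (simp add: pidiff_def)

lemma pidiff_sum: "pidiff k (\<Sum>i\<in>A. f i) = (\<Sum>i\<in>A. pidiff k (f i))"
  by (induction A rule: infinite_finite_induct) (simp_all add: pidiff_add)

lemma pidiff_mult_sym: "swapv k s = s \<Longrightarrow> pidiff k (s * f) = s * pidiff k f"
  by (simp add: pidiff_def ddiff_mult_sym mult.left_commute)

lemma pidiff_sym: "swapv k f = f \<Longrightarrow> pidiff k f = f"
  by (simp add: pidiff_eq ddiff_sym)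

text \<open>\<open>X k * X (Suc k) * f\<close> is symmetric. This is the form in which \<pi>_k kills
  the atoms with an ascent at k.\<close>

lemma pidiff_X_Suc: "swapv k f = f \<Longrightarrow> pidiff k (X (Suc k) * f) = 0"
  unfolding pidiff_def mult.assoc[symmetric] by (rule ddiff_sym) (simp add: swapv_X sw_def mult.commute)

lemma swapv_pidiff [simp]: "swapv k (pidiff k f) = pidiff k f"
  by (simp add: pidiff_def)

lemma pidiff_pidiff [simp]: "pidiff k (pidiff k f) = pidiff k f"
  by (rule pidiff_sym) simp

lemma pidiff_commute: "Suc i < j \<Longrightarrow> pidiff i (pidiff j f) = pidiff j (pidiff i f)"
proof -
  assume ij: "Suc i < j"
  have "swapv i (X j) = X j" "swapv j (X i) = X i" using ij by (auto simp: swapv_X sw_def)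
  then have *: "ddiff i (X j * g) = X j * ddiff i g" "ddiff j (X i * g) = X i * ddiff j g" for g
    by (simp_all add: ddiff_mult_sym)
  show ?thesis
    unfolding pidiff_def *[symmetric] using ddiff_commute[OF ij] by (simp add: mult.left_commute)
qed

lemma ddiff_pidiff_commute: "Suc i < j \<or> Suc j < i \<Longrightarrow> ddiff i (pidiff j f) = pidiff j (ddiff i f)"
proof -
  assume ij: "Suc i < j \<or> Suc j < i"
  have "swapv i (X j) = X j" using ij by (auto simp: swapv_X sw_def)
  then have "ddiff i (X j * g) = X j * ddiff i g" for g by (simp add: ddiff_mult_sym)
  then show ?thesis
    unfolding pidiff_def using ij ddiff_commute[of i j] ddiff_commute[of j i] by metis
qed

lemma X_mult_ddiff: "i \<noteq> j \<Longrightarrow> Suc i \<noteq> j \<Longrightarrow> X j * ddiff i f = ddiff i (X j * f)"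
  by (rule ddiff_mult_sym[symmetric]) (auto simp: swapv_X sw_def)

text \<open>Moving variables to the right turns each side into a threefold divided difference of
  \<open>X i ^ 2 * X (Suc i) * f\<close>, up to a term that is a value of
  \<open>ddiff (Suc i)\<close> and hence killed by it.\<close>

lemma pidiff_braid: "pidiff i (pidiff (Suc i) (pidiff i f)) = pidiff (Suc i) (pidiff i (pidiff (Suc i) f))"
proof -
  let ?h = "X i * (X i * X (Suc i)) * f"
  have "pidiff i (pidiff (Suc i) (pidiff i f)) = ddiff i (ddiff (Suc i) (ddiff i ?h))"
    unfolding pidiff_def
    using ddiff_XX_mult[of i "X i * f"] by (simp add: X_mult_ddiff mult.assoc mult.left_commute)
  also have "\<dots> = ddiff (Suc i) (ddiff i (ddiff (Suc i) ?h))" by (rule ddiff_braid)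
  also have "\<dots> = pidiff (Suc i) (pidiff i (pidiff (Suc i) f))"
  proof -
    let ?g = "ddiff (Suc i) (X i * (X (Suc i) * f))"
    have "pidiff (Suc i) (pidiff i (pidiff (Suc i) f)) = ddiff (Suc i) (X (Suc i) * ddiff i ?g)"
      unfolding pidiff_def by (simp add: X_mult_ddiff)
    also have "X (Suc i) * ddiff i ?g = ddiff i (X i * ?g) - ?g" by (simp add: ddiff_X_mult)
    also have "ddiff (Suc i) \<dots> = ddiff (Suc i) (ddiff i (X i * ?g))" by (simp add: ddiff_diff)
    finally show ?thesis by (simp add: X_mult_ddiff mult.assoc)
  qed
  finally show ?thesis .
qed

text \<open>A divided difference passes the pair \<pi>_i \<pi>_{i+1} with its index lowered by one.
  In the Schubert recursion this accounts for the deleted row.\<close>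

lemma ddiff_pidiff_pidiff:
  "ddiff (Suc i) (pidiff i (pidiff (Suc i) f)) = pidiff i (pidiff (Suc i) (ddiff i f))"
proof -
  have "ddiff (Suc i) (pidiff i (pidiff (Suc i) f)) = ddiff (Suc i) (ddiff i (ddiff (Suc i) (X i * (X (Suc i) * f))))"
    unfolding pidiff_def by (simp add: X_mult_ddiff)
  also have "\<dots> = ddiff i (ddiff (Suc i) (ddiff i (X i * X (Suc i) * f)))"
    by (simp add: ddiff_braid mult.assoc)
  also have "\<dots> = pidiff i (pidiff (Suc i) (ddiff i f))"
    unfolding pidiff_def ddiff_XX_mult by (simp add: X_mult_ddiff mult.assoc)
  finally show ?thesis .
qed

text \<open>With \<open>X_Suc_pidiff\<close> this is the rule for moving a variable past \<pi>_k:
  \<open>X k\<close> produces two positive terms, while the negative term produced by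
  \<open>X (Suc k)\<close> cancels as soon as the word applied afterwards absorbs \<pi>_k.\<close>

lemma X_pidiff: "X k * pidiff k f = X k * f + pidiff k (X (Suc k) * f)"
proof -
  have "pidiff k (X (Suc k) * f) = X k * X (Suc k) * ddiff k f"
    unfolding pidiff_def using ddiff_XX_mult[of k f] by (simp add: mult.assoc)
  then show ?thesis by (simp add: pidiff_eq algebra_simps)
qed

lemma X_Suc_pidiff: "X (Suc k) * pidiff k f = pidiff k (X k * f) - X k * f"
  unfolding pidiff_def[of k f] by (simp add: pidiff_eq)

section \<open>Column tuples and crystal operators\<close>

text \<open>Cars with preferred spots \<open>Y\<close> enter a one-way street whose free spots are \<open>C\<close>, and each takes the
  first free spot at or after its preference: \<open>queue C Y t\<close> cars are still driving when they reach \<open>t\<close>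
  (the subtraction is meant to truncate), and \<open>park C Y\<close> is the set of spots that get occupied.\<close>

fun queue :: "nat set \<Rightarrow> nat set \<Rightarrow> nat \<Rightarrow> nat" where
  "queue C Y 0 = 0"
| "queue C Y (Suc t) = queue C Y t + of_bool (t \<in> Y) - of_bool (t \<in> C)"

definition park :: "nat set \<Rightarrow> nat set \<Rightarrow> nat set" where
  "park C Y = {t \<in> C. queue C Y t + of_bool (t \<in> Y) > 0}"

text \<open>Entry j is column j parked in columns j - 1, ..., 0 in turn. It plays the role of the
  key of the tableau with these columns: a decreasing chain of sets whose multiplicities are the
  parts of \<open>colkey\<close>.\<close>

fun kcols :: "nat set list \<Rightarrow> nat set list" where
  "kcols [] = []"
| "kcols (C # Cs) = C # map (park C) (kcols Cs)"

text \<open>\<open>queue C (hd Cs) n = 0\<close> says that every car of the next column finds a spot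
  below n, which is Hall's condition for matching the next column into C with weakly larger
  partners.\<close>

fun feas :: "nat \<Rightarrow> nat set list \<Rightarrow> bool" where
  "feas n [] \<longleftrightarrow> True"
| "feas n (C # Cs) \<longleftrightarrow> C \<subseteq> {..<n} \<and> C \<noteq> {} \<and> (Cs \<noteq> [] \<longrightarrow> queue C (hd Cs) n = 0) \<and> feas n Cs"

definition cnt :: "nat set list \<Rightarrow> nat \<Rightarrow> nat" where
  "cnt Cs t = length (filter (\<lambda>C. t \<in> C) Cs)"

definition colkey :: "nat \<Rightarrow> nat set list \<Rightarrow> nat list" where
  "colkey n Cs = map (cnt (kcols Cs)) [0..<n]"

definition xm :: "nat \<Rightarrow> (nat \<Rightarrow> nat) \<Rightarrow> poly" where
  "xm n g = (\<Prod>t<n. X t ^ g t)"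

definition colset :: "nat list \<Rightarrow> nat set list set" where
  "colset a = {Cs. feas (length a) Cs \<and> colkey (length a) Cs = a}"

definition colatom :: "nat list \<Rightarrow> poly" where
  "colatom a = (\<Sum>Cs\<in>colset a. xm (length a) (cnt Cs))"

lemma queue_mono: "Y \<subseteq> Y' \<Longrightarrow> queue C Y t \<le> queue C Y' t"
  by (induction t) (auto intro!: diff_le_mono add_mono)

lemma park_mono: "Y \<subseteq> Y' \<Longrightarrow> park C Y \<subseteq> park C Y'"
proof
  fix t assume "Y \<subseteq> Y'" "t \<in> park C Y"
  then show "t \<in> park C Y'" using queue_mono[of Y Y' C t] by (auto simp: park_def)
qed

lemma park_subset: "park C Y \<subseteq> C"
  by (auto simp: park_def)

text \<open>Cars waiting or arriving at t either park there or drive on; the truncated subtraction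
  does no harm because \<open>park\<close> contains t only if some car is present.\<close>

lemma queue_Suc_park: "queue C Y (Suc t) + of_bool (t \<in> park C Y) = queue C Y t + of_bool (t \<in> Y)"
  by (auto simp: park_def)

lemma card_below_Suc: "card (A \<inter> {..<Suc t}) = card (A \<inter> {..<t}) + of_bool (t \<in> A)"
proof -
  have "A \<inter> {..<Suc t} = (if t \<in> A then insert t (A \<inter> {..<t}) else A \<inter> {..<t})"
    by (auto simp: less_Suc_eq)
  then show ?thesis by simp
qed

lemma card_park: "card (Y \<inter> {..<t}) = card (park C Y \<inter> {..<t}) + queue C Y t"
proof (induction t)
  case (Suc t)
  then show ?case using queue_Suc_park[of C Y t] by (simp only: card_below_Suc)
qed simp

text \<open>Parking is monotone in the set of cars and stays inside C, so a chain of keys is mapped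
  to a chain below C.\<close>

lemma kcols_chain: "sorted_wrt (\<lambda>A B. B \<subseteq> A) (kcols Cs)"
proof (induction Cs)
  case (Cons C Cs)
  have "sorted_wrt (\<lambda>A B. park C B \<subseteq> park C A) (kcols Cs)"
    by (rule sorted_wrt_mono_rel[OF _ Cons]) (simp add: park_mono)
  then show ?case by (simp add: sorted_wrt_map park_subset)
qed simp

lemma kcols_comparable: "A \<in> set (kcols Cs) \<Longrightarrow> B \<in> set (kcols Cs) \<Longrightarrow> A \<subseteq> B \<or> B \<subseteq> A"
proof (induction Cs arbitrary: A B)
  case (Cons C Cs)
  consider "A = C" | "B = C" | A' B' where "A = park C A'" "B = park C B'" "A' \<in> set (kcols Cs)" "B' \<in> set (kcols Cs)"
    using Cons.prems by auto
  then show ?case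
  proof cases
    case 1 then show ?thesis using Cons.prems park_subset[of C] by auto
  next
    case 2 then show ?thesis using Cons.prems park_subset[of C] by auto
  next
    case 3 then show ?thesis using Cons.IH[of A' B'] park_mono by blast
  qed
qed simp

lemma length_kcols [simp]: "length (kcols Cs) = length Cs"
  by (induction Cs) simp_all

section \<open>Parking under changes at two adjacent spots, and crystal operators\<close>

lemma in_sw_image: "t \<in> sw i ` A \<longleftrightarrow> sw i t \<in> A"
  by (metis image_eqI image_iff sw_sw)

lemma sw_image_sw_image [simp]: "sw i ` sw i ` A = A"
  by (auto simp: in_sw_image)

text \<open>The crystal operators for i alter membership of i and i + 1 only, so two parking
  processes can be compared through their queues at i + 2.\<close>

definition agr :: "nat \<Rightarrow> nat set \<Rightarrow> nat set \<Rightarrow> bool" where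
  "agr i A B \<longleftrightarrow> (\<forall>t. t \<noteq> i \<and> t \<noteq> Suc i \<longrightarrow> (t \<in> A \<longleftrightarrow> t \<in> B))"

lemma agr_refl [simp]: "agr i A A"
  by (simp add: agr_def)

lemma agr_sw [simp]: "agr i A (sw i ` A)" "agr i (sw i ` A) A"
  by (auto simp: agr_def in_sw_image sw_def)

lemma queue_lo: "agr i C C' \<Longrightarrow> agr i Y Y' \<Longrightarrow> t \<le> i \<Longrightarrow> queue C Y t = queue C' Y' t"
  by (induction t) (auto simp: agr_def)

text \<open>From i + 2 on both streets see the same cars and spots, and one step is monotone in the
  queue.\<close>

lemma queue_hi_le:
  "Suc (Suc i) \<le> t \<Longrightarrow> agr i C C' \<Longrightarrow> agr i Y Y' \<Longrightarrow> queue C Y (Suc (Suc i)) \<le> queue C' Y' (Suc (Suc i))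
   \<Longrightarrow> queue C Y t \<le> queue C' Y' t"
proof (induction t rule: dec_induct)
  case (step t)
  then have "t \<in> C \<longleftrightarrow> t \<in> C'" "t \<in> Y \<longleftrightarrow> t \<in> Y'" "queue C Y t \<le> queue C' Y' t"
    by (auto simp: agr_def)
  then show ?case unfolding queue.simps(2)[of _ _ t] by (simp add: diff_le_mono)
qed

lemma agr_sym: "agr i A B \<Longrightarrow> agr i B A"
  by (auto simp: agr_def)

lemma queue_hi:
  assumes "Suc (Suc i) \<le> t" "agr i C C'" "agr i Y Y'" "queue C Y (Suc (Suc i)) = queue C' Y' (Suc (Suc i))"
  shows "queue C Y t = queue C' Y' t"
  using queue_hi_le[OF assms(1-3)] queue_hi_le[OF assms(1) agr_sym[OF assms(2)] agr_sym[OF assms(3)]] assms(4)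
  by (metis order_antisym order_refl)

lemma park_agr:
  assumes "agr i C C'" "agr i Y Y'" "queue C Y (Suc (Suc i)) = queue C' Y' (Suc (Suc i))"
  shows "agr i (park C Y) (park C' Y')"
  unfolding agr_def
proof (intro allI impI)
  fix t assume t: "t \<noteq> i \<and> t \<noteq> Suc i"
  have "queue C Y t = queue C' Y' t"
  proof (cases "t \<le> i")
    case True then show ?thesis using queue_lo assms by blast
  next
    case False
    then have "Suc (Suc i) \<le> t" using t by simp
    then show ?thesis using queue_hi assms by blast
  qed
  then show "(t \<in> park C Y) = (t \<in> park C' Y')" using assms t by (auto simp: park_def agr_def)
qed

lemma agr_eqI: "agr i A B \<Longrightarrow> (i \<in> A \<longleftrightarrow> i \<in> B) \<Longrightarrow> (Suc i \<in> A \<longleftrightarrow> Suc i \<in> B) \<Longrightarrow> A = B"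
  by (auto simp: agr_def)

lemma agr_sw_eqI: "agr i A B \<Longrightarrow> (i \<in> A \<longleftrightarrow> Suc i \<in> B) \<Longrightarrow> (Suc i \<in> A \<longleftrightarrow> i \<in> B) \<Longrightarrow> A = sw i ` B"
  by (auto simp: agr_def in_sw_image sw_def)

lemma park_i: "i \<in> park C Y \<longleftrightarrow> i \<in> C \<and> queue C Y i + of_bool (i \<in> Y) > 0"
  by (auto simp: park_def)

lemma park_Suc_i: "Suc i \<in> park C Y \<longleftrightarrow>
    Suc i \<in> C \<and> (queue C Y i + of_bool (i \<in> Y) - of_bool (i \<in> C)) + of_bool (Suc i \<in> Y) > 0"
  by (auto simp: park_def)

text \<open>A column containing i but not i + 1 is an opening bracket, a column containing i + 1 but
  not i a closing one. The next two functions count the unmatched closing and opening brackets,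
  and the crystal operators act on the rightmost, respectively leftmost, of them.\<close>

abbreviation opn :: "nat \<Rightarrow> nat set \<Rightarrow> bool" where "opn i C \<equiv> i \<in> C \<and> Suc i \<notin> C"

abbreviation cls :: "nat \<Rightarrow> nat set \<Rightarrow> bool" where "cls i C \<equiv> i \<notin> C \<and> Suc i \<in> C"

fun um :: "nat \<Rightarrow> nat set list \<Rightarrow> nat" where
  "um i [] = 0"
| "um i (C # Cs) = (if opn i C then um i Cs - 1 else if cls i C then um i Cs + 1 else um i Cs)"

fun up :: "nat \<Rightarrow> nat set list \<Rightarrow> nat" where
  "up i [] = 0"
| "up i (C # Cs) = (if opn i C \<and> um i Cs = 0 then up i Cs + 1 else up i Cs)"

fun fop :: "nat \<Rightarrow> nat set list \<Rightarrow> nat set list" where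
  "fop i [] = []"
| "fop i (C # Cs) = (if opn i C \<and> um i Cs = 0 then sw i ` C # Cs else C # fop i Cs)"

fun eop :: "nat \<Rightarrow> nat set list \<Rightarrow> nat set list" where
  "eop i [] = []"
| "eop i (C # Cs) = (if cls i C \<and> um i Cs = 0 then sw i ` C # Cs else C # eop i Cs)"

lemma in_sw_image_i [simp]: "i \<in> sw i ` A \<longleftrightarrow> Suc i \<in> A" "Suc i \<in> sw i ` A \<longleftrightarrow> i \<in> A"
  by (auto simp: in_sw_image sw_def)

lemma fop_props:
  "up i Cs > 0 \<Longrightarrow> um i (fop i Cs) = um i Cs + 1 \<and> up i (fop i Cs) = up i Cs - 1 \<and> eop i (fop i Cs) = Cs"
  by (induction Cs) (auto split: if_splits)

lemma eop_props:
  "um i Cs > 0 \<Longrightarrow> um i (eop i Cs) = um i Cs - 1 \<and> up i (eop i Cs) = up i Cs + 1 \<and> fop i (eop i Cs) = Cs"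
  by (induction Cs) (auto split: if_splits)

lemma sw_image_subset: "Suc i < n \<Longrightarrow> sw i ` C \<subseteq> {..<n} \<longleftrightarrow> C \<subseteq> {..<n}"
proof -
  assume "Suc i < n"
  then have "sw i t < n \<longleftrightarrow> t < n" for t by (auto simp: sw_def)
  then show ?thesis by auto
qed

lemma hd_fop: "Cs \<noteq> [] \<Longrightarrow> hd (fop i Cs) = (if opn i (hd Cs) \<and> um i (tl Cs) = 0 then sw i ` hd Cs else hd Cs)"
  by (cases Cs) auto

lemma hd_eop: "Cs \<noteq> [] \<Longrightarrow> hd (eop i Cs) = (if cls i (hd Cs) \<and> um i (tl Cs) = 0 then sw i ` hd Cs else hd Cs)"
  by (cases Cs) auto

lemma fop_Nil_iff [simp]: "fop i Cs = [] \<longleftrightarrow> Cs = []" "eop i Cs = [] \<longleftrightarrow> Cs = []"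
  by (cases Cs; simp)+

lemma um_cls: "Cs \<noteq> [] \<Longrightarrow> cls i (hd Cs) \<Longrightarrow> um i Cs > 0"
  by (cases Cs) auto

lemma um_opn: "Cs \<noteq> [] \<Longrightarrow> opn i (hd Cs) \<Longrightarrow> um i (tl Cs) = 0 \<Longrightarrow> um i Cs = 0"
  by (cases Cs) auto

lemma queue_zero_transfer:
  assumes "agr i C C'" "agr i Y Y'" "queue C' Y' (Suc (Suc i)) \<le> queue C Y (Suc (Suc i))"
    "queue C Y n = 0" "Suc i < n"
  shows "queue C' Y' n = 0"
proof -
  have "agr i C' C" "agr i Y' Y" using assms by (auto simp: agr_def)
  then show ?thesis using queue_hi_le[of i n C' C Y' Y] assms by simp
qed

text \<open>It suffices that the queue at i + 2 does not grow. Moving a preference from i to i + 1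
  could make it grow only if C has the spot i but not i + 1, and then C would itself be the bracket
  acted upon.\<close>

lemma feas_fop: "Suc i < n \<Longrightarrow> feas n Cs \<Longrightarrow> feas n (fop i Cs)"
proof (induction Cs)
  case (Cons C Cs)
  show ?case
  proof (cases "opn i C \<and> um i Cs = 0")
    case True
    have "queue (sw i ` C) (hd Cs) n = 0" if "Cs \<noteq> []"
    proof (rule queue_zero_transfer[of i C _ "hd Cs"])
      show "queue (sw i ` C) (hd Cs) (Suc (Suc i)) \<le> queue C (hd Cs) (Suc (Suc i))"
        using True queue_lo[of i C "sw i ` C" "hd Cs" "hd Cs" i] by auto
    qed (use Cons that in auto)
    then show ?thesis using True Cons sw_image_subset[of i n C] by auto
  next
    case False
    have "queue C (hd (fop i Cs)) n = 0" if ne: "Cs \<noteq> []"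
    proof (cases "opn i (hd Cs) \<and> um i (tl Cs) = 0")
      case T: True
      then have "\<not> opn i C" using False um_opn[OF ne, of i] by auto
      moreover have "queue C (hd Cs) i = queue C (sw i ` hd Cs) i" by (rule queue_lo[of i]) auto
      ultimately have "queue C (sw i ` hd Cs) (Suc (Suc i)) \<le> queue C (hd Cs) (Suc (Suc i))"
        using T by auto
      then have "queue C (sw i ` hd Cs) n = 0"
        using queue_zero_transfer[of i C C "hd Cs" "sw i ` hd Cs" n] Cons.prems ne by auto
      then show ?thesis using T hd_fop[OF ne, of i] by simp
    next
      case F: False
      then show ?thesis using Cons.prems ne hd_fop[OF ne, of i] by auto
    qed
    then show ?thesis using False Cons by auto
  qed
qed simp

text \<open>Dual to \<open>feas_fop\<close>: moving the spot of C from i + 1 to i is harmful only if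
  the next column prefers i + 1 and not i, but such a closing bracket would be unmatched, contrary
  to \<open>um i Cs = 0\<close>.\<close>

lemma feas_eop: "Suc i < n \<Longrightarrow> feas n Cs \<Longrightarrow> feas n (eop i Cs)"
proof (induction Cs)
  case (Cons C Cs)
  show ?case
  proof (cases "cls i C \<and> um i Cs = 0")
    case True
    have "queue (sw i ` C) (hd Cs) n = 0" if ne: "Cs \<noteq> []"
    proof (rule queue_zero_transfer[of i C _ "hd Cs"])
      have "\<not> cls i (hd Cs)" using um_cls[OF ne, of i] True by auto
      then show "queue (sw i ` C) (hd Cs) (Suc (Suc i)) \<le> queue C (hd Cs) (Suc (Suc i))"
        using True queue_lo[of i C "sw i ` C" "hd Cs" "hd Cs" i] by auto
    qed (use Cons ne in auto)
    then show ?thesis using True Cons sw_image_subset[of i n C] by auto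
  next
    case False
    have "queue C (hd (eop i Cs)) n = 0" if ne: "Cs \<noteq> []"
    proof (cases "cls i (hd Cs) \<and> um i (tl Cs) = 0")
      case T: True
      have "queue C (hd Cs) i = queue C (sw i ` hd Cs) i" by (rule queue_lo[of i]) auto
      then have "queue C (sw i ` hd Cs) (Suc (Suc i)) \<le> queue C (hd Cs) (Suc (Suc i))"
        using T by auto
      then have "queue C (sw i ` hd Cs) n = 0"
        using queue_zero_transfer[of i C C "hd Cs" "sw i ` hd Cs" n] Cons.prems ne by auto
      then show ?thesis using T hd_eop[OF ne, of i] by simp
    next
      case F: False
      then show ?thesis using Cons.prems ne hd_eop[OF ne, of i] by auto
    qed
    then show ?thesis using False Cons by auto
  qed
qed simp

text \<open>If i + 1 lies in \<open>park C Y\<close>, then C contains i as well, since otherwise it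
  would be an unmatched closing bracket. The car at i + 1 either passed i when it was taken or
  prefers i + 1, and then the induction hypothesis puts i into Y.\<close>

lemma kcols_um0: "um i Cs = 0 \<Longrightarrow> K \<in> set (kcols Cs) \<Longrightarrow> Suc i \<in> K \<Longrightarrow> i \<in> K"
proof (induction Cs arbitrary: K)
  case (Cons C Cs)
  consider "K = C" | Y where "Y \<in> set (kcols Cs)" "K = park C Y" using Cons.prems by auto
  then show ?case
  proof cases
    case 1 then show ?thesis using Cons.prems by (auto split: if_splits)
  next
    case 2
    then have S: "Suc i \<in> C" using Cons.prems park_subset by blast
    then have "i \<in> C" using Cons.prems by (auto split: if_splits)
    then have "um i Cs = 0" using S Cons.prems by simp
    then have "Suc i \<in> Y \<Longrightarrow> i \<in> Y" using Cons.IH 2 by blast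
    then show ?thesis using Cons.prems 2 \<open>i \<in> C\<close> by (auto simp: park_i park_Suc_i)
  qed
qed simp

text \<open>This lemma and the next two list how an exchange of i and i + 1 meets one parking step:
  in the column, among the cars when the spot i is missing, and among the cars when both spots are
  present.\<close>

lemma park_sw_column:
  assumes "opn i C" "Suc i \<in> Y \<Longrightarrow> i \<in> Y"
  shows "park (sw i ` C) Y = sw i ` park C Y"
proof (rule agr_sw_eqI)
  have q: "queue (sw i ` C) Y i = queue C Y i" by (rule queue_lo[of i]) auto
  show "agr i (park (sw i ` C) Y) (park C Y)"
    by (rule park_agr) (use assms q in auto)
  show "(i \<in> park (sw i ` C) Y) = (Suc i \<in> park C Y)" "(Suc i \<in> park (sw i ` C) Y) = (i \<in> park C Y)"
    using assms q by (auto simp: park_i park_Suc_i)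
qed

lemma park_sw_cars:
  assumes "i \<notin> C"
  shows "park C (sw i ` Y) = park C Y"
proof (rule agr_eqI)
  have q: "queue C (sw i ` Y) i = queue C Y i" by (rule queue_lo[of i]) auto
  show "agr i (park C (sw i ` Y)) (park C Y)"
    by (rule park_agr) (use assms q in auto)
  show "(i \<in> park C (sw i ` Y)) = (i \<in> park C Y)" "(Suc i \<in> park C (sw i ` Y)) = (Suc i \<in> park C Y)"
    using assms q by (auto simp: park_i park_Suc_i)
qed

lemma park_sw_both:
  assumes "i \<in> C" "Suc i \<in> C" "Suc i \<in> Y \<Longrightarrow> i \<in> Y"
  shows "queue C Y i > 0 \<or> (i \<in> Y \<longleftrightarrow> Suc i \<in> Y) \<Longrightarrow> park C (sw i ` Y) = park C Y"
    "queue C Y i = 0 \<or> i \<in> Y \<Longrightarrow> park C (sw i ` Y) = sw i ` park C Y"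
proof -
  have q: "queue C (sw i ` Y) i = queue C Y i" by (rule queue_lo[of i]) auto
  have a: "agr i (park C (sw i ` Y)) (park C Y)"
    by (rule park_agr) (use assms q in auto)
  show "park C (sw i ` Y) = park C Y" if "queue C Y i > 0 \<or> (i \<in> Y \<longleftrightarrow> Suc i \<in> Y)"
    by (rule agr_eqI[OF a]) (use assms q that in \<open>auto simp: park_i park_Suc_i\<close>)
  show "park C (sw i ` Y) = sw i ` park C Y" if "queue C Y i = 0 \<or> i \<in> Y"
    by (rule agr_sw_eqI[OF a]) (use assms q that in \<open>auto simp: park_i park_Suc_i\<close>)
qed

text \<open>Along an i-string the key changes at most once, on leaving the head of the string
  (\<open>um = 0\<close>), and then by exchanging i and i + 1. The induction follows the exchange as
  it is parked leftwards: each column either carries it along or swallows it.\<close>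

lemma kcols_fop:
  "up i Cs > 0 \<Longrightarrow> kcols (fop i Cs) = kcols Cs
     \<or> um i Cs = 0 \<and> kcols (fop i Cs) = map ((`) (sw i)) (kcols Cs)"
proof (induction Cs)
  case (Cons C Cs)
  show ?case
  proof (cases "opn i C \<and> um i Cs = 0")
    case True
    have "park (sw i ` C) Y = sw i ` park C Y" if "Y \<in> set (kcols Cs)" for Y
    proof (rule park_sw_column)
      show "opn i C" using True by blast
      show "i \<in> Y" if "Suc i \<in> Y" by (rule kcols_um0[of i Cs]) (use True that \<open>Y \<in> set (kcols Cs)\<close> in simp_all)
    qed
    then have m: "map (park (sw i ` C)) (kcols Cs) = map ((`) (sw i)) (map (park C) (kcols Cs))" by simp
    have f: "fop i (C # Cs) = sw i ` C # Cs" using True by (simp only: fop.simps simp_thms if_True)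
    have "kcols (fop i (C # Cs)) = map ((`) (sw i)) (kcols (C # Cs))"
      unfolding f kcols.simps m list.map ..
    moreover have "um i (C # Cs) = 0" using True by simp
    ultimately show ?thesis by (intro disjI2 conjI)
  next
    case False
    then have f: "fop i (C # Cs) = C # fop i Cs" by (simp only: fop.simps if_False)
    have "up i Cs > 0" using Cons.prems False by (simp only: up.simps if_False)
    from Cons.IH[OF this] show ?thesis
    proof
      assume "kcols (fop i Cs) = kcols Cs"
      then have "kcols (fop i (C # Cs)) = kcols (C # Cs)" unfolding f by simp
      then show ?thesis by (rule disjI1)
    next
      assume *: "um i Cs = 0 \<and> kcols (fop i Cs) = map ((`) (sw i)) (kcols Cs)"
      then have u0: "\<And>Y. Y \<in> set (kcols Cs) \<Longrightarrow> Suc i \<in> Y \<Longrightarrow> i \<in> Y" using kcols_um0[of i Cs] by simp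
      have k: "kcols (fop i (C # Cs)) = C # map (\<lambda>Y. park C (sw i ` Y)) (kcols Cs)"
        unfolding f using * by (simp add: comp_def)
      show ?thesis
      proof (cases "i \<in> C")
        case False
        then have "kcols (fop i (C # Cs)) = kcols (C # Cs)" unfolding k by (simp add: park_sw_cars)
        then show ?thesis by (rule disjI1)
      next
        case True
        then have S: "Suc i \<in> C" using False * by blast
        show ?thesis
        \<comment> \<open>The remaining key is a chain, so a single such Y decides for all: smaller
          sets leave no queue at i and larger ones contain i, hence the exchange survives
          everywhere. Without such a Y it is swallowed everywhere.\<close>
        proof (cases "\<exists>Y\<in>set (kcols Cs). i \<in> Y \<and> Suc i \<notin> Y \<and> queue C Y i = 0")
          case True
          then obtain Y where Y: "Y \<in> set (kcols Cs)" "i \<in> Y" "Suc i \<notin> Y" "queue C Y i = 0" by blast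
          have "park C (sw i ` Z) = sw i ` park C Z" if Z: "Z \<in> set (kcols Cs)" for Z
          proof (rule park_sw_both(2)[OF \<open>i \<in> C\<close> S])
            have "Z \<subseteq> Y \<or> Y \<subseteq> Z" using kcols_comparable Y(1) Z by blast
            then show "queue C Z i = 0 \<or> i \<in> Z" using queue_mono[of Z Y C i] Y by auto
          qed (use u0 Z in blast)
          moreover have "sw i ` C = C" using \<open>i \<in> C\<close> S by (auto simp: in_sw_image sw_def)
          ultimately have "kcols (fop i (C # Cs)) = map ((`) (sw i)) (kcols (C # Cs))"
            unfolding k by simp
          moreover have "um i (C # Cs) = 0" using * S \<open>i \<in> C\<close> by simp
          ultimately show ?thesis by (intro disjI2 conjI)
        next
          case False
          have "park C (sw i ` Z) = park C Z" if Z: "Z \<in> set (kcols Cs)" for Z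
          proof (rule park_sw_both(1)[OF \<open>i \<in> C\<close> S])
            show "0 < queue C Z i \<or> (i \<in> Z) = (Suc i \<in> Z)" using False Z u0[OF Z] by auto
          qed (use u0 Z in blast)
          then have "kcols (fop i (C # Cs)) = kcols (C # Cs)" unfolding k by simp
          then show ?thesis by (rule disjI1)
        qed
      qed
    qed
  qed
qed simp

lemma fop_pow:
  "k \<le> up i Cs \<Longrightarrow> um i ((fop i ^^ k) Cs) = um i Cs + k \<and> up i ((fop i ^^ k) Cs) = up i Cs - k
     \<and> (eop i ^^ k) ((fop i ^^ k) Cs) = Cs"
proof (induction k)
  case (Suc k)
  then have IH: "um i ((fop i ^^ k) Cs) = um i Cs + k" "up i ((fop i ^^ k) Cs) = up i Cs - k"
    "(eop i ^^ k) ((fop i ^^ k) Cs) = Cs" by auto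
  then have "up i ((fop i ^^ k) Cs) > 0" using Suc.prems by simp
  from fop_props[OF this] IH Suc.prems show ?case
    by (auto simp: funpow_swap1[of "eop i"])
qed simp

lemma eop_pow:
  "k \<le> um i Cs \<Longrightarrow> um i ((eop i ^^ k) Cs) = um i Cs - k \<and> up i ((eop i ^^ k) Cs) = up i Cs + k
     \<and> (fop i ^^ k) ((eop i ^^ k) Cs) = Cs"
proof (induction k)
  case (Suc k)
  then have IH: "um i ((eop i ^^ k) Cs) = um i Cs - k" "up i ((eop i ^^ k) Cs) = up i Cs + k"
    "(fop i ^^ k) ((eop i ^^ k) Cs) = Cs" by auto
  then have "um i ((eop i ^^ k) Cs) > 0" using Suc.prems by simp
  from eop_props[OF this] IH Suc.prems show ?case
    by (auto simp: funpow_swap1[of "fop i"])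
qed simp

text \<open>An i-string is parametrised by \<open>um\<close>, which runs from 0 to the constant
  \<open>um + up\<close>; the result is the element with value u. Reflections of strings thus become
  arithmetic in u.\<close>

definition mv :: "nat \<Rightarrow> nat \<Rightarrow> nat set list \<Rightarrow> nat set list" where
  "mv i u Cs = (if um i Cs \<le> u then (fop i ^^ (u - um i Cs)) Cs else (eop i ^^ (um i Cs - u)) Cs)"

lemma mv_props:
  assumes "u \<le> um i Cs + up i Cs"
  shows "um i (mv i u Cs) = u" "up i (mv i u Cs) = um i Cs + up i Cs - u" "mv i (um i Cs) (mv i u Cs) = Cs"
proof -
  have "um i (mv i u Cs) = u \<and> up i (mv i u Cs) = um i Cs + up i Cs - u \<and> mv i (um i Cs) (mv i u Cs) = Cs"
  proof (cases "um i Cs \<le> u")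
    case True
    then have "u - um i Cs \<le> up i Cs" using assms by simp
    from fop_pow[OF this] True assms show ?thesis by (auto simp: mv_def)
  next
    case False
    then have "um i Cs - u \<le> um i Cs" by simp
    from eop_pow[OF this] False assms show ?thesis by (auto simp: mv_def)
  qed
  then show "um i (mv i u Cs) = u" "up i (mv i u Cs) = um i Cs + up i Cs - u" "mv i (um i Cs) (mv i u Cs) = Cs"
    by auto
qed

lemma feas_mv: "Suc i < n \<Longrightarrow> feas n Cs \<Longrightarrow> feas n (mv i u Cs)"
proof -
  assume *: "Suc i < n" "feas n Cs"
  have "feas n ((fop i ^^ k) Cs)" "feas n ((eop i ^^ k) Cs)" for k
    by (induction k) (use * feas_fop feas_eop in auto)
  then show ?thesis by (simp add: mv_def)
qed

lemma cnt_Cons: "cnt (C # Cs) t = of_bool (t \<in> C) + cnt Cs t"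
  by (simp add: cnt_def)

lemma cnt_Nil [simp]: "cnt [] t = 0"
  by (simp add: cnt_def)

lemma cnt_le: "(\<And>K. K \<in> set Ks \<Longrightarrow> s \<in> K \<Longrightarrow> t \<in> K) \<Longrightarrow> cnt Ks s \<le> cnt Ks t"
proof (induction Ks)
  case (Cons K Ks)
  have "cnt Ks s \<le> cnt Ks t" by (rule Cons.IH) (use Cons.prems in auto)
  then show ?case using Cons.prems[of K] by (auto simp: cnt_Cons)
qed simp

lemma cnt_balance: "cnt Cs i + um i Cs = cnt Cs (Suc i) + up i Cs"
  by (induction Cs) (auto simp: cnt_Cons)

lemma cnt_fop:
  "cnt (fop i Cs) i + cnt (fop i Cs) (Suc i) = cnt Cs i + cnt Cs (Suc i)"
  "cnt (eop i Cs) i + cnt (eop i Cs) (Suc i) = cnt Cs i + cnt Cs (Suc i)"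
  "t \<noteq> i \<Longrightarrow> t \<noteq> Suc i \<Longrightarrow> cnt (fop i Cs) t = cnt Cs t"
  "t \<noteq> i \<Longrightarrow> t \<noteq> Suc i \<Longrightarrow> cnt (eop i Cs) t = cnt Cs t"
  by (induction Cs) (auto simp: cnt_Cons in_sw_image[of t] sw_def)

lemma cnt_mv:
  assumes "u \<le> um i Cs + up i Cs"
  shows "cnt (mv i u Cs) (Suc i) + um i Cs = cnt Cs (Suc i) + u"
    and "cnt (mv i u Cs) i + u = cnt Cs i + um i Cs"
    and "t \<noteq> i \<Longrightarrow> t \<noteq> Suc i \<Longrightarrow> cnt (mv i u Cs) t = cnt Cs t"
proof -
  have "cnt ((fop i ^^ k) Cs) i + cnt ((fop i ^^ k) Cs) (Suc i) = cnt Cs i + cnt Cs (Suc i)"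
       "cnt ((eop i ^^ k) Cs) i + cnt ((eop i ^^ k) Cs) (Suc i) = cnt Cs i + cnt Cs (Suc i)" for k
    by (induction k) (simp_all add: cnt_fop)
  then have s: "cnt (mv i u Cs) i + cnt (mv i u Cs) (Suc i) = cnt Cs i + cnt Cs (Suc i)"
    by (simp add: mv_def)
  have b: "cnt (mv i u Cs) i + u = cnt (mv i u Cs) (Suc i) + (um i Cs + up i Cs - u)"
    using cnt_balance[of "mv i u Cs" i] mv_props[OF assms] by simp
  show "cnt (mv i u Cs) (Suc i) + um i Cs = cnt Cs (Suc i) + u" "cnt (mv i u Cs) i + u = cnt Cs i + um i Cs"
    using s b cnt_balance[of Cs i] assms by linarith+
  show "cnt (mv i u Cs) t = cnt Cs t" if "t \<noteq> i" "t \<noteq> Suc i"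
  proof -
    have "cnt ((fop i ^^ k) Cs) t = cnt Cs t" "cnt ((eop i ^^ k) Cs) t = cnt Cs t" for k
      by (induction k) (use that in \<open>simp_all add: cnt_fop\<close>)
    then show ?thesis by (simp add: mv_def)
  qed
qed

lemma kcols_fop_pow: "k \<le> up i Cs \<Longrightarrow> um i Cs \<ge> 1 \<Longrightarrow> kcols ((fop i ^^ k) Cs) = kcols Cs"
proof (induction k)
  case (Suc k)
  then show ?case using kcols_fop[of i "(fop i ^^ k) Cs"] fop_pow[of k i Cs] by auto
qed simp

lemma kcols_eop_pow: "k < um i Cs \<Longrightarrow> kcols ((eop i ^^ k) Cs) = kcols Cs"
proof (induction k)
  case (Suc k)
  let ?x = "(eop i ^^ k) Cs"
  have "um i ?x \<ge> 2" using eop_pow[of k i Cs] Suc.prems by auto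
  then have "um i (eop i ?x) \<ge> 1" "up i (eop i ?x) > 0" "fop i (eop i ?x) = ?x" using eop_props[of i ?x] by auto
  then have "kcols ?x = kcols (eop i ?x)" using kcols_fop[of i "eop i ?x"] by auto
  then show ?case using Suc by simp
qed simp

text \<open>A move between elements with \<open>um\<close> at least 1 does not pass the head of the
  string, the only place where \<open>kcols_fop\<close> allows a change.\<close>

lemma kcols_mv_pos:
  "u \<le> um i Cs + up i Cs \<Longrightarrow> um i Cs \<ge> 1 \<Longrightarrow> u \<ge> 1 \<Longrightarrow> kcols (mv i u Cs) = kcols Cs"
  by (auto simp: mv_def kcols_fop_pow kcols_eop_pow)

lemma kcols_mv:
  assumes "u \<le> um i Cs + up i Cs"
  shows "kcols (mv i u Cs) = kcols Cs \<or> kcols (mv i u Cs) = map ((`) (sw i)) (kcols Cs)"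
proof -
  have up: "kcols (mv i u Cs) = kcols Cs \<or> kcols (mv i u Cs) = map ((`) (sw i)) (kcols Cs)"
    if h: "um i Cs = 0" "u \<ge> 1" "u \<le> up i Cs" for u Cs
  proof -
    obtain k where k: "u = Suc k" using h(2) by (cases u) auto
    have "um i (fop i Cs) = 1" "k \<le> up i (fop i Cs)" using fop_props[of i Cs] h k by auto
    then have "kcols ((fop i ^^ k) (fop i Cs)) = kcols (fop i Cs)" by (simp add: kcols_fop_pow)
    then have "kcols (mv i u Cs) = kcols (fop i Cs)" using h k by (simp add: mv_def funpow_swap1)
    then show ?thesis using kcols_fop[of i Cs] h by auto
  qed
  have inv: "map ((`) (sw i)) (map ((`) (sw i)) Ks) = Ks" for Ks by (simp add: comp_def)
  consider "um i Cs \<ge> 1" "u \<ge> 1" | "um i Cs = 0" "u = 0" | "um i Cs = 0" "u \<ge> 1" | "um i Cs \<ge> 1" "u = 0"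
    by linarith
  then show ?thesis
  proof cases
    case 1 then show ?thesis using kcols_mv_pos assms by blast
  next
    case 2 then show ?thesis by (simp add: mv_def)
  next
    case 3 then show ?thesis using up assms by auto
  next
    case 4
    then have "kcols Cs = kcols (mv i u Cs) \<or> kcols Cs = map ((`) (sw i)) (kcols (mv i u Cs))"
      using up[of "mv i u Cs" "um i Cs"] mv_props[OF assms] by simp
    then show ?thesis using inv by metis
  qed
qed

section \<open>The operators \<pi>_i on atoms, and the dominant case\<close>

lemma length_lswap [simp]: "length (lswap k w) = length w"
  by (simp add: lswap_def)

lemma nth_lswap: "Suc k < length w \<Longrightarrow> t < length w \<Longrightarrow> lswap k w ! t = w ! sw k t"
  by (auto simp: lswap_def sw_def nth_list_update)

lemma lswap_lswap [simp]: "Suc k < length w \<Longrightarrow> lswap k (lswap k w) = w"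
  by (rule nth_equalityI) (auto simp: lswap_def nth_list_update)

lemma length_colkey [simp]: "length (colkey n Cs) = n"
  by (simp add: colkey_def)

lemma nth_colkey [simp]: "t < n \<Longrightarrow> colkey n Cs ! t = cnt (kcols Cs) t"
  by (simp add: colkey_def)

lemma sw_less: "Suc i < n \<Longrightarrow> sw i t < n \<longleftrightarrow> t < n"
  by (auto simp: sw_def)

lemma colkey_sw:
  assumes "kcols Ds = map ((`) (sw i)) (kcols Cs)" "Suc i < n"
  shows "colkey n Ds = lswap i (colkey n Cs)"
proof (rule nth_equalityI)
  fix t assume t: "t < length (colkey n Ds)"
  have "cnt (kcols Ds) t = cnt (kcols Cs) (sw i t)"
    unfolding assms(1) cnt_def filter_map by (simp add: comp_def in_sw_image)
  then show "colkey n Ds ! t = lswap i (colkey n Cs) ! t"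
    using t assms(2) by (simp add: nth_lswap sw_less)
qed simp

lemma swapv_xm: "Suc i < n \<Longrightarrow> swapv i (xm n g) = xm n (g \<circ> sw i)"
  unfolding xm_def swapv_prod swapv_power swapv_X
  by (rule prod.reindex_bij_witness[of _ "sw i" "sw i"]) (auto simp: sw_less)

lemma xm_cong: "(\<And>t. t < n \<Longrightarrow> g t = h t) \<Longrightarrow> xm n g = xm n h"
  by (simp add: xm_def)

lemma xm_X: "k < n \<Longrightarrow> g k > 0 \<Longrightarrow> xm n g = X k * xm n (\<lambda>t. g t - of_bool (t = k))"
proof -
  assume k: "k < n" "g k > 0"
  have 1: "xm n h = X k ^ h k * (\<Prod>t\<in>{..<n} - {k}. X t ^ h t)" for h
    unfolding xm_def by (rule prod.remove) (use k in auto)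
  have "X k ^ g k = X k * X k ^ (g k - 1)" using k by (metis One_nat_def Suc_pred power_Suc)
  moreover have "(\<Prod>t\<in>{..<n} - {k}. X t ^ g t) = (\<Prod>t\<in>{..<n} - {k}. X t ^ (g t - of_bool (t = k)))"
    by (rule prod.cong) auto
  ultimately show ?thesis unfolding 1[of g] 1[of "\<lambda>t. g t - of_bool (t = k)"] by (simp add: mult.assoc)
qed

lemma kcols_subset_hd: "Y \<in> set (kcols Cs) \<Longrightarrow> Y \<subseteq> hd Cs"
  by (cases Cs) (use park_subset in auto)

lemma card_park_feas:
  assumes "queue C D n = 0" "Y \<subseteq> D" "Y \<subseteq> {..<n}" "C \<subseteq> {..<n}"
  shows "card (park C Y) = card Y"
proof -
  have "queue C Y n = 0" using queue_mono[OF assms(2), of C n] assms(1) by simp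
  moreover have "Y \<inter> {..<n} = Y" "park C Y \<inter> {..<n} = park C Y" using assms park_subset by blast+
  ultimately show ?thesis using card_park[of Y n C] by simp
qed

lemma kcols_props: "feas n Cs \<Longrightarrow> K \<in> set (kcols Cs) \<Longrightarrow> K \<subseteq> {..<n} \<and> K \<noteq> {}"
proof (induction Cs arbitrary: K)
  case (Cons C Cs)
  show ?case
  proof (cases "K = C")
    case False
    then obtain Y where Y: "Y \<in> set (kcols Cs)" "K = park C Y" using Cons.prems by auto
    then have "Cs \<noteq> []" by auto
    then have "card K = card Y" using card_park_feas[of C "hd Cs" n Y] Cons Y kcols_subset_hd[of Y Cs] by auto
    moreover have "finite Y" using Cons Y by (meson finite_lessThan feas.simps finite_subset)
    ultimately show ?thesis using Cons Y park_subset[of C Y] by (auto simp: card_eq_0_iff)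
  qed (use Cons in auto)
qed simp

lemma sum_cnt: "(\<And>K. K \<in> set Ks \<Longrightarrow> K \<subseteq> {..<n}) \<Longrightarrow> (\<Sum>t<n. cnt Ks t) = (\<Sum>K\<leftarrow>Ks. card K)"
proof (induction Ks)
  case (Cons K Ks)
  have "(\<Sum>t<n. of_bool (t \<in> K)) = card K"
  proof -
    have "{t. t < n \<and> t \<in> K} = K" using Cons.prems[of K] by auto
    then show ?thesis by (simp add: of_bool_def sum.If_cases Int_def)
  qed
  then show ?case using Cons by (simp add: cnt_Cons sum.distrib)
qed simp

lemma length_le_colkey: "feas n Cs \<Longrightarrow> length Cs \<le> sum_list (colkey n Cs)"
proof -
  assume f: "feas n Cs"
  have "length (kcols Cs) \<le> (\<Sum>K\<leftarrow>kcols Cs. card K)"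
  proof -
    have "card K \<ge> 1" if "K \<in> set (kcols Cs)" for K
      using kcols_props[OF f that] by (metis One_nat_def Suc_leI card_gt_0_iff finite_lessThan finite_subset)
    then have "(\<Sum>K\<leftarrow>kcols Cs. 1) \<le> (\<Sum>K\<leftarrow>kcols Cs. card K)" by (intro sum_list_mono) auto
    then show ?thesis by (simp add: sum_list_triv)
  qed
  also have "\<dots> = sum_list (colkey n Cs)"
    using sum_cnt[of "kcols Cs" n] kcols_props[OF f]
    by (simp add: colkey_def sum_list_distinct_conv_sum_set atLeast0LessThan)
  finally show ?thesis by simp
qed

lemma feas_subset: "feas n Cs \<Longrightarrow> set Cs \<subseteq> Pow {..<n}"
  by (induction Cs) auto

lemma finite_colset: "finite (colset a)"
proof (rule finite_subset)
  show "colset a \<subseteq> {Cs. set Cs \<subseteq> Pow {..<length a} \<and> length Cs \<le> sum_list a}"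
    using feas_subset length_le_colkey by (fastforce simp: colset_def)
  show "finite {Cs. set Cs \<subseteq> Pow {..<length a} \<and> length Cs \<le> sum_list a}"
    by (rule finite_lists_length_le) simp
qed

text \<open>Reflecting every i-string, that is sending \<open>um\<close> to \<open>up\<close>,
  exchanges the exponents of \<open>X i\<close> and \<open>X (Suc i)\<close>. The key is kept or
  exchanged, so the union of the two classes is permuted.\<close>

lemma sum_colset_sym:
  assumes i: "Suc i < length a"
  shows "swapv i (\<Sum>Cs\<in>colset a \<union> colset (lswap i a). xm (length a) (cnt Cs))
    = (\<Sum>Cs\<in>colset a \<union> colset (lswap i a). xm (length a) (cnt Cs))"
  unfolding swapv_sum swapv_xm[OF i]
proof (rule sum.reindex_bij_witness[of _ "\<lambda>Cs. mv i (up i Cs) Cs" "\<lambda>Cs. mv i (up i Cs) Cs"])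
  fix Cs assume Cs: "Cs \<in> colset a \<union> colset (lswap i a)"
  have le: "up i Cs \<le> um i Cs + up i Cs" by simp
  show "mv i (up i (mv i (up i Cs) Cs)) (mv i (up i Cs) Cs) = Cs" using mv_props[OF le] by simp
  then show "mv i (up i (mv i (up i Cs) Cs)) (mv i (up i Cs) Cs) = Cs" .
  have "colkey (length a) (mv i (up i Cs) Cs) = colkey (length a) Cs
      \<or> colkey (length a) (mv i (up i Cs) Cs) = lswap i (colkey (length a) Cs)"
    using kcols_mv[OF le] colkey_sw[OF _ i] unfolding colkey_def by metis
  then show "mv i (up i Cs) Cs \<in> colset a \<union> colset (lswap i a)"
    using Cs feas_mv[OF i] i by (auto simp: colset_def)
  then show "mv i (up i Cs) Cs \<in> colset a \<union> colset (lswap i a)" .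
  show "xm (length a) (cnt (mv i (up i Cs) Cs)) = xm (length a) (cnt Cs \<circ> sw i)"
  proof (rule xm_cong)
    fix t
    show "cnt (mv i (up i Cs) Cs) t = (cnt Cs \<circ> sw i) t"
      using cnt_mv(1,2)[OF le] cnt_mv(3)[OF le, of t] cnt_balance[of Cs i] by (auto simp: sw_def)
  qed
qed

lemma um_pos_colset:
  assumes "Cs \<in> colset a" "Suc i < length a" "a ! i < a ! Suc i"
  shows "um i Cs > 0"
proof (rule ccontr)
  assume "\<not> um i Cs > 0"
  then have "cnt (kcols Cs) (Suc i) \<le> cnt (kcols Cs) i"
    using kcols_um0[of i Cs] by (intro cnt_le) auto
  moreover have "a ! t = cnt (kcols Cs) t" if "t < length a" for t
    using assms(1) that nth_colkey[of t "length a" Cs] by (simp add: colset_def)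
  ultimately show False using assms by simp
qed

text \<open>With an ascent at i the class consists of i-strings without their heads. After division
  by \<open>X (Suc i)\<close> such a string is symmetric again, under the reflection sending
  \<open>um\<close> to \<open>up + 1\<close>.\<close>

lemma colatom_ascent:
  assumes i: "Suc i < length a" and asc: "a ! i < a ! Suc i"
  shows "\<exists>h. colatom a = X (Suc i) * h \<and> swapv i h = h"
proof -
  let ?n = "length a"
  define h where "h = (\<Sum>Cs\<in>colset a. xm ?n (\<lambda>t. cnt Cs t - of_bool (t = Suc i)))"
  have pos: "um i Cs \<ge> 1" "cnt Cs (Suc i) \<ge> 1" if "Cs \<in> colset a" for Cs
  proof -
    show u: "um i Cs \<ge> 1" using um_pos_colset[OF that i asc] by simp
    have "um i Ds \<le> cnt Ds (Suc i)" for Ds by (induction Ds) (auto simp: cnt_Cons)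
    then show "cnt Cs (Suc i) \<ge> 1" using u le_trans by blast
  qed
  have "colatom a = X (Suc i) * h"
    unfolding colatom_def h_def sum_distrib_left
    by (rule sum.cong) (use pos(2) i xm_X in \<open>auto simp: Suc_le_eq\<close>)
  moreover have "swapv i h = h"
    unfolding h_def swapv_sum swapv_xm[OF i]
  proof (rule sum.reindex_bij_witness[of _ "\<lambda>Cs. mv i (up i Cs + 1) Cs" "\<lambda>Cs. mv i (up i Cs + 1) Cs"])
    fix Cs assume Cs: "Cs \<in> colset a"
    have le: "up i Cs + 1 \<le> um i Cs + up i Cs" using pos[OF Cs] by simp
    show "mv i (up i (mv i (up i Cs + 1) Cs) + 1) (mv i (up i Cs + 1) Cs) = Cs"
      using mv_props[OF le] pos[OF Cs] by simp
    then show "mv i (up i (mv i (up i Cs + 1) Cs) + 1) (mv i (up i Cs + 1) Cs) = Cs" .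
    have "kcols (mv i (up i Cs + 1) Cs) = kcols Cs" using kcols_mv_pos[OF le] pos[OF Cs] by simp
    then show "mv i (up i Cs + 1) Cs \<in> colset a"
      using Cs feas_mv[OF i] by (auto simp: colset_def colkey_def)
    then show "mv i (up i Cs + 1) Cs \<in> colset a" .
    show "xm ?n (\<lambda>t. cnt (mv i (up i Cs + 1) Cs) t - of_bool (t = Suc i))
        = xm ?n ((\<lambda>t. cnt Cs t - of_bool (t = Suc i)) \<circ> sw i)"
    proof (rule xm_cong)
      fix t
      show "cnt (mv i (up i Cs + 1) Cs) t - of_bool (t = Suc i) = ((\<lambda>t. cnt Cs t - of_bool (t = Suc i)) \<circ> sw i) t"
        using cnt_mv(1,2)[OF le] cnt_mv(3)[OF le, of t] cnt_balance[of Cs i] pos[OF Cs] by (auto simp: sw_def)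
    qed
  qed
  ultimately show ?thesis by blast
qed

lemma pidiff_colatom_ascent:
  "Suc i < length a \<Longrightarrow> a ! i < a ! Suc i \<Longrightarrow> pidiff i (colatom a) = 0"
  using colatom_ascent pidiff_X_Suc by metis

lemma lswap_eq: "Suc i < length a \<Longrightarrow> a ! i = a ! Suc i \<Longrightarrow> lswap i a = a"
  by (simp add: lswap_def list_eq_iff_nth_eq nth_list_update)

lemma pidiff_colatom_level:
  "Suc i < length a \<Longrightarrow> a ! i = a ! Suc i \<Longrightarrow> pidiff i (colatom a) = colatom a"
  using sum_colset_sym[of i a] by (simp add: lswap_eq colatom_def pidiff_sym)

text \<open>The sum of the two atoms is symmetric in \<open>X i\<close> and
  \<open>X (Suc i)\<close>, hence fixed by \<pi>_i, and \<pi>_i kills the second one.\<close>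

lemma pidiff_colatom_descent:
  assumes i: "Suc i < length a" and desc: "a ! Suc i < a ! i"
  shows "pidiff i (colatom a) = colatom a + colatom (lswap i a)"
proof -
  have "lswap i a ! i < lswap i a ! Suc i" using assms by (simp add: nth_lswap sw_def)
  then have 0: "pidiff i (colatom (lswap i a)) = 0" using i by (simp add: pidiff_colatom_ascent)
  have "colset a \<inter> colset (lswap i a) = {}"
    using \<open>lswap i a ! i < lswap i a ! Suc i\<close> desc i by (auto simp: colset_def)
  then have "swapv i (colatom a + colatom (lswap i a)) = colatom a + colatom (lswap i a)"
    using sum_colset_sym[OF i] by (simp add: colatom_def sum.union_disjoint finite_colset del: swapv_add)
  then have "pidiff i (colatom a + colatom (lswap i a)) = colatom a + colatom (lswap i a)" by (rule pidiff_sym)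
  then show ?thesis using 0 by (simp add: pidiff_add)
qed

text \<open>The key tableau of a, with the level sets of a as columns. The number of columns is the
  largest part; 0 is inserted so that \<open>Max\<close> is meaningful for the empty list.\<close>

definition level_cols :: "nat list \<Rightarrow> nat set list" where
  "level_cols a = map (\<lambda>j. {p. p < length a \<and> j < a ! p}) [0..<Max (insert 0 (set a))]"

lemma cnt_le_length: "cnt Ks t \<le> length Ks"
  by (simp add: cnt_def)

text \<open>In a decreasing chain the sets containing t form a prefix.\<close>

lemma chain_mem_iff:
  "sorted_wrt (\<lambda>A B. B \<subseteq> A) Ks \<Longrightarrow> j < length Ks \<Longrightarrow> t \<in> Ks ! j \<longleftrightarrow> j < cnt Ks t"
proof (induction Ks arbitrary: j)
  case (Cons K Ks)
  show ?case
  proof (cases "t \<in> K")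
    case True
    then show ?thesis using Cons by (cases j) (auto simp: cnt_Cons)
  next
    case False
    then have "t \<notin> L" if "L \<in> set Ks" for L using Cons.prems(1) that by auto
    then have "cnt Ks t = 0" "\<And>k. k < length Ks \<Longrightarrow> t \<notin> Ks ! k" by (auto simp: cnt_def filter_empty_conv)
    then show ?thesis using False Cons.prems by (cases j) (auto simp: cnt_Cons)
  qed
qed simp

text \<open>A decreasing chain is determined by how many of its members contain each point once its
  length is known, and nonemptiness of the last member fixes the length.\<close>

lemma kcols_eq_level_cols:
  assumes "Cs \<in> colset a"
  shows "kcols Cs = level_cols a"
proof -
  let ?n = "length a" and ?K = "kcols Cs"
  have f: "feas ?n Cs" and key: "\<And>t. t < ?n \<Longrightarrow> a ! t = cnt ?K t"
    using assms nth_colkey[of _ ?n Cs] by (auto simp: colset_def)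
  have sub: "K \<subseteq> {..<?n}" "K \<noteq> {}" if "K \<in> set ?K" for K using kcols_props[OF f that] by auto
  have "Max (insert 0 (set a)) = length ?K"
  proof (rule Max_eqI)
    show "length ?K \<in> insert 0 (set a)"
    proof (cases "length ?K")
      case (Suc m)
      then obtain t where t: "t \<in> ?K ! m" using sub(2)[of "?K ! m"] by fastforce
      then have "t < ?n" using sub(1)[of "?K ! m"] Suc by auto
      moreover have "m < cnt ?K t" using chain_mem_iff[OF kcols_chain, of m Cs t] t Suc by auto
      then have "cnt ?K t = length ?K" using Suc cnt_le_length[of ?K t] by simp
      ultimately show ?thesis using key[of t] by (metis insertI2 nth_mem)
    qed simp
    show "y \<le> length ?K" if "y \<in> insert 0 (set a)" for y
      using that key cnt_le_length[of ?K] by (auto simp: in_set_conv_nth)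
  qed auto
  then show ?thesis
  proof (intro nth_equalityI)
    fix j assume "Max (insert 0 (set a)) = length ?K" "j < length ?K"
    then show "?K ! j = level_cols a ! j"
      using chain_mem_iff[OF kcols_chain, of j Cs] sub(1)[of "?K ! j"] key
      by (auto simp: level_cols_def)
  qed (simp add: level_cols_def)
qed

lemma queue_subset: "Y \<subseteq> C \<Longrightarrow> queue C Y t = 0"
  by (induction t) auto

lemma park_id: "Y \<subseteq> C \<Longrightarrow> park C Y = Y"
  by (auto simp: park_def queue_subset)

lemma kcols_id: "sorted_wrt (\<lambda>A B. B \<subseteq> A) Cs \<Longrightarrow> kcols Cs = Cs"
  by (induction Cs) (auto simp: park_id map_idI)

lemma feas_chain:
  "sorted_wrt (\<lambda>A B. B \<subseteq> A) Cs \<Longrightarrow> (\<And>C. C \<in> set Cs \<Longrightarrow> C \<subseteq> {..<n} \<and> C \<noteq> {}) \<Longrightarrow> feas n Cs"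
proof (induction Cs)
  case (Cons C Cs)
  then show ?case by (cases Cs) (auto simp: queue_subset)
qed simp

lemma cnt_level_cols: "t < length a \<Longrightarrow> cnt (level_cols a) t = a ! t"
proof -
  assume t: "t < length a"
  let ?M = "Max (insert 0 (set a))"
  have "a ! t \<le> ?M" using t by (intro Max_ge) auto
  then have "{j. j < ?M \<and> j < a ! t} = {..<a ! t}" by auto
  moreover have "cnt (level_cols a) t = card {j. j < ?M \<and> j < a ! t}"
    using t by (simp add: cnt_def level_cols_def filter_map comp_def length_filter_conv_card)
      (rule arg_cong[where f = card], auto)
  ultimately show ?thesis by simp
qed

lemma level_cols_colset: "level_cols a \<in> colset a"
proof -
  let ?M = "Max (insert 0 (set a))"
  have ch: "sorted_wrt (\<lambda>A B. B \<subseteq> A) (level_cols a)"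
    unfolding level_cols_def sorted_wrt_map by (rule sorted_wrt_mono_rel[OF _ sorted_wrt_upt]) auto
  have "C \<subseteq> {..<length a} \<and> C \<noteq> {}" if C: "C \<in> set (level_cols a)" for C
  proof -
    obtain j where j: "j < ?M" "C = {p. p < length a \<and> j < a ! p}" using C by (auto simp: level_cols_def)
    have "?M \<in> insert 0 (set a)" by (intro Max_in) auto
    then obtain p where "p < length a" "a ! p = ?M" using j by (auto simp: in_set_conv_nth)
    then show ?thesis using j by auto
  qed
  then have "feas (length a) (level_cols a)" using ch by (intro feas_chain) auto
  moreover have "colkey (length a) (level_cols a) = a"
    by (rule nth_equalityI) (simp_all add: kcols_id[OF ch] cnt_level_cols)
  ultimately show ?thesis by (simp add: colset_def)
qed

lemma xmon_xm: "xmon a = xm (length a) (\<lambda>t. a ! t)"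
  by (simp add: xmon_def xm_def)

lemma card_kcols_below:
  "j < length Cs \<Longrightarrow> card (kcols Cs ! j \<inter> {..<t}) \<le> card (Cs ! j \<inter> {..<t})"
proof (induction Cs arbitrary: j)
  case (Cons C Cs)
  show ?case
  proof (cases j)
    case (Suc k)
    then have "card (park C (kcols Cs ! k) \<inter> {..<t}) \<le> card (kcols Cs ! k \<inter> {..<t})"
      using card_park[of "kcols Cs ! k" t C] by simp
    then show ?thesis using Suc Cons.IH[of k] Cons.prems by simp
  qed simp
qed simp

lemma card_kcols: "feas n Cs \<Longrightarrow> j < length Cs \<Longrightarrow> card (kcols Cs ! j) = card (Cs ! j)"
proof (induction Cs arbitrary: j)
  case (Cons C Cs)
  show ?case
  proof (cases j)
    case (Suc k)
    then have k: "kcols Cs ! k \<in> set (kcols Cs)" "Cs \<noteq> []" using Cons.prems by auto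
    then have "card (park C (kcols Cs ! k)) = card (kcols Cs ! k)"
      using card_park_feas[of C "hd Cs" n "kcols Cs ! k"] kcols_subset_hd[OF k(1)] kcols_props[of n Cs, OF _ k(1)] Cons.prems
      by auto
    then show ?thesis using Suc Cons.IH[of k] Cons.prems by simp
  qed simp
qed simp

abbreviation dominant :: "nat list \<Rightarrow> bool" where
  "dominant a \<equiv> \<forall>k. Suc k < length a \<longrightarrow> a ! Suc k \<le> a ! k"

lemma dominant_antimono: "i \<le> j \<Longrightarrow> dominant a \<Longrightarrow> j < length a \<Longrightarrow> a ! j \<le> a ! i"
proof (induction j rule: dec_induct)
  case (step j)
  then show ?case by (meson Suc_lessD le_trans)
qed simp

text \<open>Parking moves entries only to the right, so a column has at least as many entries below
  any t as its key column. For dominant a the key columns are initial segments, which leaves no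
  freedom.\<close>

lemma colset_dominant:
  assumes "dominant a"
  shows "colset a = {level_cols a}"
proof -
  have "Cs = level_cols a" if Cs: "Cs \<in> colset a" for Cs
  proof -
    have K: "kcols Cs = level_cols a" by (rule kcols_eq_level_cols[OF Cs])
    have f: "feas (length a) Cs" using Cs by (simp add: colset_def)
    have len: "length Cs = length (level_cols a)" using arg_cong[OF K, of length] by simp
    show ?thesis
    proof (rule nth_equalityI[OF len])
      fix j assume j: "j < length Cs"
      let ?L = "level_cols a ! j" and ?C = "Cs ! j"
      have fin: "finite ?C" using feas_subset[OF f] j by (meson PowD finite_lessThan finite_subset nth_mem subsetD)
      have L: "?L = {p. p < length a \<and> j < a ! p}" using j len by (simp add: level_cols_def)
      have "?L \<subseteq> ?C"
      proof
        fix p assume p: "p \<in> ?L"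
        have "{..p} \<subseteq> ?L" using p L dominant_antimono[OF _ assms] by force
        then have "?L \<inter> {..<Suc p} = {..p}" by auto
        then have "card (?C \<inter> {..<Suc p}) \<ge> Suc p"
          using card_kcols_below[of j Cs "Suc p"] j K by simp
        moreover have "?C \<inter> {..<Suc p} \<subseteq> {..<Suc p}" by blast
        ultimately have "?C \<inter> {..<Suc p} = {..<Suc p}"
          by (intro card_seteq) auto
        then show "p \<in> ?C" by auto
      qed
      moreover have "card ?L = card ?C" using card_kcols[OF f j] K by simp
      ultimately show "?C = ?L" using card_subset_eq[OF fin] by metis
    qed
  qed
  then show ?thesis using level_cols_colset by blast
qed

lemma colatom_dominant: "dominant a \<Longrightarrow> colatom a = xmon a"
  by (simp add: colatom_def colset_dominant xmon_xm cnt_level_cols cong: xm_cong)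

section \<open>Key polynomials as sums of atoms\<close>

definition bigparts :: "nat list \<Rightarrow> nat \<Rightarrow> nat \<Rightarrow> nat" where
  "bigparts a j t = (\<Sum>p<t. of_bool (j < a ! p))"

text \<open>The tableau criterion for Bruhat order on the rearrangements of a, with the dominant one
  as minimum: for every threshold j the parts above j lie at least as far to the left in b as in
  a.\<close>

definition bru :: "nat list \<Rightarrow> nat list set" where
  "bru a = {b. mset b = mset a \<and> (\<forall>j. \<forall>t\<le>length a. bigparts a j t \<le> bigparts b j t)}"

definition kap :: "nat list \<Rightarrow> poly" where
  "kap a = (\<Sum>b\<in>bru a. colatom b)"

lemma finite_bru: "finite (bru a)"
  by (rule finite_subset[of _ "{b. mset b = mset a}"]) (auto simp: bru_def mset_eq_finite)

lemma bru_length: "b \<in> bru a \<Longrightarrow> length b = length a"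
  by (auto simp: bru_def dest: mset_eq_length)

lemma bru_refl: "a \<in> bru a"
  by (simp add: bru_def)

lemma mset_lswap: "Suc i < length a \<Longrightarrow> mset (lswap i a) = mset a"
  unfolding lswap_def using mset_swap[of "Suc i" a i] by simp

lemma bigparts_Suc: "bigparts a j (Suc t) = bigparts a j t + of_bool (j < a ! t)"
  by (simp add: bigparts_def)

lemma bigparts_lswap:
  assumes "Suc i < length a" "t \<le> length a" "t \<noteq> Suc i"
  shows "bigparts (lswap i a) j t = bigparts a j t"
proof (cases "t \<le> i")
  case True
  then show ?thesis unfolding bigparts_def using assms by (intro sum.cong) (auto simp: nth_lswap sw_def)
next
  case False
  then have "Suc i < t" using assms by simp
  then show ?thesis unfolding bigparts_def
    by (intro sum.reindex_bij_witness[of _ "sw i" "sw i"]) (use assms in \<open>auto simp: nth_lswap sw_less\<close>)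
qed

lemma bigparts_length: "mset a = mset b \<Longrightarrow> bigparts a j (length a) = bigparts b j (length b)"
proof -
  have "bigparts c j (length c) = size (filter_mset (\<lambda>x. j < x) (mset c))" for c
  proof -
    have "bigparts c j (length c) = card {p. p < length c \<and> j < c ! p}"
      by (simp add: bigparts_def of_bool_def sum.If_cases Int_def)
    then show ?thesis by (simp add: length_filter_conv_card flip: mset_filter)
  qed
  then show "mset a = mset b \<Longrightarrow> ?thesis" by simp
qed

text \<open>The lifting property of Bruhat order. Swapping two neighbours changes a prefix count
  only at t = i + 1, and there the old and the new inequality are equivalent given those at i and i
  + 2.\<close>

lemma bru_step:
  assumes i: "Suc i < length a" and asc: "a ! i \<le> a ! Suc i" and len: "length b = length a"
    and b': "b' = (if b ! i < b ! Suc i then lswap i b else b)"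
  shows "b \<in> bru a \<longleftrightarrow> b' \<in> bru (lswap i a)"
proof -
  let ?a' = "lswap i a"
  have ib: "Suc i < length b" using i len by simp
  have off: "bigparts ?a' j t = bigparts a j t" "bigparts b' j t = bigparts b j t"
    if "t \<le> length a" "t \<noteq> Suc i" for j t
    using bigparts_lswap[OF i] bigparts_lswap[OF ib] that len b' by auto
  have a'i: "?a' ! i = a ! Suc i" "?a' ! Suc i = a ! i" using i by (simp_all add: nth_lswap sw_def)
  have b'i: "b' ! i \<ge> b' ! Suc i" "b' ! i = b ! i \<and> b' ! Suc i = b ! Suc i \<or> b' ! i = b ! Suc i \<and> b' ! Suc i = b ! i"
    using ib b' by (auto simp: nth_lswap sw_def)
  have ms: "mset b' = mset b" using ib b' by (simp add: mset_lswap)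
  have "(\<forall>t\<le>length a. bigparts a j t \<le> bigparts b j t) \<longleftrightarrow> (\<forall>t\<le>length a. bigparts ?a' j t \<le> bigparts b' j t)" for j
  proof -
    have key: "bigparts a j (Suc i) \<le> bigparts b j (Suc i) \<longleftrightarrow> bigparts ?a' j (Suc i) \<le> bigparts b' j (Suc i)"
      if o: "bigparts a j i \<le> bigparts b j i" "bigparts a j (Suc (Suc i)) \<le> bigparts b j (Suc (Suc i))"
      using o asc b'i off[of i j] i a'i
      by (auto simp: bigparts_Suc of_bool_def split: if_splits)
    show ?thesis
    proof
      assume L: "\<forall>t\<le>length a. bigparts a j t \<le> bigparts b j t"
      then have "bigparts ?a' j (Suc i) \<le> bigparts b' j (Suc i)" using key i by simp
      then show "\<forall>t\<le>length a. bigparts ?a' j t \<le> bigparts b' j t" using L off by metis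
    next
      assume R: "\<forall>t\<le>length a. bigparts ?a' j t \<le> bigparts b' j t"
      then have o: "bigparts a j t \<le> bigparts b j t" if "t \<le> length a" "t \<noteq> Suc i" for t using off that by metis
      then have "bigparts a j (Suc i) \<le> bigparts b j (Suc i)" using key R i by simp
      then show "\<forall>t\<le>length a. bigparts a j t \<le> bigparts b j t" using o by metis
    qed
  qed
  then show ?thesis using ms i by (simp add: bru_def mset_lswap)
qed

text \<open>\<pi>_i turns the sum over the descents D into the sum over D and its image under the
  swap, keeps the levels E and kills the ascents F; by \<open>bru_step\<close> what is left is
  exactly the interval below a.\<close>

lemma pidiff_kap:
  assumes i: "Suc i < length a" and asc: "a ! i \<le> a ! Suc i"
  shows "pidiff i (kap (lswap i a)) = kap a"
proof -
  let ?B = "bru (lswap i a)"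
  define D where "D = {b \<in> ?B. b ! Suc i < b ! i}"
  define E where "E = {b \<in> ?B. b ! i = b ! Suc i}"
  define F where "F = {b \<in> ?B. b ! i < b ! Suc i}"
  have fin: "finite D" "finite E" "finite F" by (simp_all add: D_def E_def F_def finite_bru)
  have len: "length b = length a" if "b \<in> ?B \<or> b \<in> bru a" for b using that bru_length by fastforce
  have B: "?B = D \<union> E \<union> F" "D \<inter> E = {}" "(D \<union> E) \<inter> F = {}" by (auto simp: D_def E_def F_def)
  have "pidiff i (kap (lswap i a)) = (\<Sum>b\<in>D. pidiff i (colatom b)) + (\<Sum>b\<in>E. pidiff i (colatom b)) + (\<Sum>b\<in>F. pidiff i (colatom b))"
    unfolding kap_def pidiff_sum B(1) using B fin by (simp add: sum.union_disjoint)
  also have "(\<Sum>b\<in>D. pidiff i (colatom b)) = (\<Sum>b\<in>D. colatom b + colatom (lswap i b))"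
    by (rule sum.cong) (use len i in \<open>auto simp: D_def intro!: pidiff_colatom_descent\<close>)
  also have "(\<Sum>b\<in>E. pidiff i (colatom b)) = (\<Sum>b\<in>E. colatom b)"
    by (rule sum.cong) (use len i in \<open>auto simp: E_def intro!: pidiff_colatom_level\<close>)
  also have "(\<Sum>b\<in>F. pidiff i (colatom b)) = 0"
    by (rule sum.neutral) (use len i in \<open>auto simp: F_def intro!: pidiff_colatom_ascent\<close>)
  finally have L: "pidiff i (kap (lswap i a)) = (\<Sum>b\<in>D. colatom b) + (\<Sum>b\<in>D. colatom (lswap i b)) + (\<Sum>b\<in>E. colatom b)"
    by (simp add: sum.distrib)
  have step: "b \<in> bru a \<longleftrightarrow> (if b ! i < b ! Suc i then lswap i b else b) \<in> ?B" if "length b = length a" for b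
    using bru_step[OF i asc that] by simp
  have A: "bru a = D \<union> E \<union> lswap i ` D"
  proof (intro equalityI subsetI)
    fix b assume b: "b \<in> bru a"
    then have lb: "length b = length a" using len by blast
    show "b \<in> D \<union> E \<union> lswap i ` D"
    proof (cases "b ! i < b ! Suc i")
      case True
      then have "lswap i b \<in> D" using step[OF lb] b i lb by (simp add: D_def nth_lswap sw_def)
      then have "lswap i (lswap i b) \<in> lswap i ` D" by blast
      then show ?thesis using i lb by simp
    next
      case False
      then show ?thesis using step[OF lb] b by (auto simp: D_def E_def)
    qed
  next
    fix b assume b: "b \<in> D \<union> E \<union> lswap i ` D"
    then consider "b \<in> D \<union> E" | d where "b = lswap i d" "d \<in> D" by blast
    then show "b \<in> bru a"
    proof cases
      case 1
      then have "b \<in> ?B" "\<not> b ! i < b ! Suc i" by (auto simp: D_def E_def)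
      then show ?thesis using step[of b] len[of b] by simp
    next
      case (2 d)
      then have d: "d \<in> ?B" "d ! Suc i < d ! i" by (simp_all add: D_def)
      then have ld: "length d = length a" using len by blast
      then have "b ! i < b ! Suc i" "lswap i b = d" using d i 2(1) by (simp_all add: nth_lswap sw_def)
      moreover have "length b = length a" using ld 2(1) by simp
      ultimately show ?thesis using step[of b] d(1) by simp
    qed
  qed
  have lt: "b ! i < b ! Suc i" if "b \<in> lswap i ` D" for b
    using that len i by (auto simp: D_def nth_lswap sw_def)
  have "(D \<union> E) \<inter> lswap i ` D = {}" using lt by (fastforce simp: D_def E_def)
  moreover have "inj_on (lswap i) D"
  proof (rule inj_onI)
    fix x y assume "x \<in> D" "y \<in> D" "lswap i x = lswap i y"
    then show "x = y" using len i by (metis (no_types, lifting) D_def lswap_lswap mem_Collect_eq)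
  qed
  ultimately have "kap a = (\<Sum>b\<in>D. colatom b) + (\<Sum>b\<in>E. colatom b) + (\<Sum>b\<in>D. colatom (lswap i b))"
    unfolding kap_def A using fin B(2) by (simp add: sum.union_disjoint sum.reindex)
  then show ?thesis using L by (simp add: add_ac)
qed

text \<open>For dominant a every prefix count is the minimum of t and the total, the largest value
  possible, so all counts of b agree with those of a and determine it.\<close>

lemma bru_dominant: "dominant a \<Longrightarrow> bru a = {a}"
proof -
  assume dom: "dominant a"
  have full: "bigparts a j t = min t (bigparts a j (length a))" if "t \<le> length a" for j t
    using that
  proof (induction t)
    case 0 then show ?case by (simp add: bigparts_def)
  next
    case (Suc t)
    show ?case
    proof (cases "j < a ! t")
      case True
      have "bigparts a j (Suc t) = (\<Sum>p<Suc t. 1)"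
        unfolding bigparts_def using True dominant_antimono[OF _ dom] Suc.prems
        by (intro sum.cong) (force simp: less_Suc_eq_le)+
      moreover have "bigparts a j (Suc t) \<le> bigparts a j (length a)"
        unfolding bigparts_def using Suc.prems by (intro sum_mono2) auto
      ultimately show ?thesis by simp
    next
      case False
      have "bigparts a j (length a) = bigparts a j t"
        unfolding bigparts_def
      proof (intro sum.mono_neutral_right ballI)
        fix p assume "p \<in> {..<length a} - {..<t}"
        then have "a ! p \<le> a ! t" using dominant_antimono[OF _ dom, of t p] by auto
        then show "of_bool (j < a ! p) = (0::nat)" using False by simp
      qed (use Suc.prems in auto)
      then show ?thesis using Suc False by (simp add: bigparts_Suc)
    qed
  qed
  have "b = a" if b: "b \<in> bru a" for b
  proof (rule nth_equalityI)
    show len: "length b = length a" using bru_length[OF b] .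
    have eq: "bigparts b j t = bigparts a j t" if t: "t \<le> length a" for j t
    proof -
      have "bigparts b j t \<le> (\<Sum>p<t. 1)" unfolding bigparts_def by (intro sum_mono) auto
      then have "bigparts b j t \<le> t" by simp
      moreover have "bigparts b j t \<le> bigparts b j (length b)"
        unfolding bigparts_def using t len by (intro sum_mono2) auto
      moreover have "bigparts b j (length b) = bigparts a j (length a)"
        using b by (intro bigparts_length) (simp add: bru_def)
      moreover have "bigparts a j t \<le> bigparts b j t" using b t by (simp add: bru_def)
      ultimately show ?thesis using full[OF t, of j] by simp
    qed
    fix p assume p: "p < length b"
    have "j < b ! p \<longleftrightarrow> j < a ! p" for j
      using eq[of "Suc p" j] eq[of p j] p len by (simp add: bigparts_Suc of_bool_def split: if_split_asm)
    from this[of "a ! p"] this[of "b ! p"] show "b ! p = a ! p" by simp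
  qed
  then show ?thesis using bru_refl by blast
qed

text \<open>\<open>kap\<close> satisfies the recursion for every admissible k, so all derivations
  for a end in the same polynomial.\<close>

lemma demaz_unique: "demaz a f \<Longrightarrow> f = kap a"
proof (induction rule: demaz.induct)
  case (dominant a)
  then show ?case by (simp add: kap_def bru_dominant colatom_dominant)
next
  case (step k a f)
  then show ?case using pidiff_kap[of k a] by simp
qed

text \<open>Swapping an ascent lowers the sum of the \<open>p * a ! p\<close>, so sorting
  terminates.\<close>

lemma demaz_exists: "\<exists>f. demaz a f"
proof (induction "\<Sum>p<length a. p * a ! p" arbitrary: a rule: less_induct)
  case less
  show ?case
  proof (cases "dominant a")
    case True then show ?thesis using demaz.dominant by blast
  next
    case False
    then obtain k where k: "Suc k < length a" "a ! k < a ! Suc k" by (auto simp: not_le)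
    have "(\<Sum>p<length a. p * lswap k a ! p) < (\<Sum>p<length a. p * a ! p)"
    proof -
      have 1: "(\<Sum>p<length a. p * b ! p) = k * b ! k + Suc k * b ! Suc k + (\<Sum>p\<in>{..<length a} - {k, Suc k}. p * b ! p)" for b :: "nat list"
      proof -
        have "(\<Sum>p<length a. p * b ! p) = (\<Sum>p\<in>{k, Suc k}. p * b ! p) + (\<Sum>p\<in>{..<length a} - {k, Suc k}. p * b ! p)"
          using k by (intro sum.subset_diff[THEN trans[OF _ add.commute]]) auto
        then show ?thesis by simp
      qed
      have "(\<Sum>p\<in>{..<length a} - {k, Suc k}. p * lswap k a ! p) = (\<Sum>p\<in>{..<length a} - {k, Suc k}. p * a ! p)"
        using k by (intro sum.cong) (auto simp: nth_lswap sw_def)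
      then show ?thesis using k unfolding 1 by (simp add: nth_lswap sw_def)
    qed
    then have "\<exists>f. demaz (lswap k a) f" using less[of "lswap k a"] by simp
    then show ?thesis using demaz.step[OF k] by blast
  qed
qed

lemma kappa_eq_kap: "kappa a = kap a"
  unfolding kappa_def using demaz_exists demaz_unique by (metis the_equality)

lemma pidiff_kappa:
  assumes i: "Suc i < length a"
  shows "pidiff i (kappa a) = kappa (if a ! Suc i < a ! i then lswap i a else a)"
proof (cases "a ! Suc i < a ! i")
  case True
  have "lswap i a ! i \<le> lswap i a ! Suc i" using i True by (simp add: nth_lswap sw_def)
  then show ?thesis using pidiff_kap[of i "lswap i a"] i True by (simp add: kappa_eq_kap)
next
  case False
  then have "pidiff i (kap (lswap i a)) = kap a" using i by (intro pidiff_kap) auto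
  then show ?thesis using False by (metis kappa_eq_kap pidiff_pidiff)
qed

section \<open>Schubert polynomials\<close>

text \<open>The word \<pi>_k ... \<pi>_{m-1}, with \<pi>_{m-1} applied first. In \<open>Sfn\<close>
  it compensates for the row deleted by \<open>shrink\<close>.\<close>

definition pis :: "nat \<Rightarrow> nat \<Rightarrow> poly \<Rightarrow> poly" where
  "pis k m f = foldr pidiff [k..<m] f"

definition lead :: "nat list \<Rightarrow> nat" where
  "lead a = length (takeWhile (\<lambda>x. 0 < x) a)"

definition shrink :: "nat list \<Rightarrow> nat list" where
  "shrink a = map (\<lambda>x. x - 1) (take (lead a) a) @ drop (Suc (lead a)) a"

text \<open>The Rothe diagram of a permutation \<open>w\<close> of size \<open>n\<close> has first column \<open>{1..k}\<close>, where
  \<open>k + 1\<close> is the position of the value 1 (the first zero of the code), and deleting this column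
  and the empty row \<open>k + 1\<close> leaves the diagram of a permutation of size \<open>n - 1\<close>.\<close>

fun Sfn :: "nat \<Rightarrow> nat list \<Rightarrow> poly" where
  "Sfn 0 a = 1"
| "Sfn (Suc n) a = (\<Prod>j<lead a. X j) * pis (lead a) n (Sfn n (shrink a))"

text \<open>The Lehmer codes of permutations of size n.\<close>

definition valid :: "nat \<Rightarrow> nat list \<Rightarrow> bool" where
  "valid n a \<longleftrightarrow> length a = n \<and> (\<forall>i<n. a ! i + i < n)"

text \<open>The effect on the code of exchanging a descent of the permutation at positions i, i +
  1.\<close>

definition dstep :: "nat \<Rightarrow> nat list \<Rightarrow> nat list" where
  "dstep i a = a[i := a ! Suc i, Suc i := a ! i - 1]"

lemma validD: "valid n a \<Longrightarrow> i < n \<Longrightarrow> a ! i + i < n"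
  by (simp add: valid_def)

lemma lead_props:
  assumes "valid (Suc n) a"
  shows "lead a < Suc n" "a ! lead a = 0" "\<And>i. i < lead a \<Longrightarrow> 0 < a ! i"
proof -
  have a: "length a = Suc n" "a ! n = 0" using assms by (auto simp: valid_def)
  show l: "lead a < Suc n"
  proof (rule ccontr)
    assume "\<not> lead a < Suc n"
    then have "takeWhile (\<lambda>x. 0 < x) a = a"
      using a by (metis lead_def le_antisym length_takeWhile_le not_less takeWhile_eq_take take_all_iff)
    then have "\<forall>x\<in>set a. 0 < x" by (metis takeWhile_eq_all_conv)
    then show False using a by (metis lessI less_irrefl nth_mem)
  qed
  show "a ! lead a = 0" using nth_length_takeWhile[of "\<lambda>x. 0 < x" a] l a by (simp add: lead_def)
  show "0 < a ! i" if "i < lead a" for i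
    using that by (metis lead_def nth_mem set_takeWhileD takeWhile_nth)
qed

lemma lead_eqI: "k < length a \<Longrightarrow> a ! k = 0 \<Longrightarrow> (\<And>i. i < k \<Longrightarrow> 0 < a ! i) \<Longrightarrow> lead a = k"
proof -
  assume *: "k < length a" "a ! k = 0" "\<And>i. i < k \<Longrightarrow> 0 < a ! i"
  have "takeWhile (\<lambda>x. 0 < x) a = take k a" by (rule takeWhile_eq_take_P_nth) (use * in auto)
  then show ?thesis using * by (simp add: lead_def)
qed

lemma length_shrink: "valid (Suc n) a \<Longrightarrow> length (shrink a) = n"
  using lead_props(1)[of n a] by (auto simp: shrink_def valid_def)

lemma nth_shrink:
  assumes "valid (Suc n) a" "i < n"
  shows "shrink a ! i = (if i < lead a then a ! i - 1 else a ! Suc i)"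
  using lead_props(1)[OF assms(1)] assms by (auto simp: shrink_def valid_def nth_append)

lemma valid_shrink: "valid (Suc n) a \<Longrightarrow> valid n (shrink a)"
proof -
  assume v: "valid (Suc n) a"
  have "shrink a ! i + i < n" if "i < n" for i
  proof (cases "i < lead a")
    case True
    then have "0 < a ! i" "a ! i + i < Suc n" using lead_props(3)[OF v] v that by (auto simp: valid_def)
    then show ?thesis using True that v by (simp add: nth_shrink)
  next
    case False
    have "a ! Suc i + Suc i < Suc n" using v that unfolding valid_def by (metis Suc_less_eq)
    then show ?thesis using False that v by (simp add: nth_shrink)
  qed
  then show ?thesis using length_shrink[OF v] by (simp add: valid_def)
qed

lemma length_dstep [simp]: "length (dstep i a) = length a"
  by (simp add: dstep_def)

lemma nth_dstep: "Suc i < length a \<Longrightarrow> t < length a \<Longrightarrow>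
    dstep i a ! t = (if t = i then a ! Suc i else if t = Suc i then a ! i - 1 else a ! t)"
  by (auto simp: dstep_def nth_list_update)

lemma valid_dstep:
  assumes v: "valid n a" and i: "Suc i < n" "a ! Suc i < a ! i"
  shows "valid n (dstep i a)"
proof -
  have len: "length a = n" using v by (simp add: valid_def)
  have "dstep i a ! t + t < n" if "t < n" for t
    using validD[OF v that] validD[OF v i(1)] validD[OF v, of i] i that len by (auto simp: nth_dstep)
  then show ?thesis using len by (simp add: valid_def)
qed

lemma ddiff_foldr_pidiff:
  "(\<And>l. l \<in> set L \<Longrightarrow> Suc j < l \<or> Suc l < j) \<Longrightarrow> ddiff j (foldr pidiff L g) = foldr pidiff L (ddiff j g)"
  by (induction L) (auto simp: ddiff_pidiff_commute)

lemma ddiff_pis_low: "Suc j < k \<Longrightarrow> ddiff j (pis k m g) = pis k m (ddiff j g)"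
  unfolding pis_def by (rule ddiff_foldr_pidiff) auto

text \<open>Rows behind the deleted one are renumbered by one, and the operator undergoes the same
  shift: it commutes with all letters of the word except the pair \<pi>_i \<pi>_{i+1}, which lowers
  its index.\<close>

lemma ddiff_pis_shift:
  assumes "k \<le> i" "Suc i < m"
  shows "ddiff (Suc i) (pis k m g) = pis k m (ddiff i g)"
proof -
  have L: "[k..<m] = [k..<i] @ [i, Suc i] @ [Suc (Suc i)..<m]"
    using assms by (metis Suc_leD Suc_leI append_Cons append_Nil le_add_diff_inverse upt_add_eq_append upt_conv_Cons Suc_lessD)
  let ?h = "foldr pidiff [Suc (Suc i)..<m] g"
  have "ddiff (Suc i) (pis k m g) = foldr pidiff [k..<i] (ddiff (Suc i) (pidiff i (pidiff (Suc i) ?h)))"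
    unfolding pis_def L foldr_append by (subst ddiff_foldr_pidiff) auto
  also have "\<dots> = foldr pidiff [k..<i] (pidiff i (pidiff (Suc i) (ddiff i ?h)))"
    by (simp add: ddiff_pidiff_pidiff)
  also have "ddiff i ?h = foldr pidiff [Suc (Suc i)..<m] (ddiff i g)" by (rule ddiff_foldr_pidiff) auto
  finally show ?thesis unfolding pis_def L by simp
qed

lemma swapv_omega:
  assumes "Suc i \<noteq> k"
  shows "swapv i (\<Prod>j<k. X j) = (\<Prod>j<k. X j)"
  unfolding swapv_prod swapv_X
  by (rule prod.reindex_bij_witness[of _ "sw i" "sw i"]) (use assms in \<open>auto simp: sw_def\<close>)

text \<open>The descent lies before, at or behind the row \<open>lead a\<close>, the first without a
  box in column one. Before and behind it, the operator passes through the product of variables and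
  the word, and the induction hypothesis takes over; at it, the operator combines with the last
  variable of the product into one more letter of the word.\<close>

lemma Sfn_step:
  "valid n a \<Longrightarrow> Suc i < n \<Longrightarrow> a ! Suc i < a ! i \<Longrightarrow> ddiff i (Sfn n a) = Sfn n (dstep i a)"
proof (induction n arbitrary: a i)
  case (Suc n)
  note v = Suc.prems(1) and desc = Suc.prems(3)
  let ?k = "lead a" and ?a' = "shrink a" and ?b = "dstep i a"
  note lp = lead_props[OF v]
  have len: "length a = Suc n" using v by (simp add: valid_def)
  have i: "Suc i < length a" using Suc.prems len by simp
  have vb: "valid (Suc n) ?b" using valid_dstep Suc.prems by blast
  have va': "valid n ?a'" by (rule valid_shrink[OF v])
  have la': "length ?a' = n" using va' by (simp add: valid_def)
  have ik: "i \<noteq> ?k" using desc lp(2) by auto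
  consider "Suc i < ?k" | "Suc i = ?k" | "?k < i" using ik by linarith
  then show ?case
  proof cases
    case 1
    then have pos: "0 < a ! Suc i" using lp(3) by blast
    have lb: "lead ?b = ?k"
    proof (rule lead_eqI)
      show "0 < ?b ! t" if "t < ?k" for t
        using that lp(1) lp(3)[of t] 1 desc pos i len by (auto simp: nth_dstep)
    qed (use lp 1 i len in \<open>auto simp: nth_dstep\<close>)
    have in': "Suc i < n" using 1 lp(1) by simp
    have sh: "shrink ?b = dstep i ?a'"
    proof (rule nth_equalityI)
      fix t assume "t < length (shrink ?b)"
      then have t: "t < n" using length_shrink[OF vb] by simp
      show "shrink ?b ! t = dstep i ?a' ! t"
        using t in' i len 1 lp(1) by (auto simp: nth_shrink[OF vb] nth_shrink[OF v] lb nth_dstep la')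
    qed (simp add: length_shrink[OF vb] la')
    have "ddiff i (Sfn n ?a') = Sfn n (dstep i ?a')"
      using Suc.IH[OF va' in'] desc pos 1 in' v by (simp add: nth_shrink[OF v])
    then show ?thesis
      using 1 by (simp add: lb sh ddiff_mult_sym swapv_omega ddiff_pis_low)
  next
    case 2
    have lb: "lead ?b = i"
    proof (rule lead_eqI)
      show "?b ! i = 0" using 2 lp(2) i by (simp add: nth_dstep)
    qed (use 2 lp(3) i in \<open>auto simp: nth_dstep\<close>)
    have sh: "shrink ?b = ?a'"
    proof (rule nth_equalityI)
      fix t assume "t < length (shrink ?b)"
      then have t: "t < n" using length_shrink[OF vb] by simp
      show "shrink ?b ! t = ?a' ! t"
        using t i len 2 by (cases "t = i") (auto simp: nth_shrink[OF vb] nth_shrink[OF v] lb nth_dstep)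
    qed (simp add: length_shrink[OF vb] la')
    have om: "(\<Prod>j<?k. X j) = (\<Prod>j<i. X j) * X i" unfolding 2[symmetric] by simp
    have "i < n" using i len by simp
    then have "pis i n f = pidiff i (pis ?k n f)" for f
      unfolding pis_def 2[symmetric] by (simp add: upt_conv_Cons)
    then show ?thesis
      by (simp add: lb sh om mult.assoc ddiff_mult_sym swapv_omega pidiff_def del: prod.lessThan_Suc)
  next
    case 3
    have lb: "lead ?b = ?k"
    proof (rule lead_eqI)
      show "0 < ?b ! t" if "t < ?k" for t
        using that lp(3) 3 i by (auto simp: nth_dstep)
    qed (use lp 3 i len in \<open>auto simp: nth_dstep\<close>)
    obtain i' where i': "i = Suc i'" using 3 by (cases i) auto
    have in': "Suc i' < n" using i i' len by simp
    have sh: "shrink ?b = dstep i' ?a'"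
    proof (rule nth_equalityI)
      fix t assume "t < length (shrink ?b)"
      then have t: "t < n" using length_shrink[OF vb] by simp
      show "shrink ?b ! t = dstep i' ?a' ! t"
        using t in' i len 3 i'
        by (auto simp: nth_shrink[OF vb[unfolded i']] nth_shrink[OF v] lb[unfolded i'] nth_dstep la')
    qed (simp add: length_shrink[OF vb] la')
    have "ddiff i' (Sfn n ?a') = Sfn n (dstep i' ?a')"
      using Suc.IH[OF va' in'] desc 3 in' i' v by (simp add: nth_shrink[OF v])
    then show ?thesis
      using 3 i' in' by (simp add: lb[unfolded i'] sh[unfolded i'] ddiff_mult_sym swapv_omega ddiff_pis_shift)
  qed
qed simp

lemma Sfn_longest: "Sfn n (rev [0..<n]) = xmon (rev [0..<n])"
proof (induction n)
  case (Suc n)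
  let ?a = "rev [0..<Suc n]"
  have l: "lead ?a = n" by (rule lead_eqI) (auto simp: rev_nth simp del: upt_Suc)
  have s: "shrink ?a = rev [0..<n]"
    by (rule nth_equalityI) (auto simp: shrink_def l rev_nth nth_append simp del: upt_Suc)
  have "xmon ?a = (\<Prod>k<Suc n. X k ^ (n - k))"
    unfolding xmon_def by (simp add: rev_nth del: upt_Suc prod.lessThan_Suc)
  also have "\<dots> = (\<Prod>k<n. X k * X k ^ (n - Suc k))"
    by (simp, rule prod.cong) (auto simp flip: power_Suc simp: Suc_diff_Suc)
  also have "\<dots> = (\<Prod>j<n. X j) * xmon (rev [0..<n])"
    unfolding xmon_def prod.distrib by (simp add: rev_nth)
  finally show ?case using Suc by (simp add: l s pis_def del: upt_Suc)
qed (simp add: xmon_def)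

section \<open>Lehmer codes and the recursion for Schubert polynomials\<close>

lemma length_code [simp]: "length (code w) = length w"
  by (simp add: code_def)

lemma nth_code: "i < length w \<Longrightarrow> code w ! i = card {j. i < j \<and> j < length w \<and> w ! j < w ! i}"
  by (simp add: code_def)

lemma valid_code: "valid (length w) (code w)"
proof -
  have "code w ! i + i < length w" if "i < length w" for i
  proof -
    have "card {j. i < j \<and> j < length w \<and> w ! j < w ! i} \<le> card {i<..<length w}"
      by (rule card_mono) auto
    then show ?thesis using that by (simp add: nth_code)
  qed
  then show ?thesis by (simp add: valid_def)
qed

lemma code_descent_iff:
  assumes "distinct w" "Suc k < length w"
  shows "code w ! Suc k < code w ! k \<longleftrightarrow> w ! Suc k < w ! k"
proof -
  let ?A = "\<lambda>i. {j. i < j \<and> j < length w \<and> w ! j < w ! i}"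
  have fin: "finite (?A i)" for i by simp
  show ?thesis
  proof (cases "w ! Suc k < w ! k")
    case True
    then have "insert (Suc k) (?A (Suc k)) \<subseteq> ?A k" using assms by auto
    then have "card (insert (Suc k) (?A (Suc k))) \<le> card (?A k)" by (intro card_mono fin)
    moreover have "Suc k \<notin> ?A (Suc k)" by simp
    ultimately show ?thesis using True assms fin[of "Suc k"] by (simp add: nth_code)
  next
    case False
    have "?A k \<subseteq> ?A (Suc k)"
    proof
      fix j assume "j \<in> ?A k"
      then show "j \<in> ?A (Suc k)" using False by (cases "j = Suc k") auto
    qed
    then show ?thesis using False assms card_mono[OF fin] by (simp add: nth_code not_less)
  qed
qed

text \<open>The two counts trade places, and the one belonging to the larger entry loses the
  inversion between the two.\<close>

lemma code_lswap:
  assumes "distinct w" "Suc k < length w" "w ! Suc k < w ! k"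
  shows "code (lswap k w) = dstep k (code w)"
proof (rule nth_equalityI)
  let ?A = "\<lambda>v i. {j. i < j \<and> j < length w \<and> v ! j < (v ! i::nat)}" and ?v = "lswap k w"
  have v: "?v ! j = w ! sw k j" if "j < length w" for j using assms that by (simp add: nth_lswap)
  fix t assume "t < length (code ?v)"
  then have t: "t < length w" by simp
  consider "t < k" | "t = k" | "t = Suc k" | "Suc k < t" by linarith
  then have "card (?A ?v t) = dstep k (code w) ! t"
  proof cases
    case 1
    have "card (?A ?v t) = card (?A w t)"
    proof (rule bij_betw_same_card[of "sw k"], rule bij_betw_byWitness[of _ "sw k"])
      have s: "t < sw k j \<longleftrightarrow> t < j" for j using 1 by (auto simp: sw_def)
      have "sw k t = t" using 1 by (simp add: sw_def)
      then show "sw k ` ?A ?v t \<subseteq> ?A w t" "sw k ` ?A w t \<subseteq> ?A ?v t"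
        using assms t by (auto simp: v s sw_less)
    qed auto
    then show ?thesis using 1 t assms by (simp add: nth_dstep nth_code)
  next
    case 2
    have "?A ?v k = ?A w (Suc k)"
    proof (intro equalityI subsetI)
      fix j assume "j \<in> ?A ?v k"
      then show "j \<in> ?A w (Suc k)" using assms by (cases "j = Suc k") (auto simp: v sw_def)
    qed (use assms in \<open>auto simp: v sw_def\<close>)
    then show ?thesis using 2 assms by (simp add: nth_dstep nth_code)
  next
    case 3
    have "?A ?v (Suc k) = ?A w k - {Suc k}" using assms by (auto simp: v sw_def)
    then show ?thesis using 3 assms by (simp add: nth_dstep nth_code card_Diff_singleton)
  next
    case 4
    have "?A ?v t = ?A w t" using 4 t by (auto simp: v sw_def)
    then show ?thesis using 4 t assms by (simp add: nth_dstep nth_code)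
  qed
  then show "code ?v ! t = dstep k (code w) ! t" using t by (simp add: nth_code)
qed simp

lemma distinct_lswap: "Suc k < length w \<Longrightarrow> distinct (lswap k w) = distinct w"
  unfolding lswap_def using distinct_swap[of "Suc k" w k] by simp

lemma code_longest: "code (rev [1..<Suc n]) = rev [0..<n]"
proof (rule nth_equalityI)
  fix i assume "i < length (code (rev [1..<Suc n]))"
  then have i: "i < n" by (simp del: upt_Suc)
  have "{j. i < j \<and> j < n \<and> n - j < n - i} = {i<..<n}" by auto
  moreover have "{j. i < j \<and> j < n \<and> rev [1..<Suc n] ! j < rev [1..<Suc n] ! i} = {j. i < j \<and> j < n \<and> n - j < n - i}"
    using i by (auto simp: rev_nth simp del: upt_Suc)
  ultimately show "code (rev [1..<Suc n]) ! i = rev [0..<n] ! i"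
    using i by (simp add: nth_code rev_nth del: upt_Suc)
qed (simp del: upt_Suc)

text \<open>The polynomial is a function of the code, so different descending paths from the longest
  element agree.\<close>

lemma schub_Sfn: "schub w f \<Longrightarrow> distinct w \<and> f = Sfn (length w) (code w)"
proof (induction rule: schub.induct)
  case (longest n)
  have "length (rev [1..<Suc n]) = n" by (simp del: upt_Suc)
  then show ?case unfolding code_longest using Sfn_longest[of n] by (simp del: upt_Suc)
next
  case (step w f k)
  then have "code w ! Suc k < code w ! k" by (simp add: code_descent_iff)
  then show ?case
    using step Sfn_step[OF valid_code] by (simp add: distinct_lswap code_lswap)
qed

text \<open>Induction towards larger codes, whose sums are bounded. A weak ascent of the code comes
  from a code with one more inversion; without weak ascents the code decreases strictly and is the
  staircase of the longest element.\<close>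

lemma schub_exists: "valid n a \<Longrightarrow> \<exists>w f. schub w f \<and> code w = a"
proof (induction "n * n - sum_list a" arbitrary: a rule: less_induct)
  case less
  have len: "length a = n" using less.prems by (simp add: valid_def)
  show ?case
  proof (cases "\<exists>k. Suc k < n \<and> a ! k \<le> a ! Suc k")
    case True
    then obtain k where k: "Suc k < n" "a ! k \<le> a ! Suc k" by blast
    \<comment> \<open>The preimage of a under \<open>dstep k\<close>: the part behind k returns to
      position k, increased by one.\<close>
    let ?b = "a[k := Suc (a ! Suc k), Suc k := a ! k]"
    have ak: "a ! Suc k + Suc k < n" using validD[OF less.prems k(1)] .
    have vb: "valid n ?b" using less.prems k ak by (auto simp: valid_def nth_list_update)
    have sum_lt: "sum_list c < n * n" if "valid n c" for c
    proof -
      have "c ! i < n" if "i < n" for i using \<open>valid n c\<close> that by (auto simp: valid_def)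
      then have "(\<Sum>i<n. c ! i) < (\<Sum>i<n. n)" using k by (intro sum_strict_mono) auto
      then show ?thesis using \<open>valid n c\<close> by (simp add: valid_def sum_list_sum_nth atLeast0LessThan)
    qed
    have 1: "sum_list b = b ! k + b ! Suc k + (\<Sum>p\<in>{..<n} - {k, Suc k}. b ! p)" if "length b = n" for b :: "nat list"
    proof -
      have "sum_list b = (\<Sum>p<n. b ! p)" using that by (simp add: sum_list_sum_nth atLeast0LessThan)
      also have "\<dots> = (\<Sum>p\<in>{k, Suc k}. b ! p) + (\<Sum>p\<in>{..<n} - {k, Suc k}. b ! p)"
        using k by (intro sum.subset_diff[THEN trans[OF _ add.commute]]) auto
      finally show ?thesis by simp
    qed
    have "(\<Sum>p\<in>{..<n} - {k, Suc k}. ?b ! p) = (\<Sum>p\<in>{..<n} - {k, Suc k}. a ! p)"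
      by (rule sum.cong) auto
    then have "sum_list ?b = Suc (sum_list a)" using 1[of ?b] 1[of a] len k by simp
    then have "n * n - sum_list ?b < n * n - sum_list a" using sum_lt[OF vb] by simp
    then obtain w f where w: "schub w f" "code w = ?b" using less.hyps vb by blast
    then have lw: "length w = n" using len by (metis length_code length_list_update)
    have d: "distinct w" using schub_Sfn w by blast
    have "code w ! Suc k < code w ! k" using w k len by simp
    then have desc: "w ! Suc k < w ! k" using code_descent_iff[OF d] k lw by simp
    have "code (lswap k w) = dstep k ?b" using code_lswap[OF d _ desc] k lw w by simp
    also have "\<dots> = a" using k len by (intro nth_equalityI) (auto simp: dstep_def nth_list_update)
    finally show ?thesis using schub.step[OF w(1) _ desc] k lw by blast
  next
    case False
    have "n - Suc i \<le> a ! i" if "i < n" for i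
      using that
    proof (induction "n - Suc i" arbitrary: i)
      case (Suc m)
      then have "m = n - Suc (Suc i)" "Suc i < n" by auto
      then have "n - Suc (Suc i) \<le> a ! Suc i" "a ! Suc i < a ! i" using Suc.hyps(1) False by (auto simp: not_le)
      then show ?case by simp
    qed simp
    moreover have "a ! i \<le> n - Suc i" if "i < n" for i
      using less.prems that by (auto simp: valid_def)
    ultimately have "a = rev [0..<n]"
      by (intro nth_equalityI) (auto simp: len rev_nth intro: antisym)
    then show ?thesis using schub.longest[of n] code_longest[of n] by auto
  qed
qed

section \<open>Stability and well-definedness of Schubert polynomials\<close>

lemma swapv_ddiff_commute: "Suc l < j \<Longrightarrow> swapv j (ddiff l f) = ddiff l (swapv j f)"
proof (rule ddiff_eqI[symmetric])
  assume *: "Suc l < j"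
  then have "(X l - X (Suc l)) * swapv j (ddiff l f) = swapv j ((X l - X (Suc l)) * ddiff l f)"
    by (simp add: swapv_X sw_def)
  also have "\<dots> = swapv j f - swapv l (swapv j f)" unfolding ddiff_spec by (simp add: swapv_commute[OF *])
  finally show "(X l - X (Suc l)) * swapv j (ddiff l f) = swapv j f - swapv l (swapv j f)" .
qed

text \<open>Stated as symmetry rather than as absence of the later variables, which is the form
  needed to see that \<pi>_j acts trivially.\<close>

lemma swapv_Sfn: "valid n a \<Longrightarrow> n \<le> j \<Longrightarrow> swapv j (Sfn n a) = Sfn n a"
proof (induction n arbitrary: a)
  case (Suc n)
  have fp: "swapv j (foldr pidiff L g) = foldr pidiff L (swapv j g)" if "\<And>l. l \<in> set L \<Longrightarrow> Suc l < j" for L g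
    using that
  proof (induction L)
    case (Cons l L)
    have "Suc l < j" by (rule Cons.prems) simp
    then have "swapv j (pidiff l h) = pidiff l (swapv j h)" for h
      by (simp add: pidiff_def swapv_ddiff_commute swapv_X sw_def)
    then show ?case using Cons by simp
  qed simp
  have "swapv j (pis k n g) = pis k n (swapv j g)" for k g
    unfolding pis_def by (rule fp) (use Suc.prems in auto)
  then show ?case
    using Suc valid_shrink[OF Suc.prems(1)] lead_props(1)[OF Suc.prems(1)] by (simp add: swapv_omega)
qed simp

lemma valid_pad: "valid n a \<Longrightarrow> valid (Suc n) (a @ [0])"
proof -
  assume "valid n a"
  then have l: "length a = n" and v: "\<And>i. i < n \<Longrightarrow> a ! i + i < n" by (auto simp: valid_def)
  then show ?thesis using less_SucI[OF v] by (auto simp: valid_def nth_append less_Suc_eq)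
qed

text \<open>A trailing zero adds the letter \<pi>_n at the inner end of the word, where it meets a
  polynomial symmetric in \<open>X n\<close> and \<open>X (Suc n)\<close> and does nothing.\<close>

lemma Sfn_pad1: "valid n a \<Longrightarrow> Sfn (Suc n) (a @ [0]) = Sfn n a"
proof (induction n arbitrary: a)
  case 0
  then show ?case by (simp add: valid_def lead_def pis_def)
next
  case (Suc n)
  note lp = lead_props[OF Suc.prems]
  have len: "length a = Suc n" using Suc.prems by (simp add: valid_def)
  have lb: "lead (a @ [0]) = lead a"
    by (rule lead_eqI) (use lp len in \<open>auto simp: nth_append\<close>)
  have sh: "shrink (a @ [0]) = shrink a @ [0]"
    using lp(1) len by (simp add: shrink_def lb)
  have v: "valid n (shrink a)" by (rule valid_shrink[OF Suc.prems])
  have "pidiff n (Sfn n (shrink a)) = Sfn n (shrink a)" using swapv_Sfn[OF v] by (simp add: pidiff_sym)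
  then have "pis (lead a) (Suc n) (Sfn n (shrink a)) = pis (lead a) n (Sfn n (shrink a))"
    using lp(1) by (simp add: pis_def)
  then show ?case
    using Suc.IH[OF v] by (simp only: Sfn.simps(2)[of "Suc n" "a @ [0]"] Sfn.simps(2)[of n a] lb sh)
qed

lemma Sfn_pad: "valid n a \<Longrightarrow> valid (n + m) (a @ replicate m 0) \<and> Sfn (n + m) (a @ replicate m 0) = Sfn n a"
proof (induction m)
  case (Suc m)
  have "a @ replicate (Suc m) 0 = (a @ replicate m 0) @ [0]" by (simp add: replicate_append_same)
  then show ?case using Suc valid_pad Sfn_pad1 by (metis add_Suc_right)
qed simp

text \<open>Each part is at most \<open>sum_list a\<close>, so that many zeros suffice; the extra m
  makes room for operators of larger index.\<close>

lemma valid_extend: "valid (length a + (sum_list a + m)) (a @ replicate (sum_list a + m) 0)"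
proof -
  have "a ! i \<le> sum_list a" if "i < length a" for i using that by (simp add: member_le_sum_list)
  then show ?thesis by (fastforce simp: valid_def nth_append)
qed

text \<open>Any other code equivalent to a becomes equal to c after both are padded, and padding
  does not change \<open>Sfn\<close>.\<close>

lemma schubert_eq:
  assumes v: "valid n c" and c: "trail_eq c a"
  shows "schubert a = Sfn n c"
  unfolding schubert_def
proof (rule the_equality)
  obtain w f where w: "schub w f" "code w = c" using schub_exists[OF v] by blast
  have n: "length c = n" using v by (simp add: valid_def)
  then have "f = Sfn n c" using schub_Sfn[OF w(1)] w(2) length_code by metis
  then show "\<exists>w. schub w (Sfn n c) \<and> trail_eq (code w) a" using w c by blast
  fix g assume "\<exists>w. schub w g \<and> trail_eq (code w) a"
  then obtain u where u: "schub u g" "trail_eq (code u) a" by blast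
  let ?d = "code u" and ?m = "length u"
  have g: "g = Sfn ?m ?d" using schub_Sfn[OF u(1)] by simp
  have pad: "\<exists>p q. c @ replicate p 0 = ?d @ replicate q 0"
  proof -
    obtain p q where "c @ replicate p 0 = a @ replicate q 0"
      using c unfolding trail_eq_def by (metis append_Nil2 replicate_0)
    moreover obtain p' q' where "?d @ replicate p' 0 = a @ replicate q' 0"
      using u(2) unfolding trail_eq_def by (metis append_Nil2 replicate_0)
    ultimately have "c @ replicate (p + q') 0 = a @ replicate (q + q') 0"
      "?d @ replicate (p' + q) 0 = a @ replicate (q' + q) 0"
      by (simp_all add: replicate_add flip: append_assoc)
    then show ?thesis by (metis add.commute)
  qed
  then obtain p q where pq: "c @ replicate p 0 = ?d @ replicate q 0" by blast
  then have "n + p = ?m + q" using n by (metis length_append length_code length_replicate)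
  then show "g = Sfn n c" using Sfn_pad[OF v, of p] Sfn_pad[OF valid_code, of u q] pq g by simp
qed

lemma trail_eq_refl: "trail_eq a a"
  unfolding trail_eq_def by (rule exI[of _ 0]) simp

lemma schubert_valid: "valid n a \<Longrightarrow> schubert a = Sfn n a"
  by (rule schubert_eq) (simp_all add: trail_eq_refl)

lemma schubert_extend: "schubert a = Sfn (length a + (sum_list a + m)) (a @ replicate (sum_list a + m) 0)"
  by (rule schubert_eq[OF valid_extend]) (auto simp: trail_eq_def)

text \<open>Without a descent of the code at k, the polynomial is itself the divided difference at k
  of a Schubert polynomial with one more inversion, and divided differences square to zero.\<close>

lemma ddiff_schubert: "ddiff k (schubert a) = 0 \<or> (\<exists>b. ddiff k (schubert a) = schubert b)"
proof -
  \<comment> \<open>The additional k + 2 zeros make k and k + 1 positions of the code.\<close>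
  define n where "n = length a + (sum_list a + (k + 2))"
  define c where "c = a @ replicate (sum_list a + (k + 2)) 0"
  have v: "valid n c" unfolding n_def c_def by (rule valid_extend)
  have eq: "schubert a = Sfn n c" unfolding n_def c_def by (rule schubert_extend)
  have k: "Suc k < n" by (simp add: n_def)
  show ?thesis
  proof (cases "c ! Suc k < c ! k")
    case True
    then have "ddiff k (Sfn n c) = Sfn n (dstep k c)" using Sfn_step v k by blast
    then show ?thesis using schubert_valid[OF valid_dstep[OF v k True]] eq by metis
  next
    case False
    let ?b = "c[k := Suc (c ! Suc k), Suc k := c ! k]"
    have len: "length c = n" using v by (simp add: valid_def)
    have ak: "c ! Suc k + Suc k < n" using validD[OF v k] .
    have vb: "valid n ?b" using v k ak False by (auto simp: valid_def nth_list_update)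
    have "?b ! Suc k < ?b ! k" using False k len by simp
    then have "ddiff k (Sfn n ?b) = Sfn n (dstep k ?b)" using Sfn_step vb k by blast
    also have "dstep k ?b = c" using k len by (intro nth_equalityI) (auto simp: dstep_def nth_list_update)
    finally show ?thesis using eq ddiff_ddiff by metis
  qed
qed

section \<open>Key positivity of Schubert polynomials\<close>

text \<open>Lists with repetition replace coefficient functions, so that sums and transitivity are a
  matter of concatenation; \<open>expands_pos_iff\<close> translates back.\<close>

definition cone :: "('b \<Rightarrow> poly) \<Rightarrow> poly \<Rightarrow> bool" where
  "cone G f \<longleftrightarrow> (\<exists>L. f = (\<Sum>b\<leftarrow>L. G b))"

lemma cone_0 [simp]: "cone G 0"
  unfolding cone_def by (rule exI[of _ "[]"]) simp

lemma cone_base: "cone G (G b)"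
  unfolding cone_def by (rule exI[of _ "[b]"]) simp

lemma cone_add: "cone G f \<Longrightarrow> cone G g \<Longrightarrow> cone G (f + g)"
  unfolding cone_def by (metis map_append sum_list_append)

lemma cone_sum: "(\<And>x. x \<in> A \<Longrightarrow> cone G (f x)) \<Longrightarrow> cone G (\<Sum>x\<in>A. f x)"
  by (induction A rule: infinite_finite_induct) (auto intro: cone_add)

lemma cone_sum_list: "(\<And>x. x \<in> set L \<Longrightarrow> cone G (f x)) \<Longrightarrow> cone G (\<Sum>x\<leftarrow>L. f x)"
  by (induction L) (auto intro: cone_add)

lemma cone_trans: "cone G f \<Longrightarrow> (\<And>b. cone H (G b)) \<Longrightarrow> cone H f"
  unfolding cone_def[of G] using cone_sum_list by metis

lemma cone_of_nat: "cone G f \<Longrightarrow> cone G (of_nat c * f)"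
  by (induction c) (auto simp: distrib_right intro: cone_add)

lemma expands_pos_iff: "expands_pos B B' \<longleftrightarrow> (\<forall>a. cone B' (B a))"
proof -
  have "(\<exists>S c. finite S \<and> f = (\<Sum>b\<in>S. of_nat (c b) * B' b)) \<longleftrightarrow> cone B' f" for f
  proof
    assume "\<exists>S c. finite S \<and> f = (\<Sum>b\<in>S. of_nat (c b) * B' b)"
    then obtain S c where "f = (\<Sum>b\<in>S. of_nat (c b) * B' b)" by blast
    then show "cone B' f" using cone_sum[of S B'] cone_of_nat[OF cone_base[of B']] by simp
  next
    assume "cone B' f"
    then obtain L where "f = (\<Sum>b\<leftarrow>L. B' b)" by (auto simp: cone_def)
    moreover have "(\<Sum>b\<leftarrow>L. B' b) = (\<Sum>b\<in>set L. of_nat (count_list L b) * B' b)"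
    proof (induction L)
      case (Cons b L)
      have "(\<Sum>x\<in>set (b # L). of_nat (count_list (b # L) x) * B' x)
          = (\<Sum>x\<in>insert b (set L). of_nat (count_list L x) * B' x) + (\<Sum>x\<in>insert b (set L). if x = b then B' x else 0)"
        unfolding sum.distrib[symmetric] by (rule sum.cong) (auto simp: distrib_right)
      moreover have "(\<Sum>x\<in>insert b (set L). of_nat (count_list L x) * B' x) = (\<Sum>x\<in>set L. of_nat (count_list L x) * B' x)"
        by (rule sum.mono_neutral_right) (auto simp: count_list_0_iff)
      ultimately show ?case using Cons by simp
    qed simp
    ultimately show "\<exists>S c. finite S \<and> f = (\<Sum>b\<in>S. of_nat (c b) * B' b)"
      by (intro exI[of _ "set L"] exI[of _ "count_list L"]) auto
  qed
  then show ?thesis by (simp add: expands_pos_def)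
qed

section \<open>Reduced words and the operators they define\<close>

definition act :: "nat list \<Rightarrow> poly \<Rightarrow> poly" where
  "act w f = foldr pidiff w f"

lemma act_simps [simp]: "act [] f = f" "act (i # w) f = pidiff i (act w f)" "act (u @ w) f = act u (act w f)"
  by (simp_all add: act_def)

lemma act_0 [simp]: "act w 0 = 0"
  by (induction w) simp_all

lemma act_add: "act w (f + g) = act w f + act w g"
  by (induction w) (simp_all add: pidiff_add)

lemma act_diff: "act w (f - g) = act w f - act w g"
  using act_add[of w "f - g" g] by simp

text \<open>\<open>reduced n v w\<close>: the word \<open>w\<close> is a reduced decomposition of the permutation with one-line
  notation \<open>v\<close>.\<close>

inductive reduced :: "nat \<Rightarrow> nat list \<Rightarrow> nat list \<Rightarrow> bool" for n where
  nil: "reduced n [0..<n] []"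
| snoc: "reduced n v w \<Longrightarrow> Suc j < n \<Longrightarrow> v ! j < v ! Suc j \<Longrightarrow> reduced n (lswap j v) (w @ [j])"

lemma reduced_props: "reduced n v w \<Longrightarrow> mset v = mset [0..<n] \<and> length v = n \<and> (\<forall>j\<in>set w. Suc j < n)"
  by (induction rule: reduced.induct) (auto simp: mset_lswap)

text \<open>The weights decrease from left to right, so undoing a descent lowers the sum; it stands
  in for the length of the permutation.\<close>

definition wsum :: "nat list \<Rightarrow> nat" where
  "wsum v = (\<Sum>p<length v. (length v - p) * v ! p)"

lemma wsum_lswap:
  assumes "Suc j < length v" "v ! Suc j < v ! j"
  shows "wsum (lswap j v) < wsum v"
proof -
  let ?n = "length v"
  have 1: "(\<Sum>p<?n. (?n - p) * b ! p)
      = (?n - j) * b ! j + (?n - Suc j) * b ! Suc j + (\<Sum>p\<in>{..<?n} - {j, Suc j}. (?n - p) * b ! p)" for b :: "nat list"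
  proof -
    have "(\<Sum>p<?n. (?n - p) * b ! p) = (\<Sum>p\<in>{j, Suc j}. (?n - p) * b ! p) + (\<Sum>p\<in>{..<?n} - {j, Suc j}. (?n - p) * b ! p)"
      using assms by (intro sum.subset_diff[THEN trans[OF _ add.commute]]) auto
    then show ?thesis by simp
  qed
  have "(\<Sum>p\<in>{..<?n} - {j, Suc j}. (?n - p) * lswap j v ! p) = (\<Sum>p\<in>{..<?n} - {j, Suc j}. (?n - p) * v ! p)"
    using assms by (intro sum.cong) (auto simp: nth_lswap sw_def)
  moreover obtain m where m: "?n - j = Suc m" "?n - Suc j = m" using assms by (metis Suc_diff_Suc Suc_lessD)
  ultimately show ?thesis using assms unfolding wsum_def length_lswap 1 by (simp add: nth_lswap sw_def m)
qed

lemma reduced_exists: "mset v = mset [0..<n] \<Longrightarrow> \<exists>w. reduced n v w"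
proof (induction "wsum v" arbitrary: v rule: less_induct)
  case less
  have len: "length v = n" using less.prems by (metis diff_zero length_upt mset_eq_length)
  show ?case
  proof (cases "\<exists>j. Suc j < n \<and> v ! Suc j < v ! j")
    case True
    then obtain j where j: "Suc j < n" "v ! Suc j < v ! j" by blast
    then obtain w where w: "reduced n (lswap j v) w"
      using less.hyps[of "lswap j v"] less.prems wsum_lswap[of j v] len by (auto simp: mset_lswap)
    have "lswap j v ! j < lswap j v ! Suc j" using j len by (simp add: nth_lswap sw_def)
    then show ?thesis using reduced.snoc[OF w j(1)] j len by auto
  next
    case False
    then have "sorted v" using len unfolding sorted_iff_nth_Suc by (meson not_less)
    then have "v = [0..<n]" using less.prems by (metis properties_for_sort sorted_upt)
    then show ?thesis using reduced.nil by blast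
  qed
qed

lemma reduced_cases:
  assumes "reduced n v w"
  obtains "v = [0..<n]" "w = []"
  | w1 j where "w = w1 @ [j]" "reduced n (lswap j v) w1" "Suc j < n" "v ! Suc j < v ! j"
proof (cases rule: reduced.cases[OF assms])
  case 1 then show ?thesis using that by blast
next
  case (2 u w1 j)
  have "length u = n" using reduced_props[OF 2(3)] by blast
  then have "lswap j v = u" "v ! Suc j < v ! j" using 2 by (simp_all add: nth_lswap sw_def)
  then show ?thesis using that(2)[of w1 j] 2 by blast
qed

lemma lswap_commute: "Suc i < j \<Longrightarrow> Suc j < length v \<Longrightarrow> lswap i (lswap j v) = lswap j (lswap i v)"
  by (rule nth_equalityI) (auto simp: lswap_def nth_list_update)

lemma lswap_braid:
  "Suc (Suc i) < length v \<Longrightarrow> lswap i (lswap (Suc i) (lswap i v)) = lswap (Suc i) (lswap i (lswap (Suc i) v))"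
  by (rule nth_equalityI) (auto simp: lswap_def nth_list_update)

lemma reduced_unlswap:
  assumes "reduced n (lswap j v) w" "length v = n" "Suc j < n" "v ! Suc j < v ! j"
  shows "reduced n v (w @ [j])"
proof -
  have "lswap j v ! j < lswap j v ! Suc j" using assms by (simp add: nth_lswap sw_def)
  from reduced.snoc[OF assms(1,3) this] show ?thesis using assms by simp
qed

text \<open>Matsumoto's theorem for the operators \<pi>_i. If the last letters i and j differ, a
  common word w3 is completed to reduced words of both remainders so that the results are linked by
  a commutation or braid relation, and the induction hypothesis applies to each remainder.\<close>

lemma reduced_unique: "reduced n v w \<Longrightarrow> reduced n v w' \<Longrightarrow> act w f = act w' f"
proof (induction "wsum v" arbitrary: v w w' f rule: less_induct)
  case less
  note len = reduced_props[OF less.prems(1)]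
  have IH: "act x g = act y g" if "reduced n (lswap j v) x" "reduced n (lswap j v) y" "Suc j < n" "v ! Suc j < v ! j" for j x y g
    by (rule less.hyps[OF _ that(1,2)]) (use wsum_lswap[of j v] that(3,4) len in simp)
  have key: "act (w1 @ [i]) f = act (w2 @ [j]) f"
    if w1: "reduced n (lswap i v) w1" and w2: "reduced n (lswap j v) w2" and ij: "i < j" "Suc j < n"
      and d: "v ! Suc i < v ! i" "v ! Suc j < v ! j" for i j w1 w2
  proof (cases "Suc i < j")
    case True
    let ?x = "lswap i (lswap j v)"
    have lv: "Suc i < length v" "Suc j < length v" using ij len by auto
    have "mset ?x = mset [0..<n]" using len lv by (simp add: mset_lswap)
    then obtain w3 where w3: "reduced n ?x w3" using reduced_exists by blast
    have "reduced n (lswap j v) (w3 @ [i])"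
      by (rule reduced_unlswap[OF w3]) (use True ij len d in \<open>auto simp: nth_lswap sw_def\<close>)
    then have 2: "act w2 g = act (w3 @ [i]) g" for g using IH[OF w2] ij d by simp
    have "reduced n (lswap j (lswap i v)) w3" using w3 lswap_commute[OF True lv(2)] by simp
    then have "reduced n (lswap i v) (w3 @ [j])"
      by (rule reduced_unlswap) (use True ij len d in \<open>auto simp: nth_lswap sw_def\<close>)
    then have "act w1 g = act (w3 @ [j]) g" for g using IH[OF w1] ij d by simp
    then show ?thesis using 2 pidiff_commute[OF True] by simp
  next
    case False
    then have j: "j = Suc i" using ij by simp
    let ?x = "lswap i (lswap (Suc i) (lswap i v))"
    have lv: "Suc (Suc i) < length v" using ij len j by auto
    have "mset ?x = mset [0..<n]" using len lv by (simp add: mset_lswap)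
    then obtain w3 where w3: "reduced n ?x w3" using reduced_exists by blast
    have "reduced n (lswap (Suc i) (lswap i v)) (w3 @ [i])"
      by (rule reduced_unlswap[OF w3]) (use ij len d j in \<open>auto simp: nth_lswap sw_def\<close>)
    then have "reduced n (lswap i v) ((w3 @ [i]) @ [Suc i])"
      by (rule reduced_unlswap) (use ij len d j in \<open>auto simp: nth_lswap sw_def\<close>)
    then have 1: "act w1 g = act w3 (pidiff i (pidiff (Suc i) g))" for g using IH[OF w1] ij d by simp
    have "reduced n (lswap (Suc i) (lswap i (lswap (Suc i) v))) w3" using w3 lswap_braid[OF lv] by simp
    then have "reduced n (lswap i (lswap (Suc i) v)) (w3 @ [Suc i])"
      by (rule reduced_unlswap) (use ij len d j in \<open>auto simp: nth_lswap sw_def\<close>)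
    then have "reduced n (lswap (Suc i) v) ((w3 @ [Suc i]) @ [i])"
      by (rule reduced_unlswap) (use ij len d j in \<open>auto simp: nth_lswap sw_def\<close>)
    then have 2: "act w2 g = act w3 (pidiff (Suc i) (pidiff i g))" for g using IH[of "Suc i" w2] w2 ij d j by simp
    show ?thesis using 1 2 j pidiff_braid[of i f] by simp
  qed
  show ?case
  proof (cases rule: reduced_cases[OF less.prems(1)])
    case 1
    then show ?thesis by (cases rule: reduced_cases[OF less.prems(2)]) auto
  next
    case (2 w1 i)
    show ?thesis
    proof (cases rule: reduced_cases[OF less.prems(2)])
      case 1
      then show ?thesis using 2 by auto
    next
      case (2 w2 j)
      note a = \<open>w = w1 @ [i]\<close> \<open>reduced n (lswap i v) w1\<close> \<open>Suc i < n\<close> \<open>v ! Suc i < v ! i\<close>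
      note c = \<open>w' = w2 @ [j]\<close> \<open>reduced n (lswap j v) w2\<close> \<open>Suc j < n\<close> \<open>v ! Suc j < v ! j\<close>
      have ?thesis if "i = j"
        using IH[OF a(2) _ a(3,4), of w2 "pidiff i f"] c(2) that unfolding a(1) c(1) by simp
      moreover have ?thesis if "i < j"
        unfolding a(1) c(1) by (rule key[OF a(2) c(2) that c(3) a(4) c(4)])
      moreover have ?thesis if "j < i"
        unfolding a(1) c(1) by (rule key[OF c(2) a(2) that a(3) c(4) a(4), symmetric])
      ultimately show ?thesis by (meson linorder_neqE_nat)
    qed
  qed
qed

text \<open>By uniqueness w may be replaced by a word ending in i, and \<pi>_i is
  idempotent.\<close>

lemma reduced_absorb:
  assumes "reduced n v w" "Suc i < n" "v ! Suc i < v ! i"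
  shows "act w (pidiff i f) = act w f"
proof -
  have len: "length v = n" "mset v = mset [0..<n]" using reduced_props[OF assms(1)] by auto
  then obtain w1 where w1: "reduced n (lswap i v) w1"
    using reduced_exists[of "lswap i v" n] assms by (auto simp: mset_lswap)
  have "reduced n v (w1 @ [i])" by (rule reduced_unlswap[OF w1]) (use assms len in auto)
  then have "act w g = act w1 (pidiff i g)" for g using reduced_unique[OF assms(1)] by simp
  then show ?thesis by simp
qed

text \<open>What becomes of the product of the first k variables on its way through a word of v: the
  variables at the positions where v has a value below k.\<close>

definition xset :: "nat \<Rightarrow> nat list \<Rightarrow> poly" where
  "xset k v = xm (length v) (\<lambda>p. of_bool (v ! p < k))"

lemma xset_lswap: "Suc i < length v \<Longrightarrow> swapv i (xset k v) = xset k (lswap i v)"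
  unfolding xset_def swapv_xm length_lswap by (intro xm_cong) (simp add: nth_lswap)

text \<open>If only position i is selected, both resulting terms are positive. If only i + 1 is,
  then v has a descent at i, its word absorbs \<pi>_i and the two terms cancel. Otherwise the
  product is symmetric and passes through.\<close>

lemma xset_pidiff:
  assumes r: "reduced n v w" and i: "Suc i < n"
  shows "\<exists>L. (\<forall>(v', w')\<in>set L. reduced n v' w')
    \<and> (\<forall>f. act w (xset k v * pidiff i f) = (\<Sum>(v', w')\<leftarrow>L. act w' (xset k v' * f)))"
proof -
  have len: "length v = n" using reduced_props[OF r] by blast
  define Y where "Y = xm n (\<lambda>p. of_bool (v ! p < k \<and> p \<noteq> i \<and> p \<noteq> Suc i))"
  have Y: "swapv i Y = Y"
    unfolding Y_def swapv_xm[OF i] by (rule xm_cong) (auto simp: sw_def)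
  have piY: "pidiff i (Y * g) = Y * pidiff i g" for g by (rule pidiff_mult_sym[OF Y])
  consider "v ! i < k" "k \<le> v ! Suc i" | "k \<le> v ! i" "v ! Suc i < k" | "v ! i < k \<longleftrightarrow> v ! Suc i < k" by linarith
  then show ?thesis
  proof cases
    case 1
    have xv: "xset k v = X i * Y" unfolding xset_def len Y_def
      by (subst xm_X[of i]) (use 1 i in \<open>auto intro!: arg_cong2[of _ _ _ _ "(*)"] xm_cong\<close>)
    have xl: "xset k (lswap i v) = X (Suc i) * Y"
      using xset_lswap[of i v k] i len xv Y by (simp add: swapv_X sw_def)
    have "act w (xset k v * pidiff i f) = act w (xset k v * f) + act (w @ [i]) (xset k (lswap i v) * f)" for f
    proof -
      have "xset k v * pidiff i f = Y * (X i * pidiff i f)" by (simp add: xv mult_ac)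
      also have "\<dots> = Y * (X i * f) + pidiff i (Y * (X (Suc i) * f))"
        by (simp add: X_pidiff distrib_left piY)
      finally show ?thesis by (simp add: act_add xv xl mult_ac)
    qed
    moreover have "reduced n (lswap i v) (w @ [i])" using 1 r i by (intro reduced.snoc) auto
    ultimately show ?thesis using r by (intro exI[of _ "[(v, w), (lswap i v, w @ [i])]"]) simp
  next
    case 2
    have xv: "xset k v = X (Suc i) * Y" unfolding xset_def len Y_def
      by (subst xm_X[of "Suc i"]) (use 2 i in \<open>auto intro!: arg_cong2[of _ _ _ _ "(*)"] xm_cong\<close>)
    have "act w (xset k v * pidiff i f) = 0" for f
    proof -
      have "xset k v * pidiff i f = Y * (X (Suc i) * pidiff i f)" by (simp add: xv mult_ac)
      also have "\<dots> = pidiff i (Y * (X i * f)) - Y * (X i * f)"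
        by (simp add: X_Suc_pidiff right_diff_distrib piY)
      finally show ?thesis using reduced_absorb[OF r i] 2 by (simp add: act_diff)
    qed
    then show ?thesis by (intro exI[of _ "[]"]) simp
  next
    case 3
    have l: "xset k (lswap i v) = xset k v"
      unfolding xset_def length_lswap len using i len 3 by (intro xm_cong) (auto simp: nth_lswap sw_def)
    then have e: "act w (xset k v * pidiff i f) = act w (pidiff i (xset k v * f))" for f
      using xset_lswap[of i v k] i len by (simp add: pidiff_mult_sym)
    have ne: "v ! i \<noteq> v ! Suc i"
    proof -
      have "distinct v" using reduced_props[OF r] by (metis distinct_upt mset_eq_imp_distinct_iff)
      then show ?thesis using i len by (simp add: nth_eq_iff_index_eq)
    qed
    show ?thesis
    proof (cases "v ! i < v ! Suc i")
      case True
      then have "reduced n (lswap i v) (w @ [i])" using r i by (intro reduced.snoc) auto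
      then show ?thesis using e l by (intro exI[of _ "[(lswap i v, w @ [i])]"]) simp
    next
      case False
      then show ?thesis using e r reduced_absorb[OF r i] ne by (intro exI[of _ "[(v, w)]"]) simp
    qed
  qed
qed

lemma sum_list_concat_map: "(\<Sum>x\<leftarrow>concat (map M L). g x) = (\<Sum>p\<leftarrow>L. \<Sum>x\<leftarrow>M p. g x)"
  by (induction L) simp_all

text \<open>The letters are passed from left to right. At the start stands the identity with the
  empty word, which selects exactly the first k positions.\<close>

lemma omega_act:
  assumes "k \<le> n" "\<forall>j\<in>set u. Suc j < n"
  shows "\<exists>L. (\<forall>(v, w)\<in>set L. reduced n v w)
    \<and> (\<forall>f. (\<Prod>j<k. X j) * act u f = (\<Sum>(v, w)\<leftarrow>L. act w (xset k v * f)))"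
  using assms(2)
proof (induction u rule: rev_induct)
  case Nil
  have "xset k [0..<n] = (\<Prod>j<k. X j)"
  proof -
    have "(\<Prod>j<n. X j ^ of_bool (j < k)) = (\<Prod>j<k. X j ^ of_bool (j < k))"
      by (rule prod.mono_neutral_right) (use assms in auto)
    then show ?thesis by (simp add: xset_def xm_def)
  qed
  then show ?case by (intro exI[of _ "[([0..<n], [])]"]) (simp add: reduced.nil)
next
  case (snoc i u)
  then obtain L where L: "\<forall>(v, w)\<in>set L. reduced n v w"
    "\<And>f. (\<Prod>j<k. X j) * act u f = (\<Sum>(v, w)\<leftarrow>L. act w (xset k v * f))" by auto
  have i: "Suc i < n" using snoc.prems by simp
  define Q where "Q = (\<lambda>p L. (\<forall>(v', w')\<in>set L. reduced n v' w')
    \<and> (\<forall>f. act (snd p) (xset k (fst p) * pidiff i f) = (\<Sum>(v', w')\<leftarrow>L. act w' (xset k v' * f))))"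
  have "\<exists>M. Q p M" if "p \<in> set L" for p
    using xset_pidiff[OF _ i, of "fst p" "snd p" k] L(1) that unfolding Q_def by (auto simp: case_prod_beta)
  then obtain M where M: "\<And>p. p \<in> set L \<Longrightarrow> Q p (M p)" by metis
  have "(\<Prod>j<k. X j) * act (u @ [i]) f = (\<Sum>(v, w)\<leftarrow>concat (map M L). act w (xset k v * f))" for f
  proof -
    have "(\<Prod>j<k. X j) * act (u @ [i]) f = (\<Sum>p\<leftarrow>L. act (snd p) (xset k (fst p) * pidiff i f))"
      using L(2)[of "pidiff i f"] by (simp add: case_prod_unfold)
    also have "\<dots> = (\<Sum>p\<leftarrow>L. \<Sum>(v, w)\<leftarrow>M p. act w (xset k v * f))"
    proof (intro arg_cong[of _ _ sum_list] map_cong[OF HOL.refl])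
      fix p assume "p \<in> set L"
      from M[OF this] show "act (snd p) (xset k (fst p) * pidiff i f) = (\<Sum>(v, w)\<leftarrow>M p. act w (xset k v * f))"
        unfolding Q_def by (rule conjunct2[THEN spec])
    qed
    also have "\<dots> = (\<Sum>(v, w)\<leftarrow>concat (map M L). act w (xset k v * f))"
      by (rule sum_list_concat_map[symmetric])
    finally show ?thesis .
  qed
  moreover have "\<forall>(v, w)\<in>set (concat (map M L)). reduced n v w" using M by (fastforce simp: Q_def)
  ultimately show ?case by blast
qed

text \<open>Key polynomials with exactly n parts, a family preserved by \<pi>_i for i + 1 < n. The
  value 0 elsewhere contributes nothing to the cone.\<close>

definition kapn :: "nat \<Rightarrow> nat list \<Rightarrow> poly" where
  "kapn n a = (if length a = n then kappa a else 0)"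

lemma kapn_cone_kappa: "cone (kapn n) f \<Longrightarrow> cone kappa f"
  by (erule cone_trans) (simp add: kapn_def cone_base)

lemma cone_kapnI: "length a = n \<Longrightarrow> cone (kapn n) (kappa a)"
  using cone_base[of "kapn n" a] by (simp add: kapn_def)

lemma pidiff_sum_list: "pidiff i (\<Sum>b\<leftarrow>L. f b) = (\<Sum>b\<leftarrow>L. pidiff i (f b))"
  by (induction L) (simp_all add: pidiff_add)

lemma cone_kapn_pidiff: "cone (kapn n) f \<Longrightarrow> Suc i < n \<Longrightarrow> cone (kapn n) (pidiff i f)"
proof -
  assume f: "cone (kapn n) f" and i: "Suc i < n"
  obtain L where L: "f = (\<Sum>b\<leftarrow>L. kapn n b)" using f by (auto simp: cone_def)
  have "cone (kapn n) (pidiff i (kapn n b))" for b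
  proof (cases "length b = n")
    case True
    then show ?thesis using i by (simp add: kapn_def pidiff_kappa) (auto intro!: cone_kapnI)
  qed (simp add: kapn_def)
  then show ?thesis unfolding L pidiff_sum_list by (intro cone_sum_list)
qed

lemma cone_kapn_act: "cone (kapn n) f \<Longrightarrow> \<forall>j\<in>set w. Suc j < n \<Longrightarrow> cone (kapn n) (act w f)"
  by (induction w) (auto intro: cone_kapn_pidiff)

lemma demaz_act:
  "demaz a f \<Longrightarrow> \<exists>u l. f = act u (xmon l) \<and> dominant l \<and> length l = length a \<and> (\<forall>j\<in>set u. Suc j < length a)"
proof (induction rule: demaz.induct)
  case (dominant a)
  then show ?case by (intro exI[of _ "[]"] exI[of _ a]) simp
next
  case (step k a f)
  then obtain u l where "f = act u (xmon l)" "dominant l" "length l = length a" "\<forall>j\<in>set u. Suc j < length a"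
    by auto
  then show ?case using step by (intro exI[of _ "k # u"] exI[of _ l]) simp
qed

lemma xm_mult: "xm n g * xm n h = xm n (\<lambda>t. g t + h t)"
  by (simp add: xm_def prod.distrib power_add)

lemma kappa_dominant: "dominant a \<Longrightarrow> kappa a = xmon a"
  by (simp add: kappa_eq_kap kap_def bru_dominant colatom_dominant)

text \<open>A key polynomial is a word applied to a dominant monomial. Once the product has been
  moved through the word, the exponents l have grown by an indicator vector; the new exponent m is
  either still dominant, or the term vanishes.\<close>

lemma omega_kappa:
  assumes k: "k \<le> n" and a: "length a = n"
  shows "cone (kapn n) ((\<Prod>j<k. X j) * kappa a)"
proof -
  have "demaz a (kappa a)" using demaz_exists[of a] demaz_unique[of a] by (metis kappa_eq_kap)
  then obtain u l where u: "kappa a = act u (xmon l)" "dominant l" "length l = n" "\<forall>j\<in>set u. Suc j < n"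
    using demaz_act a by blast
  obtain L where L: "\<forall>(v, w)\<in>set L. reduced n v w"
    "\<And>f. (\<Prod>j<k. X j) * act u f = (\<Sum>(v, w)\<leftarrow>L. act w (xset k v * f))"
    using omega_act[OF k u(4)] by blast
  have "cone (kapn n) (act w (xset k v * xmon l))" if r: "reduced n v w" for v w
  proof -
    have vn: "length v = n" "\<forall>j\<in>set w. Suc j < n" using reduced_props[OF r] by auto
    define m where "m = map (\<lambda>t. of_bool (v ! t < k) + l ! t) [0..<n]"
    have len: "length m = n" and nth: "\<And>t. t < n \<Longrightarrow> m ! t = of_bool (v ! t < k) + l ! t"
      by (simp_all add: m_def)
    have xm: "xset k v * xmon l = xmon m"
      unfolding xset_def xmon_xm vn(1) u(3) len xm_mult by (rule xm_cong) (simp add: nth)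
    show ?thesis
    proof (cases "dominant m")
      case True
      then show ?thesis
        unfolding xm using kappa_dominant[OF True] cone_kapnI[OF len] vn by (metis cone_kapn_act)
    next
      case False
      then obtain i where i: "Suc i < n" "m ! i < m ! Suc i" using len by (auto simp: not_le)
      have li: "l ! Suc i \<le> l ! i" using u i by simp
      \<comment> \<open>An ascent of m needs equal parts of l with i + 1 selected and i not. So it
        has height one, which makes \<pi>_i kill \<open>xmon m\<close>, and v descends there, which
        makes w absorb \<pi>_i.\<close>
      then have eq: "k \<le> v ! i" "v ! Suc i < k" "l ! i = l ! Suc i"
        using i nth[of i] nth[of "Suc i"] by (auto simp: of_bool_def split: if_splits)
      let ?g = "\<lambda>t. m ! t - of_bool (t = Suc i)"
      have "xmon m = X (Suc i) * xm n ?g" unfolding xmon_xm len by (rule xm_X) (use i in auto)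
      moreover have "swapv i (xm n ?g) = xm n ?g"
        unfolding swapv_xm[OF i(1)]
        by (rule xm_cong) (use i nth[of i] nth[of "Suc i"] eq in \<open>auto simp: sw_def\<close>)
      ultimately have "pidiff i (xmon m) = 0" by (simp add: pidiff_X_Suc)
      then have "act w (xmon m) = 0" using reduced_absorb[OF r i(1), of "xmon m"] eq by simp
      then show ?thesis by (simp add: xm)
    qed
  qed
  then show ?thesis unfolding u(1) L(2) by (intro cone_sum_list) (use L(1) in auto)
qed

lemma xmon_append0 [simp]: "xmon (a @ [0]) = xmon a"
  unfolding xmon_def by (simp add: nth_append)

lemma demaz_append0: "demaz a f \<Longrightarrow> demaz (a @ [0]) f"
proof (induction rule: demaz.induct)
  case (dominant a)
  then have "dominant (a @ [0])" by (auto simp: nth_append)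
  from demaz.dominant[OF this] show ?case by simp
next
  case (step k a f)
  have "lswap k (a @ [0]) = lswap k a @ [0]" using step by (simp add: lswap_def nth_append list_update_append)
  then show ?case using step by (intro demaz.step) (auto simp: nth_append)
qed

lemma kappa_append0: "kappa (a @ [0]) = kappa a"
  using demaz_exists[of a] demaz_append0 demaz_unique by (metis kappa_eq_kap)

lemma Sfn_cone: "valid n a \<Longrightarrow> cone (kapn n) (Sfn n a)"
proof (induction n arbitrary: a)
  case 0
  have "kappa [] = 1" by (simp add: kappa_dominant xmon_def)
  then show ?case using cone_kapnI[of "[]" 0] by simp
next
  case (Suc n)
  have "cone (kapn n) (Sfn n (shrink a))" using Suc valid_shrink by blast
  then have "cone (kapn (Suc n)) (Sfn n (shrink a))"
  proof (rule cone_trans)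
    fix b
    show "cone (kapn (Suc n)) (kapn n b)"
      using cone_kapnI[of "b @ [0]" "Suc n"] by (simp add: kapn_def kappa_append0)
  qed
  then have "cone (kapn (Suc n)) (pis (lead a) n (Sfn n (shrink a)))"
    using cone_kapn_act[of "Suc n" _ "[lead a..<n]"] by (simp add: pis_def act_def)
  then obtain L where L: "pis (lead a) n (Sfn n (shrink a)) = (\<Sum>b\<leftarrow>L. kapn (Suc n) b)" by (auto simp: cone_def)
  have "cone (kapn (Suc n)) ((\<Prod>j<lead a. X j) * kapn (Suc n) b)" for b
    using omega_kappa[of "lead a" "Suc n" b] lead_props(1)[OF Suc.prems] by (auto simp: kapn_def)
  then show ?case by (simp add: L sum_list_const_mult[symmetric] cone_sum_list)
qed

theorem schubert_kappa_positive: "cone kappa (schubert a)"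
  using Sfn_cone[OF valid_extend] kapn_cone_kappa schubert_extend by metis

section \<open>Arrays with given column sets\<close>

text \<open>The key that originates in column c + k, parked as far as column c. A variable start c
  lets inductions on k run through the tails of the tuple.\<close>

fun pk :: "(nat \<Rightarrow> nat set) \<Rightarrow> nat \<Rightarrow> nat \<Rightarrow> nat set" where
  "pk C c 0 = C c"
| "pk C c (Suc k) = park (C c) (pk C (Suc c) k)"

lemma kcols_pk: "c \<le> m \<Longrightarrow> k < m - c \<Longrightarrow> kcols (map C [c..<m]) ! k = pk C c k"
proof (induction k arbitrary: c)
  case 0
  then show ?case by (simp add: upt_conv_Cons)
next
  case (Suc k)
  then have "[c..<m] = c # [Suc c..<m]" by (simp add: upt_conv_Cons)
  then show ?case using Suc by simp
qed

lemma card_Collect_split: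
  assumes "finite I" shows "card {s \<in> I. P s \<or> Q s} \<le> card {s \<in> I. P s} + card {s \<in> I. Q s}"
proof -
  have "{s \<in> I. P s \<or> Q s} = {s \<in> I. P s} \<union> {s \<in> I. Q s}" by auto
  then show ?thesis by (simp add: card_Un_le)
qed

text \<open>A matching of cars to spots at or after them bounds the queue by the number of matched
  pairs straddling t, because each spot of the matching takes in a car whenever one is
  waiting.\<close>

lemma queue_matching:
  assumes "finite I" "inj_on x I" "x ` I \<subseteq> C" "\<And>s. s \<in> I \<Longrightarrow> y s \<le> x s"
  shows "queue C (y ` I) t \<le> card {s \<in> I. y s < t \<and> t \<le> x s}"
proof (induction t)
  case (Suc t)
  let ?A = "{s \<in> I. y s \<le> t \<and> t \<le> x s}" and ?B = "{s \<in> I. y s < Suc t \<and> Suc t \<le> x s}"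
  have A: "queue C (y ` I) t + of_bool (t \<in> y ` I) \<le> card ?A"
  proof (cases "t \<in> y ` I")
    case True
    then obtain s where s: "s \<in> I" "y s = t" by auto
    have "insert s {s \<in> I. y s < t \<and> t \<le> x s} \<subseteq> ?A" using s assms(4) by force
    then have "card (insert s {s \<in> I. y s < t \<and> t \<le> x s}) \<le> card ?A" using assms(1) by (intro card_mono) auto
    then show ?thesis using Suc s True assms(1) by simp
  next
    case False
    have "card {s \<in> I. y s < t \<and> t \<le> x s} \<le> card ?A" using assms(1) by (intro card_mono) auto
    then show ?thesis using Suc False by simp
  qed
  have "card ?A \<le> card ?B + card {s \<in> I. x s = t}"
  proof -
    have "?A \<subseteq> {s \<in> I. (y s < Suc t \<and> Suc t \<le> x s) \<or> x s = t}" by auto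
    then have "card ?A \<le> card {s \<in> I. (y s < Suc t \<and> Suc t \<le> x s) \<or> x s = t}" using assms(1) by (intro card_mono) auto
    also have "\<dots> \<le> card ?B + card {s \<in> I. x s = t}" by (rule card_Collect_split[OF assms(1)])
    finally show ?thesis .
  qed
  moreover have "card {s \<in> I. x s = t} \<le> of_bool (t \<in> C)"
  proof (cases "\<exists>s\<in>I. x s = t")
    case True
    then obtain s where s: "s \<in> I" "x s = t" by auto
    then have "{s \<in> I. x s = t} = {s}" using assms(2) by (auto dest: inj_onD)
    then show ?thesis using s assms(3) by auto
  next
    case False
    then have z: "{s \<in> I. x s = t} = {}" by auto
    show ?thesis unfolding z by simp
  qed
  ultimately show ?case using A by simp
qed simp

lemma queue_matching_0:
  assumes "finite I" "inj_on x I" "x ` I \<subseteq> C" "\<And>s. s \<in> I \<Longrightarrow> y s \<le> x s" "\<And>s. s \<in> I \<Longrightarrow> x s < t"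
  shows "queue C (y ` I) t = 0"
proof -
  have e: "{s \<in> I. y s < t \<and> t \<le> x s} = {}" using assms(5) by force
  show ?thesis using queue_matching[OF assms(1-4), of t] unfolding e by simp
qed

lemma park_matching:
  assumes "finite I" "inj_on x I" "inj_on y I" "x ` I \<subseteq> C" "\<And>s. s \<in> I \<Longrightarrow> y s \<le> x s"
    and nc: "\<And>e s. e \<in> C \<Longrightarrow> e \<notin> x ` I \<Longrightarrow> s \<in> I \<Longrightarrow> y s \<le> e \<Longrightarrow> x s < e"
  shows "park C (y ` I) = x ` I"
proof -
  have sub: "park C (y ` I) \<subseteq> x ` I"
  proof
    fix e assume e: "e \<in> park C (y ` I)"
    show "e \<in> x ` I"
    proof (rule ccontr)
      assume ne: "e \<notin> x ` I"
      have eC: "e \<in> C" using e by (auto simp: park_def)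
      have z: "{s \<in> I. y s < e \<and> e \<le> x s} = {}" using nc[OF eC ne] by force
      have "queue C (y ` I) e = 0" using queue_matching[OF assms(1,2,4,5), of e] unfolding z by simp
      moreover have "e \<notin> y ` I" using nc[OF eC ne] assms(5) by force
      ultimately show False using e by (simp add: park_def)
    qed
  qed
  obtain N where N: "\<And>s. s \<in> I \<Longrightarrow> x s < N"
    using assms(1) by (metis finite_imageI finite_nat_set_iff_bounded imageI)
  have "queue C (y ` I) N = 0" using queue_matching_0[OF assms(1,2,4,5), of N] N by blast
  then have "card (y ` I \<inter> {..<N}) = card (park C (y ` I) \<inter> {..<N})" using card_park[of "y ` I" N C] by simp
  moreover have "y ` I \<inter> {..<N} = y ` I" using N assms(5) by force
  moreover have "park C (y ` I) \<inter> {..<N} = park C (y ` I)" using sub N by force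
  ultimately have "card (park C (y ` I)) = card (x ` I)"
    using assms(2,3) by (simp add: card_image)
  then show ?thesis using card_subset_eq[OF _ sub] assms(1) by simp
qed

section \<open>Arrays with quasi-key and semi-skyline conditions\<close>

definition acol :: "nat set \<Rightarrow> (nat \<Rightarrow> nat) \<Rightarrow> (nat \<Rightarrow> nat \<Rightarrow> nat) \<Rightarrow> nat \<Rightarrow> nat set" where
  "acol R l E c = (\<lambda>r. E r c) ` {r \<in> R. c < l r}"

definition rows_ok :: "nat set \<Rightarrow> (nat \<Rightarrow> nat) \<Rightarrow> (nat \<Rightarrow> nat \<Rightarrow> nat) \<Rightarrow> bool" where
  "rows_ok R l E \<longleftrightarrow> finite R \<and> (\<forall>r\<in>R. 0 < l r)
    \<and> (\<forall>r\<in>R. \<forall>c. Suc c < l r \<longrightarrow> E r (Suc c) \<le> E r c)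
    \<and> (\<forall>r\<in>R. \<forall>s\<in>R. \<forall>c. c < l r \<and> c < l s \<and> r \<noteq> s \<longrightarrow> E r c \<noteq> E s c)"

text \<open>The conditions on quasi-key tableaux without the bound of entries by their rows. They
  depend only on the order of the rows, so rows may be renamed monotonically.\<close>

definition qk :: "nat set \<Rightarrow> (nat \<Rightarrow> nat) \<Rightarrow> (nat \<Rightarrow> nat \<Rightarrow> nat) \<Rightarrow> bool" where
  "qk R l E \<longleftrightarrow> rows_ok R l E
    \<and> (\<forall>r\<in>R. \<forall>s\<in>R. r < s \<longrightarrow> E r 0 < E s 0)
    \<and> (\<forall>r\<in>R. \<forall>s\<in>R. \<forall>c. r < s \<and> c < l r \<and> c < l s \<and> E s c < E r c \<longrightarrow> Suc c < l r \<and> E s c < E r (Suc c))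
    \<and> (\<forall>r\<in>R. \<forall>s\<in>R. \<forall>c. r < s \<and> l r < l s \<and> c < l r \<longrightarrow> E r c < E s (Suc c))"

text \<open>One condition stands for both types of triples; \<open>semi_skyline_iff\<close> proves
  the equivalence.\<close>

definition sk :: "nat set \<Rightarrow> (nat \<Rightarrow> nat) \<Rightarrow> (nat \<Rightarrow> nat \<Rightarrow> nat) \<Rightarrow> bool" where
  "sk R l E \<longleftrightarrow> rows_ok R l E \<and> (\<forall>r\<in>R. E r 0 = r)
    \<and> (\<forall>r\<in>R. \<forall>s\<in>R. \<forall>c. r < s \<and> c < l r \<and> Suc c < l s \<longrightarrow>
        E r c < E s (Suc c) \<or> Suc c < l r \<and> E s (Suc c) < E r (Suc c))"

lemma rows_okD:
  assumes "rows_ok R l E"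
  shows "finite R" "r \<in> R \<Longrightarrow> 0 < l r" "r \<in> R \<Longrightarrow> Suc c < l r \<Longrightarrow> E r (Suc c) \<le> E r c"
    "r \<in> R \<Longrightarrow> s \<in> R \<Longrightarrow> c < l r \<Longrightarrow> c < l s \<Longrightarrow> r \<noteq> s \<Longrightarrow> E r c \<noteq> E s c"
  using assms by (auto simp: rows_ok_def)

lemma rows_ok_inj: "rows_ok R l E \<Longrightarrow> I \<subseteq> {r \<in> R. c < l r} \<Longrightarrow> inj_on (\<lambda>r. E r c) I"
  by (rule inj_onI) (use rows_okD(4) in blast)

lemma rows_ok_le: "rows_ok R l E \<Longrightarrow> r \<in> R \<Longrightarrow> c < l r \<Longrightarrow> E r c \<le> E r 0"
proof (induction c)
  case (Suc c)
  then show ?case using rows_okD(3)[of R l E r c] by (meson Suc_lessD le_trans)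
qed simp

lemma acol_queue:
  assumes "rows_ok R l E" "\<And>r. r \<in> R \<Longrightarrow> E r 0 < n"
  shows "queue (acol R l E c) (acol R l E (Suc c)) n = 0"
  unfolding acol_def[of R l E "Suc c"]
proof (rule queue_matching_0)
  show "finite {r \<in> R. Suc c < l r}" using rows_okD(1)[OF assms(1)] by simp
  show "inj_on (\<lambda>r. E r c) {r \<in> R. Suc c < l r}" by (rule rows_ok_inj[OF assms(1)]) auto
  show "E s c < n" if "s \<in> {r \<in> R. Suc c < l r}" for s
    using rows_ok_le[OF assms(1), of s c] assms(2)[of s] that by simp
qed (use rows_okD(3)[OF assms(1)] in \<open>auto simp: acol_def\<close>)

lemma qkD:
  assumes "qk R l E"
  shows "rows_ok R l E" "r \<in> R \<Longrightarrow> s \<in> R \<Longrightarrow> r < s \<Longrightarrow> E r 0 < E s 0"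
    "r \<in> R \<Longrightarrow> s \<in> R \<Longrightarrow> r < s \<Longrightarrow> c < l r \<Longrightarrow> c < l s \<Longrightarrow> E s c < E r c \<Longrightarrow> Suc c < l r \<and> E s c < E r (Suc c)"
    "r \<in> R \<Longrightarrow> s \<in> R \<Longrightarrow> r < s \<Longrightarrow> l r < l s \<Longrightarrow> c < l r \<Longrightarrow> E r c < E s (Suc c)"
  using assms by (auto simp: qk_def)

text \<open>The entries of the longer rows park exactly at their left neighbours: the last two
  conditions of \<open>qk\<close> keep the entries of shorter rows from coming in between, as
  \<open>park_matching\<close> requires.\<close>

lemma qk_pk:
  assumes q: "qk R l E"
  shows "pk (acol R l E) c k = (\<lambda>r. E r c) ` {r \<in> R. c + k < l r}"
proof (induction k arbitrary: c)
  case 0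
  then show ?case by (simp add: acol_def)
next
  case (Suc k)
  note ok = qkD(1)[OF q]
  let ?I = "{r \<in> R. Suc c + k < l r}"
  have "park (acol R l E c) ((\<lambda>r. E r (Suc c)) ` ?I) = (\<lambda>r. E r c) ` ?I"
  proof (rule park_matching)
    show "finite ?I" using rows_okD(1)[OF ok] by simp
    show "inj_on (\<lambda>r. E r c) ?I" "inj_on (\<lambda>r. E r (Suc c)) ?I"
      by (rule rows_ok_inj[OF ok]; auto)+
    show "(\<lambda>r. E r c) ` ?I \<subseteq> acol R l E c" by (auto simp: acol_def)
    show "E s (Suc c) \<le> E s c" if "s \<in> ?I" for s using rows_okD(3)[OF ok, of s c] that by simp
    fix e s assume e: "e \<in> acol R l E c" "e \<notin> (\<lambda>r. E r c) ` ?I" and s: "s \<in> ?I" "E s (Suc c) \<le> e"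
    obtain r where r: "r \<in> R" "c < l r" "e = E r c" using e(1) by (auto simp: acol_def)
    have lr: "l r \<le> Suc c + k" using r e(2) by (auto simp: not_less)
    then have lt: "l r < l s" "r \<noteq> s" using s by auto
    show "E s c < e"
    proof (rule ccontr)
      assume "\<not> E s c < e"
      moreover have "E s c \<noteq> E r c" using rows_okD(4)[OF ok, of s r c] s r lt by auto
      ultimately have "E r c < E s c" using r by simp
      show False
      proof (cases "r < s")
        case True
        then show False using qkD(4)[OF q, of r s c] r s lt by simp
      next
        case False
        then have "E r c < E s (Suc c)" using qkD(3)[OF q, of s r c] r s lt \<open>E r c < E s c\<close> by auto
        then show False using s r by simp
      qed
    qed
  qed
  then show ?case using Suc by simp
qed

lemma card_below_eq_imp_eq:
  fixes A B :: "nat set"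
  assumes "\<And>t. card (A \<inter> {..<t}) = card (B \<inter> {..<t})"
  shows "A = B"
proof -
  have "t \<in> A \<longleftrightarrow> t \<in> B" for t
    using assms[of t] assms[of "Suc t"] by (auto simp: card_below_Suc of_bool_def split: if_split_asm)
  then show ?thesis by blast
qed

text \<open>Parking fills the leftmost spots possible: at a spot of C left empty no car is waiting,
  so all cars up to there have been served.\<close>

lemma card_below_park:
  assumes "Z \<subseteq> C" "\<And>t. card (Z \<inter> {..<t}) \<le> card (Y \<inter> {..<t})"
  shows "card (Z \<inter> {..<t}) \<le> card (park C Y \<inter> {..<t})"
proof (induction t)
  case (Suc t)
  show ?case
  proof (cases "t \<in> C \<and> t \<notin> park C Y")
    case True
    then have "queue C Y t = 0" "t \<notin> Y" by (auto simp: park_def)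
    then have "card (Y \<inter> {..<Suc t}) = card (park C Y \<inter> {..<Suc t})"
      using card_park[of Y t C] True by (simp add: card_below_Suc)
    then show ?thesis using assms(2)[of "Suc t"] by simp
  next
    case False
    then show ?thesis using Suc assms(1) by (auto simp: card_below_Suc of_bool_def)
  qed
qed simp

lemma card_image_below_mono:
  fixes x y :: "'a \<Rightarrow> nat"
  assumes "finite I" "inj_on x I" "inj_on y I" "\<And>s. s \<in> I \<Longrightarrow> y s \<le> x s"
  shows "card (x ` I \<inter> {..<t}) \<le> card (y ` I \<inter> {..<t})"
proof -
  have "card (z ` I \<inter> {..<t}) = card {s \<in> I. z s < t}" if z: "inj_on z I" for z :: "'a \<Rightarrow> nat"
  proof -
    have e: "z ` I \<inter> {..<t} = z ` {s \<in> I. z s < t}" by blast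
    have "inj_on z {s \<in> I. z s < t}" by (rule inj_on_subset[OF z]) blast
    then show ?thesis unfolding e by (rule card_image)
  qed
  then have "card (x ` I \<inter> {..<t}) = card {s \<in> I. x s < t}" "card (y ` I \<inter> {..<t}) = card {s \<in> I. y s < t}"
    using assms(2,3) by blast+
  moreover have "card {s \<in> I. x s < t} \<le> card {s \<in> I. y s < t}"
    using assms(1,4) by (intro card_mono) (auto intro: le_less_trans)
  ultimately show ?thesis by simp
qed

lemma pk_subset: "pk C c k \<subseteq> C c"
  by (cases k) (auto simp: park_def)

text \<open>Weakly decreasing rows are a competitor of parking, and by
  \<open>card_below_park\<close> parking has at least as many elements below every t.\<close>

lemma sk_pk_upper:
  assumes ok: "rows_ok R l E"
  shows "card ((\<lambda>r. E r c) ` {r \<in> R. c + k < l r} \<inter> {..<t}) \<le> card (pk (acol R l E) c k \<inter> {..<t})"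
proof (induction k arbitrary: c t)
  case 0
  then show ?case by (simp add: acol_def)
next
  case (Suc k)
  let ?I = "{r \<in> R. c + Suc k < l r}"
  have "card ((\<lambda>r. E r c) ` ?I \<inter> {..<t}) \<le> card (pk (acol R l E) (Suc c) k \<inter> {..<t})" for t
  proof -
    have "card ((\<lambda>r. E r c) ` ?I \<inter> {..<t}) \<le> card ((\<lambda>r. E r (Suc c)) ` ?I \<inter> {..<t})"
    proof (rule card_image_below_mono)
      show "finite ?I" using rows_okD(1)[OF ok] by simp
      show "inj_on (\<lambda>r. E r c) ?I" "inj_on (\<lambda>r. E r (Suc c)) ?I" by (rule rows_ok_inj[OF ok]; auto)+
    qed (use rows_okD(3)[OF ok] in auto)
    then show ?thesis using Suc[of "Suc c" t] by simp
  qed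
  then show ?case by (simp, intro card_below_park) (auto simp: acol_def)
qed

lemma skD:
  assumes "sk R l E"
  shows "rows_ok R l E" "r \<in> R \<Longrightarrow> E r 0 = r"
    "r \<in> R \<Longrightarrow> s \<in> R \<Longrightarrow> r < s \<Longrightarrow> c < l r \<Longrightarrow> Suc c < l s \<Longrightarrow>
       E r c < E s (Suc c) \<or> Suc c < l r \<and> E s (Suc c) < E r (Suc c)"
  using assms by (auto simp: sk_def)

text \<open>An invariant that interpolates between the sets to be compared. Every key element below
  b is accounted for by a key element below t in column c or by a row below b whose entry there is
  at least t. This is easy for c = 0, and c = j with t = 0 bounds the key by the rows longer than
  j.\<close>

lemma sk_pk_lower:
  assumes s: "sk R l E" and j: "c \<le> j" and n: "\<And>r. r \<in> R \<Longrightarrow> r < n"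
  shows "card (pk (acol R l E) 0 j \<inter> {..<b})
    \<le> card (pk (acol R l E) c (j - c) \<inter> {..<t}) + card {r \<in> R. r < b \<and> c < l r \<and> t \<le> E r c}"
  using j
proof (induction c arbitrary: t)
  case 0
  let ?X = "pk (acol R l E) 0 j"
  have fin: "finite R" using rows_okD(1) skD(1) s by blast
  have sub: "?X \<subseteq> {r \<in> R. 0 < l r}" using pk_subset[of "acol R l E" 0 j] skD(2)[OF s] by (auto simp: acol_def)
  have "?X \<inter> {..<b} \<subseteq> (?X \<inter> {..<t}) \<union> {r \<in> R. r < b \<and> 0 < l r \<and> t \<le> E r 0}"
    using sub skD(2)[OF s] by (auto simp: not_less)
  then have "card (?X \<inter> {..<b}) \<le> card ((?X \<inter> {..<t}) \<union> {r \<in> R. r < b \<and> 0 < l r \<and> t \<le> E r 0})"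
    using fin by (intro card_mono) auto
  also have "\<dots> \<le> card (?X \<inter> {..<t}) + card {r \<in> R. r < b \<and> 0 < l r \<and> t \<le> E r 0}" by (rule card_Un_le)
  finally show ?case by simp
next
  case (Suc c)
  note ok = skD(1)[OF s]
  have fin: "finite R" using rows_okD(1)[OF ok] .
  let ?K = "card (pk (acol R l E) 0 j \<inter> {..<b})"
  define X Y where "X = pk (acol R l E) c (j - c)" and "Y = pk (acol R l E) (Suc c) (j - Suc c)"
  have XY: "X = park (acol R l E c) Y" unfolding X_def Y_def using Suc.prems by (simp add: Suc_diff_Suc flip: pk.simps(2))
  have le: "card (X \<inter> {..<t}) \<le> card (Y \<inter> {..<t})" for t using card_park[of Y t "acol R l E c"] XY by simp
  have IH: "?K \<le> card (X \<inter> {..<t}) + card {r \<in> R. r < b \<and> c < l r \<and> t \<le> E r c}" for t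
    using Suc unfolding X_def by simp
  have En: "E r c < n" if "r \<in> R" "c < l r" for r c
    using rows_ok_le[OF ok that] skD(2)[OF s that(1)] n[OF that(1)] by simp
  have YC: "Y \<subseteq> acol R l E (Suc c)" unfolding Y_def by (rule pk_subset)
  let ?S = "\<lambda>t. {r \<in> R. r < b \<and> Suc c < l r \<and> t \<le> E r (Suc c)}"
  have finS: "finite (?S t)" for t using fin by simp
  \<comment> \<open>For the next column t descends from n, where no entry is large enough to be
    counted.\<close>
  have main: "?K \<le> card (Y \<inter> {..<t}) + card (?S t)" if "t \<le> n" for t
    using that
  proof (induction t rule: inc_induct)
    case base
    have z: "{r \<in> R. r < b \<and> c < l r \<and> n \<le> E r c} = {}" using En by force
    show ?case using IH[of n] le[of n] unfolding z by simp
  next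
    case (step t)
    show ?case
    proof (cases "t \<in> acol R l E (Suc c)")
      case False
      then have "t \<notin> Y" using YC by blast
      moreover have "card (?S (Suc t)) \<le> card (?S t)" by (intro card_mono finS) auto
      ultimately show ?thesis using step by (simp add: card_below_Suc)
    next
      case True
      then obtain u where u: "u \<in> R" "Suc c < l u" "t = E u (Suc c)" by (auto simp: acol_def)
      show ?thesis
      proof (cases "u < b")
        case True
        have "insert u (?S (Suc t)) \<subseteq> ?S t" using u True by auto
        then have "card (insert u (?S (Suc t))) \<le> card (?S t)" by (intro card_mono finS)
        moreover have "u \<notin> ?S (Suc t)" using u by simp
        ultimately have "Suc (card (?S (Suc t))) \<le> card (?S t)" using finS[of "Suc t"] by simp
        moreover have "card (Y \<inter> {..<Suc t}) \<le> Suc (card (Y \<inter> {..<t}))" by (simp add: card_below_Suc)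
        ultimately show ?thesis using step by linarith
      next
        case False
        \<comment> \<open>The entry t of column c + 1 sits in row u, which is above all rows below
          b. By the semi-skyline condition those of them with entry at least t in column c continue
          with an entry larger than t.\<close>
        have "{r \<in> R. r < b \<and> c < l r \<and> t \<le> E r c} \<subseteq> ?S t"
        proof safe
          fix r assume r: "r \<in> R" "r < b" "c < l r" "t \<le> E r c"
          then have "r < u" using False by simp
          then have "Suc c < l r \<and> E u (Suc c) < E r (Suc c)"
            using skD(3)[OF s r(1) u(1) _ r(3) u(2)] u r by force
          then show "Suc c < l r" "t \<le> E r (Suc c)" using u by auto
        qed
        then have "card {r \<in> R. r < b \<and> c < l r \<and> t \<le> E r c} \<le> card (?S t)" by (intro card_mono finS)
        then show ?thesis using IH[of t] le[of t] by linarith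
      qed
    qed
  qed
  show ?case
  proof (cases "t \<le> n")
    case True then show ?thesis using main unfolding Y_def by simp
  next
    case False
    have "card (Y \<inter> {..<n}) \<le> card (Y \<inter> {..<t})" using False by (intro card_mono) auto
    moreover have z: "?S n = {}" using En by force
    ultimately show ?thesis using main[of n, unfolded z] unfolding Y_def by simp
  qed
qed

lemma sk_pk:
  assumes s: "sk R l E"
  shows "pk (acol R l E) 0 j = {r \<in> R. j < l r}"
proof (rule card_below_eq_imp_eq, rule antisym)
  note ok = skD(1)[OF s]
  fix t
  obtain n where n: "\<And>r. r \<in> R \<Longrightarrow> r < n" using rows_okD(1)[OF ok] finite_nat_set_iff_bounded by auto
  have "(\<lambda>r. E r 0) ` {r \<in> R. j < l r} = {r \<in> R. j < l r}" using skD(2)[OF s] by force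
  then show "card ({r \<in> R. j < l r} \<inter> {..<t}) \<le> card (pk (acol R l E) 0 j \<inter> {..<t})"
    using sk_pk_upper[OF ok, of 0 j t] by simp
  have "{r \<in> R. r < t \<and> j < l r \<and> 0 \<le> E r j} = {r \<in> R. j < l r} \<inter> {..<t}" by auto
  then show "card (pk (acol R l E) 0 j \<inter> {..<t}) \<le> card ({r \<in> R. j < l r} \<inter> {..<t})"
    using sk_pk_lower[OF s le_refl[of j] n, of t 0] by simp
qed

text \<open>Columns are determined from the left and rows from the lowest up: each row has the
  largest entry still available that does not exceed its left neighbour.\<close>

lemma sk_unique:
  assumes s: "sk R l E" and s': "sk R l E'" and cols: "\<And>c. acol R l E c = acol R l E' c"
  shows "r \<in> R \<Longrightarrow> c < l r \<Longrightarrow> E r c = E' r c"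
proof (induction c arbitrary: r)
  case 0
  then show ?case using skD(2)[OF s] skD(2)[OF s'] by simp
next
  case (Suc c)
  have le: "E' r (Suc c) \<le> E r (Suc c)"
    if s: "sk R l E" and s': "sk R l E'" and cols: "acol R l E (Suc c) = acol R l E' (Suc c)"
      and IH: "\<And>r. r \<in> R \<Longrightarrow> c < l r \<Longrightarrow> E r c = E' r c" and r: "r \<in> R" "Suc c < l r"
      and low: "\<And>u. u \<in> R \<Longrightarrow> Suc c < l u \<Longrightarrow> u < r \<Longrightarrow> E u (Suc c) = E' u (Suc c)" for E E' r
  proof -
    have "E' r (Suc c) \<in> acol R l E (Suc c)" using r cols by (auto simp: acol_def)
    then obtain u where u: "u \<in> R" "Suc c < l u" "E' r (Suc c) = E u (Suc c)" by (auto simp: acol_def)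
    consider "u < r" | "u = r" | "r < u" by linarith
    then show ?thesis
    proof cases
      case 1
      then have "E' r (Suc c) = E' u (Suc c)" using u low by simp
      then show ?thesis using rows_okD(4)[OF skD(1)[OF s'], of r u "Suc c"] r u 1 by simp
    next
      case 2 then show ?thesis using u by simp
    next
      case 3
      have "E' r (Suc c) \<le> E r c" using rows_okD(3)[OF skD(1)[OF s'] r] IH r by simp
      then show ?thesis using skD(3)[OF s r(1) u(1) 3 _ u(2)] u r by auto
    qed
  qed
  show ?case using Suc.prems
  proof (induction r rule: less_induct)
    case (less r)
    have "E' r (Suc c) \<le> E r (Suc c)"
      by (rule le[OF s s' cols Suc.IH less.prems less.IH]) auto
    moreover have "E r (Suc c) \<le> E' r (Suc c)"
      by (rule le[OF s' s cols[symmetric] Suc.IH[symmetric] less.prems less.IH[symmetric]]) auto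
    ultimately show ?case by simp
  qed
qed

text \<open>The opposite direction of \<open>sk_unique\<close>: columns are determined from the
  right, again with the lowest row first, and each row has the smallest entry available that is not
  below its right neighbour.\<close>

lemma qk_unique:
  assumes q: "qk R l E" and q': "qk R l E'" and cols: "\<And>c. acol R l E c = acol R l E' c"
  shows "r \<in> R \<Longrightarrow> c < l r \<Longrightarrow> E r c = E' r c"
proof -
  obtain m where m: "\<And>r. r \<in> R \<Longrightarrow> l r < m"
    using rows_okD(1)[OF qkD(1)[OF q]] by (metis finite_imageI finite_nat_set_iff_bounded imageI)
  have le: "E r c \<le> E' r c"
    if q: "qk R l E" and q': "qk R l E'" and cols: "acol R l E c = acol R l E' c"
      and IH: "\<And>r. r \<in> R \<Longrightarrow> Suc c < l r \<Longrightarrow> E r (Suc c) = E' r (Suc c)" and r: "r \<in> R" "c < l r"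
      and low: "\<And>u. u \<in> R \<Longrightarrow> c < l u \<Longrightarrow> u < r \<Longrightarrow> E u c = E' u c" for E E' r c
  proof -
    have "E' r c \<in> acol R l E c" using r cols by (auto simp: acol_def)
    then obtain u where u: "u \<in> R" "c < l u" "E' r c = E u c" by (auto simp: acol_def)
    consider "u < r" | "u = r" | "r < u" by linarith
    then show ?thesis
    proof cases
      case 1
      then have "E' r c = E' u c" using u low by simp
      then show ?thesis using rows_okD(4)[OF qkD(1)[OF q'], of r u c] r u 1 by simp
    next
      case 2 then show ?thesis using u by simp
    next
      case 3
      show ?thesis
      proof (rule ccontr)
        assume "\<not> E r c \<le> E' r c"
        then have "Suc c < l r \<and> E u c < E r (Suc c)" using qkD(3)[OF q r(1) u(1) 3 r(2) u(2)] u by simp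
        then show False using IH[of r] rows_okD(3)[OF qkD(1)[OF q'], of r c] r u by simp
      qed
    qed
  qed
  have "\<forall>r\<in>R. c < l r \<longrightarrow> E r c = E' r c" if "c \<le> m" for c
    using that
  proof (induction c rule: inc_induct)
    case base
    then show ?case using m by force
  next
    case (step c)
    have "c < l r \<Longrightarrow> r \<in> R \<Longrightarrow> E r c = E' r c" for r
    proof (induction r rule: less_induct)
      case (less r)
      have "E r c \<le> E' r c" by (rule le[OF q q' cols _ less.prems(2,1)]) (use step less.IH in auto)
      moreover have "E' r c \<le> E r c" by (rule le[OF q' q cols[symmetric] _ less.prems(2,1)]) (use step less.IH in auto)
      ultimately show ?case by simp
    qed
    then show ?case by blast
  qed
  then show "r \<in> R \<Longrightarrow> c < l r \<Longrightarrow> E r c = E' r c" using m[of r] by (meson less_imp_le less_trans)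
qed

section \<open>Existence of semi-skyline arrays\<close>

lemma card_above:
  assumes "finite (A :: nat set)" shows "card {d \<in> A. t \<le> d} + card (A \<inter> {..<t}) = card A"
proof -
  have "A = {d \<in> A. t \<le> d} \<union> (A \<inter> {..<t})" by auto
  moreover have "card ({d \<in> A. t \<le> d} \<union> (A \<inter> {..<t})) = card {d \<in> A. t \<le> d} + card (A \<inter> {..<t})"
    using assms by (intro card_Un_disjoint) auto
  ultimately show ?thesis by simp
qed

text \<open>Cars only move to larger spots, so the set of occupied spots witnesses Hall's condition
  on suffixes.\<close>

lemma hall_of_queue:
  assumes "queue C D n = 0" "C \<subseteq> {..<n}" "D \<subseteq> {..<n}"
  shows "card {d \<in> D. t \<le> d} \<le> card {c \<in> C. t \<le> c}"
proof -
  let ?P = "park C D"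
  have P: "?P \<subseteq> C" by (rule park_subset)
  have fin: "finite C" "finite D" "finite ?P" using assms P by (meson finite_lessThan finite_subset)+
  have "D \<inter> {..<n} = D" "?P \<inter> {..<n} = ?P" using assms P by auto
  then have "card D = card ?P" using card_park[of D n C] assms(1) by simp
  moreover have "card (?P \<inter> {..<t}) \<le> card (D \<inter> {..<t})" using card_park[of D t C] by simp
  ultimately have "card {d \<in> D. t \<le> d} \<le> card {c \<in> ?P. t \<le> c}"
    using card_above[OF fin(2), of t] card_above[OF fin(3), of t] by simp
  also have "\<dots> \<le> card {c \<in> C. t \<le> c}" using fin P by (intro card_mono) auto
  finally show ?thesis .
qed

text \<open>Rows are served from the lowest one upwards, each taking the largest available entry that
  keeps it weakly decreasing.\<close>

lemma greedy_step:
  fixes R D :: "nat set" and f :: "nat \<Rightarrow> nat"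
  assumes "finite R" "inj_on f R" "finite D" "\<And>t. card {d \<in> D. t \<le> d} \<le> card {c \<in> f ` R. t \<le> c}"
  shows "\<exists>R' g. R' \<subseteq> R \<and> inj_on g R' \<and> g ` R' = D \<and> (\<forall>s\<in>R'. g s \<le> f s)
    \<and> (\<forall>r\<in>R. \<forall>s\<in>R'. r < s \<longrightarrow> f r < g s \<or> r \<in> R' \<and> g s < g r)"
  using assms
proof (induction R arbitrary: D rule: finite_linorder_min_induct)
  case empty
  have "card {d \<in> D. 0 \<le> d} \<le> 0" using empty.prems(3)[of 0] by simp
  then have "D = {}" using empty.prems(2) by simp
  then show ?case by simp
next
  case (insert b A)
  let ?x = "f b"
  have inj: "inj_on f A" and xA: "?x \<notin> f ` A" using insert by (auto simp: inj_on_def)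
  have finA: "finite (f ` A)" using insert by simp
  have bA: "b \<notin> A" using insert by auto
  have hall: "card {d \<in> D. t \<le> d} \<le> card {c \<in> insert ?x (f ` A). t \<le> c}" for t
    using insert.prems(3)[of t] by simp
  have big: "card {d \<in> D. t \<le> d} \<le> card {c \<in> f ` A. t \<le> c}" if "?x < t" for t
  proof -
    have "{c \<in> insert ?x (f ` A). t \<le> c} = {c \<in> f ` A. t \<le> c}" using that by auto
    then show ?thesis using hall[of t] by simp
  qed
  have mid: "card {d \<in> D. Suc ?x \<le> d} \<le> card {c \<in> f ` A. t \<le> c}" if "t \<le> ?x" for t
  proof -
    have "card {c \<in> f ` A. Suc ?x \<le> c} \<le> card {c \<in> f ` A. t \<le> c}"
      using finA that by (intro card_mono) auto
    then show ?thesis using big[of "Suc ?x"] by simp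
  qed
  show ?case
  proof (cases "\<exists>d\<in>D. d \<le> ?x")
    case True
    define y where "y = Max {d \<in> D. d \<le> ?x}"
    have fS: "finite {d \<in> D. d \<le> ?x}" "{d \<in> D. d \<le> ?x} \<noteq> {}" using True insert.prems(2) by auto
    have y: "y \<in> D" "y \<le> ?x" using Max_in[OF fS] by (simp_all add: y_def)
    have ymax: "d \<le> y" if "d \<in> D" "d \<le> ?x" for d unfolding y_def using that by (intro Max_ge fS) simp
    have hall': "card {d \<in> D - {y}. t \<le> d} \<le> card {c \<in> f ` A. t \<le> c}" for t
    proof -
      consider "t \<le> y" | "y < t" "t \<le> ?x" | "?x < t" by linarith
      then show ?thesis
      proof cases
        case 1
        have e1: "{d \<in> D. t \<le> d} = insert y {d \<in> D - {y}. t \<le> d}" using 1 y by auto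
        have e2: "{c \<in> insert ?x (f ` A). t \<le> c} = insert ?x {c \<in> f ` A. t \<le> c}" using 1 y by auto
        have "card {d \<in> D. t \<le> d} = Suc (card {d \<in> D - {y}. t \<le> d})"
          unfolding e1 using insert.prems(2) by simp
        moreover have "card {c \<in> insert ?x (f ` A). t \<le> c} = Suc (card {c \<in> f ` A. t \<le> c})"
          unfolding e2 using finA xA by simp
        ultimately show ?thesis using hall[of t] by simp
      next
        case 2
        \<comment> \<open>By the choice of y no element of D lies between t and the entry of row b,
          so the threshold may be raised past that entry, where row b does not count.\<close>
        have "{d \<in> D - {y}. t \<le> d} = {d \<in> D. Suc ?x \<le> d}" using 2 y ymax by force
        then show ?thesis using mid[OF 2(2)] by simp
      next
        case 3
        have "{d \<in> D - {y}. t \<le> d} = {d \<in> D. t \<le> d}" using 3 y by auto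
        then show ?thesis using big[OF 3] by simp
      qed
    qed
    have "finite (D - {y})" using insert.prems(2) by simp
    then obtain R' g where g: "R' \<subseteq> A" "inj_on g R'" "g ` R' = D - {y}" "\<forall>s\<in>R'. g s \<le> f s"
      "\<forall>r\<in>A. \<forall>s\<in>R'. r < s \<longrightarrow> f r < g s \<or> r \<in> R' \<and> g s < g r"
      using insert.IH[OF inj _ hall'] by blast
    have bR: "b \<notin> R'" using g(1) bA by blast
    let ?g = "g(b := y)" and ?R = "insert b R'"
    have im: "?g ` R' = g ` R'" using bR by (intro image_cong) auto
    show ?thesis
    proof (intro exI[of _ ?R] exI[of _ ?g] conjI ballI impI)
      show "?R \<subseteq> insert b A" using g(1) by blast
      show "inj_on ?g ?R" using bR g(2,3) im by (auto simp: inj_on_insert inj_on_fun_updI inj_on_def)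
      show "?g ` ?R = D" using im g(3) y(1) by auto
      show "?g s \<le> f s" if "s \<in> ?R" for s using that y(2) g(4) by auto
      fix r s assume r: "r \<in> insert b A" and s: "s \<in> ?R" and rs: "r < s"
      have sR: "s \<in> R'" using s rs r insert.hyps(2) by auto
      have gs: "?g s = g s" using sR bR by auto
      show "f r < ?g s \<or> r \<in> ?R \<and> ?g s < ?g r"
      proof (cases "r = b")
        case True
        have "g s \<in> D" "g s \<noteq> y" using g(3) sR by auto
        then show ?thesis using True gs ymax[of "g s"] by force
      next
        case False
        then show ?thesis using r g(5) sR rs gs by auto
      qed
    qed
  next
    case False
    have hall': "card {d \<in> D. t \<le> d} \<le> card {c \<in> f ` A. t \<le> c}" for t
    proof (cases "?x < t")
      case False
      have "{d \<in> D. t \<le> d} = {d \<in> D. Suc ?x \<le> d}" using False \<open>\<not> (\<exists>d\<in>D. d \<le> ?x)\<close> by force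
      then show ?thesis using mid[of t] False by simp
    qed (rule big)
    then obtain R' g where g: "R' \<subseteq> A" "inj_on g R'" "g ` R' = D" "\<forall>s\<in>R'. g s \<le> f s"
      "\<forall>r\<in>A. \<forall>s\<in>R'. r < s \<longrightarrow> f r < g s \<or> r \<in> R' \<and> g s < g r"
      using insert.IH[OF inj insert.prems(2) hall'] by blast
    show ?thesis
    proof (intro exI[of _ R'] exI[of _ g] conjI ballI impI)
      fix r s assume r: "r \<in> insert b A" and s: "s \<in> R'" and rs: "r < s"
      show "f r < g s \<or> r \<in> R' \<and> g s < g r"
      proof (cases "r = b")
        case True
        then show ?thesis using False g(3) s by force
      qed (use r g(5) s rs in auto)
    qed (use g in auto)
  qed
qed

text \<open>\<open>P c\<close> holds the rows that reach column c and \<open>E c\<close> their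
  entries there. The induction prepends the first column, whence the shifts by
  \<open>case_nat\<close>.\<close>

lemma greedy_states:
  fixes f :: "nat \<Rightarrow> nat"
  assumes "Cs \<noteq> []" "feas n Cs" "finite R" "inj_on f R" "f ` R = hd Cs"
  shows "\<exists>P E. P 0 = R \<and> E 0 = f \<and> (\<forall>c<length Cs. inj_on (E c) (P c) \<and> E c ` P c = Cs ! c)
    \<and> (\<forall>c. Suc c < length Cs \<longrightarrow> P (Suc c) \<subseteq> P c \<and> (\<forall>s\<in>P (Suc c). E (Suc c) s \<le> E c s)
      \<and> (\<forall>r\<in>P c. \<forall>s\<in>P (Suc c). r < s \<longrightarrow> E c r < E (Suc c) s \<or> r \<in> P (Suc c) \<and> E (Suc c) s < E (Suc c) r))"
  using assms
proof (induction Cs arbitrary: R f)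
  case (Cons C Cs)
  show ?case
  proof (cases "Cs = []")
    case True
    then show ?thesis using Cons.prems by (intro exI[of _ "\<lambda>_. R"] exI[of _ "\<lambda>_. f"]) auto
  next
    case False
    let ?D = "hd Cs"
    have fe: "queue C ?D n = 0" "C \<subseteq> {..<n}" "feas n Cs" using Cons.prems False by auto
    have "?D \<subseteq> {..<n}" using feas_subset[OF fe(3)] hd_in_set[OF False] by blast
    then have hall: "card {d \<in> ?D. t \<le> d} \<le> card {c \<in> f ` R. t \<le> c}" for t
      using hall_of_queue[OF fe(1,2)] Cons.prems(5) by simp
    have finD: "finite ?D" using \<open>?D \<subseteq> {..<n}\<close> finite_subset by blast
    obtain R' g where g: "R' \<subseteq> R" "inj_on g R'" "g ` R' = ?D" "\<forall>s\<in>R'. g s \<le> f s"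
      "\<forall>r\<in>R. \<forall>s\<in>R'. r < s \<longrightarrow> f r < g s \<or> r \<in> R' \<and> g s < g r"
      using greedy_step[OF Cons.prems(3,4) finD hall] by (elim exE conjE) (rule that)
    have finR': "finite R'" by (rule finite_subset[OF g(1) Cons.prems(3)])
    obtain P E where PE: "P 0 = R'" "E 0 = g" "\<forall>c<length Cs. inj_on (E c) (P c) \<and> E c ` P c = Cs ! c"
      "\<forall>c. Suc c < length Cs \<longrightarrow> P (Suc c) \<subseteq> P c \<and> (\<forall>s\<in>P (Suc c). E (Suc c) s \<le> E c s)
      \<and> (\<forall>r\<in>P c. \<forall>s\<in>P (Suc c). r < s \<longrightarrow> E c r < E (Suc c) s \<or> r \<in> P (Suc c) \<and> E (Suc c) s < E (Suc c) r)"
      using Cons.IH[OF False fe(3) finR' g(2,3)] by (elim exE conjE) (rule that)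
    show ?thesis
    proof (intro exI[of _ "case_nat R P"] exI[of _ "case_nat f E"] conjI)
      show "\<forall>c<length (C # Cs). inj_on (case_nat f E c) (case_nat R P c) \<and> case_nat f E c ` case_nat R P c = (C # Cs) ! c"
        using PE(3) Cons.prems by (auto split: nat.split)
      show "\<forall>c. Suc c < length (C # Cs) \<longrightarrow> case_nat R P (Suc c) \<subseteq> case_nat R P c
        \<and> (\<forall>s\<in>case_nat R P (Suc c). case_nat f E (Suc c) s \<le> case_nat f E c s)
        \<and> (\<forall>r\<in>case_nat R P c. \<forall>s\<in>case_nat R P (Suc c). r < s \<longrightarrow> case_nat f E c r < case_nat f E (Suc c) s
          \<or> r \<in> case_nat R P (Suc c) \<and> case_nat f E (Suc c) s < case_nat f E (Suc c) r)"
      proof (intro allI impI)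
        fix c assume "Suc c < length (C # Cs)"
        then show "case_nat R P (Suc c) \<subseteq> case_nat R P c
        \<and> (\<forall>s\<in>case_nat R P (Suc c). case_nat f E (Suc c) s \<le> case_nat f E c s)
        \<and> (\<forall>r\<in>case_nat R P c. \<forall>s\<in>case_nat R P (Suc c). r < s \<longrightarrow> case_nat f E c r < case_nat f E (Suc c) s
          \<or> r \<in> case_nat R P (Suc c) \<and> case_nat f E (Suc c) s < case_nat f E (Suc c) r)"
          using g(1,4,5) PE(1,2,4) by (cases c) simp_all
      qed
    qed simp_all
  qed
qed simp

lemma initial_segment:
  assumes "finite (S :: nat set)" "\<And>i j. i \<le> j \<Longrightarrow> j \<in> S \<Longrightarrow> i \<in> S"
  shows "j \<in> S \<longleftrightarrow> j < card S"
proof -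
  have "S = {..<card S}"
  proof (rule card_subset_eq[symmetric])
    show "{..<card S} \<subseteq> S"
    proof (rule ccontr)
      assume "\<not> {..<card S} \<subseteq> S"
      then obtain i where i: "i < card S" "i \<notin> S" by auto
      then have "S \<subseteq> {..<i}" using assms(2) by (metis lessThan_iff not_less subsetI)
      then have "card S \<le> i" using card_mono[of "{..<i}" S] by simp
      then show False using i by simp
    qed
  qed (use assms in simp_all)
  then show ?thesis by blast
qed

definition supp :: "nat list \<Rightarrow> nat set" where
  "supp a = {r. r < length a \<and> 0 < a ! r}"

text \<open>The greedy filling starts with the identity, so a row is named by its first entry. Its
  row lengths are not prescribed: by \<open>sk_pk\<close> they can be read off the key of the tuple,
  and the key is a.\<close>

lemma sk_exists:
  assumes Cs: "Cs \<in> colset a"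
  shows "\<exists>E. sk (supp a) ((!) a) E \<and> (\<forall>c<length Cs. acol (supp a) ((!) a) E c = Cs ! c)"
proof (cases "Cs = []")
  case True
  then have "level_cols a = []" using kcols_eq_level_cols[OF Cs] by simp
  then have M: "Max (insert 0 (set a)) = 0" by (simp add: level_cols_def)
  have "a ! r \<le> Max (insert 0 (set a))" if "r < length a" for r using that by (intro Max_ge) auto
  then have "supp a = {}" unfolding M by (auto simp: supp_def)
  then show ?thesis using True by (simp add: sk_def rows_ok_def)
next
  case False
  let ?n = "length a" and ?m = "length Cs" and ?R = "hd Cs"
  have f: "feas ?n Cs" using Cs by (simp add: colset_def)
  have "?R \<subseteq> {..<?n}" using feas_subset[OF f] hd_in_set[OF False] by blast
  then have finR: "finite ?R" using finite_subset by blast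
  obtain P E where PE: "P 0 = ?R" "E 0 = id" "\<And>c. c < ?m \<Longrightarrow> inj_on (E c) (P c) \<and> E c ` P c = Cs ! c"
    and step: "\<And>c. Suc c < ?m \<Longrightarrow> P (Suc c) \<subseteq> P c \<and> (\<forall>s\<in>P (Suc c). E (Suc c) s \<le> E c s)
      \<and> (\<forall>r\<in>P c. \<forall>s\<in>P (Suc c). r < s \<longrightarrow> E c r < E (Suc c) s \<or> r \<in> P (Suc c) \<and> E (Suc c) s < E (Suc c) r)"
    using greedy_states[OF False f finR, of id] by auto
  \<comment> \<open>The number of columns in which row r is present; since the sets
    \<open>P c\<close> decrease, these columns are the first \<open>l r\<close> ones.\<close>
  define l where "l = (\<lambda>r. card {c. c < ?m \<and> r \<in> P c})"
  have stepP: "P (Suc c) \<subseteq> P c" if "Suc c < ?m" for c using step[OF that] by blast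
  have mono: "P d \<subseteq> P c" if "c \<le> d" "d < ?m" for c d
    using that
  proof (induction d rule: dec_induct)
    case (step d)
    then show ?case using stepP[of d] by (meson Suc_lessD subset_trans)
  qed simp
  have lP: "r \<in> P c \<longleftrightarrow> c < l r" if "c < ?m" for r c
  proof -
    have "c \<in> {c. c < ?m \<and> r \<in> P c} \<longleftrightarrow> c < l r"
      unfolding l_def by (rule initial_segment) (use mono in auto)
    then show ?thesis using that by simp
  qed
  have lm: "l r \<le> ?m" for r
  proof -
    have "l r \<le> card {..<?m}" unfolding l_def by (rule card_mono) auto
    then show ?thesis by simp
  qed
  have m0: "0 < ?m" using False by simp
  have lR: "r \<in> ?R \<longleftrightarrow> 0 < l r" for r using lP[OF m0, of r] PE(1) by simp
  let ?E = "\<lambda>r c. E c r"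
  have Pc: "{r \<in> ?R. c < l r} = P c" if "c < ?m" for c using lP[OF that] lR by force
  have ok: "rows_ok ?R l ?E"
    unfolding rows_ok_def
  proof (intro conjI ballI allI impI)
    fix r c assume "r \<in> ?R" "Suc c < l r"
    then have "Suc c < ?m" "r \<in> P (Suc c)" using lm[of r] lP[of "Suc c" r] by auto
    then show "E (Suc c) r \<le> E c r" using step by blast
  next
    fix r s c assume "r \<in> ?R" "s \<in> ?R" and *: "c < l r \<and> c < l s \<and> r \<noteq> s"
    then have "c < ?m" using lm[of r] by simp
    then show "E c r \<noteq> E c s" using * lP[of c] PE(3)[of c] by (auto dest: inj_onD)
  qed (use finR lR in auto)
  have sk: "sk ?R l ?E"
    unfolding sk_def
  proof (intro conjI ok ballI allI impI)
    show "E 0 r = r" for r using PE(2) by simp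
    fix r s c assume "r \<in> ?R" "s \<in> ?R" and *: "r < s \<and> c < l r \<and> Suc c < l s"
    then have c: "Suc c < ?m" using lm[of s] by simp
    then have "r \<in> P c" "s \<in> P (Suc c)" using * lP by auto
    then show "E c r < E (Suc c) s \<or> Suc c < l r \<and> E (Suc c) s < E (Suc c) r"
      using step[OF c] * lP[OF c, of r] by blast
  qed
  have col: "acol ?R l ?E c = Cs ! c" if "c < ?m" for c
    unfolding acol_def Pc[OF that] using PE(3)[OF that] by simp
  have Cs_map: "Cs = map (acol ?R l ?E) [0..<?m]" by (rule nth_equalityI) (simp_all add: col)
  have lev: "j < l r \<longleftrightarrow> r < ?n \<and> j < a ! r" if "j < ?m" for j r
  proof -
    have "kcols Cs ! j = {r \<in> ?R. j < l r}"
      using kcols_pk[of 0 ?m j "acol ?R l ?E"] sk_pk[OF sk, of j] that Cs_map by simp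
    moreover have "kcols Cs ! j = {p. p < ?n \<and> j < a ! p}"
      using kcols_eq_level_cols[OF Cs] that length_kcols[of Cs] by (simp add: level_cols_def)
    ultimately show ?thesis using lR[of r] by (cases "l r = 0") auto
  qed
  have am: "a ! r \<le> ?m" if "r < ?n" for r
  proof -
    have "?m = Max (insert 0 (set a))"
      using arg_cong[OF kcols_eq_level_cols[OF Cs], of length] by (simp add: level_cols_def)
    then show ?thesis using that by simp
  qed
  have la: "l r = a ! r" if "r < ?n" for r
  proof (rule ccontr)
    assume "l r \<noteq> a ! r"
    then have "min (l r) (a ! r) < ?m" using lm[of r] am[OF that] by linarith
    from lev[OF this, of r] show False using that \<open>l r \<noteq> a ! r\<close> by (auto simp: min_def split: if_splits)
  qed
  have R: "?R = supp a" using lR lev[OF m0] by (auto simp: supp_def)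
  have cong: "l r = a ! r" if "r \<in> supp a" for r using la that by (simp add: supp_def)
  have "sk (supp a) ((!) a) ?E" using sk cong unfolding R sk_def rows_ok_def by simp
  moreover have "acol (supp a) ((!) a) ?E c = Cs ! c" if "c < ?m" for c
    using col[OF that] cong unfolding R acol_def by (metis (mono_tags, lifting) Collect_cong)
  ultimately show ?thesis by blast
qed

section \<open>Existence of quasi-key arrays\<close>

lemma park_empty [simp]: "park C {} = {}"
proof -
  have "queue C {} t = 0" for t by (induction t) simp_all
  then show ?thesis by (simp add: park_def)
qed

lemma pk_mono: "pk C c (Suc k) \<subseteq> pk C c k"
proof (induction k arbitrary: c)
  case 0
  show ?case by (simp add: park_subset)
next
  case (Suc k)
  then show ?case using park_mono by simp
qed

lemma pk_antimono: "i \<le> j \<Longrightarrow> pk C c j \<subseteq> pk C c i"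
  by (rule lift_Suc_antimono_le[of "pk C c"]) (auto simp: pk_mono simp del: pk.simps)

lemma pk_empty: "C (c + k) = {} \<Longrightarrow> pk C c k = {}"
  by (induction k arbitrary: c) simp_all

text \<open>The length that the key prescribes for the row starting at t.\<close>

definition lev :: "(nat \<Rightarrow> nat set) \<Rightarrow> nat \<Rightarrow> nat" where
  "lev C t = card {j. t \<in> pk C 0 j}"

lemma lev_iff:
  assumes "\<And>c. m \<le> c \<Longrightarrow> C c = {}"
  shows "t \<in> pk C 0 j \<longleftrightarrow> j < lev C t"
proof -
  have "{j. t \<in> pk C 0 j} \<subseteq> {..<m}" using pk_empty[of C 0] assms by (auto simp: not_less[symmetric])
  then have "finite {j. t \<in> pk C 0 j}" using finite_subset by blast
  then have "j \<in> {j. t \<in> pk C 0 j} \<longleftrightarrow> j < card {j. t \<in> pk C 0 j}"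
    by (rule initial_segment) (use pk_antimono in blast)
  then show ?thesis by (simp add: lev_def)
qed

text \<open>The set of occupied spots does not depend on the order of arrival, so y may be sent
  first and takes x, the first spot at or after y. Removing both therefore removes just x from the
  result.\<close>

lemma park_remove:
  assumes "y \<in> Y" "x \<in> C" "y \<le> x" "\<And>e. e \<in> C \<Longrightarrow> y \<le> e \<Longrightarrow> x \<le> e"
  shows "queue C Y t = queue (C - {x}) (Y - {y}) t + of_bool (y < t \<and> t \<le> x)"
    and "x \<in> park C Y" and "park (C - {x}) (Y - {y}) = park C Y - {x}"
proof -
  show q: "queue C Y t = queue (C - {x}) (Y - {y}) t + of_bool (y < t \<and> t \<le> x)" for t
  proof (induction t)
    case (Suc t)
    consider "t < y" | "t = y" "y < x" | "t = y" "y = x" | "y < t" "t < x" | "y < t" "t = x" | "x < t" by linarith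
    then show ?case
    proof cases
      case 2
      then have "t \<notin> C" using assms(4)[of t] by auto
      then show ?thesis using Suc assms 2 by simp
    next
      case 4
      then have "t \<notin> C" using assms(4)[of t] by auto
      then show ?thesis using Suc assms 4 by auto
    qed (use Suc assms in auto)
  qed simp
  show "x \<in> park C Y" using assms q[of x] by (cases "x = y") (auto simp: park_def)
  show "park (C - {x}) (Y - {y}) = park C Y - {x}"
  proof (intro set_eqI)
    fix t
    show "t \<in> park (C - {x}) (Y - {y}) \<longleftrightarrow> t \<in> park C Y - {x}"
    proof (cases "t \<in> C \<and> t \<noteq> x")
      case True
      then have "t < y \<or> x < t" using assms(4)[of t] by linarith
      then have "queue C Y t = queue (C - {x}) (Y - {y}) t" "t \<noteq> y" using q[of t] assms(3) by auto
      then show ?thesis using True by (simp add: park_def)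
    qed (auto simp: park_def)
  qed
qed

lemma park_unoccupied:
  assumes "x \<notin> park C Y"
  shows "queue (C - {x}) Y t = queue C Y t" "park (C - {x}) Y = park C Y"
proof -
  show q: "queue (C - {x}) Y t = queue C Y t" for t
  proof (induction t)
    case (Suc t)
    then show ?case using assms by (cases "t = x") (auto simp: park_def)
  qed simp
  show "park (C - {x}) Y = park C Y" using assms by (auto simp: park_def q)
qed

lemma park_ex_le: "t \<in> park C Y \<Longrightarrow> \<exists>y\<in>Y. y \<le> t"
proof -
  have "queue C Y t > 0 \<Longrightarrow> \<exists>y\<in>Y. y < t" for t
  proof (induction t)
    case (Suc t)
    show ?case
    proof (cases "t \<in> Y")
      case False
      then have "queue C Y t > 0" using Suc.prems by (auto split: if_splits)
      then show ?thesis using Suc.IH by (meson less_Suc_eq)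
    qed auto
  qed simp
  then show "t \<in> park C Y \<Longrightarrow> ?thesis" by (cases "t \<in> Y") (auto simp: park_def dest: less_imp_le)
qed

text \<open>A spot is occupied only if some car starts at or before it; choosing such a car in every
  column yields a weakly decreasing row.\<close>

lemma pk_path:
  "t \<in> pk C c k \<Longrightarrow> \<exists>p. p 0 = t \<and> (\<forall>i\<le>k. p i \<in> C (c + i)) \<and> (\<forall>i<k. p (Suc i) \<le> p i)"
proof (induction k arbitrary: c t)
  case 0
  then show ?case by (intro exI[of _ "\<lambda>_. t"]) simp
next
  case (Suc k)
  then obtain y where y: "y \<in> pk C (Suc c) k" "y \<le> t"
    using park_ex_le[of t "C c" "pk C (Suc c) k"] by auto
  obtain p where p: "p 0 = y" "\<forall>i\<le>k. p i \<in> C (Suc c + i)" "\<forall>i<k. p (Suc i) \<le> p i"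
    using Suc.IH[OF y(1)] by (elim exE conjE) (rule that)
  have "t \<in> C c" using Suc.prems pk_subset by blast
  then show ?case using p y by (intro exI[of _ "case_nat t p"]) (auto split: nat.split)
qed

text \<open>The shape of the lowest row of a quasi-key array, built from the right: the minimum of
  its last column, then in each column to the left the least entry not below the one just chosen.
  The given path guarantees that there is one.\<close>

lemma min_path:
  fixes C :: "nat \<Rightarrow> nat set"
  assumes "\<forall>i\<le>k. p i \<in> C i" "\<forall>i<k. p (Suc i) \<le> p i"
  shows "\<exists>q. (\<forall>i\<le>k. q i \<in> C i \<and> q i \<le> p i) \<and> (\<forall>e\<in>C k. q k \<le> e)
    \<and> (\<forall>i<k. q (Suc i) \<le> q i \<and> (\<forall>e\<in>C i. q (Suc i) \<le> e \<longrightarrow> q i \<le> e))"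
  using assms
proof (induction k arbitrary: C p)
  case 0
  then have "p 0 \<in> C 0" by simp
  then show ?case
    by (intro exI[of _ "\<lambda>_. LEAST e. e \<in> C 0"]) (auto intro: LeastI Least_le)
next
  case (Suc k)
  obtain q where q: "\<forall>i\<le>k. q i \<in> C (Suc i) \<and> q i \<le> p (Suc i)" "\<forall>e\<in>C (Suc k). q k \<le> e"
    "\<forall>i<k. q (Suc i) \<le> q i \<and> (\<forall>e\<in>C (Suc i). q (Suc i) \<le> e \<longrightarrow> q i \<le> e)"
    using Suc.IH[of "\<lambda>i. p (Suc i)" "\<lambda>i. C (Suc i)"] Suc.prems by auto
  define x where "x = (LEAST e. e \<in> C 0 \<and> q 0 \<le> e)"
  have p0: "p 0 \<in> C 0 \<and> q 0 \<le> p 0" using Suc.prems q(1) by (meson le0 le_trans zero_less_Suc)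
  have x: "x \<in> C 0" "q 0 \<le> x" "x \<le> p 0" "\<And>e. e \<in> C 0 \<Longrightarrow> q 0 \<le> e \<Longrightarrow> x \<le> e"
    using LeastI[of "\<lambda>e. e \<in> C 0 \<and> q 0 \<le> e", OF p0] Least_le[of "\<lambda>e. e \<in> C 0 \<and> q 0 \<le> e"] p0
    by (auto simp: x_def)
  show ?case
  proof (intro exI[of _ "case_nat x q"] conjI allI impI)
    fix i
    show "i \<le> Suc k \<Longrightarrow> case_nat x q i \<in> C i" "i \<le> Suc k \<Longrightarrow> case_nat x q i \<le> p i"
      using x q(1) by (auto split: nat.split)
    show "i < Suc k \<Longrightarrow> case_nat x q (Suc i) \<le> case_nat x q i" using x q(3) by (auto split: nat.split)
    show "i < Suc k \<Longrightarrow> \<forall>e\<in>C i. case_nat x q (Suc i) \<le> e \<longrightarrow> case_nat x q i \<le> e"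
      using x q(3) by (auto split: nat.split)
  qed (use q(2) in simp)
qed

lemma queue_no_spots: "finite Y \<Longrightarrow> Y \<subseteq> {..<n} \<Longrightarrow> queue {} Y n = 0 \<Longrightarrow> Y = {}"
  using card_park[of Y n "{}"] by (simp add: park_def Int_absorb2)

text \<open>Induction on the number of rows by splitting off the lowest. It starts at the minimum t0
  of the first column, has the length prescribed by the key and follows \<open>min_path\<close>; the
  point is that its removal leaves the keys of all other rows intact.\<close>

lemma qk_exists_fun:
  assumes "\<And>c. C c \<subseteq> {..<n}" "\<And>c. queue (C c) (C (Suc c)) n = 0" "\<And>c. m \<le> c \<Longrightarrow> C c = {}"
  shows "\<exists>E. qk (C 0) (lev C) E \<and> (\<forall>t\<in>C 0. E t 0 = t) \<and> (\<forall>c. acol (C 0) (lev C) E c = C c)"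
  using assms
proof (induction "card (C 0)" arbitrary: C rule: less_induct)
  case less
  note Cn = less.prems(1) and Cq = less.prems(2) and Cm = less.prems(3)
  have fin: "finite (C c)" for c using Cn[of c] finite_subset by blast
  have lev: "t \<in> pk C 0 j \<longleftrightarrow> j < lev C t" for t j by (rule lev_iff) (rule Cm)
  show ?case
  proof (cases "C 0 = {}")
    case True
    have "C c = {}" for c
    proof (induction c)
      case (Suc c)
      then show ?case using queue_no_spots[OF fin Cn] Cq[of c] by simp
    qed (rule True)
    then show ?thesis by (simp add: qk_def rows_ok_def acol_def)
  next
    case False
    define t0 where "t0 = (LEAST t. t \<in> C 0)"
    have t0: "t0 \<in> C 0" "\<And>t. t \<in> C 0 \<Longrightarrow> t0 \<le> t"
      using False by (auto simp: t0_def intro: LeastI Least_le)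
    obtain k where k: "lev C t0 = Suc k" using lev[of t0 0] t0(1) by (cases "lev C t0") auto
    have "t0 \<in> pk C 0 k" using lev[of t0 k] k by simp
    then obtain p where p: "p 0 = t0" "\<forall>i\<le>k. p i \<in> C i" "\<forall>i<k. p (Suc i) \<le> p i"
      using pk_path[of t0 C 0 k] by auto
    obtain q where q: "\<And>i. i \<le> k \<Longrightarrow> q i \<in> C i \<and> q i \<le> p i" and qk: "\<And>e. e \<in> C k \<Longrightarrow> q k \<le> e"
      and qs: "\<And>i. i < k \<Longrightarrow> q (Suc i) \<le> q i" and qm: "\<And>i e. i < k \<Longrightarrow> e \<in> C i \<Longrightarrow> q (Suc i) \<le> e \<Longrightarrow> q i \<le> e"
      using min_path[OF p(2,3)] by blast
    have q0: "q 0 = t0" using q[of 0] p(1) t0(2)[of "q 0"] by simp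
    define C' where "C' = (\<lambda>c. if c \<le> k then C c - {q c} else C c)"
    \<comment> \<open>Keys originating in columns up to k lose exactly the removed entry, because q
      c is the first spot at or after the entry of q in column c + 1.\<close>
    have in_lo: "q c \<in> pk C c i \<and> pk C' c i = pk C c i - {q c}" if "c + i \<le> k" for c i
      using that
    proof (induction i arbitrary: c)
      case 0
      then show ?case using q by (simp add: C'_def)
    next
      case (Suc i)
      then have IH: "q (Suc c) \<in> pk C (Suc c) i" "pk C' (Suc c) i = pk C (Suc c) i - {q (Suc c)}" by auto
      have ck: "c < k" using Suc.prems by simp
      have C'c: "C' c = C c - {q c}" using ck by (simp add: C'_def)
      show ?case
        unfolding pk.simps IH(2) C'c
        using park_remove(2,3)[OF IH(1), of "q c" "C c"] q[of c] qs[OF ck] qm[OF ck] ck by simp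
    qed
    \<comment> \<open>Keys originating behind column k never use a spot of the new row:
      \<open>park_remove\<close> would carry such an occupation leftwards to t0, whose row ends at
      k.\<close>
    have notin: "q c \<notin> pk C c (j - c)" if "c \<le> k" "k < j" for c j
      using that
    proof (induction c)
      case 0
      then show ?case using q0 lev[of t0 j] k by simp
    next
      case (Suc c)
      then have ck: "c < k" by simp
      have "j - c = Suc (j - Suc c)" using Suc.prems by simp
      then have "q c \<notin> park (C c) (pk C (Suc c) (j - Suc c))" using Suc by simp
      then show ?case using park_remove(2)[of "q (Suc c)" _ "q c" "C c"] q[of c] qs[OF ck] qm[OF ck] ck by auto
    qed
    have hi: "pk C' c i = pk C c i" if "k < c + i" for c i
      using that
    proof (induction i arbitrary: c)
      case 0
      then show ?case by (simp add: C'_def)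
    next
      case (Suc i)
      then have IH: "pk C' (Suc c) i = pk C (Suc c) i" by simp
      show ?case
      proof (cases "c \<le> k")
        case True
        have "q c \<notin> park (C c) (pk C (Suc c) i)" using notin[of c "c + Suc i"] True Suc.prems by simp
        from park_unoccupied(2)[OF this] show ?thesis using IH True by (simp add: C'_def)
      next
        case False
        then show ?thesis using IH by (simp add: C'_def)
      qed
    qed
    have C'n: "C' c \<subseteq> {..<n}" for c using Cn[of c] by (auto simp: C'_def)
    have C'm: "C' c = {}" if "m \<le> c" for c using Cm[OF that] by (simp add: C'_def)
    have C'q: "queue (C' c) (C' (Suc c)) n = 0" for c
    proof -
      consider "c < k" | "c = k" | "k < c" by linarith
      then show ?thesis
      proof cases
        case 1
        have "q c < n" using q[of c] Cn[of c] 1 by auto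
        then show ?thesis
          using park_remove(1)[of "q (Suc c)" "C (Suc c)" "q c" "C c" n] q[of c] q[of "Suc c"] qs[OF 1] qm[OF 1] 1 Cq[of c]
          by (simp add: C'_def)
      next
        case 2
        have "q c \<notin> park (C c) (C (Suc c))" using notin[of c "Suc c"] 2 by simp
        from park_unoccupied(1)[OF this, of n] show ?thesis using 2 Cq[of c] by (simp add: C'_def)
      next
        case 3
        then show ?thesis using Cq[of c] by (simp add: C'_def)
      qed
    qed
    have C'0: "C' 0 = C 0 - {t0}" by (simp add: C'_def q0)
    have "card (C' 0) < card (C 0)" unfolding C'0 using fin[of 0] t0(1) by (rule card_Diff1_less)
    from less.hyps[OF this C'n C'q C'm] obtain E where
      E: "qk (C' 0) (lev C') E" "\<forall>t\<in>C' 0. E t 0 = t" "\<forall>c. acol (C' 0) (lev C') E c = C' c" by blast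
    have levt: "lev C' t = lev C t" if "t \<in> C' 0" for t
    proof -
      have "t \<in> pk C' 0 j \<longleftrightarrow> t \<in> pk C 0 j" for j
        using in_lo[of 0 j] hi[of 0 j] that q0 C'0 by (cases "j \<le> k") auto
      then show ?thesis by (simp add: lev_def)
    qed
    let ?R = "C 0" and ?l = "lev C" and ?E = "E(t0 := q)"
    have qE: "qk (C' 0) ?l E"
      using E(1) levt unfolding qk_def rows_ok_def by simp
    have colE: "acol (C' 0) ?l E c = C' c" for c
    proof -
      have "acol (C' 0) ?l E c = acol (C' 0) (lev C') E c" unfolding acol_def using levt by (intro image_cong) auto
      then show ?thesis using E(3) by simp
    qed
    have R: "?R = insert t0 (C' 0)" "t0 \<notin> C' 0" using C'0 t0(1) by auto
    have EC: "E r c \<in> C' c" if "r \<in> C' 0" "c < ?l r" for r c using colE[of c] that by (auto simp: acol_def)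
    have pkE: "pk C c i = (\<lambda>r. E r c) ` {r \<in> C' 0. c + i < ?l r}" if "k < c + i" for c i
    proof -
      have "acol (C' 0) ?l E = C'" using colE by blast
      then show ?thesis using qk_pk[OF qE, of c i] hi[OF that] by simp
    qed
    note okE = qkD(1)[OF qE]
    \<comment> \<open>The condition on a strictly longer higher row. If it failed, then, q c being
      left empty by the longer rows, no car would be waiting there, so the longer rows with entry at
      most q c in column c + 1 would also have an entry below q c in column c. Repeated down to
      column 0 this contradicts the minimality of t0.\<close>
    have long: "q c < E r (Suc c)" if r: "r \<in> C' 0" "Suc k < ?l r" and c: "c \<le> k" for r c
    proof (rule ccontr)
      assume neg: "\<not> q c < E r (Suc c)"
      have down: "E r c < q c" if "c \<le> k" "E r (Suc c) \<le> q c" for c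
      proof -
        let ?I = "{s \<in> C' 0. Suc k < ?l s}" and ?Y = "pk C (Suc c) (k - c)"
        have Y: "?Y = (\<lambda>s. E s (Suc c)) ` ?I" using pkE[of "Suc c" "k - c"] \<open>c \<le> k\<close> by simp
        have "pk C c (Suc (k - c)) = (\<lambda>s. E s c) ` ?I" using pkE[of c "Suc (k - c)"] \<open>c \<le> k\<close> by simp
        then have X: "park (C c) ?Y = (\<lambda>s. E s c) ` ?I" by simp
        have "q c \<notin> park (C c) ?Y" using notin[of c "Suc k"] \<open>c \<le> k\<close> by (simp add: Suc_diff_le)
        moreover have "q c \<in> C c" using q \<open>c \<le> k\<close> by blast
        ultimately have 0: "queue (C c) ?Y (q c) + of_bool (q c \<in> ?Y) = 0" by (auto simp: park_def)
        then have "queue (C c) ?Y (Suc (q c)) = 0" by simp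
        then have card: "card (?Y \<inter> {..<Suc (q c)}) = card (park (C c) ?Y \<inter> {..<Suc (q c)})"
          using card_park[of ?Y "Suc (q c)" "C c"] by simp
        have finI: "finite ?I" using rows_okD(1)[OF okE] by simp
        have inj: "inj_on (\<lambda>s. E s c) ?I" "inj_on (\<lambda>s. E s (Suc c)) ?I"
          by (rule rows_ok_inj[OF okE]; use \<open>c \<le> k\<close> in auto)+
        let ?A = "{s \<in> ?I. E s c \<le> q c}" and ?B = "{s \<in> ?I. E s (Suc c) \<le> q c}"
        have YB: "?Y \<inter> {..<Suc (q c)} = (\<lambda>s. E s (Suc c)) ` ?B" unfolding Y by auto
        have XA: "park (C c) ?Y \<inter> {..<Suc (q c)} = (\<lambda>s. E s c) ` ?A" unfolding X by auto
        have finB: "finite ?B" by (rule finite_subset[OF _ finI]) blast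
        have "card ((\<lambda>s. E s c) ` ?A) = card ?A" by (intro card_image inj_on_subset[OF inj(1)]) blast
        moreover have "card ((\<lambda>s. E s (Suc c)) ` ?B) = card ?B" by (intro card_image inj_on_subset[OF inj(2)]) blast
        ultimately have cAB: "card ?A = card ?B" using card unfolding YB XA by simp
        have "?A \<subseteq> ?B"
        proof
          fix s assume s: "s \<in> ?A"
          then have "E s (Suc c) \<le> E s c" using rows_okD(3)[OF okE, of s c] \<open>c \<le> k\<close> by simp
          then show "s \<in> ?B" using s by simp
        qed
        then have "?A = ?B" by (rule card_subset_eq[OF finB _ cAB])
        then have "E r c \<le> q c" using r that by blast
        moreover have "E r c \<noteq> q c" using EC[of r c] r \<open>c \<le> k\<close> by (auto simp: C'_def)
        ultimately show ?thesis by simp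
      qed
      have "E r d < q d" if "d \<le> c" for d
        using that
      proof (induction d rule: inc_induct)
        case base
        then show ?case using down[OF c] neg by simp
      next
        case (step d)
        then show ?case using down[of d] qs[of d] c by simp
      qed
      from this[of 0] show False using q0 E(2) r(1) t0(2)[of r] R by simp
    qed
    have ok: "rows_ok ?R ?l ?E"
      unfolding rows_ok_def
    proof (intro conjI ballI allI impI)
      show "finite ?R" by (rule fin)
      show "0 < ?l r" if "r \<in> ?R" for r using lev[of r 0] that by simp
      show "?E r (Suc c) \<le> ?E r c" if "r \<in> ?R" "Suc c < ?l r" for r c
        using that qs[of c] k rows_okD(3)[OF okE, of r c] R by auto
      fix r s c assume rs: "r \<in> ?R" "s \<in> ?R" "c < ?l r \<and> c < ?l s \<and> r \<noteq> s"
      have nq: "E u c \<noteq> q c" if "u \<in> C' 0" "c < ?l u" "c \<le> k" for u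
        using EC[OF that(1,2)] that(3) by (auto simp: C'_def)
      show "?E r c \<noteq> ?E s c"
        using rs k nq[of r] nq[of s] rows_okD(4)[OF okE, of r s c] R by (auto simp: fun_upd_def)
    qed
    have "qk ?R ?l ?E"
      unfolding qk_def
    proof (intro conjI ok ballI allI impI)
      have up: "s \<in> C' 0 \<and> s \<noteq> t0" if "r \<in> ?R" "s \<in> ?R" "r < s" for r s
        using that t0(2)[of r] unfolding C'0 by auto
      have lo: "r = t0 \<or> r \<in> C' 0" if "r \<in> ?R" for r using that unfolding C'0 by blast
      fix r s assume r: "r \<in> ?R" and s: "s \<in> ?R"
      show "?E r 0 < ?E s 0" if rs: "r < s"
      proof (cases "r = t0")
        case True
        then show ?thesis using up[OF r s rs] q0 E(2) rs by simp
      next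
        case False
        then show ?thesis using up[OF r s rs] lo[OF r] qkD(2)[OF qE, of r s] rs by simp
      qed
      fix c
      show "Suc c < ?l r" "?E s c < ?E r (Suc c)" if h: "r < s \<and> c < ?l r \<and> c < ?l s \<and> ?E s c < ?E r c"
      proof -
        have sC: "s \<in> C' 0" "s \<noteq> t0" using up[OF r s] h by simp_all
        have "Suc c < ?l r \<and> ?E s c < ?E r (Suc c)"
        proof (cases "r = t0")
          case True
          have "E s c \<in> C' c" using EC[OF sC(1), of c] h by blast
          then have Esc: "E s c \<in> C c" unfolding C'_def by (simp split: if_split_asm)
          have lt': "E s c < q c" using h True sC by simp
          have "c \<noteq> k" using qk[of "E s c"] Esc lt' by auto
          then have ck: "c < k" using h True k by simp
          then show ?thesis using qm[OF ck Esc] lt' True sC k by (auto simp: not_le[symmetric])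
        next
          case False
          then show ?thesis using qkD(3)[OF qE, of r s c] h lo[OF r] sC by simp
        qed
        then show "Suc c < ?l r" "?E s c < ?E r (Suc c)" by auto
      qed
      show "?E r c < ?E s (Suc c)" if h: "r < s \<and> ?l r < ?l s \<and> c < ?l r"
      proof -
        have sC: "s \<in> C' 0" "s \<noteq> t0" using up[OF r s] h by simp_all
        show ?thesis
        proof (cases "r = t0")
          case True
          then show ?thesis using long[OF sC(1), of c] h k sC by simp
        next
          case False
          then show ?thesis using qkD(4)[OF qE, of r s c] h lo[OF r] sC by simp
        qed
      qed
    qed
    moreover have "\<forall>t\<in>?R. ?E t 0 = t" using R E(2) q0 by auto
    moreover have "acol ?R ?l ?E c = C c" for c
    proof -
      have "acol ?R ?l ?E c = (if c \<le> k then {q c} else {}) \<union> acol (C' 0) ?l E c"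
        unfolding acol_def R(1) using R(2) k by (auto simp: image_iff)
      then show ?thesis unfolding colE using q[of c] by (auto simp: C'_def)
    qed
    ultimately show ?thesis by blast
  qed
qed

lemma qk_exists:
  assumes Cs: "Cs \<in> colset b"
  shows "\<exists>E. qk (supp b) ((!) b) E \<and> (\<forall>t\<in>supp b. E t 0 = t) \<and> (\<forall>c<length Cs. acol (supp b) ((!) b) E c = Cs ! c)"
proof -
  let ?n = "length b" and ?m = "length Cs"
  \<comment> \<open>Empty columns behind the end keep the parking condition, since an empty set of
    cars leaves no queue.\<close>
  define C where "C = (\<lambda>c. if c < ?m then Cs ! c else {})"
  have f: "feas ?n Cs" using Cs by (simp add: colset_def)
  have e: "queue X {} ?n = 0" for X by (rule queue_subset) simp
  have fq: "queue (Ds ! c) (Ds ! Suc c) n = 0" if "feas n Ds" "Suc c < length Ds" for Ds c n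
    using that
  proof (induction Ds arbitrary: c)
    case (Cons D Ds)
    then show ?case by (cases c) (auto simp: hd_conv_nth)
  qed simp
  have Cn: "C c \<subseteq> {..<?n}" for c using feas_subset[OF f] by (auto simp: C_def dest!: nth_mem)
  have Cq: "queue (C c) (C (Suc c)) ?n = 0" for c using fq[OF f, of c] e by (auto simp: C_def)
  have Cm: "C c = {}" if "?m \<le> c" for c using that by (simp add: C_def)
  obtain E where E: "qk (C 0) (lev C) E" "\<forall>t\<in>C 0. E t 0 = t" "\<And>c. acol (C 0) (lev C) E c = C c"
    using qk_exists_fun[of C ?n ?m] Cn Cq Cm by blast
  have Cs_map: "Cs = map C [0..<?m]" by (rule nth_equalityI) (simp_all add: C_def)
  have L: "pk C 0 j = {p. p < ?n \<and> j < b ! p}" if "j < ?m" for j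
    using kcols_pk[of 0 ?m j C] kcols_eq_level_cols[OF Cs] that length_kcols[of Cs] Cs_map
    by (simp add: level_cols_def)
  have mM: "?m = Max (insert 0 (set b))"
    using arg_cong[OF kcols_eq_level_cols[OF Cs], of length] by (simp add: level_cols_def)
  have bm: "b ! r \<le> ?m" if "r < ?n" for r unfolding mM using that by (intro Max_ge) auto
  have lb: "lev C r = b ! r" if r: "r < ?n" for r
  proof -
    have lev: "r \<in> pk C 0 j \<longleftrightarrow> j < lev C r" for j by (rule lev_iff) (rule Cm)
    have 1: "j < lev C r \<longleftrightarrow> j < b ! r" for j
    proof (cases "j < ?m")
      case True
      then show ?thesis using L[OF True] lev[of j] r by auto
    next
      case False
      then have "pk C 0 j = {}" using pk_empty[of C 0 j] Cm[of j] by simp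
      then show ?thesis using lev[of j] bm[OF r] False by auto
    qed
    from 1[of "lev C r"] 1[of "b ! r"] show ?thesis by simp
  qed
  have R: "C 0 = supp b"
  proof (cases "?m = 0")
    case True
    have "b ! r = 0" if "r < ?n" for r using bm[OF that] True by simp
    then show ?thesis using Cm[of 0] True by (auto simp: supp_def)
  next
    case False
    then show ?thesis using L[of 0] by (simp add: supp_def)
  qed
  have cong: "lev C r = b ! r" if "r \<in> supp b" for r using lb that by (simp add: supp_def)
  have "qk (supp b) ((!) b) E" using E(1) cong unfolding R qk_def rows_ok_def by simp
  moreover have "acol (supp b) ((!) b) E c = Cs ! c" if "c < ?m" for c
  proof -
    have "acol (supp b) ((!) b) E c = acol (C 0) (lev C) E c"
      unfolding acol_def R using cong by (intro image_cong) auto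
    then show ?thesis using E(3) that by (simp add: C_def)
  qed
  ultimately show ?thesis using E(2) R by auto
qed

section \<open>Slide polynomials as sums over words\<close>

text \<open>The weakly increasing word of content a. Dominance becomes entrywise comparison of
  words, and equality of \<open>flat\<close> and refinement become equality and inclusion of ascent
  sets.\<close>

definition ex :: "nat list \<Rightarrow> nat list" where
  "ex a = concat (map (\<lambda>p. replicate (a ! p) p) [0..<length a])"

lemma ex_Nil [simp]: "ex [] = []"
  by (simp add: ex_def)

lemma ex_snoc: "ex (a @ [x]) = ex a @ replicate x (length a)"
proof -
  have "map (\<lambda>p. replicate ((a @ [x]) ! p) p) [0..<length a] = map (\<lambda>p. replicate (a ! p) p) [0..<length a]"
    by (simp add: nth_append)
  then show ?thesis by (simp only: ex_def length_append_singleton upt_Suc_append le0 map_append concat_append) simp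
qed

lemma set_ex: "set (ex a) \<subseteq> {..<length a}"
  by (auto simp: ex_def)

lemma sorted_ex: "sorted (ex a)"
proof (induction a rule: rev_induct)
  case (snoc x a)
  then show ?case using set_ex[of a] by (auto simp: ex_snoc sorted_append sorted_replicate)
qed simp

lemma length_ex [simp]: "length (ex a) = sum_list a"
  by (induction a rule: rev_induct) (simp_all add: ex_snoc)

lemma count_ex: "p < length a \<Longrightarrow> count_list (ex a) p = a ! p"
proof (induction a rule: rev_induct)
  case (snoc x a)
  have rep: "count_list (replicate x (length a)) p = (if p = length a then x else 0)"
    by (induction x) auto
  show ?case
  proof (cases "p < length a")
    case True
    then show ?thesis using snoc rep by (simp add: ex_snoc nth_append)
  next
    case False
    then have p: "p = length a" using snoc.prems by simp
    have "count_list (ex a) p = 0" unfolding p using set_ex[of a] by (auto simp: count_list_0_iff)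
    then show ?thesis using rep p by (simp add: ex_snoc nth_append)
  qed
qed simp

definition xl :: "nat list \<Rightarrow> poly" where
  "xl f = (\<Prod>k<length f. X (f ! k))"

lemma xl_append: "xl (f @ g) = xl f * xl g"
proof (induction g rule: rev_induct)
  case Nil
  then show ?case by (simp add: xl_def)
next
  case (snoc x g)
  have 1: "xl (h @ [x]) = xl h * X x" for h by (simp add: xl_def nth_append)
  show ?case using snoc 1[of g] 1[of "f @ g"] by (simp add: mult.assoc)
qed

lemma xmon_snoc: "xmon (a @ [x]) = xmon a * X (length a) ^ x"
  unfolding xmon_def by (simp add: nth_append)

lemma xl_ex: "xl (ex a) = xmon a"
proof (induction a rule: rev_induct)
  case Nil
  then show ?case by (simp add: xl_def xmon_def)
next
  case (snoc x a)
  have "xl (replicate x (length a)) = X (length a) ^ x" by (simp add: xl_def)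
  then show ?case using snoc by (simp add: ex_snoc xl_append xmon_snoc)
qed

definition cn :: "nat \<Rightarrow> nat list \<Rightarrow> nat list" where
  "cn n f = map (count_list f) [0..<n]"

lemma length_cn [simp]: "length (cn n f) = n"
  by (simp add: cn_def)

lemma cn_ex: "cn (length a) (ex a) = a"
  by (rule nth_equalityI) (simp_all add: cn_def count_ex)

lemma ex_cn:
  assumes "sorted f" "set f \<subseteq> {..<n}"
  shows "ex (cn n f) = f"
proof -
  have "count_list (ex (cn n f)) p = count_list f p" for p
  proof (cases "p < n")
    case True
    then show ?thesis using count_ex[of p "cn n f"] by (simp add: cn_def)
  next
    case False
    then have "p \<notin> set (ex (cn n f))" "p \<notin> set f" using set_ex[of "cn n f"] assms(2) by auto
    then show ?thesis by (simp add: count_list_0_iff)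
  qed
  then have "mset (ex (cn n f)) = mset f" by (intro multiset_eqI) (simp add: count_mset)
  then show ?thesis using assms(1) sorted_ex by (metis properties_for_sort)
qed

text \<open>In a sorted word the letters below t form a prefix, so letters of the word and prefix
  sums of its content determine each other.\<close>

lemma sorted_below:
  fixes f :: "nat list"
  assumes "sorted f" "k < length f"
  shows "f ! k < t \<longleftrightarrow> k < card {i. i < length f \<and> f ! i < t}"
proof -
  have "k \<in> {i. i < length f \<and> f ! i < t} \<longleftrightarrow> k < card {i. i < length f \<and> f ! i < t}"
    by (rule initial_segment) (use assms sorted_nth_mono in \<open>auto intro: le_less_trans\<close>)
  then show ?thesis using assms by simp
qed

lemma sum_take: "sum_list (take t a) = card {i. i < length (ex a) \<and> ex a ! i < t}"
proof (induction a rule: rev_induct)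
  case Nil
  then show ?case by simp
next
  case (snoc x a)
  let ?S = "\<lambda>f. {i. i < length f \<and> f ! i < t}"
  have app: "card (?S (f @ g)) = card (?S f) + card (?S g)" for f g :: "nat list"
    using length_filter_conv_card[of "\<lambda>x. x < t" "f @ g"] length_filter_conv_card[of "\<lambda>x. x < t" f]
      length_filter_conv_card[of "\<lambda>x. x < t" g] by simp
  have "card (?S (replicate x (length a))) = (if length a < t then x else 0)"
  proof -
    have "?S (replicate x (length a)) = (if length a < t then {..<x} else {})" by auto
    then show ?thesis by simp
  qed
  moreover have "sum_list (take t (a @ [x])) = sum_list (take t a) + (if length a < t then x else 0)"
    by (cases "length a < t") simp_all
  ultimately show ?case unfolding ex_snoc app using snoc by simp
qed

lemma dominates_iff:
  assumes "length b = length a" "sum_list b = sum_list a"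
  shows "dominates b a \<longleftrightarrow> (\<forall>k<sum_list a. ex b ! k \<le> ex a ! k)"
proof
  assume d: "dominates b a"
  show "\<forall>k<sum_list a. ex b ! k \<le> ex a ! k"
  proof (intro allI impI)
    fix k assume k: "k < sum_list a"
    let ?t = "Suc (ex a ! k)"
    have "ex a ! k \<in> set (ex a)" using k by (intro nth_mem) simp
    then have "ex a ! k < length a" using set_ex[of a] by auto
    then have "sum_list (take ?t a) \<le> sum_list (take ?t b)" using d by (simp add: dominates_def)
    moreover have "k < sum_list (take ?t a)"
      using sorted_below[OF sorted_ex, of k a ?t] k by (simp add: sum_take)
    ultimately have "k < sum_list (take ?t b)" by simp
    then show "ex b ! k \<le> ex a ! k"
      using sorted_below[OF sorted_ex, of k b ?t] k assms by (simp add: sum_take)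
  qed
next
  assume p: "\<forall>k<sum_list a. ex b ! k \<le> ex a ! k"
  have "sum_list (take i a) \<le> sum_list (take i b)" for i
    unfolding sum_take using p assms by (intro card_mono) (auto intro: le_less_trans)
  then show "dominates b a" using assms by (simp add: dominates_def)
qed

definition asc :: "nat list \<Rightarrow> nat set" where
  "asc f = {k. Suc k < length f \<and> f ! k < f ! Suc k}"

definition psums :: "nat list \<Rightarrow> nat set" where
  "psums a = {sum_list (take i a) | i. True}"

lemma psums_snoc: "psums (a @ [x]) = insert (sum_list a + x) (psums a)"
proof (intro equalityI subsetI)
  fix y assume "y \<in> psums (a @ [x])"
  then obtain i where i: "y = sum_list (take i (a @ [x]))" by (auto simp: psums_def)
  show "y \<in> insert (sum_list a + x) (psums a)"
  proof (cases "i \<le> length a")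
    case True then show ?thesis using i by (auto simp: psums_def)
  next
    case False then show ?thesis using i by simp
  qed
next
  fix y assume "y \<in> insert (sum_list a + x) (psums a)"
  then consider "y = sum_list a + x" | i where "y = sum_list (take i a)" by (auto simp: psums_def)
  then show "y \<in> psums (a @ [x])"
  proof cases
    case 1
    then have "y = sum_list (take (Suc (length a)) (a @ [x]))" by simp
    then show ?thesis unfolding psums_def by blast
  next
    case (2 i)
    then have "y = sum_list (take (min i (length a)) (a @ [x]))" by (simp add: min_def)
    then show ?thesis unfolding psums_def by blast
  qed
qed

lemma sum_in_psums: "sum_list a \<in> psums a"
proof -
  have "sum_list a = sum_list (take (length a) a)" by simp
  then show ?thesis unfolding psums_def by blast
qed

lemma sum_flat: "sum_list (flat a) = sum_list a"
  by (induction a) (auto simp: flat_def)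

lemma psums_flat: "psums (flat a) = psums a"
proof (induction a rule: rev_induct)
  case (snoc x a)
  show ?case
  proof (cases "x = 0")
    case True
    then show ?thesis using snoc sum_in_psums[of a] by (simp add: psums_snoc flat_def insert_absorb)
  next
    case False
    then have "flat (a @ [x]) = flat a @ [x]" by (simp add: flat_def)
    then show ?thesis using snoc by (simp add: psums_snoc sum_flat)
  qed
qed (simp add: flat_def)

text \<open>A proper partial sum k is a place where the letter changes between positions k - 1 and
  k, hence the shift by one.\<close>

lemma psums_asc: "k < sum_list a \<Longrightarrow> 0 < k \<Longrightarrow> k \<in> psums a \<longleftrightarrow> k - 1 \<in> asc (ex a)"
proof -
  assume k: "k < sum_list a" "0 < k"
  let ?f = "ex a"
  show ?thesis
  proof
    assume "k \<in> psums a"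
    then obtain t where "k = sum_list (take t a)" by (auto simp: psums_def)
    then have t: "k = card {i. i < length ?f \<and> ?f ! i < t}" by (simp only: sum_take)
    have "?f ! (k - 1) < t" using sorted_below[OF sorted_ex, of "k - 1" a t] t k by simp
    moreover have "\<not> ?f ! k < t" using sorted_below[OF sorted_ex, of k a t] t k by simp
    ultimately show "k - 1 \<in> asc ?f" using k by (simp add: asc_def)
  next
    assume a: "k - 1 \<in> asc ?f"
    let ?t = "?f ! k"
    have lt: "?f ! (k - 1) < ?f ! k" using a k by (simp add: asc_def)
    have "{i. i < length ?f \<and> ?f ! i < ?t} = {..<k}"
    proof (intro equalityI subsetI)
      fix i assume "i \<in> {i. i < length ?f \<and> ?f ! i < ?t}"
      then show "i \<in> {..<k}" using sorted_nth_mono[OF sorted_ex, of k i a] k by (auto simp: not_less[symmetric])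
    next
      fix i assume i: "i \<in> {..<k}"
      then have "?f ! i \<le> ?f ! (k - 1)" using k by (intro sorted_nth_mono[OF sorted_ex]) auto
      then show "i \<in> {i. i < length ?f \<and> ?f ! i < ?t}" using lt i k by simp
    qed
    then have "k = sum_list (take ?t a)" using sum_take[of ?t a] by simp
    then show "k \<in> psums a" unfolding psums_def by blast
  qed
qed

lemma psums_le: "y \<in> psums a \<Longrightarrow> y \<le> sum_list a"
proof -
  assume "y \<in> psums a"
  then obtain i where "y = sum_list (take i a)" by (auto simp: psums_def)
  then show ?thesis by (metis append_take_drop_id le_add1 sum_list_append)
qed

lemma psums_subset_iff:
  assumes "sum_list b = sum_list a"
  shows "psums a \<subseteq> psums b \<longleftrightarrow> asc (ex a) \<subseteq> asc (ex b)"
proof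
  assume s: "psums a \<subseteq> psums b"
  show "asc (ex a) \<subseteq> asc (ex b)"
  proof
    fix k assume k: "k \<in> asc (ex a)"
    then have "Suc k < sum_list a" by (simp add: asc_def)
    then show "k \<in> asc (ex b)" using psums_asc[of "Suc k" a] psums_asc[of "Suc k" b] k s assms by auto
  qed
next
  assume s: "asc (ex a) \<subseteq> asc (ex b)"
  show "psums a \<subseteq> psums b"
  proof
    fix y assume y: "y \<in> psums a"
    consider "y = 0" | "y = sum_list a" | "0 < y" "y < sum_list a" using psums_le[OF y] by linarith
    then show "y \<in> psums b"
    proof cases
      case 1
      then have "y = sum_list (take 0 b)" by simp
      then show ?thesis unfolding psums_def by blast
    next
      case 2 then show ?thesis using sum_in_psums[of b] assms by simp
    next
      case 3 then show ?thesis using psums_asc[of y a] psums_asc[of y b] y s assms by auto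
    qed
  qed
qed

text \<open>Compositions into positive parts correspond to their sets of partial sums, and refining
  one adds partial sums.\<close>

lemma refines_iff:
  assumes "\<And>x. x \<in> set B \<Longrightarrow> 0 < x" "\<And>x. x \<in> set A \<Longrightarrow> 0 < x"
  shows "refines B A \<longleftrightarrow> sum_list B = sum_list A \<and> psums A \<subseteq> psums B"
proof
  assume "refines B A"
  then obtain L where L: "concat L = B" "map sum_list L = A" by (auto simp: refines_def)
  have sc: "sum_list (concat M) = sum_list (map sum_list M)" for M :: "nat list list" by (induction M) simp_all
  have "psums A \<subseteq> psums B"
  proof
    fix y assume "y \<in> psums A"
    then obtain i where "y = sum_list (take i A)" by (auto simp: psums_def)
    then have "y = sum_list (concat (take i L))" using L sc by (metis take_map)
    moreover have "concat (take i L) = take (length (concat (take i L))) B"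
      using L(1) by (metis append_eq_conv_conj append_take_drop_id concat_append)
    ultimately show "y \<in> psums B" unfolding psums_def by (metis (mono_tags, lifting) mem_Collect_eq)
  qed
  then show "sum_list B = sum_list A \<and> psums A \<subseteq> psums B" using L sc by auto
next
  assume "sum_list B = sum_list A \<and> psums A \<subseteq> psums B"
  then show "refines B A" using assms
  proof (induction A arbitrary: B)
    case Nil
    then have "B = []" by (cases B) auto
    then show ?case by (auto simp: refines_def)
  next
    case (Cons x A)
    have x0: "0 < x" using Cons.prems by simp
    have "x = sum_list (take 1 (x # A))" by simp
    then have "x \<in> psums (x # A)" unfolding psums_def by blast
    then obtain i where i: "x = sum_list (take i B)" using Cons.prems(1) by (auto simp: psums_def)
    let ?B = "drop i B"
    have sumB: "sum_list B = x + sum_list ?B" using i by (metis append_take_drop_id sum_list_append)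
    have "psums A \<subseteq> psums ?B"
    proof
      fix y assume "y \<in> psums A"
      then obtain j where "y = sum_list (take j A)" by (auto simp: psums_def)
      then have "x + y = sum_list (take (Suc j) (x # A))" by simp
      then have "x + y \<in> psums (x # A)" unfolding psums_def by blast
      then obtain k where k: "x + y = sum_list (take k B)" using Cons.prems(1) by (auto simp: psums_def)
      show "y \<in> psums ?B"
      proof (cases "i \<le> k")
        case True
        then have "take k B = take i B @ take (k - i) ?B" by (metis le_add_diff_inverse take_add)
        then have "y = sum_list (take (k - i) ?B)" using k i by simp
        then show ?thesis unfolding psums_def by blast
      next
        case False
        then have "take i B = take k B @ take (i - k) (drop k B)" by (metis le_add_diff_inverse nat_le_linear take_add)
        then have "y = sum_list (take 0 ?B)" using k i by simp
        then show ?thesis unfolding psums_def by blast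
      qed
    qed
    moreover have "sum_list ?B = sum_list A" using Cons.prems(1) sumB by simp
    ultimately have "refines ?B A" using Cons.IH[of ?B] Cons.prems(2,3) by (meson in_set_dropD list.set_intros(2))
    then obtain L where L: "concat L = ?B" "\<forall>l\<in>set L. l \<noteq> []" "map sum_list L = A" by (auto simp: refines_def)
    have "take i B \<noteq> []" using i x0 by (metis less_irrefl sum_list.Nil)
    then show ?case unfolding refines_def using L i by (intro exI[of _ "take i B # L"]) simp
  qed
qed

lemma refines_antisym: "refines B A \<Longrightarrow> refines A B \<Longrightarrow> A = B"
proof -
  have len: "length L \<le> length (concat L)" if "\<forall>l\<in>set L. l \<noteq> []" for L :: "nat list list"
    using that
  proof (induction L)
    case (Cons l L)
    then have "1 \<le> length l" "length L \<le> length (concat L)" by (simp_all add: Suc_le_eq)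
    then show ?case by simp
  qed simp
  have eq: "concat L = map sum_list L" if "\<forall>l\<in>set L. l \<noteq> []" "length (concat L) \<le> length L" for L :: "nat list list"
    using that
  proof (induction L)
    case (Cons l L)
    have "length L \<le> length (concat L)" using len Cons.prems(1) by simp
    moreover have "length l \<ge> 1" using Cons.prems(1) by (simp add: Suc_le_eq)
    ultimately have "length l = 1" "length (concat L) \<le> length L" using Cons.prems(2) by auto
    then show ?case using Cons by (auto simp: length_Suc_conv)
  qed simp
  assume "refines B A" "refines A B"
  then obtain L M where L: "concat L = B" "\<forall>l\<in>set L. l \<noteq> []" "map sum_list L = A"
    and M: "concat M = A" "\<forall>l\<in>set M. l \<noteq> []" "map sum_list M = B" unfolding refines_def by blast
  have "length (concat L) \<le> length L"
    using len[OF M(2)] arg_cong[OF M(1), of length] arg_cong[OF M(3), of length]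
      arg_cong[OF L(1), of length] arg_cong[OF L(3), of length] by simp
  then have "concat L = map sum_list L" by (rule eq[OF L(2)])
  then show ?thesis unfolding L(1) L(3) by (rule sym)
qed

lemma refines_refl: "(\<And>x. x \<in> set A \<Longrightarrow> 0 < x) \<Longrightarrow> refines A A"
  using refines_iff by blast

lemma flat_pos: "x \<in> set (flat a) \<Longrightarrow> 0 < x"
  by (simp add: flat_def)

lemma refines_flat_iff: "refines (flat b) (flat a) \<longleftrightarrow> sum_list b = sum_list a \<and> asc (ex a) \<subseteq> asc (ex b)"
  using refines_iff[of "flat b" "flat a"] flat_pos psums_subset_iff[of b a] by (auto simp: sum_flat psums_flat)

lemma flat_eq_iff: "flat b = flat a \<longleftrightarrow> sum_list b = sum_list a \<and> asc (ex a) = asc (ex b)"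
proof -
  have "flat b = flat a \<longleftrightarrow> refines (flat b) (flat a) \<and> refines (flat a) (flat b)"
    using refines_antisym[of "flat b" "flat a"] refines_refl[of "flat a"] flat_pos by auto
  then show ?thesis by (auto simp: refines_flat_iff)
qed

definition FS :: "nat list \<Rightarrow> nat list set" where
  "FS g = {f. sorted f \<and> length f = length g \<and> (\<forall>k<length g. f ! k \<le> g ! k) \<and> asc g \<subseteq> asc f}"

definition MS :: "nat list \<Rightarrow> nat list set" where
  "MS g = {f. sorted f \<and> length f = length g \<and> (\<forall>k<length g. f ! k \<le> g ! k) \<and> asc f = asc g}"

text \<open>In terms of words a fixed slide keeps the last letter of every block of equal letters,
  while the other letters of the block may drop.\<close>

definition LS :: "nat list \<Rightarrow> nat list set" where
  "LS g = {f. sorted f \<and> length f = length g \<and> asc g \<subseteq> asc f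
    \<and> (\<forall>k<length g. Suc k = length g \<or> k \<in> asc g \<longrightarrow> f ! k = g ! k)}"

definition slides :: "nat list \<Rightarrow> nat list set" where
  "slides a = {b. dominates b a \<and> flat b = flat a}"

lemma set_below:
  assumes "length f = length (ex a)" "\<forall>k<length (ex a). f ! k \<le> ex a ! k"
  shows "set f \<subseteq> {..<length a}"
proof
  fix x assume "x \<in> set f"
  then obtain k where k: "k < length f" "f ! k = x" by (auto simp: in_set_conv_nth)
  then have "x \<le> ex a ! k" "ex a ! k \<in> set (ex a)" using assms by auto
  then show "x \<in> {..<length a}" using set_ex[of a] by auto
qed

lemma bij_FS: "bij_betw ex {b. dominates b a \<and> refines (flat b) (flat a)} (FS (ex a))"
proof (rule bij_betw_byWitness[of _ "cn (length a)"])
  have D: "length b = length a" "sum_list b = sum_list a" "\<forall>k<sum_list a. ex b ! k \<le> ex a ! k" "asc (ex a) \<subseteq> asc (ex b)"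
    if "dominates b a" "refines (flat b) (flat a)" for b
    using that dominates_iff[of b a] by (auto simp: refines_flat_iff dominates_def)
  show "\<forall>b\<in>{b. dominates b a \<and> refines (flat b) (flat a)}. cn (length a) (ex b) = b"
    using D(1) cn_ex by (metis (mono_tags, lifting) mem_Collect_eq)
  show "ex ` {b. dominates b a \<and> refines (flat b) (flat a)} \<subseteq> FS (ex a)"
  proof (rule image_subsetI)
    fix b assume "b \<in> {b. dominates b a \<and> refines (flat b) (flat a)}"
    then show "ex b \<in> FS (ex a)" using D[of b] sorted_ex by (simp add: FS_def)
  qed
  have E: "ex (cn (length a) f) = f" if "f \<in> FS (ex a)" for f
    using that set_below[of f a] by (intro ex_cn) (auto simp: FS_def)
  then show "\<forall>f\<in>FS (ex a). ex (cn (length a) f) = f" by blast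
  show "cn (length a) ` FS (ex a) \<subseteq> {b. dominates b a \<and> refines (flat b) (flat a)}"
  proof safe
    fix f assume f: "f \<in> FS (ex a)"
    let ?b = "cn (length a) f"
    have s: "sum_list ?b = sum_list a" using arg_cong[OF E[OF f], of length] f by (simp add: FS_def)
    show "dominates ?b a" using dominates_iff[of ?b a] s E[OF f] f by (simp add: FS_def)
    show "refines (flat ?b) (flat a)" using s E[OF f] f by (simp add: refines_flat_iff FS_def)
  qed
qed

lemma bij_MS: "bij_betw ex (slides a) (MS (ex a))"
proof (rule bij_betw_subset[OF bij_FS[of a]])
  show "slides a \<subseteq> {b. dominates b a \<and> refines (flat b) (flat a)}"
    by (auto simp: slides_def flat_eq_iff refines_flat_iff)
  show "ex ` slides a = MS (ex a)"
  proof (intro equalityI subsetI)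
    fix f assume "f \<in> ex ` slides a"
    then obtain b where b: "f = ex b" "dominates b a" "flat b = flat a" by (auto simp: slides_def)
    then have "f \<in> FS (ex a)" using bij_FS[of a] refines_refl[OF flat_pos] by (auto simp: bij_betw_def)
    then show "f \<in> MS (ex a)" using b by (auto simp: FS_def MS_def flat_eq_iff)
  next
    fix f assume f: "f \<in> MS (ex a)"
    then have "f \<in> FS (ex a)" by (auto simp: FS_def MS_def)
    then obtain b where b: "f = ex b" "dominates b a" "refines (flat b) (flat a)"
      using bij_FS[of a] by (auto simp: bij_betw_def)
    then have "flat b = flat a" using f by (auto simp: MS_def flat_eq_iff refines_flat_iff)
    then show "f \<in> ex ` slides a" using b by (auto simp: slides_def)
  qed
qed

lemma fslide_FS: "fslide a = (\<Sum>f\<in>FS (ex a). xl f)"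
  unfolding fslide_def using sum.reindex_bij_betw[OF bij_FS[of a], of xl] by (simp add: xl_ex)

lemma mslide_MS: "mslide a = (\<Sum>f\<in>MS (ex a). xl f)"
  unfolding mslide_def using sum.reindex_bij_betw[OF bij_MS[of a], of xl] by (simp add: xl_ex slides_def)

section \<open>Fixed slides as words\<close>

lemma sum_list_take_sum: "t \<le> length b \<Longrightarrow> sum_list (take t b) = (\<Sum>q<t. b ! q)"
  by (simp add: sum_list_sum_nth atLeast0LessThan min_def)

lemma sum_take_update:
  fixes b :: "nat list"
  assumes p: "Suc p < length b" and ij: "i + j = b ! p + b ! Suc p" and t: "t \<noteq> Suc p"
  shows "sum_list (take t (b[p := i, Suc p := j])) = sum_list (take t b)"
proof -
  have main: "sum_list (take t (b[p := i, Suc p := j])) = sum_list (take t b)" if "t \<le> length b" "t \<noteq> Suc p" for t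
  proof (cases "t \<le> p")
    case True
    then show ?thesis by simp
  next
    case False
    then have st: "{p, Suc p} \<subseteq> {..<t}" using that by auto
    have 1: "(\<Sum>q<t. c ! q) = c ! p + c ! Suc p + (\<Sum>q\<in>{..<t} - {p, Suc p}. c ! q)" for c :: "nat list"
    proof -
      have "(\<Sum>q<t. c ! q) = (\<Sum>q\<in>{p, Suc p}. c ! q) + (\<Sum>q\<in>{..<t} - {p, Suc p}. c ! q)"
        using st by (intro sum.subset_diff[THEN trans[OF _ add.commute]]) auto
      then show ?thesis by simp
    qed
    have "(\<Sum>q\<in>{..<t} - {p, Suc p}. b[p := i, Suc p := j] ! q) = (\<Sum>q\<in>{..<t} - {p, Suc p}. b ! q)"
      by (intro sum.cong) auto
    then show ?thesis using that p ij by (simp add: sum_list_take_sum 1 del: take_update_swap)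
  qed
  show ?thesis
  proof (cases "t \<le> length b")
    case True then show ?thesis using main t by blast
  next
    case False
    then show ?thesis using main[of "length b"] p by simp
  qed
qed

text \<open>A closed form of the inductive relation. A move changes only the prefix sum ending at
  its left position, and that position vanishes in a, because positions where a is nonzero stay
  occupied.\<close>

definition slide_char :: "nat list \<Rightarrow> nat list \<Rightarrow> bool" where
  "slide_char a b \<longleftrightarrow> length b = length a \<and> sum_list b = sum_list a
    \<and> (\<forall>p<length a. 0 < a ! p \<longrightarrow> 0 < b ! p \<and> sum_list (take (Suc p) b) = sum_list (take (Suc p) a))"

lemma fixed_slide_char: "fixed_slide a b \<Longrightarrow> slide_char a b"
proof (induction rule: fixed_slide.induct)
  case (move b p i j)
  let ?b = "b[p := i, Suc p := j]"
  have len: "length b = length a" using move by (simp add: slide_char_def)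
  have pr: "0 < b ! q \<and> sum_list (take (Suc q) b) = sum_list (take (Suc q) a)" if "q < length a" "0 < a ! q" for q
    using move.IH that by (simp add: slide_char_def)
  have tk: "sum_list (take t ?b) = sum_list (take t b)" if "t \<noteq> Suc p" for t
    using sum_take_update[of p b i j t] move that by simp
  have ap: "a ! p = 0" using pr[of p] move len by (cases "a ! p = 0") auto
  have "sum_list ?b = sum_list b" using tk[of "length b"] move(2) by simp
  moreover have "0 < ?b ! q" if "q < length a" "0 < a ! q" for q
    using that pr[OF that] move ap len by (auto simp: nth_list_update)
  moreover have "sum_list (take (Suc q) ?b) = sum_list (take (Suc q) a)" if "q < length a" "0 < a ! q" for q
    using pr[OF that] tk[of "Suc q"] that ap by (cases "q = p") auto
  ultimately show ?case using move.IH by (simp add: slide_char_def)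
qed (simp add: slide_char_def)

text \<open>Moves are undone one at a time: the part at a position where a vanishes is pushed to the
  right, which lowers the sum of all prefix sums.\<close>

lemma char_fixed_slide: "slide_char a b \<Longrightarrow> fixed_slide a b"
proof (induction "\<Sum>t\<le>length a. sum_list (take t b)" arbitrary: b rule: less_induct)
  case less
  have len: "length b = length a" and sm: "sum_list b = sum_list a"
    and pr: "\<And>p. p < length a \<Longrightarrow> 0 < a ! p \<Longrightarrow> 0 < b ! p \<and> sum_list (take (Suc p) b) = sum_list (take (Suc p) a)"
    using less.prems by (simp_all add: slide_char_def)
  have tS: "sum_list (take (Suc t) c) = sum_list (take t c) + c ! t" if "t < length c" for t and c :: "nat list"
    using that by (simp add: take_Suc_conv_app_nth)
  show ?case
  proof (cases "\<exists>p<length a. a ! p = 0 \<and> 0 < b ! p")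
    case False
    have eq: "sum_list (take t b) = sum_list (take t a)" if "t \<le> length a" for t
      using that
    proof (induction t)
      case (Suc t)
      show ?case
      proof (cases "a ! t = 0")
        case True
        then have "b ! t = 0" using False Suc.prems by (metis Suc_le_eq not_gr_zero)
        then show ?thesis using Suc True tS[of t a] tS[of t b] len by simp
      next
        case False
        then show ?thesis using pr[of t] Suc.prems by simp
      qed
    qed simp
    have "b ! t = a ! t" if "t < length a" for t
      using eq[of t] eq[of "Suc t"] tS[of t a] tS[of t b] that len by simp
    then have "b = a" using len by (intro nth_equalityI) auto
    then show ?thesis by (simp add: fixed_slide.refl)
  next
    case True
    then obtain p where p: "p < length a" "a ! p = 0" "0 < b ! p" by blast
    \<comment> \<open>A positive part in the last position, where a vanishes, would make the total
      too large, since the prefix up to the last nonzero part of a already has the full sum.\<close>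
    have Sp: "Suc p < length a"
    proof (rule ccontr)
      assume "\<not> Suc p < length a"
      then have last: "length a = Suc p" using p by simp
      define t where "t = (LEAST t. \<forall>q. t \<le> q \<and> q < length a \<longrightarrow> a ! q = 0)"
      have "\<forall>q. p \<le> q \<and> q < length a \<longrightarrow> a ! q = 0" using last p by (auto simp: le_Suc_eq less_Suc_eq)
      then have tp: "t \<le> p" and tz: "\<forall>q. t \<le> q \<and> q < length a \<longrightarrow> a ! q = 0"
        unfolding t_def by (rule Least_le, rule LeastI[of "\<lambda>t. \<forall>q. t \<le> q \<and> q < length a \<longrightarrow> a ! q = 0"])
      have ta: "sum_list (take t a) = sum_list a"
      proof -
        have "\<forall>x\<in>set (drop t a). x = 0" using tz by (auto simp: in_set_conv_nth)
        then have "sum_list (drop t a) = 0" by simp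
        then show ?thesis by (metis add.right_neutral append_take_drop_id sum_list_append)
      qed
      have "sum_list (take t b) = sum_list (take t a)"
      proof (cases t)
        case (Suc r)
        have "0 < a ! r"
        proof (rule ccontr)
          assume "\<not> 0 < a ! r"
          then have "\<forall>q. r \<le> q \<and> q < length a \<longrightarrow> a ! q = 0" using tz Suc by (metis Suc_leI le_neq_implies_less not_gr_zero)
          then have "t \<le> r" unfolding t_def by (rule Least_le)
          then show False using Suc by simp
        qed
        then show ?thesis using pr[of r] Suc tp last by simp
      qed simp
      moreover have "sum_list (take t b) \<le> sum_list (take p b)"
        using tp by (metis le_add1 le_add_diff_inverse sum_list_append take_add)
      moreover have "sum_list b = sum_list (take p b) + b ! p" using tS[of p b] last len by simp
      ultimately show False using ta sm p by simp
    qed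
    let ?b = "b[p := 0, Suc p := b ! p + b ! Suc p]"
    have tk: "sum_list (take t ?b) = sum_list (take t b)" if "t \<noteq> Suc p" for t
      using sum_take_update[of p b 0 "b ! p + b ! Suc p" t] Sp len that by simp
    have lt: "sum_list (take (Suc p) ?b) < sum_list (take (Suc p) b)"
      using tS[of p ?b] tS[of p b] tk[of p] Sp len p by simp
    have "(\<Sum>t\<le>length a. sum_list (take t ?b)) < (\<Sum>t\<le>length a. sum_list (take t b))"
    proof (rule sum_strict_mono_ex1)
      show "\<forall>t\<in>{..length a}. sum_list (take t ?b) \<le> sum_list (take t b)"
        using tk lt by (metis le_less order_refl)
      show "\<exists>t\<in>{..length a}. sum_list (take t ?b) < sum_list (take t b)"
        using lt Sp by (intro bexI[of _ "Suc p"]) auto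
    qed simp
    moreover have "slide_char a ?b"
    proof -
      have "sum_list ?b = sum_list b" using tk[of "length a"] Sp len by simp
      moreover have "0 < ?b ! q" if "q < length a" "0 < a ! q" for q
        using that pr[OF that] p Sp len by (auto simp: nth_list_update)
      moreover have "sum_list (take (Suc q) ?b) = sum_list (take (Suc q) a)" if "q < length a" "0 < a ! q" for q
        using pr[OF that] tk[of "Suc q"] that p by (cases "q = p") auto
      ultimately show ?thesis using len sm by (simp add: slide_char_def)
    qed
    ultimately have fs: "fixed_slide a ?b" by (rule less.hyps)
    have "fixed_slide a (?b[p := b ! p, Suc p := b ! Suc p])"
      by (rule fixed_slide.move[OF fs]) (use Sp len pr[of "Suc p"] in auto)
    moreover have "?b[p := b ! p, Suc p := b ! Suc p] = b"
      using Sp len by (intro nth_equalityI) (auto simp: nth_list_update)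
    ultimately show ?thesis by simp
  qed
qed

lemma fixed_slide_iff: "fixed_slide a b \<longleftrightarrow> slide_char a b"
  using fixed_slide_char char_fixed_slide by blast

text \<open>Translates the ends of blocks of equal letters into prefix sums, the language of
  \<open>slide_char\<close>.\<close>

lemma block_end:
  assumes k: "k < sum_list a"
  shows "ex a ! k = p \<and> (Suc k = sum_list a \<or> k \<in> asc (ex a))
    \<longleftrightarrow> p < length a \<and> 0 < a ! p \<and> sum_list (take (Suc p) a) = Suc k"
proof -
  let ?g = "ex a"
  note sb = sorted_below[OF sorted_ex, of _ a, folded sum_take, unfolded length_ex]
  have tS: "sum_list (take (Suc p) a) = sum_list (take p a) + a ! p" if "p < length a" for p
    using that by (simp add: take_Suc_conv_app_nth)
  have le: "sum_list (take t a) \<le> sum_list a" for t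
    by (metis append_take_drop_id le_add1 sum_list_append)
  show ?thesis
  proof
    assume L: "?g ! k = p \<and> (Suc k = sum_list a \<or> k \<in> asc ?g)"
    then have "p \<in> set ?g" using k by auto
    then have p: "p < length a" using set_ex[of a] by auto
    have "k < sum_list (take (Suc p) a)" using sb[OF k, of "Suc p"] L by simp
    moreover have "\<not> Suc k < sum_list (take (Suc p) a)"
    proof
      assume c: "Suc k < sum_list (take (Suc p) a)"
      then have "Suc k < sum_list a" using le[of "Suc p"] by simp
      then show False using sb[of "Suc k" "Suc p"] c L by (auto simp: asc_def)
    qed
    moreover have "\<not> k < sum_list (take p a)" using sb[OF k, of p] L by simp
    ultimately show "p < length a \<and> 0 < a ! p \<and> sum_list (take (Suc p) a) = Suc k" using p tS[OF p] by simp
  next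
    assume R: "p < length a \<and> 0 < a ! p \<and> sum_list (take (Suc p) a) = Suc k"
    then have "?g ! k < Suc p" "\<not> ?g ! k < p" using sb[OF k, of "Suc p"] sb[OF k, of p] tS[of p] by auto
    then have gk: "?g ! k = p" by simp
    have "k \<in> asc ?g" if "Suc k < sum_list a" using sb[OF that, of "Suc p"] R gk that by (simp add: asc_def)
    then show "?g ! k = p \<and> (Suc k = sum_list a \<or> k \<in> asc ?g)" using gk k by (meson Suc_lessI)
  qed
qed

lemma slide_char_LS:
  assumes "length b = length a"
  shows "slide_char a b \<longleftrightarrow> ex b \<in> LS (ex a)"
proof
  assume c: "slide_char a b"
  then have sm: "sum_list b = sum_list a" by (simp add: slide_char_def)
  have main: "ex b ! k = ex a ! k \<and> (Suc k = sum_list a \<or> k \<in> asc (ex b))"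
    if k: "k < sum_list a" "Suc k = sum_list a \<or> k \<in> asc (ex a)" for k
  proof -
    let ?p = "ex a ! k"
    have "?p < length a \<and> 0 < a ! ?p \<and> sum_list (take (Suc ?p) a) = Suc k" using block_end[OF k(1), of ?p] k(2) by blast
    then have "?p < length b \<and> 0 < b ! ?p \<and> sum_list (take (Suc ?p) b) = Suc k" using c assms by (simp add: slide_char_def)
    then show ?thesis using block_end[of k b ?p] k(1) sm by simp
  qed
  have "asc (ex a) \<subseteq> asc (ex b)"
  proof
    fix k assume k: "k \<in> asc (ex a)"
    then have "Suc k < sum_list a" by (simp add: asc_def)
    then show "k \<in> asc (ex b)" using main[of k] k by auto
  qed
  then show "ex b \<in> LS (ex a)" using sm sorted_ex main by (simp add: LS_def)
next
  assume f: "ex b \<in> LS (ex a)"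
  then have sm: "sum_list b = sum_list a" by (simp add: LS_def)
  have "0 < b ! p \<and> sum_list (take (Suc p) b) = sum_list (take (Suc p) a)" if p: "p < length a" "0 < a ! p" for p
  proof -
    have tS: "sum_list (take (Suc p) a) = sum_list (take p a) + a ! p" using p by (simp add: take_Suc_conv_app_nth)
    have "sum_list (take (Suc p) a) \<le> sum_list a" by (metis append_take_drop_id le_add1 sum_list_append)
    moreover define k where "k = sum_list (take (Suc p) a) - 1"
    ultimately have k: "sum_list (take (Suc p) a) = Suc k" "k < sum_list a" using tS p by auto
    then have "ex a ! k = p \<and> (Suc k = sum_list a \<or> k \<in> asc (ex a))" using block_end[OF k(2), of p] p by blast
    then have "ex b ! k = p \<and> (Suc k = sum_list b \<or> k \<in> asc (ex b))" using f k(2) sm by (auto simp: LS_def)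
    then show ?thesis using block_end[of k b p] k sm by simp
  qed
  then show "slide_char a b" using assms sm by (simp add: slide_char_def)
qed

lemma LS_set:
  assumes "f \<in> LS (ex a)"
  shows "set f \<subseteq> {..<length a}"
proof
  fix x assume "x \<in> set f"
  then obtain k where k: "k < length f" "f ! k = x" by (auto simp: in_set_conv_nth)
  let ?N = "length (ex a)"
  have N: "length f = ?N" "0 < ?N" "sorted f" using assms k by (auto simp: LS_def)
  have "f ! k \<le> f ! (?N - 1)" using N k by (intro sorted_nth_mono) auto
  also have "\<dots> = ex a ! (?N - 1)" using assms N(2) by (auto simp: LS_def)
  finally have "x \<le> ex a ! (?N - 1)" using k by simp
  moreover have "ex a ! (?N - 1) \<in> set (ex a)" using N(2) by (intro nth_mem) simp
  ultimately show "x \<in> {..<length a}" using set_ex[of a] by auto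
qed

lemma particle_LS: "particle a = (\<Sum>f\<in>LS (ex a). xl f)"
proof -
  have "bij_betw ex {b. fixed_slide a b} (LS (ex a))"
  proof (rule bij_betw_byWitness[of _ "cn (length a)"])
    have len: "length b = length a" if "fixed_slide a b" for b using that by (simp add: fixed_slide_iff slide_char_def)
    show "\<forall>b\<in>{b. fixed_slide a b}. cn (length a) (ex b) = b" using len cn_ex by (metis mem_Collect_eq)
    show "ex ` {b. fixed_slide a b} \<subseteq> LS (ex a)"
    proof (rule image_subsetI)
      fix b assume "b \<in> {b. fixed_slide a b}"
      then show "ex b \<in> LS (ex a)" using len[of b] slide_char_LS[of b a] fixed_slide_iff[of a b] by simp
    qed
    have E: "ex (cn (length a) f) = f" if "f \<in> LS (ex a)" for f
      using that LS_set[OF that] by (intro ex_cn) (auto simp: LS_def)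
    then show "\<forall>f\<in>LS (ex a). ex (cn (length a) f) = f" by blast
    show "cn (length a) ` LS (ex a) \<subseteq> {b. fixed_slide a b}"
    proof (rule image_subsetI)
      fix f assume "f \<in> LS (ex a)"
      then show "cn (length a) f \<in> {b. fixed_slide a b}"
        using E[of f] slide_char_LS[of "cn (length a) f" a] fixed_slide_iff[of a "cn (length a) f"] by simp
    qed
  qed
  from sum.reindex_bij_betw[OF this, of xl] show ?thesis by (simp add: particle_def xl_ex)
qed

section \<open>Classes of words with prescribed ascents\<close>

definition pmax :: "nat list \<Rightarrow> nat list \<Rightarrow> nat list" where
  "pmax f g = map (\<lambda>k. max (f ! k) (g ! k)) [0..<length f]"

lemma pmax_props:
  assumes "sorted f" "sorted g" "length g = length f" "asc g = asc f"
  shows "length (pmax f g) = length f" "\<And>k. k < length f \<Longrightarrow> pmax f g ! k = max (f ! k) (g ! k)"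
    "sorted (pmax f g)" "asc (pmax f g) = asc f"
proof -
  show len: "length (pmax f g) = length f" and nth: "\<And>k. k < length f \<Longrightarrow> pmax f g ! k = max (f ! k) (g ! k)"
    by (simp_all add: pmax_def)
  have step: "f ! k \<le> f ! Suc k" "g ! k \<le> g ! Suc k" if "Suc k < length f" for k
    using assms that by (auto simp: sorted_iff_nth_Suc)
  show "sorted (pmax f g)"
    unfolding sorted_iff_nth_Suc len using nth step by (simp add: max.coboundedI1 max.coboundedI2)
  show "asc (pmax f g) = asc f"
  proof (intro set_eqI)
    fix k
    show "k \<in> asc (pmax f g) \<longleftrightarrow> k \<in> asc f"
    proof (cases "Suc k < length f")
      case True
      have "f ! k < f ! Suc k \<longleftrightarrow> g ! k < g ! Suc k" using assms(3,4) True by (auto simp: asc_def)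
      then show ?thesis using step[OF True] nth[of k] nth[of "Suc k"] True len by (auto simp: asc_def)
    qed (simp add: asc_def len)
  qed
qed

text \<open>Closure under entrywise maxima makes a word of largest letter sum the greatest one, and
  closure downwards makes the class everything below it.\<close>

lemma MS_class:
  assumes fin: "finite S" and ne: "S \<noteq> {}"
    and mem: "\<And>f. f \<in> S \<Longrightarrow> sorted f \<and> length f = N \<and> asc f = A"
    and mx: "\<And>f g. f \<in> S \<Longrightarrow> g \<in> S \<Longrightarrow> pmax f g \<in> S"
    and down: "\<And>f g. f \<in> S \<Longrightarrow> sorted g \<Longrightarrow> length g = N \<Longrightarrow> asc g = A \<Longrightarrow> (\<forall>k<N. g ! k \<le> f ! k) \<Longrightarrow> g \<in> S"
  shows "\<exists>g\<in>S. S = MS g"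
proof -
  have "Max (sum_list ` S) \<in> sum_list ` S" using fin ne by (intro Max_in) auto
  then obtain g where g: "g \<in> S" "sum_list g = Max (sum_list ` S)" by auto
  have gm: "sum_list f \<le> sum_list g" if "f \<in> S" for f unfolding g(2) using fin that by (intro Max_ge) auto
  have le: "f ! k \<le> g ! k" if f: "f \<in> S" and k: "k < N" for f k
  proof (rule ccontr)
    assume "\<not> f ! k \<le> g ! k"
    have p: "length (pmax f g) = N" "\<And>k. k < N \<Longrightarrow> pmax f g ! k = max (f ! k) (g ! k)"
      using pmax_props(1,2)[of f g] mem[OF f] mem[OF g(1)] by auto
    have "(\<Sum>i<N. g ! i) < (\<Sum>i<N. pmax f g ! i)"
    proof (rule sum_strict_mono_ex1)
      show "\<forall>i\<in>{..<N}. g ! i \<le> pmax f g ! i" using p(2) by simp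
      show "\<exists>i\<in>{..<N}. g ! i < pmax f g ! i" using p(2)[OF k] k \<open>\<not> f ! k \<le> g ! k\<close> by (intro bexI[of _ k]) auto
    qed simp
    then have "sum_list g < sum_list (pmax f g)"
      using mem[OF g(1)] p(1) by (simp add: sum_list_sum_nth atLeast0LessThan)
    then show False using gm[OF mx[OF f g(1)]] by simp
  qed
  have "S = MS g"
  proof (intro equalityI subsetI)
    fix f assume "f \<in> S"
    then show "f \<in> MS g" using mem[of f] mem[OF g(1)] le[of f] by (simp add: MS_def)
  next
    fix f assume "f \<in> MS g"
    then show "f \<in> S" using down[OF g(1), of f] mem[OF g(1)] by (simp add: MS_def)
  qed
  then show ?thesis using g(1) by blast
qed

lemma finite_bounded_lists:
  assumes "\<And>f. f \<in> S \<Longrightarrow> length f = N \<and> set f \<subseteq> {..<n::nat}"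
  shows "finite S"
proof (rule finite_subset)
  show "S \<subseteq> {f. set f \<subseteq> {..<n} \<and> length f = N}" using assms by blast
qed (simp add: finite_lists_length_eq)

lemma finite_FS: "finite (FS g)"
proof (rule finite_bounded_lists)
  fix f assume "f \<in> FS g"
  then have f: "length f = length g" "\<And>k. k < length g \<Longrightarrow> f ! k \<le> g ! k" by (auto simp: FS_def)
  have "x < Suc (Max (insert 0 (set g)))" if x: "x \<in> set f" for x
  proof -
    obtain k where k: "k < length g" "x = f ! k" using x f(1) by (auto simp: in_set_conv_nth)
    have "g ! k \<le> Max (insert 0 (set g))" using k by (intro Max_ge) auto
    then show ?thesis using f(2)[OF k(1)] unfolding k(2) by (meson le_imp_less_Suc le_trans)
  qed
  then show "length f = length g \<and> set f \<subseteq> {..<Suc (Max (insert 0 (set g)))}" using f by auto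
qed

lemma sum_MS: "sorted g \<Longrightarrow> set g \<subseteq> {..<n} \<Longrightarrow> (\<Sum>f\<in>MS g. xl f) = mslide (cn n g)"
  by (simp add: mslide_MS ex_cn)

lemma sum_FS: "sorted g \<Longrightarrow> set g \<subseteq> {..<n} \<Longrightarrow> (\<Sum>f\<in>FS g. xl f) = fslide (cn n g)"
  by (simp add: fslide_FS ex_cn)

lemma sum_LS: "sorted g \<Longrightarrow> set g \<subseteq> {..<n} \<Longrightarrow> (\<Sum>f\<in>LS g. xl f) = particle (cn n g)"
  by (simp add: particle_LS ex_cn)

lemma fslide_mslide: "cone mslide (fslide a)"
proof -
  let ?g = "ex a"
  have S: "{f \<in> FS ?g. asc f = A} \<in> MS ` FS ?g" if A: "A \<in> asc ` FS ?g" for A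
  proof -
    let ?S = "{f \<in> FS ?g. asc f = A}"
    have "\<exists>h\<in>?S. ?S = MS h"
    proof (rule MS_class[where N = "length ?g"])
      show "finite ?S" using finite_FS by simp
      show "?S \<noteq> {}" using A by auto
      show "pmax f h \<in> ?S" if "f \<in> ?S" "h \<in> ?S" for f h
        using that pmax_props[of f h] by (auto simp: FS_def)
      show "h \<in> ?S" if "f \<in> ?S" "sorted h" "length h = length ?g" "asc h = A" "\<forall>k<length ?g. h ! k \<le> f ! k" for f h
        using that by (auto simp: FS_def intro: le_trans)
    qed (auto simp: FS_def)
    then show ?thesis by blast
  qed
  have "fslide a = (\<Sum>A\<in>asc ` FS ?g. \<Sum>f\<in>{f \<in> FS ?g. asc f = A}. xl f)"
    unfolding fslide_FS by (rule sum.image_gen[OF finite_FS])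
  moreover have "cone mslide (\<Sum>f\<in>{f \<in> FS ?g. asc f = A}. xl f)" if A: "A \<in> asc ` FS ?g" for A
  proof -
    obtain h where h: "h \<in> FS ?g" "{f \<in> FS ?g. asc f = A} = MS h" using S[OF A] by auto
    have "set h \<subseteq> {..<length a}" "sorted h" using h(1) set_below[of h a] by (auto simp: FS_def)
    then show ?thesis unfolding h(2) using sum_MS cone_base by metis
  qed
  ultimately show ?thesis by (simp add: cone_sum)
qed

lemma sorted_no_asc:
  fixes h :: "nat list"
  assumes "k \<le> j" "sorted h" "j < length h" "\<And>i. k \<le> i \<Longrightarrow> i < j \<Longrightarrow> i \<notin> asc h"
  shows "h ! k = h ! j"
  using assms
proof (induction j rule: dec_induct)
  case (step j)
  have "h ! j \<le> h ! Suc j" using step by (auto simp: sorted_iff_nth_Suc)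
  moreover have "j \<notin> asc h" using step by simp
  ultimately have "h ! j = h ! Suc j" using step by (auto simp: asc_def)
  then show ?case using step by simp
qed simp

text \<open>The last position of the block of k when the blocks are cut behind the elements of A;
  position N - 1 closes the final block.\<close>

definition block_last :: "nat \<Rightarrow> nat set \<Rightarrow> nat \<Rightarrow> nat" where
  "block_last N A k = (LEAST j. k \<le> j \<and> (Suc j = N \<or> j \<in> A))"

lemma block_last:
  assumes k: "k < N"
  shows "k \<le> block_last N A k" "Suc (block_last N A k) = N \<or> block_last N A k \<in> A" "block_last N A k < N" "\<And>j. k \<le> j \<Longrightarrow> Suc j = N \<or> j \<in> A \<Longrightarrow> block_last N A k \<le> j"
proof -
  have e: "k \<le> N - 1 \<and> (Suc (N - 1) = N \<or> N - 1 \<in> A)" using k by simp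
  from LeastI[of "\<lambda>j. k \<le> j \<and> (Suc j = N \<or> j \<in> A)", OF e]
  show "k \<le> block_last N A k" "Suc (block_last N A k) = N \<or> block_last N A k \<in> A" by (auto simp: block_last_def)
  have "block_last N A k \<le> N - 1" unfolding block_last_def by (rule Least_le) (use e in simp)
  then show "block_last N A k < N" using k by simp
  show "block_last N A k \<le> j" if "k \<le> j" "Suc j = N \<or> j \<in> A" for j
    unfolding block_last_def by (rule Least_le) (use that in simp)
qed

text \<open>The representative of \<open>f\<close> is constant on the blocks between consecutive elements of \<open>A\<close>,
  where it takes the value of \<open>f\<close> at the end of the block.\<close>

lemma LS_cover:
  assumes sf: "sorted f" "length f = N" "A \<subseteq> asc f"
  shows "\<exists>h. sorted h \<and> length h = N \<and> asc h = A \<and> f \<in> LS h"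
proof -
  note nx = block_last[where N = N and A = A]
  define h where "h = map (\<lambda>k. f ! block_last N A k) [0..<N]"
  have len: "length h = N" and hk: "\<And>k. k < N \<Longrightarrow> h ! k = f ! block_last N A k" by (simp_all add: h_def)
  have AN: "Suc k < N" if "k \<in> A" for k using sf that by (auto simp: asc_def)
  have nxA: "block_last N A k = k" if "k < N" "Suc k = N \<or> k \<in> A" for k
    using nx(1)[OF that(1)] nx(4)[OF that(1) order_refl that(2)] by simp
  have nxS: "block_last N A k = block_last N A (Suc k)" if k: "Suc k < N" "k \<notin> A" for k
  proof (rule antisym)
    have "k < N" using k by simp
    show "block_last N A k \<le> block_last N A (Suc k)" using nx(4)[OF \<open>k < N\<close>, of "block_last N A (Suc k)"] nx(1,2)[OF k(1)] by auto
    have "block_last N A k \<noteq> k" using nx(2)[OF \<open>k < N\<close>] k by auto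
    then show "block_last N A (Suc k) \<le> block_last N A k" using nx(4)[OF k(1), of "block_last N A k"] nx(1,2)[OF \<open>k < N\<close>] by auto
  qed
  have fmono: "f ! i \<le> f ! j" if "i \<le> j" "j < N" for i j
    using that sf by (intro sorted_nth_mono) auto
  have hA: "k \<in> asc h \<longleftrightarrow> k \<in> A" for k
  proof (cases "Suc k < N")
    case True
    show ?thesis
    proof (cases "k \<in> A")
      case kA: True
      have "f ! k < f ! Suc k" using sf(3) kA by (auto simp: asc_def)
      also have "\<dots> \<le> f ! block_last N A (Suc k)" using nx(1,3)[OF True] by (intro fmono)
      finally show ?thesis using kA True hk[of k] hk[OF True] nxA[of k] len by (simp add: asc_def)
    next
      case False
      then show ?thesis using nxS[OF True False] hk[of k] hk[OF True] True len by (simp add: asc_def)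
    qed
  next
    case False
    then show ?thesis using AN[of k] len by (auto simp: asc_def)
  qed
  have sh: "sorted h"
    unfolding sorted_iff_nth_Suc len
  proof (intro allI impI)
    fix k assume k: "Suc k < N"
    have "block_last N A k \<le> block_last N A (Suc k)"
    proof (cases "k \<in> A")
      case True
      then show ?thesis using nxA[of k] nx(1)[OF k] k by simp
    qed (use nxS[OF k] in simp)
    then show "h ! k \<le> h ! Suc k" using hk[of k] hk[OF k] fmono[of "block_last N A k" "block_last N A (Suc k)"] nx(3)[OF k] k by simp
  qed
  have hf: "h ! k = f ! k" if "k < N" "Suc k = N \<or> k \<in> A" for k using hk[OF that(1)] nxA[OF that] by simp
  have aA: "asc h = A" using hA by blast
  moreover have "f \<in> LS h" unfolding LS_def using sf len aA hf by auto
  ultimately show ?thesis using sh len by blast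
qed

text \<open>Z is closed under changes that keep the values at block ends. Each of its words lies in
  \<open>LS h\<close> for exactly one h with ascent set A, the word constant on blocks with the same
  block ends.\<close>

lemma LS_expand:
  assumes fin: "finite Z"
    and Z: "\<And>f. f \<in> Z \<Longrightarrow> sorted f \<and> length f = N \<and> A \<subseteq> asc f"
    and closed: "\<And>f h. f \<in> Z \<Longrightarrow> sorted h \<Longrightarrow> length h = N \<Longrightarrow> A \<subseteq> asc h \<Longrightarrow>
      (\<And>k. k < N \<Longrightarrow> Suc k = N \<or> k \<in> A \<Longrightarrow> h ! k = f ! k) \<Longrightarrow> h \<in> Z"
  shows "(\<Sum>f\<in>Z. xl f) = (\<Sum>h\<in>{h \<in> Z. asc h = A}. \<Sum>f\<in>LS h. xl f)"
proof -
  note nx = block_last[where N = N and A = A]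
  let ?I = "{h \<in> Z. asc h = A}"
  have LSZ: "f \<in> Z" if h: "h \<in> ?I" and f: "f \<in> LS h" for f h
    by (rule closed[of h]) (use h f Z[of h] in \<open>auto simp: LS_def\<close>)
  have blk: "h ! k = h ! block_last N A k" if h: "h \<in> ?I" and k: "k < N" for h k
  proof (rule sorted_no_asc)
    show "k \<le> block_last N A k" "sorted h" "block_last N A k < length h" using nx[OF k] Z[of h] h by auto
    show "i \<notin> asc h" if "k \<le> i" "i < block_last N A k" for i
      using nx(4)[OF k that(1)] that(2) h by auto
  qed
  have disj: "h = h'" if h: "h \<in> ?I" "h' \<in> ?I" and f: "f \<in> LS h" "f \<in> LS h'" for h h' f
  proof (rule nth_equalityI)
    show "length h = length h'" using Z h by auto
    fix k assume "k < length h"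
    then have k: "k < N" using Z[of h] h by auto
    have "f ! block_last N A k = h ! block_last N A k" "f ! block_last N A k = h' ! block_last N A k"
      using f nx(2,3)[OF k] h Z[of h] Z[of h'] by (auto simp: LS_def)
    then show "h ! k = h' ! k" using blk[OF h(1) k] blk[OF h(2) k] by simp
  qed
  have cover: "\<exists>h\<in>?I. f \<in> LS h" if f: "f \<in> Z" for f
  proof -
    obtain h where h: "sorted h" "length h = N" "asc h = A" "f \<in> LS h" using LS_cover[of f N A] Z[OF f] by blast
    have "h \<in> Z" by (rule closed[OF f h(1,2)]) (use h in \<open>auto simp: LS_def\<close>)
    then show ?thesis using h by blast
  qed
  have "Z = (\<Union>h\<in>?I. LS h)" using LSZ cover by blast
  then have "(\<Sum>f\<in>Z. xl f) = (\<Sum>f\<in>(\<Union>h\<in>?I. LS h). xl f)" by simp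
  also have "\<dots> = (\<Sum>h\<in>?I. \<Sum>f\<in>LS h. xl f)"
  proof (rule sum.UNION_disjoint)
    show "finite ?I" using fin by simp
    show "\<forall>h\<in>?I. finite (LS h)"
    proof
      fix h assume h: "h \<in> ?I"
      have "LS h \<subseteq> Z" using LSZ[OF h] by blast
      then show "finite (LS h)" using fin finite_subset by blast
    qed
    show "\<forall>h\<in>?I. \<forall>h'\<in>?I. h \<noteq> h' \<longrightarrow> LS h \<inter> LS h' = {}" using disj by blast
  qed
  finally show ?thesis .
qed

text \<open>A sorted f is at k at most what it is at the end of the block of k, and h takes the same
  value at both places.\<close>

lemma block_le:
  fixes f h :: "nat list"
  assumes f: "sorted f" "length f = length h" and h: "sorted h" and k: "k < length h"
    and e: "\<And>k. k < length h \<Longrightarrow> Suc k = length h \<or> k \<in> asc h \<Longrightarrow> f ! k \<le> h ! k"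
  shows "f ! k \<le> h ! k"
proof -
  let ?N = "length h"
  define j where "j = (LEAST j. k \<le> j \<and> (Suc j = ?N \<or> j \<in> asc h))"
  have ex: "k \<le> ?N - 1 \<and> (Suc (?N - 1) = ?N \<or> ?N - 1 \<in> asc h)" using k by (cases "length h") auto
  have j: "k \<le> j" "Suc j = ?N \<or> j \<in> asc h"
    using LeastI[of "\<lambda>j. k \<le> j \<and> (Suc j = ?N \<or> j \<in> asc h)", OF ex] by (auto simp: j_def)
  then have jN: "j < ?N" by (auto simp: asc_def)
  have "f ! k \<le> f ! j" using f j jN by (intro sorted_nth_mono) auto
  also have "\<dots> \<le> h ! j" by (rule e[OF jN j(2)])
  also have "\<dots> = h ! k"
  proof (rule sym, rule sorted_no_asc[OF j(1) h jN])
    fix i assume i: "k \<le> i" "i < j"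
    show "i \<notin> asc h"
    proof
      assume "i \<in> asc h"
      then have "j \<le> i" unfolding j_def using i by (intro Least_le) simp
      then show False using i by simp
    qed
  qed
  finally show ?thesis .
qed

lemma LS_le: "f \<in> LS h \<Longrightarrow> sorted h \<Longrightarrow> k < length h \<Longrightarrow> f ! k \<le> h ! k"
  by (rule block_le) (auto simp: LS_def)

lemma fslide_particle: "cone particle (fslide a)"
proof -
  let ?g = "ex a" and ?N = "length (ex a)"
  have e: "fslide a = (\<Sum>h\<in>{h \<in> FS ?g. asc h = asc ?g}. \<Sum>f\<in>LS h. xl f)"
    unfolding fslide_FS
  proof (rule LS_expand[where N = ?N])
    fix f h assume f: "f \<in> FS ?g" and h: "sorted h" "length h = ?N" "asc ?g \<subseteq> asc h"
      and eq: "\<And>k. k < ?N \<Longrightarrow> Suc k = ?N \<or> k \<in> asc ?g \<Longrightarrow> h ! k = f ! k"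
    have "h ! k \<le> ?g ! k" if k: "k < ?N" for k
      by (rule block_le[OF h(1,2) sorted_ex k]) (use eq f in \<open>simp add: FS_def\<close>)
    then show "h \<in> FS ?g" using h by (simp add: FS_def)
  qed (rule finite_FS, simp add: FS_def)
  have c: "cone particle (\<Sum>f\<in>LS h. xl f)" if "h \<in> FS ?g" for h
  proof -
    have "set h \<subseteq> {..<length a}" "sorted h" using that set_below[of h a] by (auto simp: FS_def)
    then show ?thesis using sum_LS cone_base by metis
  qed
  show ?thesis unfolding e by (rule cone_sum) (use c in blast)
qed

section \<open>Standardisation of tableaux\<close>

lemma finite_cells: "finite (cells a)"
proof (rule finite_subset)
  show "cells a \<subseteq> (SIGMA r:{..<length a}. {..<a ! r})" by (auto simp: cells_def)
qed auto

text \<open>The comparisons that decide the standardisation, in which equal entries are numbered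
  from right to left. Pairs within one column occur in either direction.\<close>

definition trel :: "nat list \<Rightarrow> (nat \<times> nat \<Rightarrow> nat) \<Rightarrow> ((nat \<times> nat) \<times> (nat \<times> nat)) set" where
  "trel a T = {(x, y). x \<in> cells a \<and> y \<in> cells a \<and> snd x \<le> snd y \<and> T x < T y}"

lemma trelD:
  assumes "trel a T = trel a T'" "x \<in> cells a" "y \<in> cells a" "snd x \<le> snd y"
  shows "T x < T y \<longleftrightarrow> T' x < T' y"
proof -
  have "(x, y) \<in> trel a T \<longleftrightarrow> (x, y) \<in> trel a T'" using assms by simp
  then show ?thesis using assms by (simp add: trel_def)
qed

text \<open>Places where the next cell is not strictly further left, so that equal entries are
  excluded.\<close>

definition steps :: "(nat \<times> nat) list \<Rightarrow> nat set" where
  "steps w = {k. Suc k < length w \<and> snd (w ! k) \<le> snd (w ! Suc k)}"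

lemma standard_order:
  fixes T0 :: "nat \<times> nat \<Rightarrow> nat"
  assumes inj: "\<And>x y. x \<in> cells a \<Longrightarrow> y \<in> cells a \<Longrightarrow> snd x = snd y \<Longrightarrow> T0 x = T0 y \<Longrightarrow> x = y"
  shows "\<exists>w. distinct w \<and> set w = cells a \<and>
    (\<forall>i j. i < j \<and> j < length w \<longrightarrow>
      T0 (w ! i) < T0 (w ! j) \<or> T0 (w ! i) = T0 (w ! j) \<and> snd (w ! j) < snd (w ! i))"
proof -
  obtain M where M: "\<And>x. x \<in> cells a \<Longrightarrow> snd x < M"
    using finite_nat_set_iff_bounded[of "snd ` cells a"] finite_cells by auto
  obtain w0 where w0: "set w0 = cells a" "distinct w0" using finite_distinct_list[OF finite_cells] by blast
  \<comment> \<open>Cells are ordered by entry, and among equal entries from right to left. M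
    exceeds all column indices, so the two digits do not interfere.\<close>
  define key where "key x = T0 x * M + (M - 1 - snd x)" for x
  define w where "w = sort_key key w0"
  have w: "distinct w" "set w = cells a" using w0 by (simp_all add: w_def)
  have key: "T0 x < T0 y \<or> T0 x = T0 y \<and> snd y < snd x"
    if "x \<in> cells a" "y \<in> cells a" "x \<noteq> y" "key x \<le> key y" for x y
  proof (cases "T0 x = T0 y")
    case True
    then show ?thesis using that inj[of x y] M[of x] M[of y] unfolding key_def by (cases "snd x = snd y") auto
  next
    case False
    have "\<not> T0 y < T0 x"
    proof
      assume "T0 y < T0 x"
      then have "Suc (T0 y) * M \<le> T0 x * M" by (intro mult_le_mono1) simp
      then show False using that(4) M[OF that(1)] M[OF that(2)] by (simp add: key_def)
    qed
    then show ?thesis using False by simp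
  qed
  have "key (w ! i) \<le> key (w ! j)" if "i < j" "j < length w" for i j
  proof -
    have "sorted (map key w)" by (simp add: w_def)
    then have "map key w ! i \<le> map key w ! j" using that by (intro sorted_nth_mono) auto
    then show ?thesis using that by simp
  qed
  moreover have "w ! i \<noteq> w ! j" if "i < j" "j < length w" for i j
    using w(1) that by (simp add: nth_eq_iff_index_eq)
  ultimately have "T0 (w ! i) < T0 (w ! j) \<or> T0 (w ! i) = T0 (w ! j) \<and> snd (w ! j) < snd (w ! i)"
    if "i < j" "j < length w" for i j
    using that w(2) nth_mem[of i w] nth_mem[of j w] by (intro key) auto
  then show ?thesis using w by blast
qed

text \<open>The fundamental lemma of P-partitions in this setting: along w entries weakly increase,
  and a run of equal entries goes strictly to the left, which forbids equality at the steps and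
  nowhere else.\<close>

lemma standard_bij:
  assumes fill: "filling a T0" and w: "distinct w" "set w = cells a"
    and ord: "\<forall>i j. i < j \<and> j < length w \<longrightarrow>
      T0 (w ! i) < T0 (w ! j) \<or> T0 (w ! i) = T0 (w ! j) \<and> snd (w ! j) < snd (w ! i)"
  shows "bij_betw (\<lambda>T. map (\<lambda>x. T x - 1) w) {T. filling a T \<and> trel a T = trel a T0}
    {f. sorted f \<and> length f = length w \<and> steps w \<subseteq> asc f}"
proof -
  let ?N = "length w"
  have wD: "w ! i \<in> cells a" if "i < ?N" for i using w(2) that nth_mem by blast
  have ordD: "T0 (w ! i) < T0 (w ! j) \<or> T0 (w ! i) = T0 (w ! j) \<and> snd (w ! j) < snd (w ! i)"
    if "i < j" "j < ?N" for i j using ord that by blast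
  define ix where "ix x = (THE i. i < ?N \<and> w ! i = x)" for x
  have ix: "ix x < ?N" "w ! ix x = x" if "x \<in> cells a" for x
  proof -
    have "\<exists>!i. i < ?N \<and> w ! i = x" using that w by (metis distinct_Ex1)
    from theI'[OF this] show "ix x < ?N" "w ! ix x = x" by (simp_all add: ix_def)
  qed
  have ixw: "ix (w ! i) = i" if "i < ?N" for i
    using ix[OF wD[OF that]] w(1) that by (simp add: nth_eq_iff_index_eq)
  define un where "un f = (\<lambda>x. if x \<in> cells a then Suc (f ! ix x) else 0)" for f :: "nat list"
  have pos: "0 < T x" if "filling a T" "x \<in> cells a" for T x using that by (auto simp: filling_def)
  show ?thesis
  proof (rule bij_betw_byWitness[of _ un])
    show "\<forall>T\<in>{T. filling a T \<and> trel a T = trel a T0}. un (map (\<lambda>x. T x - 1) w) = T"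
    proof
      fix T assume "T \<in> {T. filling a T \<and> trel a T = trel a T0}"
      then show "un (map (\<lambda>x. T x - 1) w) = T"
        using ix pos[of T] by (auto simp: un_def fun_eq_iff filling_def)
    qed
    show "\<forall>f\<in>{f. sorted f \<and> length f = ?N \<and> steps w \<subseteq> asc f}. map (\<lambda>x. un f x - 1) w = f"
      using wD ixw by (auto simp: un_def intro!: nth_equalityI)
    show "(\<lambda>T. map (\<lambda>x. T x - 1) w) ` {T. filling a T \<and> trel a T = trel a T0}
      \<subseteq> {f. sorted f \<and> length f = ?N \<and> steps w \<subseteq> asc f}"
    proof (rule image_subsetI)
      fix T assume "T \<in> {T. filling a T \<and> trel a T = trel a T0}"
      then have T: "filling a T" "trel a T = trel a T0" by auto
      have le: "T (w ! k) \<le> T (w ! Suc k) \<and> (k \<in> steps w \<longrightarrow> T (w ! k) < T (w ! Suc k))" if k: "Suc k < ?N" for k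
      proof (cases "snd (w ! k) \<le> snd (w ! Suc k)")
        case True
        then have "T (w ! k) < T (w ! Suc k)"
          using ordD[of k "Suc k"] k trelD[OF T(2), of "w ! k" "w ! Suc k"] wD by auto
        then show ?thesis by simp
      next
        case False
        then show ?thesis using ordD[of k "Suc k"] k trelD[OF T(2), of "w ! Suc k" "w ! k"] wD
          by (auto simp: steps_def)
      qed
      show "map (\<lambda>x. T x - 1) w \<in> {f. sorted f \<and> length f = ?N \<and> steps w \<subseteq> asc f}"
      proof (intro CollectI conjI)
        show "sorted (map (\<lambda>x. T x - 1) w)"
          unfolding sorted_iff_nth_Suc using le by (simp add: diff_le_mono)
        show "steps w \<subseteq> asc (map (\<lambda>x. T x - 1) w)"
        proof
          fix k assume k: "k \<in> steps w"
          then have "Suc k < ?N" by (simp add: steps_def)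
          then show "k \<in> asc (map (\<lambda>x. T x - 1) w)"
            using le[of k] k pos[OF T(1) wD, of k] unfolding asc_def by fastforce
        qed
      qed simp
    qed
    show "un ` {f. sorted f \<and> length f = ?N \<and> steps w \<subseteq> asc f} \<subseteq> {T. filling a T \<and> trel a T = trel a T0}"
    proof (rule image_subsetI)
      fix f assume "f \<in> {f. sorted f \<and> length f = ?N \<and> steps w \<subseteq> asc f}"
      then have f: "sorted f" "length f = ?N" "steps w \<subseteq> asc f" by auto
      \<comment> \<open>Between equal letters there is no step, so the columns decrease strictly
        along the whole block.\<close>
      have eqcol: "snd (w ! j) < snd (w ! i)" if "i < j" "j < ?N" "f ! i = f ! j" for i j
        using that
      proof (induction j rule: less_induct)
        case (less j)
        then obtain j' where j': "j = Suc j'" by (cases j) auto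
        have le: "f ! i \<le> f ! j'" "f ! j' \<le> f ! j" 
          using less.prems f(2) j' sorted_nth_mono[OF f(1), of i j'] sorted_nth_mono[OF f(1), of j' j] by simp_all
        then have "f ! j' = f ! j" using less.prems by simp
        then have "j' \<notin> steps w" using f(3) j' by (auto simp: asc_def)
        then have 1: "snd (w ! j) < snd (w ! j')" using less.prems j' by (simp add: steps_def)
        show ?case
        proof (cases "i = j'")
          case False
          then have "snd (w ! j') < snd (w ! i)" using less.IH[of j'] less.prems le j' by simp
          then show ?thesis using 1 by simp
        qed (use 1 in simp)
      qed
      have "un f x < un f y \<longleftrightarrow> T0 x < T0 y" if x: "x \<in> cells a" and y: "y \<in> cells a" and c: "snd x \<le> snd y" for x y
      proof -
        consider "ix x < ix y" | "ix x = ix y" | "ix y < ix x" by linarith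
        then show ?thesis
        proof cases
          case 1
          have "f ! ix x \<le> f ! ix y" using 1 f ix[OF y] by (intro sorted_nth_mono) auto
          then have "f ! ix x < f ! ix y" using eqcol[OF 1] ix[OF x] ix[OF y] c by fastforce
          then show ?thesis using ordD[OF 1] ix[OF x] ix[OF y] c x y by (auto simp: un_def)
        next
          case 2
          then have "x = y" using ix[OF x] ix[OF y] by metis
          then show ?thesis by simp
        next
          case 3
          have "f ! ix y \<le> f ! ix x" using 3 f ix[OF x] by (intro sorted_nth_mono) auto
          then show ?thesis using ordD[OF 3] ix[OF x] ix[OF y] x y by (auto simp: un_def)
        qed
      qed
      then have "trel a (un f) = trel a T0" by (auto simp: trel_def)
      then show "un f \<in> {T. filling a T \<and> trel a T = trel a T0}" by (auto simp: filling_def un_def)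
    qed
  qed
qed

lemma fmon_xl:
  assumes "distinct w" "set w = cells a"
  shows "fmon a T = xl (map (\<lambda>x. T x - 1) w)"
proof -
  have "bij_betw ((!) w) {..<length w} (cells a)" using assms bij_betw_nth by blast
  from prod.reindex_bij_betw[OF this, of "\<lambda>x. X (T x - 1)"]
  show ?thesis by (simp add: fmon_def xl_def)
qed

text \<open>\<open>bound\<close> is \<open>(\<le>)\<close> for quasi-key tableaux and \<open>(=)\<close> for semi-skyline fillings.  All other
  conditions only compare entries in the way recorded by \<^const>\<open>trel\<close>.  Entries of the first column
  end a block of the standardisation, so the bounds only concern block ends.\<close>

definition std_closed :: "(nat \<Rightarrow> nat \<Rightarrow> bool) \<Rightarrow> nat list \<Rightarrow> (nat \<times> nat \<Rightarrow> nat) set \<Rightarrow> bool" where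
  "std_closed bound a Q \<longleftrightarrow>
    (\<forall>T\<in>Q. filling a T \<and> (\<forall>r c. (r, c) \<in> cells a \<longrightarrow> T (r, c) \<le> T (r, 0) \<and> T (r, 0) \<le> Suc r)
      \<and> (\<forall>x\<in>cells a. \<forall>y\<in>cells a. snd x = snd y \<and> T x = T y \<longrightarrow> x = y)
      \<and> (\<forall>T'. filling a T' \<and> trel a T' = trel a T \<longrightarrow>
          (T' \<in> Q \<longleftrightarrow> (\<forall>r. (r, 0) \<in> cells a \<longrightarrow> bound (T' (r, 0) - 1) r))))"

lemma finite_std_closed:
  assumes "std_closed bound a Q" shows "finite Q"
proof (rule finite_subset)
  show "Q \<subseteq> {T. \<forall>x. (x \<in> cells a \<longrightarrow> T x \<in> {..length a}) \<and> (x \<notin> cells a \<longrightarrow> T x = 0)}"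
  proof (intro subsetI CollectI allI conjI impI)
    fix T x assume T: "T \<in> Q" 
    show "T x = 0" if "x \<notin> cells a" using assms T that unfolding std_closed_def filling_def by blast
    show "T x \<in> {..length a}" if x: "x \<in> cells a"
    proof -
      obtain r c where rc: "x = (r, c)" by (cases x)
      have "T (r, c) \<le> T (r, 0)" "T (r, 0) \<le> Suc r" using assms T x rc unfolding std_closed_def by blast+
      then show ?thesis using x rc by (simp add: cells_def)
    qed
  qed
qed (rule finite_set_of_finite_funs[OF finite_cells], simp)

text \<open>Splitting by standardisation reduces the expansion to sums over words with prescribed
  strict ascents, where only letters belonging to first-column cells are bounded.\<close>

lemma std_closed_sum:
  assumes Q: "std_closed bound a Q"
    and c: "\<And>w Z. finite Z \<Longrightarrow> Z \<noteq> {} \<Longrightarrow> distinct w \<Longrightarrow> set w = cells a \<Longrightarrow>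
      (w \<noteq> [] \<Longrightarrow> snd (last w) = 0) \<Longrightarrow>
      Z = {f. sorted f \<and> length f = length w \<and> steps w \<subseteq> asc f
        \<and> (\<forall>k<length w. snd (w ! k) = 0 \<longrightarrow> bound (f ! k) (fst (w ! k)))} \<Longrightarrow>
      (\<And>f. f \<in> Z \<Longrightarrow> set f \<subseteq> {..<length a}) \<Longrightarrow>
      cone G (\<Sum>f\<in>Z. xl f)"
  shows "cone G (\<Sum>T\<in>Q. fmon a T)"
proof -
  note finQ = finite_std_closed[OF Q]
  have "(\<Sum>T\<in>Q. fmon a T) = (\<Sum>\<rho>\<in>trel a ` Q. \<Sum>T\<in>{T \<in> Q. trel a T = \<rho>}. fmon a T)"
    by (rule sum.image_gen[OF finQ])
  moreover have "cone G (\<Sum>T\<in>{T \<in> Q. trel a T = trel a T0}. fmon a T)" if T0: "T0 \<in> Q" for T0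
  proof -
    let ?K = "{T \<in> Q. trel a T = trel a T0}"
    have D: "filling a T" "\<And>r c. (r, c) \<in> cells a \<Longrightarrow> T (r, c) \<le> T (r, 0) \<and> T (r, 0) \<le> Suc r"
      "\<And>x y. x \<in> cells a \<Longrightarrow> y \<in> cells a \<Longrightarrow> snd x = snd y \<Longrightarrow> T x = T y \<Longrightarrow> x = y"
      "\<And>T'. filling a T' \<Longrightarrow> trel a T' = trel a T \<Longrightarrow> T' \<in> Q \<longleftrightarrow> (\<forall>r. (r, 0) \<in> cells a \<longrightarrow> bound (T' (r, 0) - 1) r)"
      if "T \<in> Q" for T using Q that unfolding std_closed_def by blast+
    obtain w where w: "distinct w" "set w = cells a" and ord: "\<forall>i j. i < j \<and> j < length w \<longrightarrow>
      T0 (w ! i) < T0 (w ! j) \<or> T0 (w ! i) = T0 (w ! j) \<and> snd (w ! j) < snd (w ! i)"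
      using standard_order[of a T0, OF D(3)[OF T0]] by blast
    let ?g = "\<lambda>T. map (\<lambda>x. T x - 1) w"
    let ?Z = "{f. sorted f \<and> length f = length w \<and> steps w \<subseteq> asc f
        \<and> (\<forall>k<length w. snd (w ! k) = 0 \<longrightarrow> bound (f ! k) (fst (w ! k)))}"
    note bij = standard_bij[OF D(1)[OF T0] w ord]
    have K: "?K = {T. filling a T \<and> trel a T = trel a T0 \<and> (\<forall>r. (r, 0) \<in> cells a \<longrightarrow> bound (T (r, 0) - 1) r)}"
      using D(1) D(4)[OF T0] by blast
    have col0: "(\<forall>r. (r, 0) \<in> cells a \<longrightarrow> bound (T (r, 0) - 1) r)
        \<longleftrightarrow> (\<forall>k<length w. snd (w ! k) = 0 \<longrightarrow> bound (?g T ! k) (fst (w ! k)))" for T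
    proof -
      have "(\<forall>r. (r, 0) \<in> cells a \<longrightarrow> bound (T (r, 0) - 1) r)
        \<longleftrightarrow> (\<forall>x\<in>set w. snd x = 0 \<longrightarrow> bound (T x - 1) (fst x))" unfolding w(2) by auto
      then show ?thesis by (auto simp: all_set_conv_all_nth)
    qed
    have bijK: "bij_betw ?g ?K ?Z"
    proof (rule bij_betw_subset[OF bij])
      show "?K \<subseteq> {T. filling a T \<and> trel a T = trel a T0}" using K by blast
      show "?g ` ?K = ?Z"
      proof (intro equalityI subsetI)
        fix f assume "f \<in> ?g ` ?K"
        then obtain T where T: "T \<in> ?K" "f = ?g T" by blast
        have "f \<in> {f. sorted f \<and> length f = length w \<and> steps w \<subseteq> asc f}"
          using T K bij by (auto simp: bij_betw_def)
        moreover have "\<forall>r. (r, 0) \<in> cells a \<longrightarrow> bound (T (r, 0) - 1) r" using T K by blast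
        ultimately show "f \<in> ?Z" using T(2) col0[of T] by blast
      next
        fix f assume f: "f \<in> ?Z"
        then have "f \<in> ?g ` {T. filling a T \<and> trel a T = trel a T0}"
          using bij unfolding bij_betw_def by blast
        then obtain T where T: "filling a T" "trel a T = trel a T0" "f = ?g T" by blast
        moreover have "\<forall>r. (r, 0) \<in> cells a \<longrightarrow> bound (T (r, 0) - 1) r" using f T(3) col0[of T] by blast
        ultimately show "f \<in> ?g ` ?K" using K by blast
      qed
    qed
    have "cone G (\<Sum>f\<in>?Z. xl f)"
    proof (rule c[OF _ _ w _ HOL.refl])
      show "finite ?Z" using bij_betw_finite[OF bijK] finQ by simp
      have "T0 \<in> ?K" using T0 by simp
      then show "?Z \<noteq> {}" using bijK unfolding bij_betw_def by blast
      \<comment> \<open>The first cell of a row carries its largest entry and is read after every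
        equal entry of the row, so a cell outside the first column cannot be last.\<close>
      show "snd (last w) = 0" if "w \<noteq> []"
      proof (rule ccontr)
        assume ne: "snd (last w) \<noteq> 0"
        obtain r c where rc: "last w = (r, c)" by (cases "last w")
        have lw: "(r, c) \<in> cells a" using that w(2) rc last_in_set by metis
        then have "(r, 0) \<in> set w" unfolding w(2) by (auto simp: cells_def)
        then obtain i where i: "i < length w" "w ! i = (r, 0)" by (auto simp: in_set_conv_nth)
        have l: "w ! (length w - 1) = (r, c)" using that rc by (simp add: last_conv_nth)
        then have "i \<noteq> length w - 1" using i(2) ne rc by auto
        then have "i < length w - 1" "length w - 1 < length w" using i(1) by auto
        then show False using ord i(2) l D(2)[OF T0 lw] by fastforce
      qed
      fix f assume "f \<in> ?Z"
      then obtain T where T: "T \<in> Q" "f = ?g T" using bijK unfolding bij_betw_def by blast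
      show "set f \<subseteq> {..<length a}"
      proof
        fix v assume "v \<in> set f"
        then obtain r c where rc: "(r, c) \<in> cells a" "v = T (r, c) - 1" using T(2) w(2) by auto
        then show "v \<in> {..<length a}" using D(2)[OF T(1) rc(1)] by (auto simp: cells_def)
      qed
    qed
    moreover have "(\<Sum>T\<in>?K. fmon a T) = (\<Sum>f\<in>?Z. xl f)"
      using sum.reindex_bij_betw[OF bijK, of xl] fmon_xl[OF w] by simp
    ultimately show ?thesis by simp
  qed
  then have "cone G (\<Sum>\<rho>\<in>trel a ` Q. \<Sum>T\<in>{T \<in> Q. trel a T = \<rho>}. fmon a T)"
    by (intro cone_sum[of "trel a ` Q"]) blast
  ultimately show ?thesis by simp
qed

text \<open>No cell lies strictly to the left of the first column.\<close>

lemma steps_col0: "k < length w \<Longrightarrow> snd (w ! k) = 0 \<Longrightarrow> Suc k = length w \<or> k \<in> steps w"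
  by (auto simp: steps_def)

lemma std_closed_particle:
  assumes Q: "std_closed (=) a Q"
  shows "cone particle (\<Sum>T\<in>Q. fmon a T)"
proof (rule std_closed_sum[OF Q])
  fix w :: "(nat \<times> nat) list" and Z
  assume Z: "finite Z" "Z = {f. sorted f \<and> length f = length w \<and> steps w \<subseteq> asc f
        \<and> (\<forall>k<length w. snd (w ! k) = 0 \<longrightarrow> f ! k = fst (w ! k))}" "\<And>f. f \<in> Z \<Longrightarrow> set f \<subseteq> {..<length a}"
  have "(\<Sum>f\<in>Z. xl f) = (\<Sum>h\<in>{h \<in> Z. asc h = steps w}. \<Sum>f\<in>LS h. xl f)"
    by (rule LS_expand[OF Z(1), where N = "length w"]) (use steps_col0[of _ w] in \<open>auto simp: Z(2)\<close>)
  moreover have "cone particle (\<Sum>f\<in>LS h. xl f)" if "h \<in> Z" for h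
    using sum_LS[of h "length a"] Z(3)[OF that] that cone_base by (metis (mono_tags, lifting) Z(2) mem_Collect_eq)
  ultimately show "cone particle (\<Sum>f\<in>Z. xl f)" using cone_sum[of "{h \<in> Z. asc h = steps w}" particle "\<lambda>h. \<Sum>f\<in>LS h. xl f"] by simp
qed

text \<open>The words whose ascents are exactly the steps have a greatest element g by
  \<open>MS_class\<close>. Every word of Z lies below the block-constant word with the same block
  ends, hence below g, so Z is all of \<open>FS g\<close>.\<close>

lemma std_closed_fslide:
  assumes Q: "std_closed (\<le>) a Q"
  shows "cone fslide (\<Sum>T\<in>Q. fmon a T)"
proof (rule std_closed_sum[OF Q])
  fix w :: "(nat \<times> nat) list" and Z
  let ?N = "length w"
  assume Z: "finite Z" "Z \<noteq> {}" "Z = {f. sorted f \<and> length f = length w \<and> steps w \<subseteq> asc f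
        \<and> (\<forall>k<length w. snd (w ! k) = 0 \<longrightarrow> f ! k \<le> fst (w ! k))}" "\<And>f. f \<in> Z \<Longrightarrow> set f \<subseteq> {..<length a}"
  let ?S = "{f \<in> Z. asc f = steps w}"
  have cover: "\<exists>h\<in>?S. f \<in> LS h" if fZ: "f \<in> Z" for f
  proof -
    obtain h where h: "sorted h" "length h = ?N" "asc h = steps w" "f \<in> LS h"
      using LS_cover[of f ?N "steps w"] fZ unfolding Z(3) by blast
    have "h ! k = f ! k" if "k < ?N" "snd (w ! k) = 0" for k
      using steps_col0[OF that] h that(1) by (auto simp: LS_def)
    then have "h \<in> ?S" using fZ h unfolding Z(3) by auto
    then show ?thesis using h(4) by blast
  qed
  have "\<exists>g\<in>?S. ?S = MS g"
  proof (rule MS_class[where N = ?N])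
    show "finite ?S" using Z(1) by simp
    show "?S \<noteq> {}" using cover Z(2) by blast
    show "pmax f h \<in> ?S" if "f \<in> ?S" "h \<in> ?S" for f h
    proof -
      have fh: "sorted f" "sorted h" "length h = length f" "asc h = asc f" "length f = ?N"
        using that unfolding Z(3) by auto
      show ?thesis using that pmax_props[OF fh(1-4)] fh(5) unfolding Z(3) by auto
    qed
    show "h \<in> ?S" if "f \<in> ?S" "sorted h" "length h = ?N" "asc h = steps w" "\<forall>k<?N. h ! k \<le> f ! k" for f h
      using that unfolding Z(3) by (auto intro: le_trans)
  qed (auto simp: Z(3))
  then obtain g where g: "g \<in> ?S" "?S = MS g" by blast
  have "Z = FS g"
  proof (intro equalityI subsetI)
    fix f assume f: "f \<in> Z"
    then obtain h where h: "h \<in> ?S" "f \<in> LS h" using cover by blast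
    have hg: "\<forall>k<length g. h ! k \<le> g ! k" "length h = length g" using h(1) g(2) by (auto simp: MS_def)
    have "f ! k \<le> h ! k" if "k < length g" for k
      using LS_le[OF h(2)] h(1) that hg(2) unfolding Z(3) by auto
    then show "f \<in> FS g" using f g(1) hg unfolding Z(3) by (auto simp: FS_def intro: le_trans)
  next
    fix f assume "f \<in> FS g"
    then show "f \<in> Z" using g(1) unfolding Z(3) by (auto simp: FS_def intro: le_trans)
  qed
  moreover have "sorted g" "set g \<subseteq> {..<length a}" using g(1) Z(3,4) by auto
  ultimately show "cone fslide (\<Sum>f\<in>Z. xl f)" using sum_FS cone_base by metis
qed

section \<open>Standardisation classes of quasi-key tableaux and semi-skyline fillings\<close>

lemma cells_Suc: "(r, Suc c) \<in> cells a \<Longrightarrow> (r, c) \<in> cells a"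
  by (auto simp: cells_def)

lemma row_le_first:
  assumes "\<And>c. (r, c) \<in> cells a \<Longrightarrow> (r, Suc c) \<in> cells a \<Longrightarrow> T (r, Suc c) \<le> T (r, c)"
  shows "(r, c) \<in> cells a \<Longrightarrow> T (r, c) \<le> (T (r, 0) :: nat)"
proof (induction c)
  case (Suc c)
  then show ?case using assms[of c] cells_Suc[OF Suc.prems] by simp
qed simp

text \<open>Apart from the bound by the row, each condition is a strict comparison recorded by
  \<open>trel\<close>, the negation of one, or a combination of these. The bound may be tested in
  the first column because rows decrease.\<close>

lemma std_closed_qkey: "std_closed (\<le>) a {T. qkey_tableau a T}"
  unfolding std_closed_def
proof (intro ballI conjI allI impI)
  fix T assume "T \<in> {T. qkey_tableau a T}"
  then have T: "qkey_tableau a T" by simp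
  then show "filling a T" by (simp add: qkey_tableau_def)
  show "T (r, c) \<le> T (r, 0)" if "(r, c) \<in> cells a" for r c
    by (rule row_le_first[OF _ that]) (use T in \<open>auto simp: qkey_tableau_def\<close>)
  show "T (r, 0) \<le> Suc r" if "(r, c) \<in> cells a" for r c
    using T that by (auto simp: qkey_tableau_def cells_def)
  show "x = y" if "x \<in> cells a" "y \<in> cells a" "snd x = snd y \<and> T x = T y" for x y
    using T that unfolding qkey_tableau_def by (metis prod.collapse)
  fix T' assume T': "filling a T' \<and> trel a T' = trel a T"
  have q1: "\<And>r c. (r, c) \<in> cells a \<Longrightarrow> (r, Suc c) \<in> cells a \<Longrightarrow> T (r, Suc c) \<le> T (r, c)" (is "PROP ?q1")
    and q2: "\<And>r s c. (r, c) \<in> cells a \<Longrightarrow> (s, c) \<in> cells a \<Longrightarrow> r \<noteq> s \<Longrightarrow> T (r, c) \<noteq> T (s, c)" (is "PROP ?q2")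
    and q3: "\<And>r s. r < s \<Longrightarrow> (r, 0) \<in> cells a \<Longrightarrow> (s, 0) \<in> cells a \<Longrightarrow> T (r, 0) < T (s, 0)" (is "PROP ?q3")
    and q4: "\<And>r s c. r < s \<Longrightarrow> (r, c) \<in> cells a \<Longrightarrow> (s, c) \<in> cells a \<Longrightarrow> T (s, c) < T (r, c) \<Longrightarrow>
        (r, Suc c) \<in> cells a \<and> T (s, c) < T (r, Suc c)" (is "PROP ?q4")
    and q5: "\<And>r s c. r < s \<Longrightarrow> a ! r < a ! s \<Longrightarrow> (r, c) \<in> cells a \<Longrightarrow> (s, Suc c) \<in> cells a \<Longrightarrow> T (r, c) < T (s, Suc c)" (is "PROP ?q5")
  proof -
    note q = T[unfolded qkey_tableau_def, THEN conjunct2]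
    show "PROP ?q1" using q[THEN conjunct1] by blast
    show "PROP ?q2" using q[THEN conjunct2, THEN conjunct2, THEN conjunct1] by blast
    show "PROP ?q3" using q[THEN conjunct2, THEN conjunct2, THEN conjunct2, THEN conjunct1] by blast
    show "PROP ?q4" using q[THEN conjunct2, THEN conjunct2, THEN conjunct2, THEN conjunct2, THEN conjunct1] by blast
    show "PROP ?q5" using q[THEN conjunct2, THEN conjunct2, THEN conjunct2, THEN conjunct2, THEN conjunct2] by blast
  qed
  have rel: "T' (r, c) < T' (s, d) \<longleftrightarrow> T (r, c) < T (s, d)"
    if "(r, c) \<in> cells a" "(s, d) \<in> cells a" "c \<le> d" for r c s d
    using trelD[of a T' T "(r, c)" "(s, d)"] T' that by simp
  have rel2: "T' (r, Suc c) \<le> T' (r, c) \<longleftrightarrow> T (r, Suc c) \<le> T (r, c)"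
    if "(r, c) \<in> cells a" "(r, Suc c) \<in> cells a" for r c
    using rel[of r c r "Suc c"] that by (simp add: not_less[symmetric])
  have rel3: "T' (r, c) \<noteq> T' (s, c) \<longleftrightarrow> T (r, c) \<noteq> T (s, c)"
    if "(r, c) \<in> cells a" "(s, c) \<in> cells a" for r s c
    using rel[of r c s c] rel[of s c r c] that by (simp add: nat_neq_iff)
  have rows: "T' (r, Suc c) \<le> T' (r, c)" if "(r, c) \<in> cells a" "(r, Suc c) \<in> cells a" for r c
    using rel2[OF that] that q1 by blast
  have "T' (r, c) \<le> T' (r, 0)" if "(r, c) \<in> cells a" for r c
    by (rule row_le_first[OF rows that])
  then have le: "\<And>r c. (r, c) \<in> cells a \<Longrightarrow> (r, 0) \<in> cells a \<and> T' (r, c) \<le> T' (r, 0)" by (auto simp: cells_def)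
  have flag: "(\<forall>r c. (r, c) \<in> cells a \<longrightarrow> T' (r, c) \<le> Suc r) \<longleftrightarrow> (\<forall>r. (r, 0) \<in> cells a \<longrightarrow> T' (r, 0) - 1 \<le> r)"
  proof (intro iffI allI impI)
    fix r c assume "\<forall>r. (r, 0) \<in> cells a \<longrightarrow> T' (r, 0) - 1 \<le> r" "(r, c) \<in> cells a"
    then show "T' (r, c) \<le> Suc r" using le[of r c] by fastforce
  qed fastforce
  have "qkey_tableau a T' \<longleftrightarrow> (\<forall>r c. (r, c) \<in> cells a \<longrightarrow> T' (r, c) \<le> Suc r)"
  proof
    assume f: "\<forall>r c. (r, c) \<in> cells a \<longrightarrow> T' (r, c) \<le> Suc r"
    show "qkey_tableau a T'"
      unfolding qkey_tableau_def
    proof (intro conjI)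
      show "\<forall>r s c. (r, c) \<in> cells a \<and> (s, c) \<in> cells a \<and> r \<noteq> s \<longrightarrow> T' (r, c) \<noteq> T' (s, c)"
        using q2 rel3 by blast
      show "\<forall>r s. r < s \<and> (r, 0) \<in> cells a \<and> (s, 0) \<in> cells a \<longrightarrow> T' (r, 0) < T' (s, 0)"
        using q3 rel by blast
      show "\<forall>r s c. r < s \<and> (r, c) \<in> cells a \<and> (s, c) \<in> cells a \<and> T' (s, c) < T' (r, c) \<longrightarrow>
          (r, Suc c) \<in> cells a \<and> T' (s, c) < T' (r, Suc c)"
      proof (intro allI impI, elim conjE)
        fix r s c assume rs: "r < s" "(r, c) \<in> cells a" "(s, c) \<in> cells a" "T' (s, c) < T' (r, c)"
        then have "T (s, c) < T (r, c)" using rel[of s c r c] by simp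
        from q4[OF rs(1-3) this] show "(r, Suc c) \<in> cells a \<and> T' (s, c) < T' (r, Suc c)"
          using rel[of s c r "Suc c"] rs by simp
      qed
      show "\<forall>r s c. r < s \<and> a ! r < a ! s \<and> (r, c) \<in> cells a \<and> (s, Suc c) \<in> cells a \<longrightarrow> T' (r, c) < T' (s, Suc c)"
      proof (intro allI impI, elim conjE)
        fix r s c assume rs: "r < s" "a ! r < a ! s" "(r, c) \<in> cells a" "(s, Suc c) \<in> cells a"
        show "T' (r, c) < T' (s, Suc c)" using rel[of r c s "Suc c"] q5[OF rs] rs by simp
      qed
    qed (use T' f rows in auto)
  qed (auto simp: qkey_tableau_def)
  then show "T' \<in> {T. qkey_tableau a T} \<longleftrightarrow> (\<forall>r. (r, 0) \<in> cells a \<longrightarrow> T' (r, 0) - 1 \<le> r)"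
    using flag by simp
qed

lemma qkey_fslide: "cone fslide (qkey a)"
  unfolding qkey_def by (rule std_closed_fslide[OF std_closed_qkey])

text \<open>As for quasi-key tableaux: an inversion triple is decided by comparisons within one
  column and from one column to the next.\<close>

lemma std_closed_atom:
  "std_closed (=) a {T. semi_skyline a T \<and> (\<forall>r. (r, 0) \<in> cells a \<longrightarrow> T (r, 0) = Suc r)}"
  unfolding std_closed_def
proof (intro ballI conjI allI impI)
  fix T assume "T \<in> {T. semi_skyline a T \<and> (\<forall>r. (r, 0) \<in> cells a \<longrightarrow> T (r, 0) = Suc r)}"
  then have T: "semi_skyline a T" and T0: "\<And>r. (r, 0) \<in> cells a \<Longrightarrow> T (r, 0) = Suc r" by auto
  then show "filling a T" by (simp add: semi_skyline_def)
  show "T (r, c) \<le> T (r, 0)" if "(r, c) \<in> cells a" for r c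
    by (rule row_le_first[OF _ that]) (use T in \<open>auto simp: semi_skyline_def\<close>)
  show "T (r, 0) \<le> Suc r" if "(r, c) \<in> cells a" for r c
    using T0[of r] that by (auto simp: cells_def)
  show "x = y" if "x \<in> cells a" "y \<in> cells a" "snd x = snd y \<and> T x = T y" for x y
    using T that unfolding semi_skyline_def by (metis prod.collapse)
  fix T' assume T': "filling a T' \<and> trel a T' = trel a T"
  have q1: "\<And>r c. (r, c) \<in> cells a \<Longrightarrow> (r, Suc c) \<in> cells a \<Longrightarrow> T (r, Suc c) \<le> T (r, c)"
    and q2: "\<And>r s c. (r, c) \<in> cells a \<Longrightarrow> (s, c) \<in> cells a \<Longrightarrow> r \<noteq> s \<Longrightarrow> T (r, c) \<noteq> T (s, c)"
    and q3: "\<And>r s c. r < s \<Longrightarrow> a ! s \<le> a ! r \<Longrightarrow> (r, c) \<in> cells a \<Longrightarrow> (r, Suc c) \<in> cells a \<Longrightarrow> (s, Suc c) \<in> cells a \<Longrightarrow>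
        inv_triple (T (r, c)) (T (r, Suc c)) (T (s, Suc c))"
    and q4: "\<And>r s c. r < s \<Longrightarrow> a ! r < a ! s \<Longrightarrow> (s, c) \<in> cells a \<Longrightarrow> (s, Suc c) \<in> cells a \<Longrightarrow> (r, c) \<in> cells a \<Longrightarrow>
        inv_triple (T (s, c)) (T (s, Suc c)) (T (r, c))"
    using T unfolding semi_skyline_def by blast+
  have rel: "T' (r, c) < T' (s, d) \<longleftrightarrow> T (r, c) < T (s, d)"
    if "(r, c) \<in> cells a" "(s, d) \<in> cells a" "c \<le> d" for r c s d
    using trelD[of a T' T "(r, c)" "(s, d)"] T' that by simp
  have rel2: "T' (r, Suc c) \<le> T' (r, c) \<longleftrightarrow> T (r, Suc c) \<le> T (r, c)"
    if "(r, c) \<in> cells a" "(r, Suc c) \<in> cells a" for r c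
    using rel[of r c r "Suc c"] that by (simp add: not_less[symmetric])
  have rel3: "T' (r, c) \<noteq> T' (s, c) \<longleftrightarrow> T (r, c) \<noteq> T (s, c)"
    if "(r, c) \<in> cells a" "(s, c) \<in> cells a" for r s c
    using rel[of r c s c] rel[of s c r c] that by (simp add: nat_neq_iff)
  have "semi_skyline a T'"
    unfolding semi_skyline_def
  proof (intro conjI)
    show "filling a T'" using T' by simp
    show "\<forall>r c. (r, c) \<in> cells a \<and> (r, Suc c) \<in> cells a \<longrightarrow> T' (r, Suc c) \<le> T' (r, c)"
      using q1 rel2 by blast
    show "\<forall>r s c. (r, c) \<in> cells a \<and> (s, c) \<in> cells a \<and> r \<noteq> s \<longrightarrow> T' (r, c) \<noteq> T' (s, c)"
      using q2 rel3 by blast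
    show "\<forall>r s c. r < s \<and> a ! s \<le> a ! r \<and> (r, c) \<in> cells a \<and> (r, Suc c) \<in> cells a
              \<and> (s, Suc c) \<in> cells a \<longrightarrow> inv_triple (T' (r, c)) (T' (r, Suc c)) (T' (s, Suc c))"
    proof (intro allI impI, elim conjE)
      fix r s c assume rs: "r < s" "a ! s \<le> a ! r" "(r, c) \<in> cells a" "(r, Suc c) \<in> cells a" "(s, Suc c) \<in> cells a"
      show "inv_triple (T' (r, c)) (T' (r, Suc c)) (T' (s, Suc c))"
        using q3[OF rs] rel[OF rs(3,5)] rel2[OF rs(3,4)] rel[OF rs(5,4)] by (auto simp: inv_triple_def)
    qed
    show "\<forall>r s c. r < s \<and> a ! r < a ! s \<and> (s, c) \<in> cells a \<and> (s, Suc c) \<in> cells a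
              \<and> (r, c) \<in> cells a \<longrightarrow> inv_triple (T' (s, c)) (T' (s, Suc c)) (T' (r, c))"
    proof (intro allI impI, elim conjE)
      fix r s c assume rs: "r < s" "a ! r < a ! s" "(s, c) \<in> cells a" "(s, Suc c) \<in> cells a" "(r, c) \<in> cells a"
      show "inv_triple (T' (s, c)) (T' (s, Suc c)) (T' (r, c))"
        using q4[OF rs] rel[OF rs(3,5)] rel2[OF rs(3,4)] rel[OF rs(5,4)] by (auto simp: inv_triple_def)
    qed
  qed
  moreover have "T' (r, 0) = Suc r \<longleftrightarrow> T' (r, 0) - 1 = r" if "(r, 0) \<in> cells a" for r
    using T' that by (auto simp: filling_def)
  ultimately show "T' \<in> {T. semi_skyline a T \<and> (\<forall>r. (r, 0) \<in> cells a \<longrightarrow> T (r, 0) = Suc r)}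
      \<longleftrightarrow> (\<forall>r. (r, 0) \<in> cells a \<longrightarrow> T' (r, 0) - 1 = r)"
    by auto
qed

lemma atom_particle: "cone particle (atom a)"
  unfolding atom_def by (rule std_closed_particle[OF std_closed_atom])

section \<open>Quasi-keys and atoms by column sets\<close>

lemma bigparts_eq: "t \<le> length b \<Longrightarrow> bigparts b j t = length (filter (\<lambda>x. j < x) (flat (take t b)))"
proof (induction t)
  case (Suc t)
  then have "take (Suc t) b = take t b @ [b ! t]" by (simp add: take_Suc_conv_app_nth)
  then show ?case using Suc by (auto simp: bigparts_Suc flat_def)
qed (simp add: bigparts_def flat_def)

text \<open>Two prefixes of one list are comparable, and with positive entries the longer one has
  the larger sum.\<close>

lemma positive_prefix:
  fixes u v :: "nat list"
  assumes "u @ u' = v @ v'" "sum_list u \<le> sum_list v" "\<And>x. x \<in> set (u @ u') \<Longrightarrow> 0 < x"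
  shows "\<exists>z. v = u @ z"
proof -
  obtain z where "u = v @ z \<and> z @ u' = v' \<or> u @ z = v \<and> u' = z @ v'"
    using assms(1) by (auto simp: append_eq_append_conv2)
  then show ?thesis
  proof
    assume "u = v @ z \<and> z @ u' = v'"
    then have "z = []" using assms(2,3) by (cases z) auto
    then show ?thesis using \<open>u = v @ z \<and> z @ u' = v'\<close> by auto
  qed auto
qed

text \<open>For equal \<open>flat\<close>, a larger prefix sum means a longer prefix of the same
  composition, so the counts for all thresholds grow together.\<close>

lemma bigparts_mono:
  assumes "flat b = flat b'" "t \<le> length b" "t' \<le> length b'" "sum_list (take t b) \<le> sum_list (take t' b')"
  shows "bigparts b j t \<le> bigparts b' j t'"
proof -
  have "flat (take t b) @ flat (drop t b) = flat (take t' b') @ flat (drop t' b')"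
    using assms(1) by (metis append_take_drop_id filter_append flat_def)
  moreover have "sum_list (flat (take t b)) \<le> sum_list (flat (take t' b'))" using assms(4) by (simp add: sum_flat)
  moreover have "0 < x" if "x \<in> set (flat (take t b) @ flat (drop t b))" for x using that by (auto simp: flat_def)
  ultimately obtain z where "flat (take t' b') = flat (take t b) @ z" using positive_prefix by blast
  then show ?thesis using assms(2,3) by (simp add: bigparts_eq)
qed

lemma mset_flat: "mset b = mset (flat b) + replicate_mset (length b - length (flat b)) 0"
  by (induction b) (auto simp: flat_def Suc_diff_le[OF length_filter_le])

lemma mset_eq_of_flat: "flat b = flat a \<Longrightarrow> length b = length a \<Longrightarrow> mset b = mset a"
  using mset_flat[of a] mset_flat[of b] by simp

text \<open>For a fixed value of \<open>flat\<close> the Bruhat condition is inherited whenever each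
  prefix sum is at least that of some member, by \<open>bigparts_mono\<close>. This covers entrywise
  smaller words, whose prefix sums are larger, and maxima of two words, so \<open>MS_class\<close>
  applies.\<close>

lemma bru_flat_class:
  assumes b: "b \<in> bru a"
  shows "\<exists>a'. {b' \<in> bru a. flat b' = flat b} = slides a'"
proof -
  let ?n = "length a" and ?S = "ex ` {b' \<in> bru a. flat b' = flat b}"
  have lb: "length b = ?n" using b by (rule bru_length)
  have D: "length b' = ?n" "sum_list b' = sum_list b" "asc (ex b') = asc (ex b)"
    if "b' \<in> bru a" "flat b' = flat b" for b'
    using bru_length[OF that(1)] that(2) flat_eq_iff[of b' b] by auto
  have mem: "cn ?n f \<in> {b' \<in> bru a. flat b' = flat b} \<and> f \<in> ?S"
    if f: "sorted f" "length f = sum_list b" "asc f = asc (ex b)" "set f \<subseteq> {..<?n}"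
      and upper: "\<And>t. t \<le> ?n \<Longrightarrow> \<exists>b'\<in>bru a. flat b' = flat b \<and>
        sum_list (take t b') \<le> card {i. i < length f \<and> f ! i < t}" for f
  proof -
    have e: "ex (cn ?n f) = f" using f by (intro ex_cn) auto
    have fl: "flat (cn ?n f) = flat b"
      using f(2,3) length_ex[of "cn ?n f"] unfolding flat_eq_iff e by auto
    have "bigparts a j t \<le> bigparts (cn ?n f) j t" if t: "t \<le> ?n" for j t
    proof -
      obtain b' where b': "b' \<in> bru a" "flat b' = flat b"
        "sum_list (take t b') \<le> card {i. i < length f \<and> f ! i < t}" using upper[OF t] by blast
      then have "sum_list (take t b') \<le> sum_list (take t (cn ?n f))" using sum_take[of t "cn ?n f"] e by simp
      then have "bigparts b' j t \<le> bigparts (cn ?n f) j t"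
        using b' fl t D(1)[of b'] by (intro bigparts_mono) auto
      moreover have "bigparts a j t \<le> bigparts b' j t" using b'(1) t by (simp add: bru_def)
      ultimately show ?thesis by simp
    qed
    moreover have "mset (cn ?n f) = mset a"
      using mset_eq_of_flat[OF fl] lb b by (simp add: bru_def)
    ultimately have "cn ?n f \<in> {b' \<in> bru a. flat b' = flat b}" using fl by (simp add: bru_def)
    then show ?thesis using e by (metis imageI)
  qed
  have "\<exists>g\<in>?S. ?S = MS g"
  proof (rule MS_class[where N = "sum_list b" and A = "asc (ex b)"])
    show "finite ?S" using finite_bru by simp
    show "?S \<noteq> {}" using b by blast
    show "sorted f \<and> length f = sum_list b \<and> asc f = asc (ex b)" if "f \<in> ?S" for f
      using that D sorted_ex by auto
    show "pmax f g \<in> ?S" if fg: "f \<in> ?S" "g \<in> ?S" for f g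
    proof -
      obtain c d where c: "f = ex c" "c \<in> bru a" "flat c = flat b" and d: "g = ex d" "d \<in> bru a" "flat d = flat b"
        using fg by blast
      have s: "sorted f" "sorted g" "length g = length f" "asc g = asc f" "length f = sum_list b"
        using c d D sorted_ex by auto
      note p = pmax_props[OF s(1-4)]
      have sf: "set f \<subseteq> {..<?n}" "set g \<subseteq> {..<?n}" using set_ex c(1) d(1) D(1)[OF c(2,3)] D(1)[OF d(2,3)] by metis+
      have st: "set (pmax f g) \<subseteq> {..<?n}"
      proof
        fix x assume "x \<in> set (pmax f g)"
        then obtain k where k: "k < length f" "x = max (f ! k) (g ! k)" using p(1,2) by (auto simp: in_set_conv_nth)
        then have "f ! k \<in> set f" "g ! k \<in> set g" using s(3) by auto
        then have "f ! k \<in> {..<?n}" "g ! k \<in> {..<?n}" using sf by blast+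
        then show "x \<in> {..<?n}" using k(2) by simp
      qed
      have "\<exists>b'\<in>bru a. flat b' = flat b \<and>
        sum_list (take t b') \<le> card {i. i < length (pmax f g) \<and> pmax f g ! i < t}" for t
      proof -
        let ?F = "{i. i < length f \<and> f ! i < t}" and ?G = "{i. i < length f \<and> g ! i < t}"
        have "card ?F \<le> card {..<length f}" "card ?G \<le> card {..<length f}" by (rule card_mono; auto)+
        then have le: "card ?F \<le> length f" "card ?G \<le> length f" by simp_all
        have F: "i \<in> ?F \<longleftrightarrow> i < card ?F" for i
          using sorted_below[OF s(1), of i t] le(1) by (cases "i < length f") auto
        have G: "i \<in> ?G \<longleftrightarrow> i < card ?G" for i
          using sorted_below[OF s(2), of i t] s(3) le(2) by (cases "i < length f") auto
        have P: "{i. i < length (pmax f g) \<and> pmax f g ! i < t} = ?F \<inter> ?G" using p(1,2) by auto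
        have cd: "sum_list (take t c) = card ?F" "sum_list (take t d) = card ?G"
          using sum_take[of t c] sum_take[of t d] c(1) d(1) s(3) by simp_all
        have "?F = {..<card ?F}" "?G = {..<card ?G}" using F G by blast+
        \<comment> \<open>The letters below t form a prefix of either word, one contained in the
          other, so at each t the maximum has the prefix sum of one of the two words.\<close>
        then have "?F \<inter> ?G = ?F \<or> ?F \<inter> ?G = ?G" 
          using linear[of "card ?F" "card ?G"] by (metis (no_types, lifting) Int_absorb1 Int_absorb2 lessThan_subset_iff)
        then have "card (?F \<inter> ?G) = sum_list (take t c) \<or> card (?F \<inter> ?G) = sum_list (take t d)"
          unfolding cd by (elim disjE) simp_all
        then show ?thesis
        proof
          assume "card (?F \<inter> ?G) = sum_list (take t c)"
          then show ?thesis unfolding P using c by (intro bexI[of _ c]) auto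
        next
          assume "card (?F \<inter> ?G) = sum_list (take t d)"
          then show ?thesis unfolding P using d by (intro bexI[of _ d]) auto
        qed
      qed
      then show ?thesis using mem[of "pmax f g"] p st s(5) c(1) D(3)[OF c(2,3)] by auto
    qed
    show "g \<in> ?S" if f: "f \<in> ?S" and g: "sorted g" "length g = sum_list b" "asc g = asc (ex b)" "\<forall>k<sum_list b. g ! k \<le> f ! k" for f g
    proof -
      obtain c where c: "f = ex c" "c \<in> bru a" "flat c = flat b" using f by blast
      have lf: "length f = sum_list b" "length c = ?n" using c D by auto
      have "set g \<subseteq> {..<?n}" using set_below[of g c] g lf c(1) by simp
      moreover have "sum_list (take t c) \<le> card {i. i < length g \<and> g ! i < t}" for t
        unfolding sum_take using lf g c(1) by (intro card_mono) (auto intro: le_less_trans)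
      ultimately show ?thesis using mem[OF g(1-3)] c by blast
    qed
  qed
  then obtain g where g: "g \<in> ?S" "?S = MS g" by blast
  then obtain a' where a': "g = ex a'" "a' \<in> bru a" by blast
  have la: "length a' = ?n" using bru_length[OF a'(2)] .
  have "ex ` {b' \<in> bru a. flat b' = flat b} = ex ` slides a'"
    using g(2) bij_MS[of a'] a'(1) by (simp add: bij_betw_def)
  moreover have len: "length b' = ?n" if "b' \<in> slides a' \<or> b' \<in> bru a" for b'
    using that la bru_length by (auto simp: slides_def dominates_def)
  have "inj_on ex ({b' \<in> bru a. flat b' = flat b} \<union> slides a')"
  proof (rule inj_onI)
    fix c d assume "c \<in> {b' \<in> bru a. flat b' = flat b} \<union> slides a'"
      "d \<in> {b' \<in> bru a. flat b' = flat b} \<union> slides a'" "ex c = ex d"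
    then show "c = d" using len[of c] len[of d] cn_ex[of c] cn_ex[of d] by auto
  qed
  ultimately have "{b' \<in> bru a. flat b' = flat b} = slides a'" by (simp add: inj_on_image_eq_iff)
  then show ?thesis by blast
qed

lemma kappa_slides: "\<exists>L. kappa a = (\<Sum>a'\<leftarrow>L. \<Sum>b\<in>slides a'. colatom b)"
proof -
  have 1: "kappa a = (\<Sum>\<alpha>\<in>flat ` bru a. \<Sum>b\<in>{b \<in> bru a. flat b = \<alpha>}. colatom b)"
    unfolding kappa_eq_kap kap_def by (rule sum.image_gen[OF finite_bru])
  have "cone (\<lambda>a'. \<Sum>b\<in>slides a'. colatom b) (\<Sum>b\<in>{b \<in> bru a. flat b = \<alpha>}. colatom b)"
    if \<alpha>: "\<alpha> \<in> flat ` bru a" for \<alpha>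
  proof -
    obtain b where b: "b \<in> bru a" "\<alpha> = flat b" using \<alpha> by blast
    obtain a' where "{b' \<in> bru a. flat b' = flat b} = slides a'" using bru_flat_class[OF b(1)] by blast
    then show ?thesis unfolding b(2) using cone_base[of "\<lambda>a'. \<Sum>b\<in>slides a'. colatom b" a'] by simp
  qed
  then have "cone (\<lambda>a'. \<Sum>b\<in>slides a'. colatom b) (kappa a)" unfolding 1 by (rule cone_sum)
  then show ?thesis by (simp add: cone_def)
qed

section \<open>From fillings to arrays\<close>

lemma cells_iff: "(r, c) \<in> cells a \<longleftrightarrow> r \<in> supp a \<and> c < a ! r"
  by (auto simp: cells_def supp_def)

lemma finite_supp: "finite (supp a)"
  by (simp add: supp_def)

text \<open>Entries are shifted to start at 0, so that they name variables and rows alike.\<close>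

definition arr :: "(nat \<times> nat \<Rightarrow> nat) \<Rightarrow> nat \<Rightarrow> nat \<Rightarrow> nat" where
  "arr T r c = T (r, c) - 1"

definition tab :: "nat list \<Rightarrow> (nat \<Rightarrow> nat \<Rightarrow> nat) \<Rightarrow> nat \<times> nat \<Rightarrow> nat" where
  "tab a E = (\<lambda>(r, c). if (r, c) \<in> cells a then Suc (E r c) else 0)"

lemma filling_tab: "filling a (tab a E)"
  by (auto simp: filling_def tab_def)

lemma arr_tab: "r \<in> supp a \<Longrightarrow> c < a ! r \<Longrightarrow> arr (tab a E) r c = E r c"
  by (simp add: arr_def tab_def cells_iff)

lemma T_eq_arr: "filling a T \<Longrightarrow> r \<in> supp a \<Longrightarrow> c < a ! r \<Longrightarrow> T (r, c) = Suc (arr T r c)"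
  by (simp add: filling_def arr_def cells_iff)

lemma rows_ok_cong: "(\<And>r c. r \<in> R \<Longrightarrow> c < l r \<Longrightarrow> E r c = E' r c) \<Longrightarrow> rows_ok R l E = rows_ok R l E'"
  unfolding rows_ok_def by (auto simp: Suc_lessD)

lemma sk_cong:
  assumes e: "\<And>r c. r \<in> R \<Longrightarrow> c < l r \<Longrightarrow> E r c = E' r c" and s: "sk R l E"
  shows "sk R l E'"
  unfolding sk_def
proof (intro conjI ballI allI impI)
  show "rows_ok R l E'" using rows_ok_cong[of R l E E', OF e] skD(1)[OF s] by simp
  show "E' r 0 = r" if "r \<in> R" for r using e[OF that] rows_okD(2)[OF skD(1)[OF s] that] skD(2)[OF s that] by simp
  show "E' r c < E' q (Suc c) \<or> Suc c < l r \<and> E' q (Suc c) < E' r (Suc c)"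
    if "r \<in> R" "q \<in> R" "r < q \<and> c < l r \<and> Suc c < l q" for r q c
    using skD(3)[OF s that(1,2)] that e by metis
qed

lemma qk_cong:
  assumes e: "\<And>r c. r \<in> R \<Longrightarrow> c < l r \<Longrightarrow> E r c = E' r c" and s: "qk R l E"
  shows "qk R l E'"
  unfolding qk_def
proof (intro conjI ballI allI impI)
  have p: "0 < l r" if "r \<in> R" for r using rows_okD(2)[OF qkD(1)[OF s] that] .
  show "rows_ok R l E'" using rows_ok_cong[of R l E E', OF e] qkD(1)[OF s] by simp
  show "E' r 0 < E' q 0" if "r \<in> R" "q \<in> R" "r < q" for r q
    using e[OF that(1) p] e[OF that(2) p] qkD(2)[OF s that] that by simp
  show "Suc c < l r" "E' q c < E' r (Suc c)"
    if "r \<in> R" "q \<in> R" "r < q \<and> c < l r \<and> c < l q \<and> E' q c < E' r c" for r q c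
    using qkD(3)[OF s that(1,2), of c] that e[of r c] e[of q c] e[of r "Suc c"] by simp_all
  show "E' r c < E' q (Suc c)" if "r \<in> R" "q \<in> R" "r < q \<and> l r < l q \<and> c < l r" for r q c
    using qkD(4)[OF s that(1,2), of c] that e[of r c] e[of q "Suc c"] by simp
qed

lemma qkey_tableau_iff:
  assumes f: "filling a T"
  shows "qkey_tableau a T \<longleftrightarrow> qk (supp a) ((!) a) (arr T) \<and> (\<forall>r\<in>supp a. arr T r 0 \<le> r)"
proof
  assume T: "qkey_tableau a T"
  note q = T[unfolded qkey_tableau_def, THEN conjunct2]
  have E: "T (r, c) = Suc (arr T r c)" if "(r, c) \<in> cells a" for r c using T_eq_arr[OF f] that by (simp add: cells_iff)
  have c0: "(r, 0) \<in> cells a" if "r \<in> supp a" for r using that by (simp add: cells_iff supp_def)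
  show "qk (supp a) ((!) a) (arr T) \<and> (\<forall>r\<in>supp a. arr T r 0 \<le> r)"
    unfolding qk_def rows_ok_def
  proof (intro conjI ballI allI impI)
    show "finite (supp a)" by (rule finite_supp)
    show "0 < a ! r" if "r \<in> supp a" for r using that by (simp add: supp_def)
    show "arr T r (Suc c) \<le> arr T r c" if "r \<in> supp a" "Suc c < a ! r" for r c
      using q[THEN conjunct1, rule_format, of r c] that by (simp add: arr_def cells_iff diff_le_mono)
    show "arr T r c \<noteq> arr T s c" if "r \<in> supp a" "s \<in> supp a" "c < a ! r \<and> c < a ! s \<and> r \<noteq> s" for r s c
      using q[THEN conjunct2, THEN conjunct2, THEN conjunct1, rule_format, of r c s] that E[of r c] E[of s c] by (simp add: cells_iff)
    show "arr T r 0 < arr T s 0" if "r \<in> supp a" "s \<in> supp a" "r < s" for r s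
      using q[THEN conjunct2, THEN conjunct2, THEN conjunct2, THEN conjunct1, rule_format, of r s] that E[OF c0] c0 by simp
    show "Suc c < a ! r" "arr T s c < arr T r (Suc c)"
      if "r \<in> supp a" "s \<in> supp a" "r < s \<and> c < a ! r \<and> c < a ! s \<and> arr T s c < arr T r c" for r s c
    proof -
      have rs: "(r, c) \<in> cells a" "(s, c) \<in> cells a" using that by (simp_all add: cells_iff)
      then have "T (s, c) < T (r, c)" using E that by simp
      then have "(r, Suc c) \<in> cells a \<and> T (s, c) < T (r, Suc c)"
        using q[THEN conjunct2, THEN conjunct2, THEN conjunct2, THEN conjunct2, THEN conjunct1, rule_format, of r s c]
          that rs by blast
      then show "Suc c < a ! r" "arr T s c < arr T r (Suc c)" using E[OF rs(2)] E[of r "Suc c"] by (auto simp: cells_iff)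
    qed
    show "arr T r c < arr T s (Suc c)" if "r \<in> supp a" "s \<in> supp a" "r < s \<and> a ! r < a ! s \<and> c < a ! r" for r s c
    proof -
      have rs: "(r, c) \<in> cells a" "(s, Suc c) \<in> cells a" using that by (simp_all add: cells_iff)
      then have "T (r, c) < T (s, Suc c)"
        using q[THEN conjunct2, THEN conjunct2, THEN conjunct2, THEN conjunct2, THEN conjunct2, rule_format, of r s c] that by simp
      then show ?thesis using E rs by simp
    qed
    show "arr T r 0 \<le> r" if "r \<in> supp a" for r
      using q[THEN conjunct2, THEN conjunct1, rule_format, of r 0] c0[OF that] by (simp add: arr_def)
  qed
next
  assume "qk (supp a) ((!) a) (arr T) \<and> (\<forall>r\<in>supp a. arr T r 0 \<le> r)"
  then have q: "qk (supp a) ((!) a) (arr T)" and b: "\<And>r. r \<in> supp a \<Longrightarrow> arr T r 0 \<le> r" by auto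
  have E: "T (r, c) = Suc (arr T r c)" if "(r, c) \<in> cells a" for r c using T_eq_arr[OF f] that by (simp add: cells_iff)
  note ok = qkD(1)[OF q]
  show "qkey_tableau a T"
    unfolding qkey_tableau_def
  proof (intro conjI allI impI; (elim conjE)?)
    show "filling a T" by (rule f)
    show "T (r, Suc c) \<le> T (r, c)" if "(r, c) \<in> cells a" "(r, Suc c) \<in> cells a" for r c
      using E[OF that(1)] E[OF that(2)] rows_okD(3)[OF ok, of r c] that by (simp add: cells_iff)
    show "T (r, c) \<le> Suc r" if "(r, c) \<in> cells a" for r c
      using E[OF that] rows_ok_le[OF ok, of r c] b[of r] that by (simp add: cells_iff)
    show "T (r, c) \<noteq> T (s, c)" if "(r, c) \<in> cells a" "(s, c) \<in> cells a" "r \<noteq> s" for r s c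
      using E[OF that(1)] E[OF that(2)] rows_okD(4)[OF ok, of r s c] that by (simp add: cells_iff)
    show "T (r, 0) < T (s, 0)" if "r < s" "(r, 0) \<in> cells a" "(s, 0) \<in> cells a" for r s
      using E[OF that(2)] E[OF that(3)] qkD(2)[OF q, of r s] that by (simp add: cells_iff)
    show "(r, Suc c) \<in> cells a" "T (s, c) < T (r, Suc c)"
      if "r < s" "(r, c) \<in> cells a" "(s, c) \<in> cells a" "T (s, c) < T (r, c)" for r s c
    proof -
      show 1: "(r, Suc c) \<in> cells a"
        using E[OF that(2)] E[OF that(3)] qkD(3)[OF q, of r s c] that by (simp add: cells_iff)
      show "T (s, c) < T (r, Suc c)"
        using E[OF that(2)] E[OF that(3)] E[OF 1] qkD(3)[OF q, of r s c] that by (simp add: cells_iff)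
    qed
    show "T (r, c) < T (s, Suc c)" if "r < s" "a ! r < a ! s" "(r, c) \<in> cells a" "(s, Suc c) \<in> cells a" for r s c
      using E[OF that(3)] E[OF that(4)] qkD(4)[OF q, of r s c] that by (simp add: cells_iff)
  qed
qed

text \<open>For r < s with row s longer, only the first alternative of \<open>sk\<close> can occur:
  given the triples it is forced from the first column onwards, and given \<open>sk\<close> it is
  forced from the end of the shorter row backwards. For other pairs the condition is the Type A
  triple.\<close>

lemma semi_skyline_iff:
  assumes f: "filling a T"
  shows "semi_skyline a T \<and> (\<forall>r. (r, 0) \<in> cells a \<longrightarrow> T (r, 0) = Suc r) \<longleftrightarrow> sk (supp a) ((!) a) (arr T)"
proof
  assume "semi_skyline a T \<and> (\<forall>r. (r, 0) \<in> cells a \<longrightarrow> T (r, 0) = Suc r)"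
  then have T: "semi_skyline a T" and T0: "\<And>r. (r, 0) \<in> cells a \<Longrightarrow> T (r, 0) = Suc r" by auto
  note q = T[unfolded semi_skyline_def, THEN conjunct2]
  have E: "T (r, c) = Suc (arr T r c)" if "r \<in> supp a" "c < a ! r" for r c using T_eq_arr[OF f that] .
  have dec: "arr T r (Suc c) \<le> arr T r c" if "r \<in> supp a" "Suc c < a ! r" for r c
    using q[THEN conjunct1, rule_format, of r c] that by (simp add: arr_def cells_iff diff_le_mono)
  have first: "arr T r 0 = r" if "r \<in> supp a" for r using T0[of r] that by (simp add: arr_def cells_iff supp_def)
  \<comment> \<open>In a Type B triple the second alternative \<open>\<gamma> \<ge> \<alpha> > \<beta>\<close> holds in the first column and persists.\<close>
  have longer: "arr T r c < arr T s (Suc c)" if "r \<in> supp a" "s \<in> supp a" "r < s" "a ! r < a ! s" "c < a ! r" for r s c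
    using that(5)
  proof (induction c)
    case 0
    have "inv_triple (T (s, 0)) (T (s, Suc 0)) (T (r, 0))"
      using q[THEN conjunct2, THEN conjunct2, THEN conjunct2, rule_format, of r s 0] that 0 by (simp add: cells_iff)
    then show ?case using E[of s 0] E[of s "Suc 0"] E[of r 0] first[OF that(1)] first[OF that(2)] that 0
      by (auto simp: inv_triple_def)
  next
    case (Suc c)
    have "inv_triple (T (s, Suc c)) (T (s, Suc (Suc c))) (T (r, Suc c))"
      using q[THEN conjunct2, THEN conjunct2, THEN conjunct2, rule_format, of r s "Suc c"] that Suc.prems by (simp add: cells_iff)
    moreover have "arr T r (Suc c) < arr T s (Suc c)" using Suc dec[OF that(1), of c] by simp
    ultimately show ?case using E[of s "Suc c"] E[of s "Suc (Suc c)"] E[of r "Suc c"] that Suc.prems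
      by (auto simp: inv_triple_def)
  qed
  show "sk (supp a) ((!) a) (arr T)"
    unfolding sk_def rows_ok_def
  proof (intro conjI ballI allI impI)
    show "finite (supp a)" by (rule finite_supp)
    show "0 < a ! r" if "r \<in> supp a" for r using that by (simp add: supp_def)
    show "arr T r (Suc c) \<le> arr T r c" if "r \<in> supp a" "Suc c < a ! r" for r c by (rule dec[OF that])
    show "arr T r c \<noteq> arr T s c" if "r \<in> supp a" "s \<in> supp a" "c < a ! r \<and> c < a ! s \<and> r \<noteq> s" for r s c
      using q[THEN conjunct2, THEN conjunct1, rule_format, of r c s] that E[of r c] E[of s c] by (simp add: cells_iff)
    show "arr T r 0 = r" if "r \<in> supp a" for r by (rule first[OF that])
    show "arr T r c < arr T s (Suc c) \<or> Suc c < a ! r \<and> arr T s (Suc c) < arr T r (Suc c)"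
      if rs: "r \<in> supp a" "s \<in> supp a" "r < s \<and> c < a ! r \<and> Suc c < a ! s" for r s c
    proof (cases "a ! r < a ! s")
      case True
      then show ?thesis using longer[OF rs(1,2)] rs(3) by simp
    next
      case False
      then have "inv_triple (T (r, c)) (T (r, Suc c)) (T (s, Suc c))"
        using q[THEN conjunct2, THEN conjunct2, THEN conjunct1, rule_format, of r s c] rs by (simp add: cells_iff)
      then show ?thesis using False E[of r c] E[of r "Suc c"] E[of s "Suc c"] rs by (auto simp: inv_triple_def)
    qed
  qed
next
  assume s: "sk (supp a) ((!) a) (arr T)"
  have E: "T (r, c) = Suc (arr T r c)" if "(r, c) \<in> cells a" for r c using T_eq_arr[OF f] that by (simp add: cells_iff)
  note ok = skD(1)[OF s]
  have longer: "arr T r c < arr T q (Suc c)" if rq: "r \<in> supp a" "q \<in> supp a" "r < q" "a ! r < a ! q" "c < a ! r" for r q c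
    using that(5)
  proof (induction "a ! r - c" arbitrary: c rule: less_induct)
    case less
    have "\<not> (Suc c < a ! r \<and> arr T q (Suc c) < arr T r (Suc c))"
    proof
      assume *: "Suc c < a ! r \<and> arr T q (Suc c) < arr T r (Suc c)"
      then have "arr T r (Suc c) < arr T q (Suc (Suc c))" using less.hyps[of "Suc c"] by (simp add: diff_less_mono2)
      moreover have "arr T q (Suc (Suc c)) \<le> arr T q (Suc c)" using rows_okD(3)[OF ok rq(2)] * rq(4) by simp
      ultimately show False using * by simp
    qed
    then show ?case using skD(3)[OF s rq(1,2,3), of c] less.prems rq(4) by auto
  qed
  have dec: "T (r, Suc c) \<le> T (r, c)" if "(r, c) \<in> cells a" "(r, Suc c) \<in> cells a" for r c
    using E[OF that(1)] E[OF that(2)] rows_okD(3)[OF ok, of r c] that by (simp add: cells_iff)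
  have "semi_skyline a T"
    unfolding semi_skyline_def
  proof (intro conjI allI impI; (elim conjE)?)
    show "filling a T" by (rule f)
    show "T (r, Suc c) \<le> T (r, c)" if "(r, c) \<in> cells a" "(r, Suc c) \<in> cells a" for r c by (rule dec[OF that])
    show "T (r, c) \<noteq> T (q, c)" if "(r, c) \<in> cells a" "(q, c) \<in> cells a" "r \<noteq> q" for r q c
      using E[OF that(1)] E[OF that(2)] rows_okD(4)[OF ok, of r q c] that by (simp add: cells_iff)
    show "inv_triple (T (r, c)) (T (r, Suc c)) (T (q, Suc c))"
      if "r < q" "a ! q \<le> a ! r" "(r, c) \<in> cells a" "(r, Suc c) \<in> cells a" "(q, Suc c) \<in> cells a" for r q c
      using skD(3)[OF s, of r q c] that E[OF that(3)] E[OF that(4)] E[OF that(5)] dec[OF that(3,4)]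
      by (auto simp: inv_triple_def cells_iff)
    show "inv_triple (T (q, c)) (T (q, Suc c)) (T (r, c))"
      if "r < q" "a ! r < a ! q" "(q, c) \<in> cells a" "(q, Suc c) \<in> cells a" "(r, c) \<in> cells a" for r q c
      using longer[of r q c] that E[OF that(4)] E[OF that(5)] dec[OF that(3,4)]
      by (auto simp: inv_triple_def cells_iff)
  qed
  moreover have "T (r, 0) = Suc r" if "(r, 0) \<in> cells a" for r
    using E[OF that] skD(2)[OF s, of r] that by (simp add: cells_iff)
  ultimately show "semi_skyline a T \<and> (\<forall>r. (r, 0) \<in> cells a \<longrightarrow> T (r, 0) = Suc r)" by blast
qed

section \<open>Slides as maps between supports\<close>

abbreviation sl :: "nat list \<Rightarrow> nat list" where
  "sl a \<equiv> filter (\<lambda>p. a ! p \<noteq> 0) [0..<length a]"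

lemma set_sl: "set (sl a) = supp a"
  by (auto simp: supp_def)

lemma flat_sl: "flat a = map ((!) a) (sl a)"
proof -
  have "flat a = filter (\<lambda>x. x \<noteq> 0) (map ((!) a) [0..<length a])" by (simp add: flat_def map_nth)
  then show ?thesis by (simp add: filter_map comp_def)
qed

lemma sorted_sl: "sorted_wrt (<) (sl a)"
  by (rule sorted_wrt_filter) (rule sorted_wrt_upt)

lemma sum_take_supp: "t \<le> length a \<Longrightarrow> sum_list (take t a) = (\<Sum>r\<in>{r \<in> supp a. r < t}. a ! r)"
  unfolding sum_list_take_sum by (rule sum.mono_neutral_right) (auto simp: supp_def)

text \<open>Equality of \<open>flat\<close> is an order isomorphism \<phi> of the supports that
  preserves parts, and dominance says that \<phi> moves no row up. In this form slides match the
  first columns of quasi-key tableaux.\<close>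

lemma slidesI:
  assumes len: "length b = length a" and mono: "\<And>r s. r \<in> supp a \<Longrightarrow> s \<in> supp a \<Longrightarrow> r < s \<Longrightarrow> \<phi> r < \<phi> s"
    and le: "\<And>r. r \<in> supp a \<Longrightarrow> \<phi> r \<le> r" and im: "\<phi> ` supp a = supp b"
    and val: "\<And>r. r \<in> supp a \<Longrightarrow> b ! \<phi> r = a ! r"
  shows "b \<in> slides a"
proof -
  have s: "sorted_wrt (<) (map \<phi> (sl a))"
    unfolding sorted_wrt_map
    by (rule sorted_wrt_mono_rel[OF _ sorted_sl]) (use mono set_sl[of a] in blast)
  have "map \<phi> (sl a) = sl b"
  proof (rule sorted_distinct_set_unique)
    show "sorted (map \<phi> (sl a))" "distinct (map \<phi> (sl a))" using s strict_sorted_iff by blast+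
    show "sorted (sl b)" "distinct (sl b)" using sorted_sl strict_sorted_iff by blast+
    show "set (map \<phi> (sl a)) = set (sl b)" using im set_sl[of a] set_sl[of b] by simp
  qed
  then have "flat b = map ((!) b) (map \<phi> (sl a))" by (simp add: flat_sl)
  then have "flat b = flat a" using val set_sl[of a] by (auto simp: flat_sl)
  moreover have "sum_list (take t a) \<le> sum_list (take t b)" if t: "t \<le> length a" for t
  proof -
    have inj: "inj_on \<phi> {r \<in> supp a. r < t}"
      by (rule inj_onI) (metis (mono_tags, lifting) less_irrefl linorder_neqE_nat mem_Collect_eq mono)
    have "sum_list (take t a) = (\<Sum>r\<in>{r \<in> supp a. r < t}. b ! \<phi> r)"
      using sum_take_supp[OF t] val by simp
    also have "\<dots> = (\<Sum>q\<in>\<phi> ` {r \<in> supp a. r < t}. b ! q)" using inj by (simp add: sum.reindex)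
    also have "\<dots> \<le> (\<Sum>q\<in>{q \<in> supp b. q < t}. b ! q)"
      by (rule sum_mono2) (use finite_supp im le in \<open>auto intro: le_less_trans\<close>)
    also have "\<dots> = sum_list (take t b)" using sum_take_supp[of t b] t len by simp
    finally show ?thesis .
  qed
  ultimately show ?thesis using len by (simp add: slides_def dominates_def)
qed

lemma slidesE:
  assumes b: "b \<in> slides a"
  obtains \<phi> where "\<And>r s. r \<in> supp a \<Longrightarrow> s \<in> supp a \<Longrightarrow> r < s \<Longrightarrow> \<phi> r < \<phi> s"
    "\<And>r. r \<in> supp a \<Longrightarrow> \<phi> r \<le> r" "\<phi> ` supp a = supp b" "\<And>r. r \<in> supp a \<Longrightarrow> b ! \<phi> r = a ! r"
proof -
  have len: "length b = length a" and dom: "\<And>t. t \<le> length a \<Longrightarrow> sum_list (take t a) \<le> sum_list (take t b)"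
    and fl: "map ((!) b) (sl b) = map ((!) a) (sl a)"
    using b by (auto simp: slides_def dominates_def flat_sl)
  let ?m = "length (sl a)"
  have lm: "length (sl b) = ?m" using arg_cong[OF fl, of length] by simp
  have val: "b ! (sl b ! i) = a ! (sl a ! i)" if "i < ?m" for i
    using arg_cong[OF fl, of "\<lambda>l. l ! i"] that lm by simp
  have da: "distinct (sl a)" "distinct (sl b)" by simp_all
  define \<phi> where "\<phi> r = sl b ! (THE i. i < ?m \<and> sl a ! i = r)" for r
  have \<phi>: "\<phi> (sl a ! i) = sl b ! i" if "i < ?m" for i
  proof -
    have "(THE j. j < ?m \<and> sl a ! j = sl a ! i) = i"
      using that nth_eq_iff_index_eq[OF da(1)] by (intro the_equality) blast+
    then show ?thesis by (simp add: \<phi>_def)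
  qed
  have ix: "\<exists>i<?m. r = sl a ! i" if "r \<in> supp a" for r using that set_sl[of a] by (metis in_set_conv_nth)
  have lt: "sl c ! i < sl c ! j \<longleftrightarrow> i < j" if "i < length (sl c)" "j < length (sl c)" for c i j
    using that sorted_wrt_nth_less[OF sorted_sl[of c]] by (metis less_asym' linorder_neqE_nat)
  show thesis
  proof
    show "\<phi> r < \<phi> s" if "r \<in> supp a" "s \<in> supp a" "r < s" for r s
      using ix[OF that(1)] ix[OF that(2)] that(3) \<phi> lt lm by metis
    show "\<phi> ` supp a = supp b"
    proof -
      have "supp b = (\<lambda>i. sl b ! i) ` {..<?m}" using set_sl[of b] lm by (auto simp: set_conv_nth)
      also have "\<dots> = (\<lambda>i. \<phi> (sl a ! i)) ` {..<?m}" using \<phi> by simp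
      also have "\<dots> = \<phi> ` (\<lambda>i. sl a ! i) ` {..<?m}" by (simp add: image_image)
      also have "(\<lambda>i. sl a ! i) ` {..<?m} = supp a" using set_sl[of a] by (auto simp: set_conv_nth)
      finally show ?thesis by simp
    qed
    show "b ! \<phi> r = a ! r" if "r \<in> supp a" for r using ix[OF that] \<phi> val by metis
    show "\<phi> r \<le> r" if "r \<in> supp a" for r
    proof (rule ccontr)
      assume n: "\<not> \<phi> r \<le> r"
      obtain i where i: "i < ?m" "r = sl a ! i" using ix[OF \<open>r \<in> supp a\<close>] by blast
      have rl: "r < length a" "0 < a ! r" using that by (auto simp: supp_def)
      \<comment> \<open>If the image of r lay above r, the first r + 1 positions of b could contain
        only parts preceding that image, and the prefix sum would fall short by at least the part of
        a at r.\<close>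
      have sub: "{q \<in> supp b. q < Suc r} \<subseteq> (\<lambda>j. sl b ! j) ` {..<i}"
      proof
        fix q assume q: "q \<in> {q \<in> supp b. q < Suc r}"
        then obtain j where j: "j < ?m" "q = sl b ! j" using set_sl[of b] lm by (metis (no_types, lifting) in_set_conv_nth mem_Collect_eq)
        have "sl b ! j < sl b ! i" using q j n i \<phi> by auto
        then have "j < i" using lt[of j b i] j i lm by simp
        then show "q \<in> (\<lambda>j. sl b ! j) ` {..<i}" using j by blast
      qed
      have "sum_list (take (Suc r) b) = (\<Sum>q\<in>{q \<in> supp b. q < Suc r}. b ! q)"
        using sum_take_supp[of "Suc r" b] rl len by simp
      also have "\<dots> \<le> (\<Sum>q\<in>(\<lambda>j. sl b ! j) ` {..<i}. b ! q)" by (rule sum_mono2) (use sub in auto)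
      also have "\<dots> = (\<Sum>j<i. b ! (sl b ! j))"
        by (subst sum.reindex) (use i lm in \<open>auto simp: inj_on_def nth_eq_iff_index_eq\<close>)
      also have "\<dots> = (\<Sum>j<i. a ! (sl a ! j))" using val i by simp
      also have "\<dots> < (\<Sum>j<Suc i. a ! (sl a ! j))" using rl i by simp
      also have "\<dots> = (\<Sum>q\<in>(\<lambda>j. sl a ! j) ` {..<Suc i}. a ! q)"
        by (subst sum.reindex) (use i in \<open>auto simp: inj_on_def nth_eq_iff_index_eq\<close>)
      also have "\<dots> \<le> (\<Sum>q\<in>{q \<in> supp a. q < Suc r}. a ! q)"
      proof (rule sum_mono2)
        show "(\<lambda>j. sl a ! j) ` {..<Suc i} \<subseteq> {q \<in> supp a. q < Suc r}"
        proof (rule image_subsetI)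
          fix j assume j: "j \<in> {..<Suc i}"
          then have "j < ?m" using i by simp
          then have "sl a ! j \<in> supp a" using nth_mem[of j "sl a"] set_sl[of a] by blast
          moreover have "sl a ! j \<le> r" using lt[of i a j] i j \<open>j < ?m\<close> by (simp add: not_less[symmetric])
          ultimately show "sl a ! j \<in> {q \<in> supp a. q < Suc r}" by simp
        qed
      qed (use finite_supp in auto)
      also have "\<dots> = sum_list (take (Suc r) a)" using sum_take_supp[of "Suc r" a] rl by simp
      finally show False using dom[of "Suc r"] rl by simp
    qed
  qed
qed

lemma slides_refl: "a \<in> slides a"
  by (simp add: slides_def dominates_def)

section \<open>Column tuples of fillings\<close>

abbreviation height :: "nat list \<Rightarrow> nat" where
  "height a \<equiv> Max (insert 0 (set a))"

lemma nth_le_height: "r < length a \<Longrightarrow> a ! r \<le> height a"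
  by (intro Max_ge) auto

definition tcols :: "nat list \<Rightarrow> (nat \<Rightarrow> nat \<Rightarrow> nat) \<Rightarrow> nat set list" where
  "tcols a E = map (acol (supp a) ((!) a) E) [0..<height a]"

lemma length_tcols [simp]: "length (tcols a E) = height a"
  by (simp add: tcols_def)

lemma nth_tcols: "c < height a \<Longrightarrow> tcols a E ! c = acol (supp a) ((!) a) E c"
  by (simp add: tcols_def)

lemma acol_beyond: "height a \<le> c \<Longrightarrow> acol (supp a) ((!) a) E c = {}"
  by (auto simp: acol_def supp_def) (metis leD nth_mem)

lemma tcols_eqD: "tcols a E = tcols a E' \<Longrightarrow> acol (supp a) ((!) a) E c = acol (supp a) ((!) a) E' c"
  using acol_beyond[of a c] by (cases "c < height a") (metis nth_tcols, metis leI)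

lemma feas_map:
  assumes "\<And>c. i \<le> c \<Longrightarrow> c < m \<Longrightarrow> C c \<subseteq> {..<n} \<and> C c \<noteq> {}"
    and "\<And>c. i \<le> c \<Longrightarrow> Suc c < m \<Longrightarrow> queue (C c) (C (Suc c)) n = 0"
  shows "feas n (map C [i..<m])"
  using assms
proof (induction "m - i" arbitrary: i)
  case (Suc k)
  then have "[i..<m] = i # [Suc i..<m]" by (simp add: upt_conv_Cons)
  moreover have "feas n (map C [Suc i..<m])" using Suc by auto
  moreover have "hd (map C [Suc i..<m]) = C (Suc i)" if "Suc i < m" using that by (simp add: upt_conv_Cons)
  ultimately show ?case using Suc.prems Suc.hyps(2) by auto
qed simp

lemma feas_tcols:
  assumes ok: "rows_ok (supp a) ((!) a) E" and n: "\<And>r. r \<in> supp a \<Longrightarrow> E r 0 < n"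
  shows "feas n (tcols a E)"
  unfolding tcols_def
proof (rule feas_map)
  fix c assume c: "c < height a"
  have "height a \<in> insert 0 (set a)" by (intro Max_in) auto
  then obtain r where r: "r < length a" "a ! r = height a" using c by (auto simp: in_set_conv_nth)
  then have "r \<in> supp a" using c by (simp add: supp_def)
  then have "E r c \<in> acol (supp a) ((!) a) E c" using r c by (auto simp: acol_def)
  moreover have "E q c < n" if "q \<in> supp a" "c < a ! q" for q
    using rows_ok_le[OF ok that] n[OF that(1)] by simp
  ultimately show "acol (supp a) ((!) a) E c \<subseteq> {..<n} \<and> acol (supp a) ((!) a) E c \<noteq> {}"
    by (auto simp: acol_def)
qed (rule acol_queue[OF ok n])

text \<open>The key columns consist of the first entries of the sufficiently long rows, for either
  kind of array; this alone determines \<open>colkey\<close>.\<close>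

lemma tcols_key:
  assumes pk: "\<And>j. pk (acol (supp a) ((!) a) E) 0 j = (\<lambda>r. E r 0) ` {r \<in> supp a. j < a ! r}"
    and inj: "inj_on (\<lambda>r. E r 0) (supp a)" and n: "\<And>r. r \<in> supp a \<Longrightarrow> E r 0 < n"
  shows "\<And>r. r \<in> supp a \<Longrightarrow> colkey n (tcols a E) ! E r 0 = a ! r" "supp (colkey n (tcols a E)) = (\<lambda>r. E r 0) ` supp a"
proof -
  let ?b = "colkey n (tcols a E)"
  have K: "kcols (tcols a E) ! j = (\<lambda>r. E r 0) ` {r \<in> supp a. j < a ! r}" if "j < height a" for j
    using kcols_pk[of 0 "height a" j "acol (supp a) ((!) a) E"] that pk by (simp add: tcols_def)
  have cnt: "cnt (kcols (tcols a E)) t = card {j. j < height a \<and> t \<in> (\<lambda>r. E r 0) ` {r \<in> supp a. j < a ! r}}" for t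
    using K by (auto simp: cnt_def length_filter_conv_card intro!: arg_cong[where f = card])
  show 1: "?b ! E r 0 = a ! r" if r: "r \<in> supp a" for r
  proof -
    have "E r 0 \<in> (\<lambda>r. E r 0) ` {r \<in> supp a. j < a ! r} \<longleftrightarrow> j < a ! r" for j
      using inj r by (auto simp: inj_on_def)
    moreover have "j < a ! r \<Longrightarrow> j < height a" for j using less_le_trans[OF _ nth_le_height[of r a]] r unfolding supp_def by blast
    ultimately have "{j. j < height a \<and> E r 0 \<in> (\<lambda>r. E r 0) ` {r \<in> supp a. j < a ! r}} = {..<a ! r}" by auto
    then show ?thesis using n[OF r] cnt[of "E r 0"] by simp
  qed
  show "supp ?b = (\<lambda>r. E r 0) ` supp a"
  proof (intro equalityI subsetI)
    fix t assume "t \<in> supp ?b"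
    then have "0 < card {j. j < height a \<and> t \<in> (\<lambda>r. E r 0) ` {r \<in> supp a. j < a ! r}}"
      using nth_colkey[of t n "tcols a E"] unfolding cnt[symmetric] supp_def[of ?b] by auto
    then show "t \<in> (\<lambda>r. E r 0) ` supp a" by (auto simp: card_gt_0_iff)
  next
    fix t assume "t \<in> (\<lambda>r. E r 0) ` supp a"
    then show "t \<in> supp ?b" using 1 n by (auto simp: supp_def)
  qed
qed

lemma fmon_tcols:
  assumes f: "filling a T" and ok: "rows_ok (supp a) ((!) a) (arr T)" and n: "\<And>r. r \<in> supp a \<Longrightarrow> arr T r 0 < n"
  shows "fmon a T = xm n (cnt (tcols a (arr T)))"
proof -
  let ?C = "acol (supp a) ((!) a) (arr T)" and ?m = "height a"
  let ?P = "\<lambda>c. {r \<in> supp a. c < a ! r}"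
  have sub: "?C c \<subseteq> {..<n}" for c
    using rows_ok_le[OF ok] n by (auto simp: acol_def intro: le_less_trans)
  have "cnt (tcols a (arr T)) t = (\<Sum>c<?m. of_bool (t \<in> ?C c))" for t
    by (simp add: cnt_def length_filter_conv_card tcols_def sum.If_cases of_bool_def Int_def conj_commute cong: conj_cong)
  then have "xm n (cnt (tcols a (arr T))) = (\<Prod>t<n. \<Prod>c<?m. if t \<in> ?C c then X t else 1)"
    by (simp add: xm_def prod.If_cases)
  also have "\<dots> = (\<Prod>c<?m. \<Prod>t<n. if t \<in> ?C c then X t else 1)" by (rule prod.swap)
  also have "\<dots> = (\<Prod>c<?m. \<Prod>t\<in>?C c. X t)"
    using sub by (intro prod.cong[OF HOL.refl] prod.mono_neutral_cong_right) auto
  also have "\<dots> = (\<Prod>c<?m. \<Prod>r\<in>?P c. X (arr T r c))"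
    unfolding acol_def by (rule prod.cong[OF HOL.refl]) (simp add: prod.reindex rows_ok_inj[OF ok])
  also have "\<dots> = (\<Prod>(c, r)\<in>(SIGMA c:{..<?m}. ?P c). X (arr T r c))"
    by (rule prod.Sigma) (simp_all add: finite_supp)
  also have "\<dots> = (\<Prod>x\<in>cells a. X (T x - 1))"
  proof (rule prod.reindex_bij_witness[of _ "\<lambda>(r, c). (c, r)" "\<lambda>(c, r). (r, c)"])
    fix x assume "x \<in> cells a"
    then obtain r c where x: "x = (r, c)" "r \<in> supp a" "c < a ! r" by (cases x) (auto simp: cells_iff)
    have "r < length a" using x(2) by (simp add: supp_def)
    from less_le_trans[OF x(3) nth_le_height[OF this]] show "(case x of (r, c) \<Rightarrow> (c, r)) \<in> (SIGMA c:{..<?m}. ?P c)" using x by simp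
  qed (auto simp: cells_iff arr_def)
  finally show ?thesis by (simp add: fmon_def)
qed

lemma arr_inj:
  assumes f: "filling a T" "filling a T'" and e: "\<And>r c. r \<in> supp a \<Longrightarrow> c < a ! r \<Longrightarrow> arr T r c = arr T' r c"
  shows "T = T'"
proof
  fix x :: "nat \<times> nat"
  obtain r c where x: "x = (r, c)" by (cases x)
  show "T x = T' x"
    using e[of r c] T_eq_arr[OF f(1), of r c] T_eq_arr[OF f(2), of r c] f x
    by (cases "(r, c) \<in> cells a") (auto simp: cells_iff filling_def)
qed

text \<open>Rows are named by their first entries, so the key of the column tuple is a itself;
  \<open>sk_unique\<close> and \<open>sk_exists\<close> make the passage to columns
  bijective.\<close>

lemma atom_eq_colatom: "atom a = colatom a"
proof -
  let ?Q = "{T. semi_skyline a T \<and> (\<forall>r. (r, 0) \<in> cells a \<longrightarrow> T (r, 0) = Suc r)}"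
  let ?R = "supp a" and ?n = "length a"
  have Qf: "filling a T" if "T \<in> ?Q" for T using that by (simp add: semi_skyline_def)
  have Q: "sk ?R ((!) a) (arr T)" if "T \<in> ?Q" for T using semi_skyline_iff[OF Qf[OF that]] that by blast
  have n: "r < ?n" if "r \<in> ?R" for r using that by (simp add: supp_def)
  have key: "tcols a E \<in> colset a" if s: "sk ?R ((!) a) E" for E
  proof -
    have E0: "E r 0 = r" if "r \<in> ?R" for r using skD(2)[OF s that] .
    have i: "(\<lambda>r. E r 0) ` {r \<in> ?R. P r} = {r \<in> ?R. P r}" for P using E0 by force
    have b1: "colkey ?n (tcols a E) ! E r 0 = a ! r" if "r \<in> ?R" for r
      by (rule tcols_key(1)[OF _ _ _ that]) (use sk_pk[OF s] i E0 n in \<open>auto simp: inj_on_def\<close>)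
    have b2: "supp (colkey ?n (tcols a E)) = (\<lambda>r. E r 0) ` ?R"
      by (rule tcols_key(2)) (use sk_pk[OF s] i E0 n in \<open>auto simp: inj_on_def\<close>)
    have "colkey ?n (tcols a E) = a"
    proof (rule nth_equalityI)
      fix t assume "t < length (colkey ?n (tcols a E))"
      then have t: "t < ?n" by simp
      show "colkey ?n (tcols a E) ! t = a ! t"
      proof (cases "t \<in> ?R")
        case True
        then show ?thesis using b1[OF True] E0[OF True] by simp
      next
        case False
        then have "t \<notin> supp (colkey ?n (tcols a E))" using b2 i[of "\<lambda>_. True"] by simp
        then show ?thesis using False t by (simp add: supp_def)
      qed
    qed simp
    moreover have "feas ?n (tcols a E)" using feas_tcols[OF skD(1)[OF s]] E0 n by simp
    ultimately show ?thesis by (simp add: colset_def)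
  qed
  have "bij_betw (\<lambda>T. tcols a (arr T)) ?Q (colset a)"
    unfolding bij_betw_def
  proof (intro conjI equalityI subsetI)
    show "inj_on (\<lambda>T. tcols a (arr T)) ?Q"
    proof (rule inj_onI)
      fix T T' assume T: "T \<in> ?Q" and T': "T' \<in> ?Q" and eq: "tcols a (arr T) = tcols a (arr T')"
      have e: "arr T r c = arr T' r c" if "r \<in> ?R" "c < a ! r" for r c
        by (rule sk_unique[OF Q[OF T] Q[OF T'] tcols_eqD[OF eq] that])
      show "T = T'" by (rule arr_inj[OF Qf[OF T] Qf[OF T'] e])
    qed
    fix Cs assume "Cs \<in> (\<lambda>T. tcols a (arr T)) ` ?Q"
    then show "Cs \<in> colset a" using key Q by blast
  next
    fix Cs assume Cs: "Cs \<in> colset a"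
    obtain E where E: "sk ?R ((!) a) E" "\<forall>c<length Cs. acol ?R ((!) a) E c = Cs ! c" using sk_exists[OF Cs] by blast
    have len: "length Cs = height a"
      using arg_cong[OF kcols_eq_level_cols[OF Cs], of length] by (simp add: level_cols_def)
    have e: "E r c = arr (tab a E) r c" if "r \<in> ?R" "c < a ! r" for r c using arr_tab[OF that] by simp
    have s: "sk ?R ((!) a) (arr (tab a E))" by (rule sk_cong[OF e E(1)])
    then have "tab a E \<in> ?Q" using semi_skyline_iff[OF filling_tab] by blast
    moreover have "tcols a (arr (tab a E)) = Cs"
    proof (rule nth_equalityI)
      fix c assume "c < length (tcols a (arr (tab a E)))"
      then have c: "c < height a" by simp
      have "acol ?R ((!) a) (arr (tab a E)) c = acol ?R ((!) a) E c"
        unfolding acol_def using e by (intro image_cong) auto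
      then show "tcols a (arr (tab a E)) ! c = Cs ! c" using E(2) len c by (simp add: nth_tcols)
    qed (simp add: len)
    ultimately show "Cs \<in> (\<lambda>T. tcols a (arr T)) ` ?Q" by blast
  qed
  then have "colatom a = (\<Sum>T\<in>?Q. xm ?n (cnt (tcols a (arr T))))"
    unfolding colatom_def by (rule sum.reindex_bij_betw[symmetric])
  also have "\<dots> = (\<Sum>T\<in>?Q. fmon a T)"
  proof (rule sum.cong[OF HOL.refl])
    fix T assume T: "T \<in> ?Q"
    show "xm ?n (cnt (tcols a (arr T))) = fmon a T"
      by (rule fmon_tcols[symmetric, OF Qf[OF T] skD(1)[OF Q[OF T]]]) (use skD(2)[OF Q[OF T]] n in simp)
  qed
  finally show ?thesis by (simp add: atom_def)
qed

lemma qk_reindex: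
  assumes q: "qk R' l' E" and fin: "finite R" and im: "\<phi> ` R = R'"
    and mono: "\<And>r s. r \<in> R \<Longrightarrow> s \<in> R \<Longrightarrow> r < s \<Longrightarrow> \<phi> r < \<phi> s" and l: "\<And>r. r \<in> R \<Longrightarrow> l' (\<phi> r) = l r"
  shows "qk R l (\<lambda>r. E (\<phi> r))"
proof -
  have m: "\<phi> r \<in> R'" if "r \<in> R" for r using that im by blast
  have ne: "\<phi> r \<noteq> \<phi> s" if "r \<in> R" "s \<in> R" "r \<noteq> s" for r s
    using mono[of r s] mono[of s r] that by (metis less_irrefl linorder_neqE_nat)
  note ok = qkD(1)[OF q]
  show ?thesis
    unfolding qk_def rows_ok_def
  proof (intro conjI ballI allI impI; (elim conjE)?)
    show "finite R" by (rule fin)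
    show "0 < l r" if "r \<in> R" for r using rows_okD(2)[OF ok m[OF that]] l[OF that] by simp
    show "E (\<phi> r) (Suc c) \<le> E (\<phi> r) c" if "r \<in> R" "Suc c < l r" for r c
      using rows_okD(3)[OF ok m[OF that(1)]] l[OF that(1)] that(2) by simp
    show "E (\<phi> r) c \<noteq> E (\<phi> s) c" if "r \<in> R" "s \<in> R" "c < l r" "c < l s" "r \<noteq> s" for r s c
      using rows_okD(4)[OF ok m[OF that(1)] m[OF that(2)], of c] ne[OF that(1,2,5)] l that by simp
    show "E (\<phi> r) 0 < E (\<phi> s) 0" if "r \<in> R" "s \<in> R" "r < s" for r s
      using qkD(2)[OF q m[OF that(1)] m[OF that(2)] mono[OF that]] .
    show "Suc c < l r" "E (\<phi> s) c < E (\<phi> r) (Suc c)"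
      if "r \<in> R" "s \<in> R" "r < s" "c < l r" "c < l s" "E (\<phi> s) c < E (\<phi> r) c" for r s c
      using qkD(3)[OF q m[OF that(1)] m[OF that(2)] mono[OF that(1-3)], of c] l that by simp_all
    show "E (\<phi> r) c < E (\<phi> s) (Suc c)" if "r \<in> R" "s \<in> R" "r < s" "l r < l s" "c < l r" for r s c
      using qkD(4)[OF q m[OF that(1)] m[OF that(2)] mono[OF that(1-3)], of c] l that by simp
  qed
qed

lemma insert_set_flat: "insert 0 (set (flat a)) = insert 0 (set a)"
  by (auto simp: flat_def)

lemma finite_slides: "finite (slides a)"
proof (rule finite_subset)
  show "slides a \<subseteq> {b. mset b = mset a}"
  proof
    fix b assume "b \<in> slides a"
    then have "flat b = flat a" "length b = length a" by (simp_all add: slides_def dominates_def)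
    then show "b \<in> {b. mset b = mset a}" by (intro CollectI mset_eq_of_flat)
  qed
qed (rule mset_eq_finite)

text \<open>First entries may now differ from row indices: the key of the tuple is a slide b of a,
  with the first column as the map \<phi>. Conversely a tuple with key b is arranged into rows named
  after b, which are then renamed along \<phi>.\<close>

lemma qkey_eq_colatom: "qkey a = (\<Sum>b\<in>slides a. colatom b)"
proof -
  let ?Q = "{T. qkey_tableau a T}" and ?U = "\<Union>b\<in>slides a. colset b"
  let ?R = "supp a" and ?n = "length a"
  have Qf: "filling a T" if "T \<in> ?Q" for T using that by (simp add: qkey_tableau_def)
  have Q: "qk ?R ((!) a) (arr T)" "\<And>r. r \<in> ?R \<Longrightarrow> arr T r 0 \<le> r" if "T \<in> ?Q" for T
    using qkey_tableau_iff[OF Qf[OF that]] that by blast+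
  have n: "r < ?n" if "r \<in> ?R" for r using that by (simp add: supp_def)
  have key: "tcols a E \<in> ?U" if q: "qk ?R ((!) a) E" and le: "\<And>r. r \<in> ?R \<Longrightarrow> E r 0 \<le> r" for E
  proof -
    let ?b = "colkey ?n (tcols a E)"
    have En: "E r 0 < ?n" if "r \<in> ?R" for r using le[OF that] n[OF that] by simp
    have pk: "pk (acol ?R ((!) a) E) 0 j = (\<lambda>r. E r 0) ` {r \<in> ?R. j < a ! r}" for j
      using qk_pk[OF q, of 0 j] by simp
    have inj: "inj_on (\<lambda>r. E r 0) ?R" by (rule rows_ok_inj[OF qkD(1)[OF q]]) (auto simp: supp_def)
    have "?b \<in> slides a"
      by (rule slidesI[where \<phi> = "\<lambda>r. E r 0"]) (use qkD(2)[OF q] le tcols_key[OF pk inj En] in auto)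
    moreover have "tcols a E \<in> colset ?b"
      using feas_tcols[OF qkD(1)[OF q] En] by (simp add: colset_def)
    ultimately show ?thesis by blast
  qed
  have "bij_betw (\<lambda>T. tcols a (arr T)) ?Q ?U"
    unfolding bij_betw_def
  proof (intro conjI equalityI subsetI)
    show "inj_on (\<lambda>T. tcols a (arr T)) ?Q"
    proof (rule inj_onI)
      fix T T' assume T: "T \<in> ?Q" and T': "T' \<in> ?Q" and eq: "tcols a (arr T) = tcols a (arr T')"
      have e: "arr T r c = arr T' r c" if "r \<in> ?R" "c < a ! r" for r c
        by (rule qk_unique[OF Q(1)[OF T] Q(1)[OF T'] tcols_eqD[OF eq] that])
      show "T = T'" by (rule arr_inj[OF Qf[OF T] Qf[OF T'] e])
    qed
    fix Cs assume "Cs \<in> (\<lambda>T. tcols a (arr T)) ` ?Q"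
    then show "Cs \<in> ?U" using key Q by blast
  next
    fix Cs assume "Cs \<in> ?U"
    then obtain b where b: "b \<in> slides a" and Cs: "Cs \<in> colset b" by blast
    obtain \<phi> where \<phi>: "\<And>r s. r \<in> ?R \<Longrightarrow> s \<in> ?R \<Longrightarrow> r < s \<Longrightarrow> \<phi> r < \<phi> s"
      "\<And>r. r \<in> ?R \<Longrightarrow> \<phi> r \<le> r" "\<phi> ` ?R = supp b" "\<And>r. r \<in> ?R \<Longrightarrow> b ! \<phi> r = a ! r"
      using slidesE[OF b] by blast
    obtain E' where E': "qk (supp b) ((!) b) E'" "\<forall>t\<in>supp b. E' t 0 = t"
      "\<forall>c<length Cs. acol (supp b) ((!) b) E' c = Cs ! c" using qk_exists[OF Cs] by blast
    define E where "E = (\<lambda>r. E' (\<phi> r))"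
    have "flat b = flat a" using b by (simp add: slides_def)
    then have "insert 0 (set b) = insert 0 (set a)" using insert_set_flat[of a] insert_set_flat[of b] by simp
    then have len: "length Cs = height a"
      using arg_cong[OF kcols_eq_level_cols[OF Cs], of length] by (simp add: level_cols_def)
    have e: "E r c = arr (tab a E) r c" if "r \<in> ?R" "c < a ! r" for r c using arr_tab[OF that] by simp
    have q: "qk ?R ((!) a) E" unfolding E_def
      by (rule qk_reindex[OF E'(1) finite_supp \<phi>(3) \<phi>(1) \<phi>(4)])
    have "E r 0 \<le> r" if "r \<in> ?R" for r
    proof -
      have "\<phi> r \<in> supp b" using \<phi>(3) that by blast
      then show ?thesis using E'(2) \<phi>(2)[OF that] by (simp add: E_def)
    qed
    moreover have "0 < a ! r" if "r \<in> ?R" for r using that by (simp add: supp_def)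
    ultimately have "arr (tab a E) r 0 \<le> r" if "r \<in> ?R" for r using e[of r 0] that by metis
    then have "tab a E \<in> ?Q" using qkey_tableau_iff[OF filling_tab] qk_cong[OF e q] by blast
    moreover have "tcols a (arr (tab a E)) = Cs"
    proof (rule nth_equalityI)
      fix c assume "c < length (tcols a (arr (tab a E)))"
      then have c: "c < height a" by simp
      have "acol ?R ((!) a) (arr (tab a E)) c = acol ?R ((!) a) E c"
        unfolding acol_def using e by (intro image_cong) auto
      also have "\<dots> = (\<lambda>t. E' t c) ` \<phi> ` {r \<in> ?R. c < a ! r}" by (simp add: acol_def E_def image_image)
      also have "\<phi> ` {r \<in> ?R. c < a ! r} = {t \<in> supp b. c < b ! t}" unfolding \<phi>(3)[symmetric] using \<phi>(4) by auto
      finally show "tcols a (arr (tab a E)) ! c = Cs ! c" using E'(3) len c by (simp add: nth_tcols acol_def)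
    qed (simp add: len)
    ultimately show "Cs \<in> (\<lambda>T. tcols a (arr T)) ` ?Q" by blast
  qed
  then have "(\<Sum>Cs\<in>?U. xm ?n (cnt Cs)) = (\<Sum>T\<in>?Q. xm ?n (cnt (tcols a (arr T))))"
    by (rule sum.reindex_bij_betw[symmetric])
  also have "\<dots> = qkey a"
    unfolding qkey_def
  proof (rule sum.cong[OF HOL.refl])
    fix T assume T: "T \<in> ?Q"
    show "xm ?n (cnt (tcols a (arr T))) = fmon a T"
      by (rule fmon_tcols[symmetric, OF Qf[OF T] qkD(1)[OF Q(1)[OF T]]]) (use Q(2)[OF T] n in \<open>auto intro: le_less_trans\<close>)
  qed
  finally have "qkey a = (\<Sum>Cs\<in>?U. xm ?n (cnt Cs))" by simp
  also have "\<dots> = (\<Sum>b\<in>slides a. \<Sum>Cs\<in>colset b. xm ?n (cnt Cs))"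
  proof (rule sum.UNION_disjoint[OF finite_slides])
    show "\<forall>b\<in>slides a. finite (colset b)" using finite_colset by blast
    have len: "length b = ?n" if "b \<in> slides a" for b using that by (simp add: slides_def dominates_def)
    show "\<forall>b\<in>slides a. \<forall>b'\<in>slides a. b \<noteq> b' \<longrightarrow> colset b \<inter> colset b' = {}"
      using len by (auto simp: colset_def)
  qed
  also have "\<dots> = (\<Sum>b\<in>slides a. colatom b)"
    by (rule sum.cong) (auto simp: colatom_def slides_def dominates_def)
  finally show ?thesis .
qed

lemma qkey_atom: "cone atom (qkey a)"
  unfolding qkey_eq_colatom by (rule cone_sum) (simp add: atom_eq_colatom[symmetric] cone_base)

lemma kappa_qkey: "cone qkey (kappa a)"
  using kappa_slides[of a] by (auto simp: cone_def qkey_eq_colatom)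

lemma cone_induct [consumes 1, case_names zero base add]:
  assumes "cone G f" "P 0" "\<And>b. P (G b)" "\<And>f g. P f \<Longrightarrow> P g \<Longrightarrow> P (f + g)"
  shows "P f"
proof -
  obtain L where "f = (\<Sum>b\<leftarrow>L. G b)" using assms(1) by (auto simp: cone_def)
  moreover have "P (\<Sum>b\<leftarrow>L. G b)" by (induction L) (auto intro: assms)
  ultimately show ?thesis by simp
qed

lemma mslide_xmon: "cone xmon (mslide a)"
  unfolding mslide_def by (rule cone_sum) (rule cone_base)

lemma particle_xmon: "cone xmon (particle a)"
  unfolding particle_def by (rule cone_sum) (rule cone_base)

section \<open>Failure of positivity\<close>

definition nonneg :: "poly \<Rightarrow> bool" where
  "nonneg f \<longleftrightarrow> (\<forall>m. 0 \<le> lookup f m)"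

lemma nonneg_add: "nonneg f \<Longrightarrow> nonneg g \<Longrightarrow> nonneg (f + g)"
  by (simp add: nonneg_def lookup_add)

lemma nonneg_mon: "nonneg (mon m)"
  by (simp add: nonneg_def lookup_single when_def)

lemma not_nonneg: "\<not> nonneg (- mon m)"
  unfolding nonneg_def by (intro notI) (auto dest: spec[of _ m])

lemma nonneg_add_eq_0:
  assumes "nonneg f" "nonneg g" "f + g = 0"
  shows "f = 0 \<and> g = 0"
proof -
  have "lookup f m = 0 \<and> lookup g m = 0" for m
  proof -
    have "lookup f m + lookup g m = 0" using arg_cong[OF assms(3), of "\<lambda>h. lookup h m"] by (simp add: lookup_add)
    then show ?thesis using assms(1,2) unfolding nonneg_def by (metis add_nonneg_eq_0_iff)
  qed
  then show ?thesis by (auto intro: poly_mapping_eqI)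
qed

lemma xm_mon: "\<exists>m. xm n g = mon m"
  by (auto simp: xm_def X_power prod_mon)

lemma xmon_mon: "\<exists>m. xmon a = mon m"
  unfolding xmon_xm by (rule xm_mon)

lemma cone_xmon_nonneg: "cone xmon f \<Longrightarrow> nonneg f"
proof (induction rule: cone_induct)
  case (base b)
  then show ?case using xmon_mon[of b] nonneg_mon by metis
qed (simp_all add: nonneg_add, simp add: nonneg_def)

lemma atom_nonneg: "nonneg (atom a)"
  using atom_particle particle_xmon cone_trans cone_xmon_nonneg by metis

lemma kappa_nonneg: "nonneg (kappa a)"
  by (rule cone_xmon_nonneg, rule cone_trans[OF kappa_qkey], rule cone_trans[OF qkey_fslide],
    rule cone_trans[OF fslide_mslide], rule mslide_xmon)

lemma schubert_nonneg: "nonneg (schubert a)"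
proof -
  obtain L where "schubert a = (\<Sum>b\<leftarrow>L. kappa b)" using schubert_kappa_positive[of a] by (auto simp: cone_def)
  moreover have "nonneg (\<Sum>b\<leftarrow>L. kappa b)"
    by (induction L) (auto simp: nonneg_add kappa_nonneg, simp add: nonneg_def)
  ultimately show ?thesis by simp
qed

section \<open>Coefficients of sums over words\<close>

definition xexp :: "nat list \<Rightarrow> (nat \<Rightarrow>\<^sub>0 nat)" where
  "xexp f = (\<Sum>k<length f. Poly_Mapping.single (f ! k) 1)"

lemma xl_mon: "xl f = mon (xexp f)"
  unfolding xl_def xexp_def X_def by (simp add: prod_mon)

lemma lookup_xexp: "lookup (xexp f) t = count_list f t"
proof (induction f rule: rev_induct)
  case (snoc x f)
  have "xexp (f @ [x]) = xexp f + Poly_Mapping.single x 1" by (simp add: xexp_def nth_append)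
  then show ?case using snoc by (simp add: lookup_add lookup_single when_def)
qed (simp add: xexp_def)

lemma xexp_inject: "sorted f \<Longrightarrow> sorted g \<Longrightarrow> xexp f = xexp g \<longleftrightarrow> f = g"
proof
  assume s: "sorted f" "sorted g" and "xexp f = xexp g"
  then have "count_list f t = count_list g t" for t by (metis lookup_xexp)
  then have "mset f = mset g" by (intro multiset_eqI) (simp add: count_mset)
  then show "f = g" using s by (metis properties_for_sort)
qed simp

lemma lookup_sum_xl:
  assumes "\<And>f. f \<in> S \<Longrightarrow> sorted f" "sorted g"
  shows "lookup (\<Sum>f\<in>S. xl f) (xexp g) = of_bool (finite S \<and> g \<in> S)"
proof (cases "finite S")
  case True
  have "lookup (\<Sum>f\<in>S. xl f) (xexp g) = (\<Sum>f\<in>S. if f = g then 1 else 0)"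
    unfolding lookup_sum by (rule sum.cong) (use assms xexp_inject in \<open>auto simp: xl_mon lookup_single when_def\<close>)
  then show ?thesis using True by simp
qed simp

lemma asc_pair: "asc [x, y] = (if x < y then {0} else {})"
  by (auto simp: asc_def less_Suc_eq)

lemma pidiff_X: "pidiff k (X k) = X k + X (Suc k)"
  unfolding pidiff_def by (rule ddiff_eqI) (simp add: swapv_X sw_def algebra_simps)

lemma colatom_02: "colatom [0, 2] = (\<Sum>f\<in>{[0, 1], [1, 1]}. xl f)"
proof -
  have "pidiff 0 (X 0 ^ 2) = X 0 ^ 2 + X 0 * X 1 + X 1 ^ 2"
    unfolding pidiff_def by (rule ddiff_eqI) (simp add: swapv_X swapv_power sw_def algebra_simps power2_eq_square)
  moreover have "colatom [2, 0] = X 0 ^ 2"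
    by (subst colatom_dominant) (auto simp: less_Suc_eq xmon_def numeral_2_eq_2)
  moreover have "pidiff 0 (colatom [2, 0]) = colatom [2, 0] + colatom [0, 2]"
    using pidiff_colatom_descent[of 0 "[2, 0]"] by (simp add: lswap_def)
  ultimately have "colatom [0, 2] = X 0 * X 1 + X 1 ^ 2" by (simp add: add.assoc)
  then show ?thesis by (simp add: xl_def numeral_2_eq_2)
qed

text \<open>A class \<open>MS g\<close> containing \<open>[1, 1]\<close> also contains
  \<open>[0, 0]\<close>, so in the cone the coefficient of \<open>X 1 ^ 2\<close> is at most that of
  \<open>X 0 ^ 2\<close>; the atom \<open>X 0 * X 1 + X 1 ^ 2\<close> violates this.\<close>

lemma atom_not_mslide: "\<not> cone mslide (atom [0, 2])"
proof
  assume "cone mslide (atom [0, 2])"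
  then have "lookup (atom [0, 2]) (xexp [1, 1]) \<le> lookup (atom [0, 2]) (xexp [0, 0])"
  proof (induction rule: cone_induct)
    case (base b)
    let ?g = "ex b"
    have s: "sorted f" if "f \<in> MS ?g" for f using that by (simp add: MS_def)
    have "[0, 0] \<in> MS g" if "[1, 1] \<in> MS g" for g
    proof -
      have "length g = 2" using that by (simp add: MS_def)
      then show ?thesis using that by (auto simp: MS_def asc_pair less_Suc_eq numeral_2_eq_2)
    qed
    then show ?case unfolding mslide_MS using lookup_sum_xl[of "MS ?g" "[1, 1]", OF s] lookup_sum_xl[of "MS ?g" "[0, 0]", OF s] by auto
  qed (auto simp: lookup_add intro: add_mono)
  moreover have "sorted f" if "f \<in> {[0, 1], [1, 1 :: nat]}" for f using that by auto
  ultimately show False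
    unfolding atom_eq_colatom colatom_02
    using lookup_sum_xl[of "{[0, 1], [1, 1]}" "[1, 1]"] lookup_sum_xl[of "{[0, 1], [1, 1]}" "[0, 0]"] by fastforce
qed

text \<open>A class \<open>LS g\<close> containing \<open>[1, 1]\<close> also contains
  \<open>[0, 1]\<close>, since only the last letter is held fixed; the monomial slide
  \<open>X 0 ^ 2 + X 1 ^ 2\<close> violates the resulting inequality.\<close>

lemma mslide_not_particle: "\<not> cone particle (mslide [0, 2])"
proof
  assume "cone particle (mslide [0, 2])"
  then have "lookup (mslide [0, 2]) (xexp [1, 1]) \<le> lookup (mslide [0, 2]) (xexp [0, 1])"
  proof (induction rule: cone_induct)
    case (base b)
    let ?g = "ex b"
    have s: "sorted f" if "f \<in> LS ?g" for f using that by (simp add: LS_def)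
    have "[0, 1] \<in> LS g" if m: "[1, 1] \<in> LS g" for g
    proof -
      have "asc g = {}" "length g = 2" using m by (auto simp: LS_def asc_pair)
      then show ?thesis using m by (auto simp: LS_def All_less_Suc numeral_2_eq_2)
    qed
    then show ?case unfolding particle_LS using lookup_sum_xl[of "LS ?g" "[1, 1]", OF s] lookup_sum_xl[of "LS ?g" "[0, 1]", OF s] by auto
  qed (auto simp: lookup_add intro: add_mono)
  moreover have "ex [0, 2] = [1, 1]" by (simp add: ex_def numeral_2_eq_2)
  moreover have "finite (MS [1, 1])" by (rule finite_subset[OF _ finite_FS[of "[1, 1]"]]) (auto simp: MS_def FS_def)
  moreover have "[1, 1] \<in> MS [1, 1]" "[0, 1] \<notin> MS [1, 1]" by (auto simp: MS_def asc_pair)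
  moreover have "sorted f" if "f \<in> MS [1, 1]" for f using that by (simp add: MS_def)
  ultimately show False
    using lookup_sum_xl[of "MS [1, 1]" "[1, 1]"] lookup_sum_xl[of "MS [1, 1]" "[0, 1]"] by (simp add: mslide_MS)
qed

text \<open>Provides the second part that \<pi>_0 needs; with fewer than two parts an atom is a
  power of \<open>X 0\<close>.\<close>

lemma atom_append0_short: "length a < 2 \<Longrightarrow> \<exists>k. atom a = atom [k, 0]"
proof -
  assume "length a < 2"
  then consider "a = []" | k where "a = [k]" by (cases a) auto
  then obtain k where k: "dominant a" "xmon a = xmon [k, 0]"
  proof cases
    case 1
    then show ?thesis using that[of 0] by (simp add: xmon_def lessThan_Suc)
  next
    case (2 k)
    then show ?thesis using that[of k] by (simp add: xmon_def lessThan_Suc)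
  qed
  have "dominant [k, 0]" by (auto simp: less_Suc_eq)
  then show ?thesis using k by (metis atom_eq_colatom colatom_dominant)
qed

lemma cone_atom_pidiff: "cone atom f \<Longrightarrow> cone atom (pidiff 0 f)"
proof (induction rule: cone_induct)
  case (base a)
  have long: "cone atom (pidiff 0 (atom a))" if l: "Suc 0 < length a" for a
  proof -
    consider "a ! 0 < a ! Suc 0" | "a ! 0 = a ! Suc 0" | "a ! Suc 0 < a ! 0" by linarith
    then show ?thesis
    proof cases
      case 1
      then show ?thesis using pidiff_colatom_ascent[OF l] by (simp add: atom_eq_colatom)
    next
      case 2
      then show ?thesis using pidiff_colatom_level[OF l] cone_base[of atom a] by (simp add: atom_eq_colatom)
    next
      case 3
      then show ?thesis using pidiff_colatom_descent[OF l] cone_add[OF cone_base cone_base, of atom a "lswap 0 a"]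
        by (simp add: atom_eq_colatom)
    qed
  qed
  show ?case
  proof (cases "length a < 2")
    case True
    then show ?thesis using atom_append0_short[OF True] long by fastforce
  qed (use long in simp)
qed (simp_all add: pidiff_add cone_add)

lemma pidiff_X_X3: "pidiff 0 (X 0 * X 1 ^ 3) = - (X 0 ^ 2 * X 1 ^ 2)"
  unfolding pidiff_def by (rule ddiff_eqI) (simp add: swapv_X swapv_power sw_def algebra_simps power2_eq_square power3_eq_cube)

lemma fslide_13: "fslide [1, 3] = X 0 * X 1 ^ 3"
proof -
  have ex: "ex [1, 3] = [0, 1, 1, 1]" by (simp add: ex_def numeral_3_eq_3)
  have "FS [0, 1, 1, 1] = {[0, 1, 1, 1]}"
  proof (intro equalityI subsetI)
    fix f assume "f \<in> FS [0, 1, 1, 1]"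
    then have f: "length f = 4" "\<forall>k<4. f ! k \<le> [0, 1, 1, 1] ! k" "0 \<in> asc f" "sorted f"
      by (auto simp: FS_def asc_def numeral_eq_Suc)
    then have "f ! 0 = 0" "f ! 1 = 1" "f ! 1 \<le> f ! 2" "f ! 2 \<le> f ! 3" "f ! 2 \<le> 1" "f ! 3 \<le> 1"
      by (auto simp: asc_def sorted_iff_nth_mono All_less_Suc numeral_eq_Suc)
    then show "f \<in> {[0, 1, 1, 1]}" using f(1) by (auto simp: list_eq_iff_nth_eq numeral_eq_Suc less_Suc_eq)
  qed (auto simp: FS_def)
  then show ?thesis unfolding fslide_FS ex by (simp add: xl_def numeral_eq_Suc mult.assoc)
qed

text \<open>A nonzero first part leaves no room to slide, so the polynomial is a single monomial,
  and the gap of two between the exponents makes its image under \<pi>_0 negative.\<close>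

lemma fslide_not_atom: "\<not> cone atom (fslide [1, 3])"
proof
  assume "cone atom (fslide [1, 3])"
  then have "cone atom (- (X 0 ^ 2 * X 1 ^ 2))" using cone_atom_pidiff pidiff_X_X3 fslide_13 by metis
  then have "nonneg (- (X 0 ^ 2 * X 1 ^ 2))"
    by (rule cone_xmon_nonneg[OF cone_trans]) (rule cone_trans[OF atom_particle particle_xmon])
  then show False using not_nonneg by (metis X_power mult.right_neutral mult_single)
qed

lemma colatom_12: "colatom [1, 2] = X 0 * X 1 ^ 2"
proof -
  have "pidiff 0 (X 0 ^ 2 * X 1) = X 0 ^ 2 * X 1 + X 0 * X 1 ^ 2"
    unfolding pidiff_def by (rule ddiff_eqI) (simp add: swapv_X swapv_power sw_def algebra_simps power2_eq_square)
  moreover have "colatom [2, 1] = X 0 ^ 2 * X 1"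
    by (subst colatom_dominant) (auto simp: less_Suc_eq xmon_def numeral_2_eq_2)
  moreover have "pidiff 0 (colatom [2, 1]) = colatom [2, 1] + colatom [1, 2]"
    using pidiff_colatom_descent[of 0 "[2, 1]"] by (simp add: lswap_def)
  ultimately show ?thesis by simp
qed

lemma slides_12: "slides [1, 2] = {[1, 2]}"
proof -
  have "b = [1, 2]" if "length b = 2" "flat b = [1, 2]" for b :: "nat list"
    using that by (auto simp: length_Suc_conv numeral_2_eq_2 flat_def split: if_splits)
  then show ?thesis using slides_refl by (auto simp: slides_def dominates_def flat_def numeral_2_eq_2)
qed

lemma nonneg_sum_eq_0:
  assumes h: "(\<Sum>x\<in>A. h x) = 0" "finite A" "\<And>x. x \<in> A \<Longrightarrow> nonneg (h x)" "x \<in> A"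
  shows "h x = 0"
proof -
  have "nonneg (\<Sum>x\<in>A - {x}. h x)" using h(3) by (auto simp: nonneg_def lookup_sum intro!: sum_nonneg)
  then show "h x = 0" using nonneg_add_eq_0[OF h(3)[OF h(4)]] h(1) sum.remove[OF h(2,4), of h] by simp
qed

text \<open>The atom of a is one of the summands, its class contains \<open>level_cols a\<close>,
  and nonnegative summands cannot cancel.\<close>

lemma kappa_nonzero: "kappa a \<noteq> 0"
proof
  assume 0: "kappa a = 0"
  have nn: "nonneg (colatom b)" for b using atom_nonneg by (simp add: atom_eq_colatom)
  have "colatom a = 0"
    by (rule nonneg_sum_eq_0[where A = "bru a" and h = colatom]) (use 0 nn finite_bru bru_refl in \<open>auto simp: kappa_eq_kap kap_def\<close>)
  moreover have "nonneg (xm (length a) g)" for g using xm_mon[of "length a" g] nonneg_mon by metis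
  ultimately have "xm (length a) (cnt (level_cols a)) = 0"
    by (intro nonneg_sum_eq_0[where A = "colset a" and h = "\<lambda>Cs. xm (length a) (cnt Cs)"])
      (auto simp: colatom_def finite_colset level_cols_colset)
  then show False using xm_mon[of "length a" "cnt (level_cols a)"] by auto
qed

lemma pidiff_kappa_ex: "\<exists>b. pidiff 0 (kappa a) = kappa b"
proof -
  have "kappa a = kappa (a @ [0] @ [0])" using kappa_append0[of a] kappa_append0[of "a @ [0]"] by simp
  then show ?thesis using pidiff_kappa[of 0 "a @ [0] @ [0]"] by auto
qed

text \<open>\<pi>_0 sends key polynomials to key polynomials, which are nonzero with nonnegative
  coefficients, so it cannot vanish on a nonzero element of the cone.\<close>

lemma cone_kappa_pidiff_0: "cone kappa f \<Longrightarrow> nonneg f \<and> nonneg (pidiff 0 f) \<and> (pidiff 0 f = 0 \<longrightarrow> f = 0)"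
proof (induction rule: cone_induct)
  case (base b)
  then show ?case using pidiff_kappa_ex[of b] kappa_nonneg kappa_nonzero by metis
next
  case (add f g)
  then show ?case using nonneg_add_eq_0[of "pidiff 0 f" "pidiff 0 g"] by (auto simp: pidiff_add nonneg_add)
qed (simp add: nonneg_def)

text \<open>A composition without room to slide has a quasi-key equal to its atom, and its ascent
  lets \<pi>_0 kill it.\<close>

lemma qkey_not_kappa: "\<not> cone kappa (qkey [1, 2])"
proof
  assume "cone kappa (qkey [1, 2])"
  moreover have "qkey [1, 2] = colatom [1, 2]" unfolding qkey_eq_colatom slides_12 by simp
  moreover have "pidiff 0 (colatom [1, 2]) = 0" by (rule pidiff_colatom_ascent) auto
  ultimately have "X 0 * X 1 ^ 2 = 0" using cone_kappa_pidiff_0[of "qkey [1, 2]"] colatom_12 by simp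
  then show False by (simp add: X_def)
qed

lemma cone_schubert_ddiff: "cone schubert f \<Longrightarrow> cone schubert (ddiff k f)"
proof (induction rule: cone_induct)
  case (base b)
  then show ?case using ddiff_schubert[of k b] cone_0 cone_base by metis
qed (simp_all add: ddiff_add cone_add)

text \<open>The polynomial is \<open>X 0 * (X 1 + X 2)\<close>. Its divided difference at 0 is
  \<open>X 2\<close>, and the divided difference of that at 1 is -1, whereas the Schubert cone is
  closed under divided differences and nonnegative.\<close>

lemma kappa_not_schubert: "\<not> cone schubert (kappa [1, 0, 1])"
proof
  assume c: "cone schubert (kappa [1, 0, 1])"
  have "kappa [1, 1, 0] = X 0 * X 1"
    by (subst kappa_dominant) (auto simp: less_Suc_eq xmon_def lessThan_Suc mult.commute)
  moreover have "kappa [1, 0, 1] = pidiff 1 (kappa [1, 1, 0])"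
    using pidiff_kappa[of 1 "[1, 1, 0]"] by (simp add: lswap_def)
  ultimately have "kappa [1, 0, 1] = X 0 * (X 1 + X 2)"
    using pidiff_mult_sym[of 1 "X 0" "X 1"] pidiff_X[of 1] by (simp add: swapv_X sw_def numeral_2_eq_2)
  moreover have "ddiff 0 (X 0 * (X 1 + X 2)) = X 2"
    by (rule ddiff_eqI) (simp add: swapv_X sw_def algebra_simps)
  moreover have "ddiff 1 (X 2) = - 1"
    by (rule ddiff_eqI) (simp add: swapv_X sw_def numeral_2_eq_2)
  ultimately have "cone schubert (- 1)" using cone_schubert_ddiff[OF c, of 0] cone_schubert_ddiff[of "X 2" 1] by simp
  then have "nonneg (- 1)"
    by (rule cone_induct) (auto simp: schubert_nonneg nonneg_add, simp add: nonneg_def)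
  then show False using not_nonneg[of 0] by simp
qed

theorem theoremA:
  fixes B B' :: family
  assumes "B \<noteq> B'"
  shows "expands_pos (fam B) (fam B') \<longleftrightarrow> fam_gt B B'"
proof -
  define E where "E x y \<longleftrightarrow> (\<forall>a. cone (fam y) (fam x a))" for x y
  have refl: "E x x" for x by (simp add: E_def cone_base)
  have tr: "E x z" if "E x y" "E y z" for x y z using that cone_trans unfolding E_def by blast
  have covers: "E Schub Demaz" "E Demaz QKey" "E QKey FSlide" "E QKey Atom" "E FSlide MSlide" "E FSlide Part"
    "E Atom Part" "E MSlide Mono" "E Part Mono"
    by (simp_all add: E_def schubert_kappa_positive kappa_qkey qkey_fslide qkey_atom fslide_mslide fslide_particle
        atom_particle mslide_xmon particle_xmon)
  have low: "E MSlide Mono" "E Part Mono" "E Atom Part" "E Atom Mono" "E FSlide MSlide" "E FSlide Part" "E FSlide Mono"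
    using covers tr by metis+
  have mid: "E QKey y" if "y \<noteq> Schub" "y \<noteq> Demaz" for y
    using that covers low tr refl by (cases y) metis+
  have high: "E Demaz y" if "y \<noteq> Schub" for y using mid covers tr refl that by metis
  have top: "E Schub y" for y using high covers tr refl by metis
  have gt: "E x y" if "fam_gt x y" for x y
    using that low mid high top unfolding fam_gt_def by auto
  have neg: "\<not> E x y" if "(x, y) \<in> {(Atom, MSlide), (MSlide, Part), (FSlide, Atom), (QKey, Demaz), (Demaz, Schub)}" for x y
    using that atom_not_mslide mslide_not_particle fslide_not_atom qkey_not_kappa kappa_not_schubert
    by (auto simp: E_def)
  have "fam_gt B B'" if e: "E B B'"
  proof (rule ccontr)
    assume n: "\<not> fam_gt B B'"
    \<comment> \<open>Every failing pair lies inside one of the five: with x at or above B and y at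
      or below B', an expansion of B in B' would compose to one of x in y.\<close>
    have "\<exists>(x, y) \<in> {(Atom, MSlide), (MSlide, Part), (FSlide, Atom), (QKey, Demaz), (Demaz, Schub)}.
      (x = B \<or> fam_gt x B) \<and> (B' = y \<or> fam_gt B' y)"
      using n assms by (cases B; cases B') (simp_all add: fam_gt_def)
    then obtain x y where xy: "(x, y) \<in> {(Atom, MSlide), (MSlide, Part), (FSlide, Atom), (QKey, Demaz), (Demaz, Schub)}"
      "x = B \<or> fam_gt x B" "B' = y \<or> fam_gt B' y" by blast
    then have "E x y" using gt refl e tr by metis
    then show False using neg xy(1) by blast
  qed
  then show ?thesis using gt[of B B'] unfolding expands_pos_iff E_def by blast
qed

end
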